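(* For all positive integers $k,n,N$, the reduced level-rank map $\bar\tau:\mathcal H_{kN}(kn,1)_{\mathfrak{sl}_k[z]}\to\mathcal H_N(n,k)$ becomes an isomorphism after inverting the discriminant $\mathrm{Disc}=\prod_{i<j}(x_i-x_j)^2\in\mathbb C[\mathbb A^{(N)}]$, i.e. $$\mathcal H_{kN}(kn,1)_{\mathfrak{sl}_k[z]}[\mathrm{Disc}^{-1}]\cong\mathcal H_N(n,k)[\mathrm{Disc}^{-1}].$$
   Context: For positive integers $M,p,\ell$ let $\mathbb C[X,A]$ be the polynomial ring in the entries of an $M\times M$ matrix $X$ and a $p\times M$ matrix $A$, and $\mathcal H_M(p,\ell)=\{f: f(gXg^{-1},Ag^{-1})=\det(g)^{-\ell}f(X,A)\ \forall g\in GL_M(\mathbb C)\}$. $\mathfrak{gl}_p[z]$ acts on it by $E^a_b\otimes z^m\mapsto\sum_{i,j}A^a_i(X^m)^i_j\,\partial/\partial A^b_j$. With $\mathbb C^{kn}=\mathbb C^n\otimes\mathbb C^k$, $\mathfrak{sl}_k[z]\subset\mathfrak{gl}_{kn}[z]$ via $y\otimes z^m\mapsto(1_n\otimes y)z^m$; the coinvariants are $\mathcal H_{kN}(kn,1)_{\mathfrak{sl}_k[z]}=\mathcal H_{kN}(kn,1)/\mathfrak{sl}_k[z]\cdot\mathcal H_{kN}(kn,1)$. The level-rank map $\tau:\mathcal H_{kN}(kn,1)\to\mathcal H_N(n,k)$ is $\tau(f)(X,A)=f(X\otimes1_k,A\otimes1_k)$ (Kronecker products; geometrically, restriction of sections of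 the determinant line bundle to the $GL_k$-fixed locus of the Quot scheme). It is surjective and annihilates $\mathfrak{sl}_k[z]\cdot\mathcal H_{kN}(kn,1)$; the induced map on coinvariants is $\bar\tau$. $\mathbb C[\mathbb A^{(N)}]=\mathbb C[x_1,\dots,x_N]^{S_N}=\mathbb C[p_1,\dots,p_N]$ (power sums). It acts on $\mathcal H_N(n,k)$ with $p_r$ acting as multiplication by $\mathrm{Tr}(X^r)$, and on $\mathcal H_{kN}(kn,1)_{\mathfrak{sl}_k[z]}$ with $p_r$ acting as multiplication by $\frac1k\mathrm{Tr}(X^r)$; $\bar\tau$ is $\mathbb C[\mathbb A^{(N)}]$-linear. *)

theory Defs
  imports
    "HOL-Analysis.Derivative"
    "HOL-Combinatorics.Permutations"
    "HOL-Algebra.AbelCoset"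
    "Jordan_Normal_Form.Determinant"
    "Jordan_Normal_Form.Missing_VectorSpace"
begin

section \<open>Modules: quotients and localization at one element\<close>

definition quot_module ::
  "('r, 'm, 'c) module_scheme \<Rightarrow> 'm set \<Rightarrow> ('r, 'm set) module" where
  "quot_module M S =
     \<lparr>carrier = a_rcosets\<^bsub>M\<^esub> S, mult = undefined, one = undefined,
      zero = S, add = (<+>\<^bsub>M\<^esub>),
      module.smult = (\<lambda>r C. \<Union>m\<in>C. S +>\<^bsub>M\<^esub> (r \<odot>\<^bsub>M\<^esub> m))\<rparr>"

text \<open>The map induced on a quotient by a map that is constant on each coset.\<close>

definition quot_map :: "('m \<Rightarrow> 'n) \<Rightarrow> 'm set \<Rightarrow> 'n" where
  "quot_map f C = the_elem (f ` C)"

text \<open>A pair \<open>(m, a)\<close> stands for the fraction \<open>m / d^a\<close>.\<close>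

definition loc_rel ::
  "('r, 'b) ring_scheme \<Rightarrow> ('r, 'm, 'c) module_scheme \<Rightarrow> 'r
    \<Rightarrow> (('m \<times> nat) \<times> ('m \<times> nat)) set" where
  "loc_rel R M d =
     {((m, a), (m', b)) | m a m' b. m \<in> carrier M \<and> m' \<in> carrier M \<and>
        (\<exists>c. (d [^]\<^bsub>R\<^esub> (c + b)) \<odot>\<^bsub>M\<^esub> m = (d [^]\<^bsub>R\<^esub> (c + a)) \<odot>\<^bsub>M\<^esub> m')}"

definition loc_frac ::
  "('r, 'b) ring_scheme \<Rightarrow> ('r, 'm, 'c) module_scheme \<Rightarrow> 'r
    \<Rightarrow> 'm \<Rightarrow> nat \<Rightarrow> ('m \<times> nat) set" where
  "loc_frac R M d m a = loc_rel R M d `` {(m, a)}"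

definition loc_carrier ::
  "('r, 'b) ring_scheme \<Rightarrow> ('r, 'm, 'c) module_scheme \<Rightarrow> 'r \<Rightarrow> ('m \<times> nat) set set" where
  "loc_carrier R M d = (carrier M \<times> UNIV) // loc_rel R M d"

definition loc_add ::
  "('r, 'b) ring_scheme \<Rightarrow> ('r, 'm, 'c) module_scheme \<Rightarrow> 'r
    \<Rightarrow> ('m \<times> nat) set \<Rightarrow> ('m \<times> nat) set \<Rightarrow> ('m \<times> nat) set" where
  "loc_add R M d C E =
     (\<Union>(m, a)\<in>C. \<Union>(m', b)\<in>E.
        loc_frac R M d ((d [^]\<^bsub>R\<^esub> b) \<odot>\<^bsub>M\<^esub> m \<oplus>\<^bsub>M\<^esub> (d [^]\<^bsub>R\<^esub> a) \<odot>\<^bsub>M\<^esub> m') (a + b))"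

definition loc_smult ::
  "('r, 'b) ring_scheme \<Rightarrow> ('r, 'm, 'c) module_scheme \<Rightarrow> 'r
    \<Rightarrow> ('r \<times> nat) set \<Rightarrow> ('m \<times> nat) set \<Rightarrow> ('m \<times> nat) set" where
  "loc_smult R M d C E =
     (\<Union>(r, a)\<in>C. \<Union>(m, b)\<in>E. loc_frac R M d (r \<odot>\<^bsub>M\<^esub> m) (a + b))"

definition regular_module :: "('r, 'b) ring_scheme \<Rightarrow> ('r, 'r) module" where
  "regular_module R =
     \<lparr>carrier = carrier R, mult = mult R, one = one R, zero = zero R, add = add R,
      module.smult = mult R\<rparr>"

text \<open>The ring \<open>R[1/d]\<close> and the \<open>R[1/d]\<close>-module \<open>M[1/d]\<close>.\<close>

definition loc_ring :: "('r, 'b) ring_scheme \<Rightarrow> 'r \<Rightarrow> ('r \<times> nat) set ring" where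
  "loc_ring R d =
     \<lparr>carrier = loc_carrier R (regular_module R) d,
      mult = loc_smult R (regular_module R) d,
      one = loc_frac R (regular_module R) d \<one>\<^bsub>R\<^esub> 0,
      zero = loc_frac R (regular_module R) d \<zero>\<^bsub>R\<^esub> 0,
      add = loc_add R (regular_module R) d\<rparr>"

definition loc_module ::
  "('r, 'b) ring_scheme \<Rightarrow> ('r, 'm, 'c) module_scheme \<Rightarrow> 'r
    \<Rightarrow> (('r \<times> nat) set, ('m \<times> nat) set) module" where
  "loc_module R M d =
     \<lparr>carrier = loc_carrier R M d, mult = undefined, one = undefined,
      zero = loc_frac R M d \<zero>\<^bsub>M\<^esub> 0, add = loc_add R M d, module.smult = loc_smult R M d\<rparr>"

text \<open>The map \<open>m / d^a \<mapsto> \<phi> m / d^a\<close>; the second module is the target.\<close>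

definition loc_map ::
  "('r, 'b) ring_scheme \<Rightarrow> ('r, 'n, 'c) module_scheme \<Rightarrow> 'r \<Rightarrow> ('m \<Rightarrow> 'n)
    \<Rightarrow> ('m \<times> nat) set \<Rightarrow> ('n \<times> nat) set" where
  "loc_map R N d \<phi> C = (\<Union>(m, a)\<in>C. loc_frac R N d (\<phi> m) a)"

definition is_module_iso ::
  "('r, 'b) ring_scheme \<Rightarrow> ('r, 'm, 'c) module_scheme \<Rightarrow> ('r, 'n, 'e) module_scheme
    \<Rightarrow> ('m \<Rightarrow> 'n) \<Rightarrow> bool" where
  "is_module_iso R M N f \<longleftrightarrow> mod_hom R M N f \<and> bij_betw f (carrier M) (carrier N)"


section \<open>Polynomial functions\<close>

text \<open>
  The \<open>\<complex>\<close>-algebra of functions on \<open>D\<close> generated by the coordinate functions in \<open>G\<close>.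
  When \<open>D\<close> is an affine space \<open>\<complex>\<^sup>m\<close> with coordinates \<open>G\<close>, this is the polynomial ring
  in \<open>m\<close> variables, since \<open>\<complex>\<close> is infinite. Functions are extensional (\<^const>\<open>restrict\<close>), so
  that equality of functions is equality on \<open>D\<close>.
\<close>

inductive_set poly_funs :: "'a set \<Rightarrow> ('a \<Rightarrow> complex) set \<Rightarrow> ('a \<Rightarrow> complex) set"
  for D :: "'a set" and G :: "('a \<Rightarrow> complex) set" where
  const: "(\<lambda>x\<in>D. c) \<in> poly_funs D G"
| coord: "g \<in> G \<Longrightarrow> (\<lambda>x\<in>D. g x) \<in> poly_funs D G"
| add: "f \<in> poly_funs D G \<Longrightarrow> g \<in> poly_funs D G \<Longrightarrow> (\<lambda>x\<in>D. f x + g x) \<in> poly_funs D G"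
| mult: "f \<in> poly_funs D G \<Longrightarrow> g \<in> poly_funs D G \<Longrightarrow> (\<lambda>x\<in>D. f x * g x) \<in> poly_funs D G"

definition vec_polys :: "nat \<Rightarrow> (complex vec \<Rightarrow> complex) set" where
  "vec_polys N = poly_funs (carrier_vec N) {(\<lambda>x. x $ i) | i. i < N}"

definition sym_polys :: "nat \<Rightarrow> (complex vec \<Rightarrow> complex) set" where
  "sym_polys N =
     {r \<in> vec_polys N. \<forall>\<pi>. \<pi> permutes {..<N} \<longrightarrow>
        (\<forall>x\<in>carrier_vec N. r (vec N (\<lambda>i. x $ \<pi> i)) = r x)}"

text \<open>The ring \<open>\<complex>[x\<^sub>1,\<dots>,x\<^sub>N]\<^sup>S\<close> of symmetric polynomials (with 0-based indices).\<close>

definition sym_ring :: "nat \<Rightarrow> (complex vec \<Rightarrow> complex) ring" where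
  "sym_ring N =
     \<lparr>carrier = sym_polys N,
      mult = (\<lambda>r s. \<lambda>x\<in>carrier_vec N. r x * s x),
      one = (\<lambda>x\<in>carrier_vec N. 1),
      zero = (\<lambda>x\<in>carrier_vec N. 0),
      add = (\<lambda>r s. \<lambda>x\<in>carrier_vec N. r x + s x)\<rparr>"

definition Disc :: "nat \<Rightarrow> complex vec \<Rightarrow> complex" where
  "Disc N = (\<lambda>x\<in>carrier_vec N. \<Prod>j<N. \<Prod>i<j. (x $ i - x $ j)\<^sup>2)"

text \<open>
  The unique polynomial \<open>P\<close> with \<open>r = P(p\<^sub>1,\<dots>,p\<^sub>N)\<close>, where \<open>p\<^sub>m = \<Sum>\<^sub>j x\<^sub>j^m\<close>. Entry \<open>i\<close>
  of the argument of \<open>P\<close> is the place of \<open>p\<^bsub>i+1\<^esub>\<close>.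
\<close>

definition power_sum_form :: "nat \<Rightarrow> (complex vec \<Rightarrow> complex) \<Rightarrow> complex vec \<Rightarrow> complex" where
  "power_sum_form N r =
     (THE P. P \<in> vec_polys N \<and>
        (\<forall>x\<in>carrier_vec N. P (vec N (\<lambda>i. \<Sum>j<N. (x $ j) ^ (i + 1))) = r x))"


section \<open>The spaces \<open>\<H>\<^sub>M(p, \<ell>)\<close>\<close>

text \<open>The ring \<open>\<complex>[X,A]\<close> for \<open>X\<close> of size \<open>M \<times> M\<close> and \<open>A\<close> of size \<open>p \<times> M\<close>.\<close>

definition mat_pairs :: "nat \<Rightarrow> nat \<Rightarrow> (complex mat \<times> complex mat) set" where
  "mat_pairs M p = carrier_mat M M \<times> carrier_mat p M"

definition mat_polys :: "nat \<Rightarrow> nat \<Rightarrow> (complex mat \<times> complex mat \<Rightarrow> complex) set" where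
  "mat_polys M p =
     poly_funs (mat_pairs M p)
       ({(\<lambda>(X, A). X $$ (i, j)) | i j. i < M \<and> j < M} \<union>
        {(\<lambda>(X, A). A $$ (a, j)) | a j. a < p \<and> j < M})"

definition \<H> :: "nat \<Rightarrow> nat \<Rightarrow> nat \<Rightarrow> (complex mat \<times> complex mat \<Rightarrow> complex) set" where
  "\<H> M p l =
     {f \<in> mat_polys M p.
        \<forall>g\<in>carrier_mat M M. \<forall>h\<in>carrier_mat M M. inverts_mat g h \<and> inverts_mat h g \<longrightarrow>
          (\<forall>(X, A)\<in>mat_pairs M p. f (g * X * h, A * h) = inverse (det g ^ l) * f (X, A))}"

definition mat_trace :: "'a :: comm_monoid_add mat \<Rightarrow> 'a" where
  "mat_trace X = (\<Sum>i<dim_row X. X $$ (i, i))"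

text \<open>
  \<open>\<H>\<^sub>M(p, l)\<close> as a module over \<open>\<complex>[p\<^sub>1,\<dots>,p\<^sub>N]\<close>, where \<open>p\<^sub>m\<close> acts as multiplication
  by \<open>c Tr(X^m)\<close> for \<open>m = 1,\<dots>,N\<close>.
\<close>

definition \<H>_module ::
  "nat \<Rightarrow> complex \<Rightarrow> nat \<Rightarrow> nat \<Rightarrow> nat
    \<Rightarrow> (complex vec \<Rightarrow> complex, complex mat \<times> complex mat \<Rightarrow> complex) module" where
  "\<H>_module N c M p l =
     \<lparr>carrier = \<H> M p l, mult = undefined, one = undefined,
      zero = (\<lambda>XA\<in>mat_pairs M p. 0),
      add = (\<lambda>f g. \<lambda>XA\<in>mat_pairs M p. f XA + g XA),
      module.smult = (\<lambda>r f. \<lambda>(X, A)\<in>mat_pairs M p.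
        power_sum_form N r (vec N (\<lambda>i. c * mat_trace (X ^\<^sub>m (i + 1)))) * f (X, A))\<rparr>"


section \<open>The current algebra action and coinvariants\<close>

definition partial_A ::
  "nat \<Rightarrow> nat \<Rightarrow> nat \<Rightarrow> nat \<Rightarrow> (complex mat \<times> complex mat \<Rightarrow> complex)
    \<Rightarrow> complex mat \<times> complex mat \<Rightarrow> complex" where
  "partial_A M p b j f = (\<lambda>(X, A)\<in>mat_pairs M p.
     deriv (\<lambda>t. f (X, mat p M (\<lambda>ai. if ai = (b, j) then t else A $$ ai))) (A $$ (b, j)))"

text \<open>
  Elements of \<open>\<gg>\<ll>\<^sub>p[z]\<close> are \<open>p \<times> p\<close> matrices \<open>Y\<close> over \<open>\<complex>[z]\<close>. The coefficient
  of \<open>z^m\<close> in the entry \<open>(a, b)\<close> is the coefficient of \<open>E\<^sup>a\<^sub>b \<otimes> z^m\<close>, which acts as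
  \<open>\<Sum>\<^sub>i\<^sub>,\<^sub>j A\<^sup>a\<^sub>i (X^m)\<^sup>i\<^sub>j \<partial>/\<partial>A\<^sup>b\<^sub>j\<close>.
\<close>

definition gl_act ::
  "nat \<Rightarrow> nat \<Rightarrow> complex poly mat \<Rightarrow> (complex mat \<times> complex mat \<Rightarrow> complex)
    \<Rightarrow> complex mat \<times> complex mat \<Rightarrow> complex" where
  "gl_act M p Y f = (\<lambda>(X, A)\<in>mat_pairs M p.
     \<Sum>a<p. \<Sum>b<p. \<Sum>m\<le>degree (Y $$ (a, b)). coeff (Y $$ (a, b)) m *
       (\<Sum>i<M. \<Sum>j<M. A $$ (a, i) * (X ^\<^sub>m m) $$ (i, j) * partial_A M p b j f (X, A)))"

definition kron :: "'a :: times mat \<Rightarrow> 'a mat \<Rightarrow> 'a mat" (infixl \<open>\<otimes>\<^sub>K\<close> 70) where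
  "B \<otimes>\<^sub>K C =
     mat (dim_row B * dim_row C) (dim_col B * dim_col C)
       (\<lambda>(i, j). B $$ (i div dim_row C, j div dim_col C) *
                 C $$ (i mod dim_row C, j mod dim_col C))"

definition sl_current :: "nat \<Rightarrow> complex poly mat set" where
  "sl_current k = {y \<in> carrier_mat k k. mat_trace y = 0}"

text \<open>
  The span \<open>\<ss>\<ll>\<^sub>k[z] \<cdot> \<H>\<^bsub>kN\<^esub>(kn, 1)\<close>, with \<open>\<ss>\<ll>\<^sub>k[z]\<close> embedded in \<open>\<gg>\<ll>\<^bsub>kn\<^esub>[z]\<close>
  by \<open>y \<mapsto> 1\<^sub>n \<otimes> y\<close>. Scalar coefficients are absorbed into the \<open>f i\<close>.
\<close>

definition sl_image ::
  "nat \<Rightarrow> nat \<Rightarrow> nat \<Rightarrow> (complex mat \<times> complex mat \<Rightarrow> complex) set" where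
  "sl_image k n N =
     {(\<lambda>XA\<in>mat_pairs (k * N) (k * n).
         \<Sum>i<s. gl_act (k * N) (k * n) (1\<^sub>m n \<otimes>\<^sub>K y i) (f i) XA) | (s :: nat) y f.
       \<forall>i<s. y i \<in> sl_current k \<and> f i \<in> \<H> (k * N) (k * n) 1}"

definition coinvariants ::
  "nat \<Rightarrow> nat \<Rightarrow> nat
    \<Rightarrow> (complex vec \<Rightarrow> complex, (complex mat \<times> complex mat \<Rightarrow> complex) set) module" where
  "coinvariants k n N =
     quot_module (\<H>_module N (1 / of_nat k) (k * N) (k * n) 1) (sl_image k n N)"


section \<open>The level-rank map\<close>

definition level_rank ::
  "nat \<Rightarrow> nat \<Rightarrow> nat \<Rightarrow> (complex mat \<times> complex mat \<Rightarrow> complex)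
    \<Rightarrow> complex mat \<times> complex mat \<Rightarrow> complex" where
  "level_rank k n N f = (\<lambda>(X, A)\<in>mat_pairs N n. f (X \<otimes>\<^sub>K 1\<^sub>m k, A \<otimes>\<^sub>K 1\<^sub>m k))"

definition reduced_level_rank ::
  "nat \<Rightarrow> nat \<Rightarrow> nat \<Rightarrow> (complex mat \<times> complex mat \<Rightarrow> complex) set
    \<Rightarrow> complex mat \<times> complex mat \<Rightarrow> complex" where
  "reduced_level_rank k n N = quot_map (level_rank k n N)"

end

theory Submission
  imports Defs
    "HOL-Computational_Algebra.Fundamental_Theorem_Algebra"
    "Jordan_Normal_Form.Jordan_Normal_Form_Existence"
begin

text \<open>
  By equivariance an element of \<open>\<H>\<^sub>M(p,\<ell>)\<close> is determined by its values at the points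
  \<open>(diag z, A)\<close>, and for \<open>\<ell> = 1\<close> it is a sum of antisymmetrizations of \<open>q(z) \<Prod>\<^sub>r A(w\<^sub>r, r)\<close>
  (a polynomial \<open>q\<close> and a word \<open>w\<close> of row indices). Take \<open>M = kN\<close>; the index \<open>r = ik + a\<close>
  stands for the site \<open>i\<close> and the colour \<open>a\<close>.

  In the coinvariants, the Cartan part of \<open>\<ss>\<ll>\<^sub>k[z]\<close> kills the words in which the colours do not
  occur equally often and identifies the power sums of the variables of any two colours. Hence every
  \<open>z\<^sub>r\<close> is a root of \<open>\<Prod>\<^sub>i (t - x\<^sub>i)\<close>, where \<open>x\<^sub>1, \<dots>, x\<^sub>N\<close> are the variables of colour
  0, and after inverting the discriminant (Lagrange interpolation) a polynomial \<open>q\<close> matters only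
  through its values at the points \<open>x \<circ> s\<close> with \<open>s\<close> bijective on each colour. A product over
  pairs of distinct sites selects the point where \<open>s\<close> is the site, and there the root
  vectors of \<open>\<ss>\<ll>\<^sub>k\<close> permute the rows over each site. The level-rank map sends the remaining
  classes to multiples of distinct products \<open>\<Prod>\<^sub>r A(b\<^sub>r, r div k)\<close>, symmetrized over the sites; these
  products are linearly independent, which gives injectivity, and after inverting the discriminant
  their symmetrizations span \<open>\<H>\<^sub>N(n,k)\<close>.
\<close>

subsection \<open>Localization of modules\<close>

text \<open>Where the discriminant of the colour 0 variables vanishes, the relations in the
  coinvariants are not controlled. So a fixed power of the discriminant is carried along:
  \<open>disc_fun ^ disc_exp\<close> is built into the elements \<open>sep_elt\<close>, and a
  polynomial that vanishes at the points \<open>x \<circ> s\<close> then gives an honest zero in the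
  coinvariants. The isomorphism thereby reduces to two statements without fractions: one power of
  the discriminant moves the kernel of the level-rank map into \<open>sl_image\<close>, another
  moves the target into the image. Preferring one of the points \<open>x \<circ> s\<close> costs
  only a further power, since the sum \<open>theta\<close> of all rearrangements of the selecting
  product is a positive integer times a power of the discriminant. The scalars act through the
  polynomial in \<open>power_sum_form\<close>, whose existence and uniqueness rest on Newton's
  identities; the same identities show that the polynomial with the variables of a colour as roots
  has coefficients independent of the colour, modulo the relations.\<close>

locale localized_module = module R M for R (structure) and M (structure) +
  fixes d
  assumes d_closed [simp]: "d \<in> carrier R"
begin

abbreviation scale :: "nat \<Rightarrow> 'c \<Rightarrow> 'c" where
  "scale a m \<equiv> (d [^]\<^bsub>R\<^esub> a) \<odot>\<^bsub>M\<^esub> m"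

abbreviation frac :: "'c \<Rightarrow> nat \<Rightarrow> ('c \<times> nat) set" where
  "frac \<equiv> loc_frac R M d"

lemma scale_scale: "m \<in> carrier M \<Longrightarrow> scale a (scale b m) = scale (a + b) m"
  by (simp add: smult_assoc1[symmetric] R.nat_pow_mult)

lemma scale_smult:
  "r \<in> carrier R \<Longrightarrow> m \<in> carrier M \<Longrightarrow> scale a (r \<odot>\<^bsub>M\<^esub> m) = r \<odot>\<^bsub>M\<^esub> scale a m"
  by (simp add: smult_assoc1[symmetric] R.m_comm)

lemma scale_add:
  "m \<in> carrier M \<Longrightarrow> m' \<in> carrier M \<Longrightarrow> scale a (m \<oplus>\<^bsub>M\<^esub> m') = scale a m \<oplus>\<^bsub>M\<^esub> scale a m'"
  by (simp add: smult_r_distr)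

text \<open>Clearing the middle fraction of a chain costs a further power of \<open>d\<close>. The
  free exponent in \<open>loc_rel\<close> absorbs it, so the relation is transitive even where
  \<open>d\<close> kills elements of \<open>M\<close>.\<close>

lemma equiv_loc_rel: "equiv (carrier M \<times> UNIV) (loc_rel R M d)"
proof (rule equivI)
  show "loc_rel R M d \<subseteq> (carrier M \<times> UNIV) \<times> (carrier M \<times> UNIV)"
    by (auto simp: loc_rel_def)
  show "refl_on (carrier M \<times> UNIV) (loc_rel R M d)"
    by (auto simp: refl_on_def loc_rel_def)
  show "sym (loc_rel R M d)"
    unfolding sym_def loc_rel_def by (auto; metis)
  show "trans (loc_rel R M d)"
  proof (rule transI)
    fix u v w assume "(u, v) \<in> loc_rel R M d" "(v, w) \<in> loc_rel R M d"
    then obtain m a m' b m'' e c c' where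
      uvw: "u = (m, a)" "v = (m', b)" "w = (m'', e)" and
      c: "m \<in> carrier M" "m' \<in> carrier M" "m'' \<in> carrier M" and
      1: "scale (c + b) m = scale (c + a) m'" and 2: "scale (c' + e) m' = scale (c' + b) m''"
      unfolding loc_rel_def by blast
    have "scale ((c + c' + b) + e) m = scale (c' + e) (scale (c + b) m)"
      using c by (simp add: scale_scale ac_simps)
    also have "\<dots> = scale (c + a) (scale (c' + e) m')"
      unfolding 1 using c by (simp add: scale_scale ac_simps)
    also have "\<dots> = scale ((c + c' + b) + a) m''"
      unfolding 2 using c by (simp add: scale_scale ac_simps)
    finally show "(u, w) \<in> loc_rel R M d"
      using c unfolding loc_rel_def uvw by blast
  qed
qed

lemma frac_eq_iff:
  assumes "m \<in> carrier M" "m' \<in> carrier M"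
  shows "frac m a = frac m' b \<longleftrightarrow> (\<exists>c. scale (c + b) m = scale (c + a) m')"
proof -
  have "frac m a = frac m' b \<longleftrightarrow> ((m, a), (m', b)) \<in> loc_rel R M d"
    unfolding loc_frac_def using assms by (intro eq_equiv_class_iff[OF equiv_loc_rel]) auto
  also have "\<dots> \<longleftrightarrow> (\<exists>c. scale (c + b) m = scale (c + a) m')"
    using assms unfolding loc_rel_def by auto
  finally show ?thesis .
qed

lemma in_frac_iff:
  assumes "m \<in> carrier M"
  shows "(m', b) \<in> frac m a \<longleftrightarrow> m' \<in> carrier M \<and> frac m' b = frac m a"
  using assms equiv_class_eq_iff[OF equiv_loc_rel, of "(m, a)" "(m', b)"]
  unfolding loc_frac_def by auto

lemma frac_self: "m \<in> carrier M \<Longrightarrow> (m, a) \<in> frac m a"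
  by (simp add: in_frac_iff)

lemma loc_carrier_iff: "C \<in> loc_carrier R M d \<longleftrightarrow> (\<exists>m\<in>carrier M. \<exists>a. C = frac m a)"
  unfolding loc_carrier_def quotient_def loc_frac_def by auto

lemma frac_closed: "m \<in> carrier M \<Longrightarrow> frac m a \<in> loc_carrier R M d"
  unfolding loc_carrier_iff by blast

lemma frac_eqI: "m \<in> carrier M \<Longrightarrow> m' \<in> carrier M \<Longrightarrow> scale b m = scale a m' \<Longrightarrow> frac m a = frac m' b"
  unfolding frac_eq_iff by (rule exI[of _ 0]) simp

lemma frac_scale: "m \<in> carrier M \<Longrightarrow> frac (scale c m) (c + a) = frac m a"
  by (rule frac_eqI) (auto simp: scale_scale ac_simps)

text \<open>The union in \<open>loc_add\<close> runs over all representatives of both fractions; it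
  is a single class because every choice of representatives gives the same fraction.\<close>

lemma loc_add_frac:
  assumes "m \<in> carrier M" "m' \<in> carrier M"
  shows "loc_add R M d (frac m a) (frac m' b) = frac (scale b m \<oplus>\<^bsub>M\<^esub> scale a m') (a + b)"
proof -
  have eq: "frac (scale b1 m1 \<oplus>\<^bsub>M\<^esub> scale a1 m1') (a1 + b1) = frac (scale b m \<oplus>\<^bsub>M\<^esub> scale a m') (a + b)"
    if 1: "(m1, a1) \<in> frac m a" and 2: "(m1', b1) \<in> frac m' b" for m1 a1 m1' b1
  proof -
    have c1: "m1 \<in> carrier M" and c2: "m1' \<in> carrier M"
      using 1 2 assms by (auto simp: in_frac_iff)
    obtain c where c: "scale (c + a) m1 = scale (c + a1) m"
      using 1 assms c1 by (auto simp: in_frac_iff frac_eq_iff)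
    obtain e where e: "scale (e + b) m1' = scale (e + b1) m'"
      using 2 assms c2 by (auto simp: in_frac_iff frac_eq_iff)
    have "scale ((c + e) + (a + b)) (scale b1 m1 \<oplus>\<^bsub>M\<^esub> scale a1 m1')
       = scale (e + b + b1) (scale (c + a) m1) \<oplus>\<^bsub>M\<^esub> scale (c + a + a1) (scale (e + b) m1')"
      using c1 c2 by (simp add: scale_add scale_scale ac_simps)
    also have "\<dots> = scale ((c + e) + (a1 + b1)) (scale b m \<oplus>\<^bsub>M\<^esub> scale a m')"
      unfolding c e using assms by (simp add: scale_add scale_scale ac_simps)
    finally show ?thesis
      using c1 c2 assms by (subst frac_eq_iff) auto
  qed
  show ?thesis
    unfolding loc_add_def
  proof (intro equalityI subsetI)
    fix u assume "u \<in> (\<Union>(m, a)\<in>frac m a. \<Union>(m', b)\<in>frac m' b. frac (scale b m \<oplus>\<^bsub>M\<^esub> scale a m') (a + b))"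
    then obtain m1 a1 m1' b1 where "(m1, a1) \<in> frac m a" "(m1', b1) \<in> frac m' b"
      "u \<in> frac (scale b1 m1 \<oplus>\<^bsub>M\<^esub> scale a1 m1') (a1 + b1)" by auto
    then show "u \<in> frac (scale b m \<oplus>\<^bsub>M\<^esub> scale a m') (a + b)" using eq by auto
  next
    fix u assume "u \<in> frac (scale b m \<oplus>\<^bsub>M\<^esub> scale a m') (a + b)"
    then show "u \<in> (\<Union>(m, a)\<in>frac m a. \<Union>(m', b)\<in>frac m' b. frac (scale b m \<oplus>\<^bsub>M\<^esub> scale a m') (a + b))"
      using frac_self[of m a] frac_self[of m' b] assms by blast
  qed
qed

lemma abelian_group_loc: "abelian_group (loc_module R M d)"
proof (rule abelian_groupI, goal_cases)
  case (1 x y)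
  then obtain m a m' b where
    xyz: "x = frac m a" "y = frac m' b" and
    [simp]: "m \<in> carrier M" "m' \<in> carrier M"
    by (auto simp: loc_module_def loc_carrier_iff)
  show ?case
    by (simp add: loc_module_def xyz loc_add_frac frac_closed)
next
  case 2
  then show ?case by (auto simp: loc_module_def intro: frac_closed)
next
  case (3 x y z)
  then obtain m a m' b m'' c where
    xyz: "x = frac m a" "y = frac m' b" "z = frac m'' c" and
    [simp]: "m \<in> carrier M" "m' \<in> carrier M" "m'' \<in> carrier M"
    by (auto simp: loc_module_def loc_carrier_iff)
  show ?case
    by (simp add: loc_module_def xyz loc_add_frac scale_add scale_scale M.a_assoc ac_simps)
next
  case (4 x y)
  then obtain m a m' b where
    xyz: "x = frac m a" "y = frac m' b" and
    [simp]: "m \<in> carrier M" "m' \<in> carrier M"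
    by (auto simp: loc_module_def loc_carrier_iff)
  show ?case
    by (simp add: loc_module_def xyz loc_add_frac M.a_comm ac_simps)
next
  case (5 x)
  then obtain m a where
    xyz: "x = frac m a" and [simp]: "m \<in> carrier M"
    by (auto simp: loc_module_def loc_carrier_iff)
  show ?case
    by (simp add: loc_module_def xyz loc_add_frac)
next
  case (6 x)
  then obtain m a where
    xyz: "x = frac m a" and [simp]: "m \<in> carrier M"
    by (auto simp: loc_module_def loc_carrier_iff)
  have "loc_add R M d (frac (\<ominus>\<^bsub>M\<^esub> m) a) x = frac \<zero>\<^bsub>M\<^esub> 0"
    unfolding xyz
    by (simp add: loc_add_frac) (rule frac_eqI; simp add: scale_add[symmetric] M.l_neg)
  then show ?case
    using frac_closed[of "\<ominus>\<^bsub>M\<^esub> m" a] by (auto simp: loc_module_def)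
qed

end

section \<open>The localized ring and its action on the localized module\<close>

text \<open>A ring and its regular module are different records with the same additive structure;
  the group axioms are proved for one and carried to the other.\<close>

lemma abelian_group_cong:
  assumes "abelian_group G" "carrier H = carrier G" "add H = add G" "zero H = zero G"
  shows "abelian_group H"
proof -
  interpret G: abelian_group G by fact
  show ?thesis
  proof (rule abelian_groupI)
    fix x assume "x \<in> carrier H"
    then show "\<exists>y\<in>carrier H. y \<oplus>\<^bsub>H\<^esub> x = \<zero>\<^bsub>H\<^esub>"
      using assms G.l_neg[of x] G.a_inv_closed[of x] by metis
  qed (simp_all add: assms G.a_ac)
qed

lemma (in cring) regular_module_is_module: "module R (regular_module R)"
proof (rule moduleI)
  show "abelian_group (regular_module R)"
    by (rule abelian_group_cong[OF abelian_group_axioms]) (simp_all add: regular_module_def)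
qed (simp_all add: regular_module_def cring_axioms m_assoc l_distr r_distr)

context localized_module
begin

interpretation Reg: localized_module R "regular_module R" d
  using regular_module_is_module d_closed
  by (simp add: localized_module_def localized_module_axioms_def)

lemma loc_smult_frac:
  assumes "r \<in> carrier R" "m \<in> carrier M"
  shows "loc_smult R M d (loc_frac R (regular_module R) d r a) (frac m b) = frac (r \<odot>\<^bsub>M\<^esub> m) (a + b)"
proof -
  have sm: "\<And>x y. x \<odot>\<^bsub>regular_module R\<^esub> y = x \<otimes> y" and cr: "carrier (regular_module R) = carrier R"
    by (simp_all add: regular_module_def)
  have eq: "frac (r1 \<odot>\<^bsub>M\<^esub> m1) (a1 + b1) = frac (r \<odot>\<^bsub>M\<^esub> m) (a + b)"
    if 1: "(r1, a1) \<in> Reg.frac r a" and 2: "(m1, b1) \<in> frac m b" for r1 a1 m1 b1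
  proof -
    have c1: "r1 \<in> carrier R" and c2: "m1 \<in> carrier M"
      using 1 2 assms by (auto simp: in_frac_iff Reg.in_frac_iff cr)
    obtain c where c: "d [^] (c + a) \<otimes> r1 = d [^] (c + a1) \<otimes> r"
      using 1 assms c1 by (auto simp: Reg.in_frac_iff Reg.frac_eq_iff cr sm)
    obtain e where e: "scale (e + b) m1 = scale (e + b1) m"
      using 2 assms c2 by (auto simp: in_frac_iff frac_eq_iff)
    have "scale ((c + e) + (a + b)) (r1 \<odot>\<^bsub>M\<^esub> m1) = scale (c + a) (scale (e + b) (r1 \<odot>\<^bsub>M\<^esub> m1))"
      using c1 c2 by (simp add: scale_scale ac_simps)
    also have "\<dots> = (d [^] (c + a) \<otimes> r1) \<odot>\<^bsub>M\<^esub> scale (e + b) m1"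
      using c1 c2 by (simp add: scale_smult[of r1 m1] smult_assoc1)
    also have "\<dots> = scale (c + a1) (scale (e + b1) (r \<odot>\<^bsub>M\<^esub> m))"
      unfolding c e using assms by (simp add: scale_smult[of r m] smult_assoc1)
    also have "\<dots> = scale ((c + e) + (a1 + b1)) (r \<odot>\<^bsub>M\<^esub> m)"
      using assms by (simp add: scale_scale ac_simps)
    finally show ?thesis
      using c1 c2 assms by (subst frac_eq_iff) auto
  qed
  have ne: "(r, a) \<in> Reg.frac r a"
    using assms by (simp add: Reg.frac_self cr)
  show ?thesis
    unfolding loc_smult_def
  proof (intro equalityI subsetI)
    fix u assume "u \<in> (\<Union>(r, a)\<in>Reg.frac r a. \<Union>(m, b)\<in>frac m b. frac (r \<odot>\<^bsub>M\<^esub> m) (a + b))"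
    then obtain r1 a1 m1 b1 where "(r1, a1) \<in> Reg.frac r a" "(m1, b1) \<in> frac m b"
      "u \<in> frac (r1 \<odot>\<^bsub>M\<^esub> m1) (a1 + b1)" by auto
    then show "u \<in> frac (r \<odot>\<^bsub>M\<^esub> m) (a + b)" using eq by auto
  next
    fix u assume "u \<in> frac (r \<odot>\<^bsub>M\<^esub> m) (a + b)"
    then show "u \<in> (\<Union>(r, a)\<in>Reg.frac r a. \<Union>(m, b)\<in>frac m b. frac (r \<odot>\<^bsub>M\<^esub> m) (a + b))"
      using frac_self[of m b] ne assms by blast
  qed
qed

end

locale localized_cring = cring R for R (structure) +
  fixes d
  assumes d_closed [simp]: "d \<in> carrier R"
begin

sublocale Reg: localized_module R "regular_module R" d
  using regular_module_is_module d_closed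
  by (simp add: localized_module_def localized_module_axioms_def)

lemma loc_mult_frac:
  assumes "r \<in> carrier R" "s \<in> carrier R"
  shows "loc_smult R (regular_module R) d (Reg.frac r a) (Reg.frac s b) = Reg.frac (r \<otimes> s) (a + b)"
  using Reg.loc_smult_frac[of r s a b] assms by (simp add: regular_module_def)

lemma loc_ring_elem:
  assumes "x \<in> carrier (loc_ring R d)"
  obtains r a where "x = Reg.frac r a" "r \<in> carrier R"
  using assms by (auto simp: loc_ring_def Reg.loc_carrier_iff) (auto simp: regular_module_def)

lemma frac_eqI:
  "r \<in> carrier R \<Longrightarrow> s \<in> carrier R \<Longrightarrow> d [^] b \<otimes> r = d [^] a \<otimes> s \<Longrightarrow> Reg.frac r a = Reg.frac s b"
  by (rule Reg.frac_eqI) (simp_all add: regular_module_def)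

lemma loc_add_ring_frac:
  assumes "r \<in> carrier R" "s \<in> carrier R"
  shows "loc_add R (regular_module R) d (Reg.frac r a) (Reg.frac s b)
    = Reg.frac (d [^] b \<otimes> r \<oplus> d [^] a \<otimes> s) (a + b)"
  using Reg.loc_add_frac[of r s a b] assms by (simp add: regular_module_def)

lemma frac_ring_closed: "r \<in> carrier R \<Longrightarrow> Reg.frac r a \<in> carrier (loc_ring R d)"
  using Reg.frac_closed[of r a] by (simp add: regular_module_def loc_ring_def)

lemma cring_loc_ring: "cring (loc_ring R d)"
proof (rule cringI)
  have "abelian_group (loc_module R (regular_module R) d)"
    by (rule Reg.abelian_group_loc)
  then show "abelian_group (loc_ring R d)"
    by (rule abelian_group_cong) (simp_all add: loc_ring_def loc_module_def regular_module_def)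
  show "comm_monoid (loc_ring R d)"
  proof (rule comm_monoidI, goal_cases)
    case (1 x y)
    then show ?case
      by (elim loc_ring_elem) (auto simp: loc_ring_def loc_mult_frac frac_ring_closed[unfolded loc_ring_def, simplified])
  next
    case 2
    then show ?case using frac_ring_closed[of \<one> 0] by (simp add: loc_ring_def)
  next
    case (3 x y z)
    then show ?case
      by (elim loc_ring_elem) (auto simp: loc_ring_def loc_mult_frac m_assoc ac_simps)
  next
    case (4 x)
    then show ?case
      by (elim loc_ring_elem) (auto simp: loc_ring_def loc_mult_frac)
  next
    case (5 x y)
    then show ?case
      by (elim loc_ring_elem) (auto simp: loc_ring_def loc_mult_frac m_comm ac_simps)
  qed
next
  fix x y z assume "x \<in> carrier (loc_ring R d)" "y \<in> carrier (loc_ring R d)" "z \<in> carrier (loc_ring R d)"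
  then obtain r a s b t c where xyz: "x = Reg.frac r a" "y = Reg.frac s b" "z = Reg.frac t c"
    and [simp]: "r \<in> carrier R" "s \<in> carrier R" "t \<in> carrier R"
    by (metis loc_ring_elem)
  have "d [^] (a + c + (b + c)) \<otimes> ((d [^] b \<otimes> r \<oplus> d [^] a \<otimes> s) \<otimes> t) =
    d [^] (a + b + c) \<otimes> (d [^] (b + c) \<otimes> (r \<otimes> t) \<oplus> d [^] (a + c) \<otimes> (s \<otimes> t))"
    by (simp add: nat_pow_mult[symmetric] l_distr r_distr m_ac)
  then show "(x \<oplus>\<^bsub>loc_ring R d\<^esub> y) \<otimes>\<^bsub>loc_ring R d\<^esub> z =
    x \<otimes>\<^bsub>loc_ring R d\<^esub> z \<oplus>\<^bsub>loc_ring R d\<^esub> y \<otimes>\<^bsub>loc_ring R d\<^esub> z"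
    unfolding xyz
    by (simp add: loc_ring_def loc_mult_frac loc_add_ring_frac) (rule frac_eqI; simp)
qed

end

context localized_module
begin

interpretation C: localized_cring R d
  by unfold_locales simp

lemma module_loc_module: "module (loc_ring R d) (loc_module R M d)"
proof (rule moduleI)
  show "cring (loc_ring R d)" by (rule C.cring_loc_ring)
  show "abelian_group (loc_module R M d)" by (rule abelian_group_loc)
next
  have el: "\<exists>m a. x = frac m a \<and> m \<in> carrier M" if "x \<in> carrier (loc_module R M d)" for x
    using that by (auto simp: loc_module_def loc_carrier_iff)
  have [simp]: "module.smult (loc_module R M d) = loc_smult R M d" "add (loc_module R M d) = loc_add R M d"
    "carrier (loc_module R M d) = loc_carrier R M d"
    "add (loc_ring R d) = loc_add R (regular_module R) d" "mult (loc_ring R d) = loc_smult R (regular_module R) d"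
    "one (loc_ring R d) = C.Reg.frac \<one> 0"
    by (simp_all add: loc_module_def loc_ring_def)
  fix x assume x: "x \<in> carrier (loc_module R M d)"
  then obtain m a where xm: "x = frac m a" and [simp]: "m \<in> carrier M"
    using el by metis
  show "\<one>\<^bsub>loc_ring R d\<^esub> \<odot>\<^bsub>loc_module R M d\<^esub> x = x"
    by (simp add: xm loc_smult_frac)
  fix r assume r: "r \<in> carrier (loc_ring R d)"
  then obtain p b where rp: "r = C.Reg.frac p b" and [simp]: "p \<in> carrier R"
    by (metis C.loc_ring_elem)
  show "r \<odot>\<^bsub>loc_module R M d\<^esub> x \<in> carrier (loc_module R M d)"
    by (simp add: xm rp loc_smult_frac frac_closed)
  {
    fix s assume s: "s \<in> carrier (loc_ring R d)"
    then obtain q c where sq: "s = C.Reg.frac q c" and [simp]: "q \<in> carrier R"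
      by (metis C.loc_ring_elem)
    show "(r \<otimes>\<^bsub>loc_ring R d\<^esub> s) \<odot>\<^bsub>loc_module R M d\<^esub> x =
      r \<odot>\<^bsub>loc_module R M d\<^esub> (s \<odot>\<^bsub>loc_module R M d\<^esub> x)"
      by (simp add: xm rp sq loc_smult_frac C.loc_mult_frac smult_assoc1 ac_simps)
    have "scale (b + a + (c + a)) ((d [^] c \<otimes> p \<oplus> d [^] b \<otimes> q) \<odot>\<^bsub>M\<^esub> m)
      = scale (b + c + a) (scale (c + a) (p \<odot>\<^bsub>M\<^esub> m) \<oplus>\<^bsub>M\<^esub> scale (b + a) (q \<odot>\<^bsub>M\<^esub> m))"
      by (simp add: smult_l_distr smult_assoc1 scale_add scale_scale ac_simps)
    then show "(r \<oplus>\<^bsub>loc_ring R d\<^esub> s) \<odot>\<^bsub>loc_module R M d\<^esub> x =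
      r \<odot>\<^bsub>loc_module R M d\<^esub> x \<oplus>\<^bsub>loc_module R M d\<^esub> s \<odot>\<^bsub>loc_module R M d\<^esub> x"
      by (simp add: xm rp sq loc_smult_frac C.loc_add_ring_frac loc_add_frac) (rule frac_eqI; simp)
  }
  fix y assume y: "y \<in> carrier (loc_module R M d)"
  then obtain m' c where ym: "y = frac m' c" and [simp]: "m' \<in> carrier M"
    using el by metis
  have "scale (b + a + (b + c)) (p \<odot>\<^bsub>M\<^esub> (scale c m \<oplus>\<^bsub>M\<^esub> scale a m'))
      = scale (b + (a + c)) (scale (b + c) (p \<odot>\<^bsub>M\<^esub> m) \<oplus>\<^bsub>M\<^esub> scale (b + a) (p \<odot>\<^bsub>M\<^esub> m'))"
    by (simp add: smult_r_distr scale_add scale_smult[of p m, symmetric] scale_smult[of p m', symmetric] scale_scale ac_simps)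
  then show "r \<odot>\<^bsub>loc_module R M d\<^esub> (x \<oplus>\<^bsub>loc_module R M d\<^esub> y) =
    r \<odot>\<^bsub>loc_module R M d\<^esub> x \<oplus>\<^bsub>loc_module R M d\<^esub> r \<odot>\<^bsub>loc_module R M d\<^esub> y"
    by (simp add: xm rp ym loc_smult_frac loc_add_frac) (rule frac_eqI; simp)
qed

end

subsection \<open>Quotient modules\<close>

locale quotient_of_module = module R M for R (structure) and M (structure) +
  fixes S
  assumes S_subset: "S \<subseteq> carrier M"
    and S_zero: "\<zero>\<^bsub>M\<^esub> \<in> S"
    and S_add: "x \<in> S \<Longrightarrow> y \<in> S \<Longrightarrow> x \<oplus>\<^bsub>M\<^esub> y \<in> S"
    and S_smult: "r \<in> carrier R \<Longrightarrow> x \<in> S \<Longrightarrow> r \<odot>\<^bsub>M\<^esub> x \<in> S"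
begin

lemma S_minus: "x \<in> S \<Longrightarrow> \<ominus>\<^bsub>M\<^esub> x \<in> S"
  using S_smult[of "\<ominus> \<one>" x] S_subset by (auto simp: smult_l_minus)

sublocale S: abelian_subgroup S M
proof -
  have "additive_subgroup S M"
    using S_subset S_zero S_add S_minus
    by (intro additive_subgroupI M.add.subgroupI) (auto simp: a_inv_def[symmetric])
  then show "abelian_subgroup S M"
    by (rule abelian_subgroupI3) (rule M.abelian_group_axioms)
qed

lemma coset_eq_iff:
  assumes "x \<in> carrier M" "y \<in> carrier M"
  shows "S +>\<^bsub>M\<^esub> x = S +>\<^bsub>M\<^esub> y \<longleftrightarrow> x \<ominus>\<^bsub>M\<^esub> y \<in> S"
  using S.a_rcos_module[of y x] S.a_repr_independence'[of x y] S.a_repr_independenceD[of x y] assms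
  by (metis M.minus_eq)

lemma quot_carrier_iff: "C \<in> carrier (quot_module M S) \<longleftrightarrow> (\<exists>x\<in>carrier M. C = S +>\<^bsub>M\<^esub> x)"
  by (auto simp: quot_module_def A_RCOSETS_def')

lemma quot_add: "x \<in> carrier M \<Longrightarrow> y \<in> carrier M \<Longrightarrow>
    (S +>\<^bsub>M\<^esub> x) \<oplus>\<^bsub>quot_module M S\<^esub> (S +>\<^bsub>M\<^esub> y) = S +>\<^bsub>M\<^esub> (x \<oplus>\<^bsub>M\<^esub> y)"
  by (simp add: quot_module_def S.a_rcos_sum)

lemma quot_smult:
  assumes r: "r \<in> carrier R" and x: "x \<in> carrier M"
  shows "r \<odot>\<^bsub>quot_module M S\<^esub> (S +>\<^bsub>M\<^esub> x) = S +>\<^bsub>M\<^esub> (r \<odot>\<^bsub>M\<^esub> x)"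
proof -
  have eq: "S +>\<^bsub>M\<^esub> (r \<odot>\<^bsub>M\<^esub> y) = S +>\<^bsub>M\<^esub> (r \<odot>\<^bsub>M\<^esub> x)" if y: "y \<in> S +>\<^bsub>M\<^esub> x" for y
  proof -
    have yc: "y \<in> carrier M" using y x M.a_r_coset_subset_G[OF S_subset, of x] by blast
    then have "y \<ominus>\<^bsub>M\<^esub> x \<in> S" using y x S.a_rcos_module[of x y] by (simp add: M.minus_eq)
    then have "r \<odot>\<^bsub>M\<^esub> (y \<ominus>\<^bsub>M\<^esub> x) \<in> S" using r S_smult by blast
    then show ?thesis
      using r x yc by (simp add: coset_eq_iff M.minus_eq smult_r_distr smult_r_minus)
  qed
  have "(\<Union>y\<in>S +>\<^bsub>M\<^esub> x. S +>\<^bsub>M\<^esub> (r \<odot>\<^bsub>M\<^esub> y)) = (\<Union>y\<in>S +>\<^bsub>M\<^esub> x. S +>\<^bsub>M\<^esub> (r \<odot>\<^bsub>M\<^esub> x))"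
    by (intro SUP_cong refl eq)
  also have "\<dots> = S +>\<^bsub>M\<^esub> (r \<odot>\<^bsub>M\<^esub> x)"
    using S.a_rcos_self[OF x] by auto
  finally show ?thesis by (simp add: quot_module_def)
qed

lemma quot_zero: "\<zero>\<^bsub>quot_module M S\<^esub> = S +>\<^bsub>M\<^esub> \<zero>\<^bsub>M\<^esub>"
  by (simp add: quot_module_def S_subset)

lemma quot_closed: "x \<in> carrier M \<Longrightarrow> S +>\<^bsub>M\<^esub> x \<in> carrier (quot_module M S)"
  using quot_carrier_iff by blast

lemma module_quot_module: "module R (quot_module M S)"
proof (rule moduleI)
  show "cring R" by unfold_locales
  show "abelian_group (quot_module M S)"
  proof (rule abelian_groupI)
    show "\<zero>\<^bsub>quot_module M S\<^esub> \<in> carrier (quot_module M S)"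
      by (simp add: quot_zero quot_closed)
    fix x assume "x \<in> carrier (quot_module M S)"
    then obtain m where [simp]: "x = S +>\<^bsub>M\<^esub> m" "m \<in> carrier M" by (auto simp: quot_carrier_iff)
    show "\<zero>\<^bsub>quot_module M S\<^esub> \<oplus>\<^bsub>quot_module M S\<^esub> x = x"
      by (simp add: quot_zero quot_add)
    show "\<exists>y\<in>carrier (quot_module M S). y \<oplus>\<^bsub>quot_module M S\<^esub> x = \<zero>\<^bsub>quot_module M S\<^esub>"
      by (rule bexI[of _ "S +>\<^bsub>M\<^esub> (\<ominus>\<^bsub>M\<^esub> m)"]) (simp_all add: quot_zero quot_add quot_closed M.l_neg)
    fix y assume "y \<in> carrier (quot_module M S)"
    then obtain n where [simp]: "y = S +>\<^bsub>M\<^esub> n" "n \<in> carrier M" by (auto simp: quot_carrier_iff)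
    show "x \<oplus>\<^bsub>quot_module M S\<^esub> y \<in> carrier (quot_module M S)"
      by (simp add: quot_add quot_closed)
    show "x \<oplus>\<^bsub>quot_module M S\<^esub> y = y \<oplus>\<^bsub>quot_module M S\<^esub> x"
      by (simp add: quot_add M.a_comm)
    fix z assume "z \<in> carrier (quot_module M S)"
    then obtain l where [simp]: "z = S +>\<^bsub>M\<^esub> l" "l \<in> carrier M" by (auto simp: quot_carrier_iff)
    show "x \<oplus>\<^bsub>quot_module M S\<^esub> y \<oplus>\<^bsub>quot_module M S\<^esub> z =
      x \<oplus>\<^bsub>quot_module M S\<^esub> (y \<oplus>\<^bsub>quot_module M S\<^esub> z)"
      by (simp add: quot_add M.a_assoc)
  qed
qed (auto simp: quot_carrier_iff quot_smult quot_add smult_l_distr smult_r_distr smult_assoc1)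

end

text \<open>Kernel and cokernel that are killed by powers of \<open>d\<close> disappear in the
  localization. The assumptions \<open>inj\<close> and \<open>surj\<close> are these two torsion
  statements, free of fractions and cosets, so that all later work takes place in \<open>M\<close>
  and \<open>L\<close> themselves.\<close>

lemma loc_map_quot_iso:
  fixes R (structure) and M (structure) and L (structure)
  assumes M: "module R M" and L: "module R L" and quot: "quotient_of_module R M S"
    and d: "d \<in> carrier R" and \<phi>: "\<phi> \<in> module_hom R M L"
    and kills: "\<And>x. x \<in> S \<Longrightarrow> \<phi> x = \<zero>\<^bsub>L\<^esub>"
    and inj: "\<And>x. x \<in> carrier M \<Longrightarrow> \<phi> x = \<zero>\<^bsub>L\<^esub> \<Longrightarrow> \<exists>c :: nat. (d [^]\<^bsub>R\<^esub> c) \<odot>\<^bsub>M\<^esub> x \<in> S"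
    and surj: "\<And>y. y \<in> carrier L \<Longrightarrow> \<exists>c :: nat. \<exists>x\<in>carrier M. \<phi> x = (d [^]\<^bsub>R\<^esub> c) \<odot>\<^bsub>L\<^esub> y"
  shows "is_module_iso (loc_ring R d) (loc_module R (quot_module M S) d) (loc_module R L d)
    (loc_map R L d (quot_map \<phi>))"
proof -
  interpret L: localized_module R L d
    using L d by (simp add: localized_module_def localized_module_axioms_def)
  interpret M: quotient_of_module R M S by fact
  interpret Q: localized_module R "quot_module M S" d
    using M.module_quot_module d by (simp add: localized_module_def localized_module_axioms_def)
  interpret C: localized_cring R d by unfold_locales (rule d)
  have \<phi>c: "\<And>x. x \<in> carrier M \<Longrightarrow> \<phi> x \<in> carrier L"
    and \<phi>add: "\<And>x y. x \<in> carrier M \<Longrightarrow> y \<in> carrier M \<Longrightarrow> \<phi> (x \<oplus>\<^bsub>M\<^esub> y) = \<phi> x \<oplus>\<^bsub>L\<^esub> \<phi> y"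
    and \<phi>sm: "\<And>r x. r \<in> carrier R \<Longrightarrow> x \<in> carrier M \<Longrightarrow> \<phi> (r \<odot>\<^bsub>M\<^esub> x) = r \<odot>\<^bsub>L\<^esub> \<phi> x"
    using \<phi> by (auto simp: module_hom_def)
  have \<phi>diff: "\<phi> (x \<ominus>\<^bsub>M\<^esub> y) = \<phi> x \<ominus>\<^bsub>L\<^esub> \<phi> y" if "x \<in> carrier M" "y \<in> carrier M" for x y
  proof -
    have "\<phi> (\<ominus>\<^bsub>M\<^esub> y) = \<ominus>\<^bsub>L\<^esub> \<phi> y"
      using \<phi>sm[of "\<ominus>\<^bsub>R\<^esub> \<one>\<^bsub>R\<^esub>" y] that \<phi>c by (simp add: M.smult_l_minus L.smult_l_minus)
    then show ?thesis using that by (simp add: \<phi>add M.M.minus_eq L.M.minus_eq)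
  qed
  let ?\<psi> = "quot_map \<phi>"
  have \<psi>: "?\<psi> (S +>\<^bsub>M\<^esub> x) = \<phi> x" if x: "x \<in> carrier M" for x
  proof -
    have "\<phi> y = \<phi> x" if y: "y \<in> S +>\<^bsub>M\<^esub> x" for y
    proof -
      have yc: "y \<in> carrier M" using y x M.M.a_r_coset_subset_G[OF M.S_subset, of x] by blast
      then have "y \<ominus>\<^bsub>M\<^esub> x \<in> S"
        using y x M.S.a_rcos_module[of x y] by (simp add: M.M.minus_eq)
      then have "\<phi> y \<ominus>\<^bsub>L\<^esub> \<phi> x = \<zero>\<^bsub>L\<^esub>"
        using kills \<phi>diff[OF yc x] by metis
      then show ?thesis using \<phi>c yc x by simp
    qed
    moreover have "x \<in> S +>\<^bsub>M\<^esub> x" by (rule M.S.a_rcos_self) (rule x)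
    ultimately have "\<phi> ` (S +>\<^bsub>M\<^esub> x) = {\<phi> x}"
      by (intro equalityI subsetI) (metis imageE singletonI, metis imageI singletonD)
    then show ?thesis by (simp add: quot_map_def)
  qed
  have qel: "\<exists>x. C = S +>\<^bsub>M\<^esub> x \<and> x \<in> carrier M" if "C \<in> carrier (quot_module M S)" for C
    using that M.quot_carrier_iff by auto
  have \<psi>c: "?\<psi> C \<in> carrier L" if "C \<in> carrier (quot_module M S)" for C
    using qel[OF that] \<psi> \<phi>c by auto
  have \<psi>add: "?\<psi> (C \<oplus>\<^bsub>quot_module M S\<^esub> E) = ?\<psi> C \<oplus>\<^bsub>L\<^esub> ?\<psi> E"
    if "C \<in> carrier (quot_module M S)" "E \<in> carrier (quot_module M S)" for C E
    using qel[OF that(1)] qel[OF that(2)] by (auto simp: \<psi> M.quot_add \<phi>add)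
  have \<psi>sm: "?\<psi> (r \<odot>\<^bsub>quot_module M S\<^esub> C) = r \<odot>\<^bsub>L\<^esub> ?\<psi> C"
    if "C \<in> carrier (quot_module M S)" "r \<in> carrier R" for C r
    using qel[OF that(1)] that(2) by (auto simp: \<psi> M.quot_smult \<phi>sm)
  let ?F = "loc_map R L d ?\<psi>"
  have F: "?F (Q.frac C a) = L.frac (?\<psi> C) a" if C: "C \<in> carrier (quot_module M S)" for C a
  proof -
    have "L.frac (?\<psi> E) b = L.frac (?\<psi> C) a" if E: "(E, b) \<in> Q.frac C a" for E b
    proof -
      have Ec: "E \<in> carrier (quot_module M S)" using E C by (simp add: Q.in_frac_iff)
      then obtain c where "Q.scale (c + a) E = Q.scale (c + b) C"
        using E C by (auto simp: Q.in_frac_iff Q.frac_eq_iff)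
      then have "?\<psi> (Q.scale (c + a) E) = ?\<psi> (Q.scale (c + b) C)" by simp
      then show ?thesis
        using C Ec d by (simp add: \<psi>sm L.frac_eq_iff \<psi>c) blast
    qed
    moreover have "(C, a) \<in> Q.frac C a" using C by (rule Q.frac_self)
    ultimately show ?thesis unfolding loc_map_def by fast
  qed
  have "?F \<in> module_hom (loc_ring R d) (loc_module R (quot_module M S) d) (loc_module R L d)"
  proof -
    have "?F x \<in> loc_carrier R L d" if "x \<in> loc_carrier R (quot_module M S) d" for x
      using that by (auto simp: Q.loc_carrier_iff F L.frac_closed \<psi>c)
    moreover have "?F (loc_add R (quot_module M S) d x y) = loc_add R L d (?F x) (?F y)"
      if "x \<in> loc_carrier R (quot_module M S) d" "y \<in> loc_carrier R (quot_module M S) d" for x y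
      using that d by (auto simp: Q.loc_carrier_iff F Q.loc_add_frac L.loc_add_frac \<psi>c \<psi>add \<psi>sm)
    moreover have "?F (loc_smult R (quot_module M S) d r x) = loc_smult R L d r (?F x)"
      if x: "x \<in> loc_carrier R (quot_module M S) d" and r: "r \<in> carrier (loc_ring R d)" for x r
    proof -
      obtain p c where p: "r = C.Reg.frac p c" "p \<in> carrier R"
        using C.loc_ring_elem[OF r] by metis
      obtain C a where C: "x = Q.frac C a" "C \<in> carrier (quot_module M S)"
        using x Q.loc_carrier_iff by metis
      show ?thesis
        using p(2) C(2) unfolding p(1) C(1)
        by (simp add: F Q.loc_smult_frac L.loc_smult_frac \<psi>c \<psi>sm)
    qed
    ultimately show ?thesis by (simp add: module_hom_def loc_module_def)
  qed
  moreover have "inj_on ?F (loc_carrier R (quot_module M S) d)"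
  proof (rule inj_onI)
    fix u v assume u: "u \<in> loc_carrier R (quot_module M S) d" and v: "v \<in> loc_carrier R (quot_module M S) d"
      and eq: "?F u = ?F v"
    obtain C a E b where uv: "u = Q.frac C a" "v = Q.frac E b"
      and Cc: "C \<in> carrier (quot_module M S)" and Ec: "E \<in> carrier (quot_module M S)"
      using u v Q.loc_carrier_iff by metis
    obtain x y where x: "C = S +>\<^bsub>M\<^esub> x" "x \<in> carrier M" and y: "E = S +>\<^bsub>M\<^esub> y" "y \<in> carrier M"
      using qel Cc Ec by metis
    have "L.frac (\<phi> x) a = L.frac (\<phi> y) b"
      using eq Cc Ec unfolding uv by (simp add: F x y \<psi>)
    then obtain c where c: "L.scale (c + b) (\<phi> x) = L.scale (c + a) (\<phi> y)"
      using L.frac_eq_iff \<phi>c x y by auto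
    interpret MM: localized_module R M d
      using M d by (simp add: localized_module_def localized_module_axioms_def)
    \<comment> \<open>The difference of the cross-multiplied numerators lies in the kernel of
      \<open>\<phi>\<close>, so \<open>inj\<close> applies to it.\<close>
    let ?w = "MM.scale (c + b) x \<ominus>\<^bsub>M\<^esub> MM.scale (c + a) y"
    have sc: "MM.scale e z \<in> carrier M" if "z \<in> carrier M" for e z using that d by simp
    have "\<phi> ?w = \<zero>\<^bsub>L\<^esub>"
      using x y d c by (simp add: \<phi>diff \<phi>sm sc \<phi>c)
    then obtain e where "MM.scale e ?w \<in> S"
      using inj[of ?w] x y sc by auto
    then have "MM.scale (e + (c + b)) x \<ominus>\<^bsub>M\<^esub> MM.scale (e + (c + a)) y \<in> S"
      using x y sc d by (simp add: M.M.minus_eq M.smult_r_distr M.smult_r_minus MM.scale_scale)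
    then have "S +>\<^bsub>M\<^esub> MM.scale (e + (c + b)) x = S +>\<^bsub>M\<^esub> MM.scale (e + (c + a)) y"
      using x y sc by (simp add: M.coset_eq_iff)
    then have "Q.scale ((e + c) + b) C = Q.scale ((e + c) + a) E"
      using x y d by (simp add: M.quot_smult add.assoc)
    then show "u = v"
      unfolding uv using Cc Ec by (subst Q.frac_eq_iff) auto
  qed
  moreover have "loc_carrier R L d \<subseteq> ?F ` loc_carrier R (quot_module M S) d"
  proof
    fix v assume "v \<in> loc_carrier R L d"
    then obtain y a where v: "v = L.frac y a" and y: "y \<in> carrier L"
      by (auto simp: L.loc_carrier_iff)
    obtain c x where x: "x \<in> carrier M" "\<phi> x = L.scale c y"
      using surj[OF y] by auto
    have "?F (Q.frac (S +>\<^bsub>M\<^esub> x) (c + a)) = v"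
      using x y by (simp add: F M.quot_closed \<psi> v L.frac_scale)
    then show "v \<in> ?F ` loc_carrier R (quot_module M S) d"
      using Q.frac_closed M.quot_closed x by blast
  qed
  moreover have "?F ` loc_carrier R (quot_module M S) d \<subseteq> loc_carrier R L d"
    by (auto simp: Q.loc_carrier_iff F L.frac_closed \<psi>c)
  ultimately show ?thesis
    unfolding is_module_iso_def mod_hom_def mod_hom_axioms_def
    using Q.module_loc_module L.module_loc_module
    by (auto simp: bij_betw_def loc_module_def)
qed

subsection \<open>Polynomial functions\<close>

lemma poly_funs_ext: "f \<in> poly_funs D G \<Longrightarrow> restrict f D = f"
  by (induction rule: poly_funs.induct) (auto simp: restrict_def fun_eq_iff)

lemma restrict_UNIV_id [simp]: "restrict f UNIV = f"
  by (simp add: restrict_def)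

text \<open>The parts of a compound expression are not extensional one by one; closure stated for
  restrictions lets such an expression be taken apart as it is written.\<close>

lemma poly_funs_add':
  "restrict f D \<in> poly_funs D G \<Longrightarrow> restrict g D \<in> poly_funs D G \<Longrightarrow> (\<lambda>x\<in>D. f x + g x) \<in> poly_funs D G"
  using poly_funs.add[of "restrict f D" D G "restrict g D"] by (simp cong: restrict_cong)

lemma poly_funs_mult':
  "restrict f D \<in> poly_funs D G \<Longrightarrow> restrict g D \<in> poly_funs D G \<Longrightarrow> (\<lambda>x\<in>D. f x * g x) \<in> poly_funs D G"
  using poly_funs.mult[of "restrict f D" D G "restrict g D"] by (simp cong: restrict_cong)

lemma poly_funs_sum':
  "(\<And>i. i \<in> I \<Longrightarrow> restrict (f i) D \<in> poly_funs D G) \<Longrightarrow> (\<lambda>x\<in>D. \<Sum>i\<in>I. f i x) \<in> poly_funs D G"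
  by (induction I rule: infinite_finite_induct) (auto intro: poly_funs.const poly_funs_add')

lemma poly_funs_prod':
  "(\<And>i. i \<in> I \<Longrightarrow> restrict (f i) D \<in> poly_funs D G) \<Longrightarrow> (\<lambda>x\<in>D. \<Prod>i\<in>I. f i x) \<in> poly_funs D G"
  by (induction I rule: infinite_finite_induct) (auto intro: poly_funs.const poly_funs_mult')

lemma poly_funs_power':
  "restrict f D \<in> poly_funs D G \<Longrightarrow> (\<lambda>x\<in>D. f x ^ m) \<in> poly_funs D G"
  using poly_funs_prod'[of "{..<m}" "\<lambda>_. f" D G] by simp

lemma poly_funs_uminus':
  "restrict f D \<in> poly_funs D G \<Longrightarrow> (\<lambda>x\<in>D. - f x) \<in> poly_funs D G"
  using poly_funs_mult'[OF poly_funs.const[of "-1"], of f D G] by (simp cong: restrict_cong)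

lemma poly_funs_diff':
  "restrict f D \<in> poly_funs D G \<Longrightarrow> restrict g D \<in> poly_funs D G \<Longrightarrow> (\<lambda>x\<in>D. f x - g x) \<in> poly_funs D G"
  using poly_funs_add'[OF _ poly_funs_uminus', of f D G g] by simp

lemmas poly_funs_intros = poly_funs.const poly_funs_add' poly_funs_mult' poly_funs_sum' poly_funs_prod'
  poly_funs_power' poly_funs_uminus' poly_funs_diff'

lemma poly_funs_compose:
  assumes "f \<in> poly_funs D G" and "\<And>t. t \<in> E \<Longrightarrow> \<phi> t \<in> D"
    and "\<And>g. g \<in> G \<Longrightarrow> (\<lambda>t\<in>E. g (\<phi> t)) \<in> poly_funs E K"
  shows "(\<lambda>t\<in>E. f (\<phi> t)) \<in> poly_funs E K"
  using assms(1)
proof (induction rule: poly_funs.induct)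
  case (const c)
  have "(\<lambda>t\<in>E. (\<lambda>x\<in>D. c) (\<phi> t)) = (\<lambda>t\<in>E. c)" using assms(2) by (auto simp: restrict_def fun_eq_iff)
  then show ?case by (simp only: poly_funs.const)
next
  case (coord g)
  have "(\<lambda>t\<in>E. (\<lambda>x\<in>D. g x) (\<phi> t)) = (\<lambda>t\<in>E. g (\<phi> t))" using assms(2) by (auto simp: restrict_def fun_eq_iff)
  then show ?case using assms(3) coord by (simp only:)
next
  case (add f g)
  have "(\<lambda>t\<in>E. (\<lambda>x\<in>D. f x + g x) (\<phi> t)) = (\<lambda>t\<in>E. f (\<phi> t) + g (\<phi> t))"
    using assms(2) by (auto simp: restrict_def fun_eq_iff)
  then show ?case using poly_funs_add' add.IH by (simp only:)
next
  case (mult f g)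
  have "(\<lambda>t\<in>E. (\<lambda>x\<in>D. f x * g x) (\<phi> t)) = (\<lambda>t\<in>E. f (\<phi> t) * g (\<phi> t))"
    using assms(2) by (auto simp: restrict_def fun_eq_iff)
  then show ?case using poly_funs_mult' mult.IH by (simp only:)
qed

lemma poly_funs_univariate:
  assumes "f \<in> poly_funs UNIV {\<lambda>t :: complex. t}"
  obtains p where "\<And>t. f t = poly p t"
proof -
  have "\<exists>p. \<forall>t. f t = poly p t"
    using assms
  proof (induction rule: poly_funs.induct)
    case (const c) show ?case by (rule exI[of _ "[:c:]"]) simp
  next
    case (coord g) then show ?case by (intro exI[of _ "[:0, 1:]"]) simp
  next
    case (add f g)
    then obtain p q where "\<forall>t. f t = poly p t" "\<forall>t. g t = poly q t" by blast
    then show ?case by (intro exI[of _ "p + q"]) simp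
  next
    case (mult f g)
    then obtain p q where "\<forall>t. f t = poly p t" "\<forall>t. g t = poly q t" by blast
    then show ?case by (intro exI[of _ "p * q"]) simp
  qed
  then show ?thesis using that by blast
qed

text \<open>A nonzero polynomial has finitely many roots, and the complex line is infinite. The
  density arguments of the proof are reduced to this one-parameter case.\<close>

lemma poly_funs_univariate_vanish:
  assumes "f \<in> poly_funs UNIV {\<lambda>t :: complex. t}" and "finite {t. f t \<noteq> 0}"
  shows "f t = 0"
proof -
  obtain p where p: "\<And>t. f t = poly p t" using poly_funs_univariate[OF assms(1)] by blast
  have "p = 0"
  proof (rule ccontr)
    assume "p \<noteq> 0"
    then have "finite {t. poly p t = 0}" by (rule poly_roots_finite)
    moreover have "{t. poly p t = 0} \<union> {t. f t \<noteq> 0} = UNIV" using p by auto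
    ultimately have "finite (UNIV :: complex set)" using assms(2) by (metis finite_Un)
    then show False by (simp add: infinite_UNIV_char_0)
  qed
  then show ?thesis using p by simp
qed

section \<open>Polynomials in \<open>M\<close> variables\<close>

text \<open>Points are total functions on \<open>nat\<close> rather than vectors, so substitutions
  carry no carrier conditions; coordinates from \<open>M\<close> on are ignored, see
  \<open>poly_maps_cong\<close>.\<close>

definition poly_maps :: "nat \<Rightarrow> ((nat \<Rightarrow> complex) \<Rightarrow> complex) set" where
  "poly_maps M = poly_funs UNIV {(\<lambda>z. z i) | i. i < M}"

lemma poly_maps_const [intro]: "(\<lambda>z. c) \<in> poly_maps M"
  using poly_funs.const[of c UNIV] by (simp add: poly_maps_def)

lemma poly_maps_var [intro]: "i < M \<Longrightarrow> (\<lambda>z. z i) \<in> poly_maps M"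
  using poly_funs.coord[of "\<lambda>z. z i" "{(\<lambda>z. z i) | i. i < M}" UNIV] by (auto simp: poly_maps_def)

lemma poly_maps_add [intro]: "f \<in> poly_maps M \<Longrightarrow> g \<in> poly_maps M \<Longrightarrow> (\<lambda>z. f z + g z) \<in> poly_maps M"
  using poly_funs_add'[of f UNIV] by (simp add: poly_maps_def)

lemma poly_maps_mult [intro]: "f \<in> poly_maps M \<Longrightarrow> g \<in> poly_maps M \<Longrightarrow> (\<lambda>z. f z * g z) \<in> poly_maps M"
  using poly_funs_mult'[of f UNIV] by (simp add: poly_maps_def)

lemma poly_maps_diff [intro]: "f \<in> poly_maps M \<Longrightarrow> g \<in> poly_maps M \<Longrightarrow> (\<lambda>z. f z - g z) \<in> poly_maps M"
  using poly_funs_diff'[of f UNIV] by (simp add: poly_maps_def)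

lemma poly_maps_sum [intro]: "(\<And>i. i \<in> I \<Longrightarrow> f i \<in> poly_maps M) \<Longrightarrow> (\<lambda>z. \<Sum>i\<in>I. f i z) \<in> poly_maps M"
  using poly_funs_sum'[of I f UNIV] by (simp add: poly_maps_def)

lemma poly_maps_prod [intro]: "(\<And>i. i \<in> I \<Longrightarrow> f i \<in> poly_maps M) \<Longrightarrow> (\<lambda>z. \<Prod>i\<in>I. f i z) \<in> poly_maps M"
  using poly_funs_prod'[of I f UNIV] by (simp add: poly_maps_def)

lemma poly_maps_power [intro]: "f \<in> poly_maps M \<Longrightarrow> (\<lambda>z. f z ^ m) \<in> poly_maps M"
  using poly_funs_power'[of f UNIV] by (simp add: poly_maps_def)

lemma poly_maps_induct [consumes 1, case_names const var add mult]:
  assumes "f \<in> poly_maps M" and "\<And>c. P (\<lambda>z. c)" and "\<And>i. i < M \<Longrightarrow> P (\<lambda>z. z i)"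
    and "\<And>f g. f \<in> poly_maps M \<Longrightarrow> g \<in> poly_maps M \<Longrightarrow> P f \<Longrightarrow> P g \<Longrightarrow> P (\<lambda>z. f z + g z)"
    and "\<And>f g. f \<in> poly_maps M \<Longrightarrow> g \<in> poly_maps M \<Longrightarrow> P f \<Longrightarrow> P g \<Longrightarrow> P (\<lambda>z. f z * g z)"
  shows "P f"
  using assms(1) unfolding poly_maps_def
  by (induction rule: poly_funs.induct) (use assms(2-) in \<open>auto simp: poly_maps_def\<close>)

lemma poly_maps_subst:
  assumes "f \<in> poly_maps M" and "\<And>i. i < M \<Longrightarrow> g i \<in> poly_maps L"
  shows "(\<lambda>z. f (\<lambda>i. g i z)) \<in> poly_maps L"
  using assms(1) by (induction rule: poly_maps_induct) (use assms(2) in auto)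

lemma poly_maps_cong:
  assumes "f \<in> poly_maps M" and "\<And>i. i < M \<Longrightarrow> z i = z' i"
  shows "f z = f z'"
  using assms(1) by (induction rule: poly_maps_induct) (use assms(2) in auto)

lemma poly_maps_comp: "f \<in> poly_maps M \<Longrightarrow> (\<And>i. i < M \<Longrightarrow> s i < L) \<Longrightarrow> (\<lambda>z. f (\<lambda>i. z (s i))) \<in> poly_maps L"
  by (rule poly_maps_subst) auto

text \<open>Provides induction over monomials for constructions that are additive but not
  multiplicative in the polynomial, such as symmetrization and antisymmetrization.\<close>

inductive_set monomial_span :: "nat \<Rightarrow> ((nat \<Rightarrow> complex) \<Rightarrow> complex) set" for M where
  monomial: "(\<lambda>z. c * (\<Prod>i<M. z i ^ m i)) \<in> monomial_span M"
| add: "f \<in> monomial_span M \<Longrightarrow> g \<in> monomial_span M \<Longrightarrow> (\<lambda>z. f z + g z) \<in> monomial_span M"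

lemma monomial_span_mult:
  assumes "f \<in> monomial_span M" "g \<in> monomial_span M"
  shows "(\<lambda>z. f z * g z) \<in> monomial_span M"
  using assms(1)
proof (induction rule: monomial_span.induct)
  case (monomial c m)
  show ?case using assms(2)
  proof (induction rule: monomial_span.induct)
    case (monomial c' m')
    then show ?case
      using monomial_span.monomial[where c="c * c'" and M=M and m="\<lambda>i. m i + m' i"]
      by (simp add: power_add prod.distrib mult_ac)
  next
    case (add f g)
    then show ?case using monomial_span.add by (simp add: distrib_left)
  qed
next
  case (add f g)
  then show ?case using monomial_span.add by (simp add: distrib_right)
qed

lemma poly_maps_monomial_induct [consumes 1, case_names monomial add]:
  assumes "f \<in> poly_maps M" and mono: "\<And>c m. P (\<lambda>z. c * (\<Prod>i<M. z i ^ m i))"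
    and add: "\<And>f g. P f \<Longrightarrow> P g \<Longrightarrow> P (\<lambda>z. f z + g z)"
  shows "P f"
proof -
  have "f \<in> monomial_span M" using assms(1)
  proof (induction rule: poly_maps_induct)
    case (const c)
    then show ?case using monomial_span.monomial[where c=c and M=M and m="\<lambda>_. 0"] by simp
  next
    case (var i)
    have "(\<Prod>j<M. z j ^ (if j = i then 1 else 0)) = z i" for z :: "nat \<Rightarrow> complex"
      using var by (simp add: if_distrib prod.delta cong: if_cong)
    then show ?case using monomial_span.monomial[where c=1 and M=M and m="\<lambda>j. if j = i then 1 else 0"] by simp
  qed (auto intro: monomial_span.add monomial_span_mult)
  then show ?thesis
    by (induction rule: monomial_span.induct) (auto intro: mono add)
qed

subsection \<open>Power sums\<close>

definition psum :: "nat \<Rightarrow> (nat \<Rightarrow> complex) \<Rightarrow> nat \<Rightarrow> complex" where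
  "psum N x m = (\<Sum>j<N. x j ^ m)"

definition root_poly :: "nat \<Rightarrow> (nat \<Rightarrow> complex) \<Rightarrow> complex poly" where
  "root_poly N x = (\<Prod>j<N. [:- x j, 1:])"

lemma poly_root_poly: "poly (root_poly N x) t = (\<Prod>j<N. t - x j)"
  by (simp add: root_poly_def poly_prod)

lemma degree_root_poly: "degree (root_poly N x) = N"
  unfolding root_poly_def by (subst degree_prod_eq_sum_degree) auto

lemma coeff_root_poly_top: "coeff (root_poly N x) N = 1"
proof -
  have "lead_coeff (root_poly N x) = 1"
    unfolding root_poly_def by (simp add: lead_coeff_prod)
  then show ?thesis by (simp add: degree_root_poly)
qed

text \<open>Horner's recursion \<open>coeff g l = coeff f (Suc l) + a * coeff g (Suc l)\<close>,
  unrolled downwards from degree \<open>N\<close>.\<close>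

lemma coeff_synthetic_division:
  fixes f g :: "complex poly"
  assumes f: "f = [:- a, 1:] * g" and deg: "degree f \<le> N"
  shows "coeff g l = (\<Sum>i\<in>{l<..N}. coeff f i * a ^ (i - l - 1))"
proof (cases "l \<le> N")
  case True
  have degf: "degree f = Suc (degree g)" if "g \<noteq> 0"
    unfolding f using that by (subst degree_mult_eq) auto
  have rec: "coeff g l = coeff f (Suc l) + a * coeff g (Suc l)" for l
    unfolding f by (simp add: coeff_pCons)
  have deg_g: "degree g \<le> N - 1 \<or> g = 0"
    using deg degf by (cases "g = 0") auto
  have g0: "coeff g l = 0" if "l \<ge> N" for l
  proof (cases "N = 0")
    case True
    then have "g = 0" using deg degf by (cases "g = 0") auto
    then show ?thesis by simp
  next
    case False
    then show ?thesis using deg_g that by (auto intro: coeff_eq_0)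
  qed
  from True show ?thesis
  proof (induction rule: inc_induct)
    case base
    then show ?case using g0[of N] by simp
  next
    case (step l)
    have "{l<..N} = insert (Suc l) {Suc l<..N}" using step by auto
    then have "(\<Sum>i\<in>{l<..N}. coeff f i * a ^ (i - l - 1)) =
      coeff f (Suc l) + (\<Sum>i\<in>{Suc l<..N}. coeff f i * a ^ (i - l - 1))" by simp
    also have "(\<Sum>i\<in>{Suc l<..N}. coeff f i * a ^ (i - l - 1)) =
      (\<Sum>i\<in>{Suc l<..N}. a * (coeff f i * a ^ (i - Suc l - 1)))"
    proof (rule sum.cong[OF refl])
      fix i assume "i \<in> {Suc l<..N}"
      then have "i - l - 1 = Suc (i - Suc l - 1)" by auto
      then show "coeff f i * a ^ (i - l - 1) = a * (coeff f i * a ^ (i - Suc l - 1))" by simp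
    qed
    finally show ?case using step.IH rec[of l] by (simp add: sum_distrib_left)
  qed
next
  case False
  have "degree f = Suc (degree g)" if "g \<noteq> 0"
    unfolding f using that by (subst degree_mult_eq) auto
  then have "degree g \<le> N"
    using deg by (cases "g = 0") auto
  then have "coeff g l = 0" using False by (intro coeff_eq_0) simp
  then show ?thesis using False by simp
qed

text \<open>Compare coefficients in \<open>f' = \<Sum>\<^sub>j f / (t - x\<^sub>j)\<close>.\<close>

lemma newton_identity:
  assumes m: "0 < m" "m \<le> N"
  shows "psum N x m = - of_nat m * coeff (root_poly N x) (N - m)
    - (\<Sum>s\<in>{0<..<m}. coeff (root_poly N x) (N - m + s) * psum N x s)"
proof -
  let ?f = "root_poly N x"
  have pd: "pderiv ?f = (\<Sum>j<N. \<Prod>i\<in>{..<N}-{j}. [:- x i, 1:])"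
    unfolding root_poly_def by (subst pderiv_prod) (simp add: pderiv_pCons)
  have fac: "?f = [:- x j, 1:] * (\<Prod>i\<in>{..<N}-{j}. [:- x i, 1:])" if "j < N" for j
    unfolding root_poly_def using that by (subst prod.remove[of _ j]) auto
  have c: "of_nat (Suc l) * coeff ?f (Suc l) = (\<Sum>i\<in>{l<..N}. coeff ?f i * psum N x (i - l - 1))" for l
  proof -
    have "of_nat (Suc l) * coeff ?f (Suc l) = coeff (pderiv ?f) l"
      by (simp add: coeff_pderiv)
    also have "\<dots> = (\<Sum>j<N. \<Sum>i\<in>{l<..N}. coeff ?f i * x j ^ (i - l - 1))"
      unfolding pd coeff_sum
      by (intro sum.cong refl coeff_synthetic_division[OF fac]) (auto simp: degree_root_poly)
    also have "\<dots> = (\<Sum>i\<in>{l<..N}. coeff ?f i * psum N x (i - l - 1))"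
      by (subst sum.swap) (simp add: psum_def sum_distrib_left)
    finally show ?thesis .
  qed
  have "of_nat (N - m) * coeff ?f (N - m) = (\<Sum>i\<in>{N - m..N}. coeff ?f i * psum N x (i - (N - m)))"
  proof (cases "N = m")
    case False
    then have "N - m = Suc (N - m - 1)" using m by simp
    moreover have "{N - m - 1<..N} = {N - m..N}" using False m by auto
    ultimately show ?thesis using c[of "N - m - 1"] by (smt (verit) diff_diff_left plus_1_eq_Suc sum.cong add.commute)
  next
    case True
    text \<open>The constant coefficient: every root annihilates \<open>f\<close>.\<close>
    have "(\<Sum>i\<in>{0..N}. coeff ?f i * psum N x i) = (\<Sum>j<N. \<Sum>i\<in>{0..N}. coeff ?f i * x j ^ i)"
      by (subst sum.swap) (simp add: psum_def sum_distrib_left)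
    also have "\<dots> = (\<Sum>j<N. poly ?f (x j))"
      by (simp add: poly_altdef degree_root_poly atMost_atLeast0)
    also have "\<dots> = 0" by (intro sum.neutral) (auto simp: poly_root_poly)
    finally show ?thesis using True by simp
  qed
  also have "\<dots> = (\<Sum>s\<in>{0..m}. coeff ?f (N - m + s) * psum N x s)"
    using m by (intro sum.reindex_bij_witness[where i="\<lambda>s. N - m + s" and j="\<lambda>i. i - (N - m)"]) auto
  \<comment> \<open>The term \<open>s = 0\<close> contains the power sum of exponent 0, which is
    \<open>N\<close>; against the \<open>N - m\<close> on the left it leaves the coefficient
    \<open>- m\<close>. The term \<open>s = m\<close> is the power sum itself because the polynomial
    is monic.\<close>
  also have "{0..m} = insert 0 (insert m {0<..<m})" using m by auto
  also have "(\<Sum>s\<in>\<dots>. coeff ?f (N - m + s) * psum N x s) =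
    coeff ?f (N - m) * of_nat N + psum N x m + (\<Sum>s\<in>{0<..<m}. coeff ?f (N - m + s) * psum N x s)"
    using m by (simp add: psum_def[of _ _ 0] coeff_root_poly_top)
  finally have "psum N x m = of_nat (N - m) * coeff ?f (N - m) - of_nat N * coeff ?f (N - m)
    - (\<Sum>s\<in>{0<..<m}. coeff ?f (N - m + s) * psum N x s)" by simp
  then show ?thesis using m by (simp add: of_nat_diff left_diff_distrib)
qed

text \<open>Each \<open>x j\<close> is a root of \<open>root_poly N x\<close>; multiply its equation
  by \<open>x j ^ (m - N)\<close> and sum over \<open>j\<close>.\<close>

lemma newton_identity_large:
  assumes "m \<ge> N"
  shows "psum N x m = - (\<Sum>l<N. coeff (root_poly N x) l * psum N x (m - N + l))"
proof -
  let ?f = "root_poly N x"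
  have "0 = (\<Sum>j<N. x j ^ (m - N) * poly ?f (x j))"
    by (intro sum.neutral[symmetric]) (auto simp: poly_root_poly)
  also have "\<dots> = (\<Sum>j<N. \<Sum>l\<le>N. coeff ?f l * x j ^ (m - N + l))"
    by (simp add: poly_altdef degree_root_poly sum_distrib_left power_add mult_ac)
  also have "\<dots> = (\<Sum>l\<le>N. coeff ?f l * psum N x (m - N + l))"
    by (subst sum.swap) (simp add: psum_def sum_distrib_left)
  also have "{..N} = insert N {..<N}" by auto
  also have "(\<Sum>l\<in>\<dots>. coeff ?f l * psum N x (m - N + l)) =
    psum N x m + (\<Sum>l<N. coeff ?f l * psum N x (m - N + l))"
    using assms by (simp add: coeff_root_poly_top)
  finally show ?thesis by (simp add: eq_neg_iff_add_eq_0)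
qed

text \<open>Newton's identities can be solved for the coefficients, as only divisions by
  \<open>m > 0\<close> occur. Prescribed power sums thus determine a monic polynomial of degree
  \<open>N\<close>, and its roots serve as \<open>x\<close>.\<close>

lemma power_sums_surjective: "\<exists>x. \<forall>i<N. psum N x (Suc i) = v i"
proof -
  \<comment> \<open>\<open>c m\<close> is the coefficient of \<open>t ^ (N - m)\<close> in the
    polynomial to be built; entry \<open>s - 1\<close> of \<open>v\<close> is the prescribed power
    sum of exponent \<open>s\<close>.\<close>
  define c :: "nat \<Rightarrow> complex" where
    "c = wfrec less_than (\<lambda>c m. if m = 0 then 1 else - (v (m - 1) + (\<Sum>s\<in>{0<..<m}. c (m - s) * v (s - 1))) / of_nat m)"
  have c: "c m = (if m = 0 then 1 else - (v (m - 1) + (\<Sum>s\<in>{0<..<m}. c (m - s) * v (s - 1))) / of_nat m)" for m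
    unfolding c_def by (subst wfrec[OF wf_less_than]) (auto simp: cut_def intro!: sum.cong)
  define f where "f = (\<Sum>l\<le>N. monom (c (N - l)) l)"
  have cf: "coeff f l = (if l \<le> N then c (N - l) else 0)" for l
    by (simp add: f_def coeff_sum)
  have "f \<noteq> 0" using cf[of N] c[of 0] by auto
  moreover have deg: "degree f = N"
    by (rule antisym) (auto simp: cf c[of 0] intro!: degree_le le_degree)
  ultimately obtain A where A: "size A = N" and fA: "f = (\<Prod>x\<in>#A. [:- x, 1:])"
    using alg_closed_imp_factorization[of f] cf[of N] c[of 0] by auto
  obtain xs where xs: "mset xs = A" using ex_mset by blast
  define x where "x i = xs ! i" for i
  have "f = prod_list (map (\<lambda>x. [:- x, 1:]) xs)"
    unfolding fA xs[symmetric] by (simp add: prod_mset_prod_list[symmetric])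
  also have "\<dots> = (\<Prod>j<N. [:- x j, 1:])"
    using A xs by (auto simp: prod.list_conv_set_nth atLeast0LessThan x_def intro!: prod.cong)
  finally have f: "f = root_poly N x" by (simp add: root_poly_def)
  have "psum N x m = v (m - 1)" if "0 < m" "m \<le> N" for m
    using that
  proof (induction m rule: less_induct)
    case (less m)
    have "psum N x m = - of_nat m * c m - (\<Sum>s\<in>{0<..<m}. c (m - s) * v (s - 1))"
      using newton_identity[OF less.prems, of x] less
      by (auto simp: f[symmetric] cf intro!: sum.cong)
    also have "\<dots> = v (m - 1)"
      using less.prems by (subst c[of m]) simp
    finally show ?case .
  qed
  then show ?thesis by (intro exI[of _ x]) auto
qed

definition psum_alg :: "nat \<Rightarrow> ((nat \<Rightarrow> complex) \<Rightarrow> complex) set" where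
  "psum_alg N = {f. \<exists>P\<in>poly_maps N. \<forall>x. f x = P (\<lambda>i. psum N x (Suc i))}"

lemma psum_alg_const: "(\<lambda>x. c) \<in> psum_alg N"
  by (auto simp: psum_alg_def intro: bexI[of _ "\<lambda>_. c"])

lemma psum_alg_add: "f \<in> psum_alg N \<Longrightarrow> g \<in> psum_alg N \<Longrightarrow> (\<lambda>x. f x + g x) \<in> psum_alg N"
  by (auto simp: psum_alg_def intro: bexI[OF _ poly_maps_add])

lemma psum_alg_mult: "f \<in> psum_alg N \<Longrightarrow> g \<in> psum_alg N \<Longrightarrow> (\<lambda>x. f x * g x) \<in> psum_alg N"
  by (auto simp: psum_alg_def intro: bexI[OF _ poly_maps_mult])

lemma psum_alg_uminus: "f \<in> psum_alg N \<Longrightarrow> (\<lambda>x. - f x) \<in> psum_alg N"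
  using psum_alg_mult[OF psum_alg_const[of "-1"]] by simp

lemma psum_alg_diff: "f \<in> psum_alg N \<Longrightarrow> g \<in> psum_alg N \<Longrightarrow> (\<lambda>x. f x - g x) \<in> psum_alg N"
  using psum_alg_add[OF _ psum_alg_uminus] by simp

lemma psum_alg_sum: "(\<And>i. i \<in> I \<Longrightarrow> f i \<in> psum_alg N) \<Longrightarrow> (\<lambda>x. \<Sum>i\<in>I. f i x) \<in> psum_alg N"
  by (induction I rule: infinite_finite_induct) (auto intro: psum_alg_const psum_alg_add)

lemma psum_alg_psum_small: "m \<le> N \<Longrightarrow> (\<lambda>x. psum N x m) \<in> psum_alg N"
proof (cases "m = 0")
  case True
  then show ?thesis using psum_alg_const[of "of_nat N"] by (simp add: psum_def)
next
  case False
  assume "m \<le> N"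
  with False have "(\<lambda>z. z (m - 1)) \<in> poly_maps N" by (intro poly_maps_var) auto
  then show ?thesis using False by (auto simp: psum_alg_def intro!: bexI[of _ "\<lambda>z. z (m - 1)"])
qed

text \<open>These coefficients are the elementary symmetric functions up to sign. Newton's identity
  expresses the one of index \<open>N - m\<close> through power sums and coefficients of higher
  index, so induction on \<open>m\<close> applies.\<close>

lemma coeff_root_poly_psum_alg: "(\<lambda>x. coeff (root_poly N x) l) \<in> psum_alg N"
proof -
  have *: "(\<lambda>x. coeff (root_poly N x) (N - m)) \<in> psum_alg N" if "m \<le> N" for m
    using that
  proof (induction m rule: less_induct)
    case (less m)
    show ?case
    proof (cases "m = 0")
      case True
      then show ?thesis using psum_alg_const[of 1] by (simp add: coeff_root_poly_top)
    next
      case False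
      have "coeff (root_poly N x) (N - m) = - (1 / of_nat m) * (psum N x m +
        (\<Sum>s\<in>{0<..<m}. coeff (root_poly N x) (N - (m - s)) * psum N x s))" for x
      proof -
        have "(\<Sum>s\<in>{0<..<m}. coeff (root_poly N x) (N - (m - s)) * psum N x s)
          = (\<Sum>s\<in>{0<..<m}. coeff (root_poly N x) (N - m + s) * psum N x s)"
          using less.prems by (intro sum.cong refl) (auto simp: Nat.diff_diff_right)
        then show ?thesis
          using newton_identity[of m N x] False less.prems by (simp add: field_simps)
      qed
      moreover have "(\<lambda>x. - (1 / of_nat m) * (psum N x m +
        (\<Sum>s\<in>{0<..<m}. coeff (root_poly N x) (N - (m - s)) * psum N x s))) \<in> psum_alg N"
        using less by (intro psum_alg_mult psum_alg_const psum_alg_add psum_alg_sum psum_alg_psum_small less.IH) auto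
      ultimately show ?thesis by simp
    qed
  qed
  show ?thesis
  proof (cases "l \<le> N")
    case True
    then show ?thesis using *[of "N - l"] by simp
  next
    case False
    then have "coeff (root_poly N x) l = 0" for x
      by (intro coeff_eq_0) (simp add: degree_root_poly)
    then show ?thesis using psum_alg_const[of 0] by simp
  qed
qed

lemma psum_alg_psum: "(\<lambda>x. psum N x m) \<in> psum_alg N"
proof (induction m rule: less_induct)
  case (less m)
  show ?case
  proof (cases "m \<le> N")
    case False
    have "psum N x m = - (\<Sum>l<N. coeff (root_poly N x) l * psum N x (m - N + l))" for x
      using False by (intro newton_identity_large) simp
    then show ?thesis
      using False by (simp) (intro psum_alg_uminus psum_alg_sum psum_alg_mult coeff_root_poly_psum_alg less.IH, auto)
  qed (rule psum_alg_psum_small)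
qed

definition distinct_lists :: "nat \<Rightarrow> nat \<Rightarrow> nat list set" where
  "distinct_lists N l = {js. length js = l \<and> distinct js \<and> set js \<subseteq> {..<N}}"

text \<open>The augmented monomial symmetric function. Summing over sequences of distinct indices,
  not over distinct monomials, avoids dividing by the order of a stabilizer.\<close>

definition aug_monomial :: "nat \<Rightarrow> nat list \<Rightarrow> (nat \<Rightarrow> complex) \<Rightarrow> complex" where
  "aug_monomial N ms x = (\<Sum>js\<in>distinct_lists N (length ms). \<Prod>i<length ms. x (js ! i) ^ (ms ! i))"

lemma finite_distinct_lists: "finite (distinct_lists N l)"
proof -
  have "distinct_lists N l \<subseteq> {js. set js \<subseteq> {..<N} \<and> length js = l}" by (auto simp: distinct_lists_def)
  then show ?thesis using finite_lists_length_eq[of "{..<N}" l] finite_subset by blast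
qed

text \<open>Letting the first index run freely gives the product with a power sum. A collision with
  the \<open>i\<close>-th remaining index merges two exponents and has to be subtracted.\<close>

lemma aug_monomial_Cons:
  "aug_monomial N (m # ms) x = psum N x m * aug_monomial N ms x
    - (\<Sum>i<length ms. aug_monomial N (ms[i := ms ! i + m]) x)"
proof -
  let ?L = "length ms" and ?D = "distinct_lists N (length ms)"
  let ?P = "\<lambda>js. \<Prod>i<?L. x (js ! i) ^ (ms ! i)"
  have "aug_monomial N (m # ms) x = (\<Sum>(js, j)\<in>(SIGMA js:?D. {..<N} - set js). x j ^ m * ?P js)"
    unfolding aug_monomial_def
    by (rule sum.reindex_bij_witness[where i="\<lambda>(js, j). j # js" and j="\<lambda>l. (tl l, hd l)"])
      (auto simp: distinct_lists_def length_Suc_conv prod.lessThan_Suc_shift simp del: prod.lessThan_Suc)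
  also have "\<dots> = (\<Sum>js\<in>?D. \<Sum>j\<in>{..<N} - set js. x j ^ m * ?P js)"
    by (rule sum.Sigma[symmetric]) (auto simp: finite_distinct_lists)
  also have "\<dots> = (\<Sum>js\<in>?D. psum N x m * ?P js - (\<Sum>i<?L. x (js ! i) ^ m * ?P js))"
  proof (rule sum.cong[OF refl])
    fix js assume js: "js \<in> ?D"
    then have sub: "set js \<subseteq> {..<N}" and d: "distinct js" and l: "length js = ?L"
      by (auto simp: distinct_lists_def)
    have "(\<Sum>j\<in>set js. x j ^ m) = (\<Sum>i<?L. x (js ! i) ^ m)"
      using sum.reindex_bij_betw[OF bij_betw_nth[OF d, of "{..<?L}" "set js"], of "\<lambda>j. x j ^ m"] l by simp
    moreover have "(\<Sum>j\<in>{..<N} - set js. x j ^ m) = psum N x m - (\<Sum>j\<in>set js. x j ^ m)"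
      using sub by (simp add: psum_def sum_diff)
    ultimately show "(\<Sum>j\<in>{..<N} - set js. x j ^ m * ?P js) = psum N x m * ?P js - (\<Sum>i<?L. x (js ! i) ^ m * ?P js)"
      by (simp add: sum_distrib_right[symmetric] left_diff_distrib)
  qed
  also have "\<dots> = psum N x m * aug_monomial N ms x - (\<Sum>i<?L. \<Sum>js\<in>?D. x (js ! i) ^ m * ?P js)"
    unfolding sum_subtractf aug_monomial_def sum_distrib_left by (subst sum.swap) simp
  also have "(\<Sum>i<?L. \<Sum>js\<in>?D. x (js ! i) ^ m * ?P js) = (\<Sum>i<?L. aug_monomial N (ms[i := ms ! i + m]) x)"
  proof (rule sum.cong[OF refl])
    fix i assume "i \<in> {..<?L}"
    then have i: "i < ?L" by simp
    have "x (js ! i) ^ m * ?P js = (\<Prod>l<?L. x (js ! l) ^ (ms[i := ms ! i + m] ! l))" for js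
      using i by (simp add: prod.remove[of "{..<?L}" i] power_add mult_ac)
    then show "(\<Sum>js\<in>?D. x (js ! i) ^ m * ?P js) = aug_monomial N (ms[i := ms ! i + m]) x"
      by (simp add: aug_monomial_def)
  qed
  finally show ?thesis .
qed

lemma aug_monomial_psum_alg: "aug_monomial N ms \<in> psum_alg N"
proof (induction "length ms" arbitrary: ms)
  case 0
  moreover have "distinct_lists N 0 = {[]}" by (auto simp: distinct_lists_def)
  ultimately have "aug_monomial N ms = (\<lambda>x. 1)"
    by (auto simp: aug_monomial_def fun_eq_iff)
  then show ?case by (simp add: psum_alg_const)
next
  case (Suc l)
  then obtain m ms' where ms: "ms = m # ms'" "length ms' = l" by (metis length_Suc_conv)
  have "aug_monomial N ms = (\<lambda>x. psum N x m * aug_monomial N ms' x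
    - (\<Sum>i<length ms'. aug_monomial N (ms'[i := ms' ! i + m]) x))"
    unfolding ms aug_monomial_Cons by simp
  then show ?case
    using ms Suc.hyps(1) by (simp add: psum_alg_diff psum_alg_mult psum_alg_psum psum_alg_sum)
qed

text \<open>Permutations of \<open>N\<close> letters are the distinct lists of full length, so a
  symmetrized monomial is an augmented monomial function in which zero exponents are kept.\<close>

lemma symmetrization_psum_alg:
  assumes "q \<in> poly_maps N"
  shows "(\<lambda>x. \<Sum>\<pi> | \<pi> permutes {..<N}. q (\<lambda>i. x (\<pi> i))) \<in> psum_alg N"
  using assms
proof (induction rule: poly_maps_monomial_induct)
  case (monomial c m)
  have "(\<Sum>\<pi> | \<pi> permutes {..<N}. c * (\<Prod>i<N. x (\<pi> i) ^ m i)) = c * aug_monomial N (map m [0..<N]) x" for x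
  proof -
    have inj: "map \<pi> [0..<N] ! i = \<pi> i" if "i < N" for \<pi> :: "nat \<Rightarrow> nat" and i using that by simp
    have "(\<Sum>\<pi> | \<pi> permutes {..<N}. (\<Prod>i<N. x (\<pi> i) ^ m i)) = aug_monomial N (map m [0..<N]) x"
      unfolding aug_monomial_def length_map length_upt
    proof (rule sum.reindex_bij_witness[where j="\<lambda>\<pi>. map \<pi> [0..<N]" and i="\<lambda>js i. if i < N then js ! i else i"], goal_cases)
      case (1 \<pi>)
      then show ?case by (auto simp: fun_eq_iff permutes_def)
    next
      case (2 \<pi>)
      then have "inj_on \<pi> {..<N}" "\<pi> ` {..<N} = {..<N}" by (simp_all add: permutes_inj_on permutes_image)
      then show ?case
        by (simp add: distinct_lists_def distinct_map atLeast0LessThan)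
    next
      case (3 js)
      then show ?case by (auto simp: distinct_lists_def intro!: nth_equalityI)
    next
      case (4 js)
      then have l: "length js = N" and d: "distinct js" and s: "set js \<subseteq> {..<N}" by (auto simp: distinct_lists_def)
      have "card (set js) = N" using d l distinct_card by blast
      then have "set js = {..<N}" using s by (intro card_subset_eq) auto
      then have b: "bij_betw ((!) js) {..<N} {..<N}"
        by (intro bij_betw_nth d) (simp_all only: l)
      have "bij_betw (\<lambda>i. if i < N then js ! i else i) {..<N} {..<N}"
        by (rule bij_betw_cong[THEN iffD1, OF _ b]) simp
      then have "(\<lambda>i. if i < N then js ! i else i) permutes {..<N}"
        by (rule bij_imp_permutes) simp
      then show ?case by simp
    next
      case (5 \<pi>)
      then show ?case by (auto intro!: prod.cong)
    qed
    then show ?thesis by (simp add: sum_distrib_left[symmetric])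
  qed
  then show ?case by (simp add: psum_alg_mult psum_alg_const aug_monomial_psum_alg)
next
  case (add f g)
  then show ?case by (simp add: sum.distrib psum_alg_add)
qed

text \<open>A symmetric polynomial equals its own average over the permutations, which is available
  in characteristic 0.\<close>

theorem symmetric_poly_psum_alg:
  assumes "q \<in> poly_maps N" and sym: "\<And>\<pi> x. \<pi> permutes {..<N} \<Longrightarrow> q (\<lambda>i. x (\<pi> i)) = q x"
  shows "q \<in> psum_alg N"
proof -
  have "q x = (1 / of_nat (fact N)) * (\<Sum>\<pi> | \<pi> permutes {..<N}. q (\<lambda>i. x (\<pi> i)))" for x
    using sym by (simp add: card_permutations[OF refl])
  then have "q = (\<lambda>x. (1 / of_nat (fact N)) * (\<Sum>\<pi> | \<pi> permutes {..<N}. q (\<lambda>i. x (\<pi> i))))" by blast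
  then show ?thesis
    using psum_alg_mult[OF psum_alg_const symmetrization_psum_alg[OF assms(1)]] by metis
qed

section \<open>Symmetric polynomials as polynomials in the power sums\<close>

lemma vec_polys_poly_maps:
  assumes "r \<in> vec_polys N"
  shows "(\<lambda>x. r (vec N x)) \<in> poly_maps N"
proof -
  have "(\<lambda>x\<in>UNIV. r (vec N x)) \<in> poly_funs UNIV {(\<lambda>z. z i) | i. i < N}"
    using assms unfolding vec_polys_def
  proof (rule poly_funs_compose)
    fix g :: "complex vec \<Rightarrow> complex" assume "g \<in> {(\<lambda>x. x $ i) | i. i < N}"
    then obtain i where "i < N" "g = (\<lambda>x. x $ i)" by blast
    then show "(\<lambda>x\<in>UNIV. g (vec N x)) \<in> poly_funs UNIV {(\<lambda>z. z i) | i. i < N}"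
      using poly_maps_var[of i N] by (simp add: poly_maps_def)
  qed simp
  then show ?thesis by (simp add: poly_maps_def)
qed

lemma poly_maps_vec_polys:
  assumes "q \<in> poly_maps N"
  shows "(\<lambda>v\<in>carrier_vec N. q (\<lambda>i. v $ i)) \<in> vec_polys N"
  using assms unfolding vec_polys_def poly_maps_def
proof (rule poly_funs_compose)
  fix g :: "(nat \<Rightarrow> complex) \<Rightarrow> complex" assume "g \<in> {(\<lambda>z. z i) | i. i < N}"
  then obtain i where "i < N" "g = (\<lambda>z. z i)" by blast
  then show "(\<lambda>v\<in>carrier_vec N. g (\<lambda>i. v $ i)) \<in> poly_funs (carrier_vec N) {(\<lambda>x. x $ i) | i. i < N}"
    using poly_funs.coord[of "\<lambda>x. x $ i" "{(\<lambda>x. x $ i) | i. i < N}" "carrier_vec N"] by auto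
qed simp

lemma vec_index_eta: "v \<in> carrier_vec N \<Longrightarrow> vec N (\<lambda>i. v $ i) = v"
  by auto

text \<open>Existence is the theorem on symmetric polynomials. Uniqueness needs no algebraic
  independence: the power sums reach every point of the affine space, so the values of
  \<open>P\<close> are forced.\<close>

lemma power_sum_form_ex1:
  assumes r: "r \<in> sym_polys N"
  shows "\<exists>!P. P \<in> vec_polys N \<and>
    (\<forall>x\<in>carrier_vec N. P (vec N (\<lambda>i. \<Sum>j<N. (x $ j) ^ (i + 1))) = r x)"
proof -
  let ?q = "\<lambda>x. r (vec N x)"
  have q: "?q \<in> poly_maps N" using r by (simp add: sym_polys_def vec_polys_poly_maps)
  moreover have "?q (\<lambda>i. x (\<pi> i)) = ?q x" if "\<pi> permutes {..<N}" for \<pi> x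
  proof -
    have "\<pi> i < N" if "i < N" for i
      using permutes_in_image[OF \<open>\<pi> permutes {..<N}\<close>, of i] that by simp
    then    have "vec N (\<lambda>i. vec N x $ \<pi> i) = vec N (\<lambda>i. x (\<pi> i))"
      by (intro eq_vecI) simp_all
    moreover have "r (vec N (\<lambda>i. vec N x $ \<pi> i)) = r (vec N x)"
      using r that by (simp add: sym_polys_def)
    ultimately show ?thesis by simp
  qed
  ultimately have "?q \<in> psum_alg N" by (rule symmetric_poly_psum_alg)
  then obtain P where P: "P \<in> poly_maps N" "\<And>x. r (vec N x) = P (\<lambda>i. psum N x (Suc i))"
    by (auto simp: psum_alg_def)
  show ?thesis
  proof (rule ex1I[of _ "\<lambda>v\<in>carrier_vec N. P (\<lambda>i. v $ i)"], intro conjI ballI)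
    show "(\<lambda>v\<in>carrier_vec N. P (\<lambda>i. v $ i)) \<in> vec_polys N" by (rule poly_maps_vec_polys) (rule P)
    fix x :: "complex vec" assume x: "x \<in> carrier_vec N"
    have "P (\<lambda>i. vec N (\<lambda>i. \<Sum>j<N. (x $ j) ^ (i + 1)) $ i) = P (\<lambda>i. psum N (\<lambda>i. x $ i) (Suc i))"
      by (rule poly_maps_cong[OF P(1)]) (simp add: psum_def)
    also have "\<dots> = r x" using x by (simp add: P(2)[symmetric] vec_index_eta)
    finally show "(\<lambda>v\<in>carrier_vec N. P (\<lambda>i. v $ i)) (vec N (\<lambda>i. \<Sum>j<N. (x $ j) ^ (i + 1))) = r x"
      by simp
  next
    fix Q assume Q: "Q \<in> vec_polys N \<and> (\<forall>x\<in>carrier_vec N. Q (vec N (\<lambda>i. \<Sum>j<N. (x $ j) ^ (i + 1))) = r x)"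
    show "Q = (\<lambda>v\<in>carrier_vec N. P (\<lambda>i. v $ i))"
    proof
      fix v
      show "Q v = (\<lambda>v\<in>carrier_vec N. P (\<lambda>i. v $ i)) v"
      proof (cases "v \<in> carrier_vec N")
        case True
        obtain x where x: "\<And>i. i < N \<Longrightarrow> psum N x (Suc i) = v $ i"
          using power_sums_surjective[of N "\<lambda>i. v $ i"] by blast
        have v: "v = vec N (\<lambda>i. \<Sum>j<N. (vec N x $ j) ^ (i + 1))"
          using True x by (auto simp: psum_def)
        have "Q v = r (vec N x)"
          using bspec[OF conjunct2[OF Q], of "vec N x"] unfolding v[symmetric] by simp
        also have "\<dots> = P (\<lambda>i. v $ i)"
          unfolding P(2) by (rule poly_maps_cong[OF P(1)]) (simp add: x)
        finally show ?thesis using True by simp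
      next
        case False
        have "restrict Q (carrier_vec N) = Q"
          using Q unfolding vec_polys_def by (intro poly_funs_ext) blast
        from fun_cong[OF this, of v] have "Q v = undefined" using False by simp
        then show ?thesis using False by simp
      qed
    qed
  qed
qed

lemma power_sum_form_vec_polys: "r \<in> sym_polys N \<Longrightarrow> power_sum_form N r \<in> vec_polys N"
  using theI'[OF power_sum_form_ex1] unfolding power_sum_form_def by blast

lemma power_sum_form_psum:
  assumes "r \<in> sym_polys N"
  shows "power_sum_form N r (vec N (\<lambda>i. psum N x (Suc i))) = r (vec N x)"
proof -
  have "power_sum_form N r (vec N (\<lambda>i. \<Sum>j<N. (vec N x $ j) ^ (i + 1))) = r (vec N x)"
    using bspec[OF conjunct2[OF theI'[OF power_sum_form_ex1[OF assms]]] vec_carrier]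
    unfolding power_sum_form_def .
  moreover have "vec N (\<lambda>i. \<Sum>j<N. (vec N x $ j) ^ (i + 1)) = vec N (\<lambda>i. psum N x (Suc i))"
    by (auto simp: psum_def)
  ultimately show ?thesis by (simp only:)
qed

text \<open>Any argument \<open>v\<close> consists of the power sums of some \<open>x\<close>.
  Evaluating all forms at \<open>v\<close> is therefore evaluating all \<open>r\<close> at one
  \<open>x\<close>, which is visibly compatible with sums and products.\<close>

lemma power_sum_form_point:
  obtains x where "x \<in> carrier_vec N" "\<And>r. r \<in> sym_polys N \<Longrightarrow> power_sum_form N r (vec N v) = r x"
proof -
  obtain x where x: "\<And>i. i < N \<Longrightarrow> psum N x (Suc i) = v i"
    using power_sums_surjective[of N v] by blast
  have "vec N v = vec N (\<lambda>i. psum N x (Suc i))" using x by auto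
  then show ?thesis using that[of "vec N x"] power_sum_form_psum by simp
qed

subsection \<open>The ring of symmetric polynomials\<close>

lemma sym_polys_const: "(\<lambda>x\<in>carrier_vec N. c) \<in> sym_polys N"
  by (auto simp: sym_polys_def vec_polys_def intro: poly_funs.const)

lemma sym_polys_add:
  "r \<in> sym_polys N \<Longrightarrow> s \<in> sym_polys N \<Longrightarrow> (\<lambda>x\<in>carrier_vec N. r x + s x) \<in> sym_polys N"
  by (auto simp: sym_polys_def vec_polys_def intro: poly_funs.add)

lemma sym_polys_mult:
  "r \<in> sym_polys N \<Longrightarrow> s \<in> sym_polys N \<Longrightarrow> (\<lambda>x\<in>carrier_vec N. r x * s x) \<in> sym_polys N"
  by (auto simp: sym_polys_def vec_polys_def intro: poly_funs.mult)

lemma sym_polys_ext: "r \<in> sym_polys N \<Longrightarrow> restrict r (carrier_vec N) = r"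
  by (auto simp: sym_polys_def vec_polys_def intro: poly_funs_ext)

lemma cring_sym_ring: "cring (sym_ring N)"
proof (rule cringI)
  have sel: "carrier (sym_ring N) = sym_polys N" "mult (sym_ring N) = (\<lambda>r s. \<lambda>x\<in>carrier_vec N. r x * s x)"
    "one (sym_ring N) = (\<lambda>x\<in>carrier_vec N. 1)" "zero (sym_ring N) = (\<lambda>x\<in>carrier_vec N. 0)"
    "add (sym_ring N) = (\<lambda>r s. \<lambda>x\<in>carrier_vec N. r x + s x)"
    by (simp_all add: sym_ring_def)
  show "abelian_group (sym_ring N)"
  proof (rule abelian_groupI)
    fix r assume r: "r \<in> carrier (sym_ring N)"
    show "\<exists>s\<in>carrier (sym_ring N). s \<oplus>\<^bsub>sym_ring N\<^esub> r = \<zero>\<^bsub>sym_ring N\<^esub>"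
      using sym_polys_mult[OF sym_polys_const[where N=N and c="-1"], of r] r
      by (intro bexI[of _ "\<lambda>x\<in>carrier_vec N. (\<lambda>x\<in>carrier_vec N. - 1) x * r x"]) (auto simp: sel restrict_def fun_eq_iff)
    show "\<zero>\<^bsub>sym_ring N\<^esub> \<oplus>\<^bsub>sym_ring N\<^esub> r = r"
      using r sym_polys_ext[of r N] by (simp add: sel cong: restrict_cong)
  qed (simp add: sel sym_polys_add | simp add: sel sym_polys_const | auto simp: sel restrict_def algebra_simps)+
  show "comm_monoid (sym_ring N)"
  proof (rule comm_monoidI)
    fix r assume r: "r \<in> carrier (sym_ring N)"
    show "\<one>\<^bsub>sym_ring N\<^esub> \<otimes>\<^bsub>sym_ring N\<^esub> r = r"
      using r sym_polys_ext[of r N] by (simp add: sel cong: restrict_cong)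
  qed (simp add: sel sym_polys_mult | simp add: sel sym_polys_const | auto simp: sel restrict_def algebra_simps)+
  fix r s t
  show "(r \<oplus>\<^bsub>sym_ring N\<^esub> s) \<otimes>\<^bsub>sym_ring N\<^esub> t =
    r \<otimes>\<^bsub>sym_ring N\<^esub> t \<oplus>\<^bsub>sym_ring N\<^esub> s \<otimes>\<^bsub>sym_ring N\<^esub> t"
    by (auto simp: sel restrict_def fun_eq_iff algebra_simps)
qed

text \<open>The discriminant up to sign. As a product over ordered pairs it splits into one factor
  per index, the form in which Lagrange interpolation produces it.\<close>

definition ordered_disc :: "nat \<Rightarrow> (nat \<Rightarrow> complex) \<Rightarrow> complex" where
  "ordered_disc N x = (\<Prod>i<N. \<Prod>j\<in>{..<N} - {i}. (x i - x j))"

lemma ordered_disc_poly_maps: "ordered_disc N \<in> poly_maps N"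
  unfolding ordered_disc_def by (intro poly_maps_prod poly_maps_diff poly_maps_var) auto

lemma ordered_disc_eq: "\<exists>e. e * e = 1 \<and> (\<forall>x. Disc N (vec N x) = e * ordered_disc N x)"
proof -
  have "\<exists>e. e * e = 1 \<and> (\<forall>x :: nat \<Rightarrow> complex. (\<Prod>j<N. \<Prod>i<j. (x i - x j)\<^sup>2) = e * ordered_disc N x)"
  proof (induction N)
    case 0
    then show ?case by (intro exI[of _ 1]) (simp add: ordered_disc_def)
  next
    case (Suc N)
    then obtain e where e: "e * e = 1" "\<And>x :: nat \<Rightarrow> complex. (\<Prod>j<N. \<Prod>i<j. (x i - x j)\<^sup>2) = e * ordered_disc N x" by blast
    \<comment> \<open>The new variable meets each old one twice, with opposite signs, hence the
      factor \<open>(-1) ^ N\<close>. Only the square of the total sign is kept.\<close>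
    have "(\<Prod>j<Suc N. \<Prod>i<j. (x i - x j)\<^sup>2) = (e * (-1) ^ N) * ordered_disc (Suc N) x" for x :: "nat \<Rightarrow> complex"
    proof -
      have set1: "{..<Suc N} - {i} = insert N ({..<N} - {i})" if "i < N" for i using that by auto
      have set2: "{..<Suc N} - {N} = {..<N}" by auto
      have "ordered_disc (Suc N) x = (\<Prod>i<N. \<Prod>j\<in>{..<Suc N} - {i}. x i - x j) * (\<Prod>j<N. x N - x j)"
        by (simp add: ordered_disc_def set2)
      also have "(\<Prod>i<N. \<Prod>j\<in>{..<Suc N} - {i}. x i - x j) = (\<Prod>i<N. (x i - x N) * (\<Prod>j\<in>{..<N} - {i}. x i - x j))"
        by (intro prod.cong refl) (subst set1, auto)
      also have "\<dots> = (\<Prod>i<N. x i - x N) * ordered_disc N x"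
        by (simp add: prod.distrib ordered_disc_def)
      also have "(\<Prod>j<N. x N - x j) = (\<Prod>j<N. (-1) * (x j - x N))" by (intro prod.cong) auto
      also have "\<dots> = (-1) ^ N * (\<Prod>j<N. x j - x N)" by (simp only: prod.distrib prod_constant card_lessThan)
      finally have "ordered_disc (Suc N) x = (-1) ^ N * (\<Prod>j<N. x j - x N)\<^sup>2 * ordered_disc N x"
        by (simp add: power2_eq_square mult_ac)
      moreover have "(-1 :: complex) ^ N * (-1) ^ N = 1" by (simp add: power_add[symmetric])
      ultimately show ?thesis
        using e(2)[of x] by (simp add: prod_power_distrib mult_ac)
    qed
    moreover have "(e * (-1) ^ N) * (e * (-1) ^ N) = 1"
      using e(1) by (simp add: mult_ac power_add[symmetric])
    ultimately show ?case by blast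
  qed
  then show ?thesis by (auto simp: Disc_def)
qed

lemma ordered_disc_permute: "\<pi> permutes {..<N} \<Longrightarrow> ordered_disc N (\<lambda>i. x (\<pi> i)) = ordered_disc N x"
proof -
  assume \<pi>: "\<pi> permutes {..<N}"
  have "(\<Prod>j\<in>{..<N} - {i}. x (\<pi> i) - x (\<pi> j)) = (\<Prod>j\<in>{..<N} - {\<pi> i}. x (\<pi> i) - x j)" for i
  proof (rule prod.reindex_bij_betw[of \<pi>])
    have "\<pi> ` ({..<N} - {i}) = {..<N} - {\<pi> i}"
      using permutes_image[OF \<pi>] permutes_inj[OF \<pi>] by (auto simp: image_set_diff)
    then show "bij_betw \<pi> ({..<N} - {i}) ({..<N} - {\<pi> i})"
      using permutes_inj_on[OF \<pi>] by (simp add: bij_betw_def)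
  qed
  then have "ordered_disc N (\<lambda>i. x (\<pi> i)) = (\<Prod>i<N. \<Prod>j\<in>{..<N} - {\<pi> i}. x (\<pi> i) - x j)"
    by (simp add: ordered_disc_def)
  also have "\<dots> = ordered_disc N x"
    unfolding ordered_disc_def by (rule prod.reindex_bij_betw) (rule permutes_imp_bij[OF \<pi>])
  finally show ?thesis .
qed

lemma Disc_sym_polys: "Disc N \<in> sym_polys N"
proof -
  obtain e where e: "\<And>x. Disc N (vec N x) = e * ordered_disc N x" using ordered_disc_eq by blast
  have ext: "Disc N = (\<lambda>v\<in>carrier_vec N. e * ordered_disc N (\<lambda>i. v $ i))"
  proof
    fix v show "Disc N v = (\<lambda>v\<in>carrier_vec N. e * ordered_disc N (\<lambda>i. v $ i)) v"
      using e[of "\<lambda>i. v $ i"] by (cases "v \<in> carrier_vec N") (simp_all add: vec_index_eta Disc_def)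
  qed
  have "Disc N \<in> vec_polys N"
    unfolding ext by (rule poly_maps_vec_polys) (intro poly_maps_mult poly_maps_const ordered_disc_poly_maps)
  moreover have "Disc N (vec N (\<lambda>i. x $ \<pi> i)) = Disc N x" if "\<pi> permutes {..<N}" "x \<in> carrier_vec N" for \<pi> x
    using e[of "\<lambda>i. x $ \<pi> i"] e[of "\<lambda>i. x $ i"] ordered_disc_permute[OF that(1), of "\<lambda>i. x $ i"] that(2)
    by (simp add: vec_index_eta)
  ultimately show ?thesis by (simp add: sym_polys_def)
qed

subsection \<open>Polynomials in the matrix entries\<close>

lemma mat_pairs_iff: "XA \<in> mat_pairs M p \<longleftrightarrow> fst XA \<in> carrier_mat M M \<and> snd XA \<in> carrier_mat p M"
  by (cases XA) (auto simp: mat_pairs_def)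

lemma mat_polys_X: "i < M \<Longrightarrow> j < M \<Longrightarrow> (\<lambda>XA\<in>mat_pairs M p. fst XA $$ (i, j)) \<in> mat_polys M p"
  unfolding mat_polys_def by (rule poly_funs.coord) (auto simp: fun_eq_iff)

lemma mat_polys_A: "a < p \<Longrightarrow> j < M \<Longrightarrow> (\<lambda>XA\<in>mat_pairs M p. snd XA $$ (a, j)) \<in> mat_polys M p"
  unfolding mat_polys_def by (rule poly_funs.coord) (auto simp: fun_eq_iff)

lemmas mat_polys_intros = poly_funs_intros[where D="mat_pairs M p" and G="
       ({(\<lambda>(X, A). X $$ (i, j)) | i j. i < M \<and> j < M} \<union>
        {(\<lambda>(X, A). A $$ (a, j)) | a j. a < p \<and> j < M})" for M p, folded mat_polys_def]

lemma mat_polys_ext: "f \<in> mat_polys M p \<Longrightarrow> restrict f (mat_pairs M p) = f"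
  unfolding mat_polys_def by (rule poly_funs_ext)

lemma mat_polys_compose:
  assumes f: "f \<in> mat_polys M p" and "\<And>t. t \<in> E \<Longrightarrow> \<phi> t \<in> mat_pairs M p"
    and X: "\<And>i j. i < M \<Longrightarrow> j < M \<Longrightarrow> (\<lambda>t\<in>E. fst (\<phi> t) $$ (i, j)) \<in> poly_funs E K"
    and A: "\<And>i j. i < p \<Longrightarrow> j < M \<Longrightarrow> (\<lambda>t\<in>E. snd (\<phi> t) $$ (i, j)) \<in> poly_funs E K"
  shows "(\<lambda>t\<in>E. f (\<phi> t)) \<in> poly_funs E K"
  using f unfolding mat_polys_def
  by (rule poly_funs_compose) (use assms in \<open>auto simp: case_prod_unfold\<close>)

lemma pow_carrier: "X \<in> carrier_mat M M \<Longrightarrow> X ^\<^sub>m m \<in> carrier_mat M M"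
  by (rule pow_carrier_mat)

lemma mat_polys_pow:
  "i < M \<Longrightarrow> j < M \<Longrightarrow> (\<lambda>XA\<in>mat_pairs M p. (fst XA ^\<^sub>m m) $$ (i, j)) \<in> mat_polys M p"
proof (induction m arbitrary: i j)
  case 0
  have "(\<lambda>XA\<in>mat_pairs M p. (fst XA ^\<^sub>m 0) $$ (i, j)) = (\<lambda>XA\<in>mat_pairs M p. if i = j then 1 else 0)"
    using 0 by (auto simp: mat_pairs_iff fun_eq_iff)
  then show ?case unfolding mat_polys_def by (simp only: poly_funs.const)
next
  case (Suc m)
  have "(fst XA ^\<^sub>m Suc m) $$ (i, j) = (\<Sum>l<M. (fst XA ^\<^sub>m m) $$ (i, l) * fst XA $$ (l, j))"
    if "XA \<in> mat_pairs M p" for XA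
  proof -
    have X: "fst XA \<in> carrier_mat M M" using that by (simp add: mat_pairs_iff)
    then show ?thesis using Suc.prems pow_carrier[OF X, of m]
      by (simp add: scalar_prod_def atLeast0LessThan)
  qed
  then have "(\<lambda>XA\<in>mat_pairs M p. (fst XA ^\<^sub>m Suc m) $$ (i, j)) =
    (\<lambda>XA\<in>mat_pairs M p. \<Sum>l<M. (fst XA ^\<^sub>m m) $$ (i, l) * fst XA $$ (l, j))"
    by (rule restrict_ext)
  moreover have "(\<lambda>XA\<in>mat_pairs M p. \<Sum>l<M. (fst XA ^\<^sub>m m) $$ (i, l) * fst XA $$ (l, j)) \<in> mat_polys M p"
    using Suc by (intro mat_polys_intros Suc.IH mat_polys_X) auto
  ultimately show ?case by (simp only:)
qed

lemma mat_polys_trace: "(\<lambda>XA\<in>mat_pairs M p. mat_trace (fst XA ^\<^sub>m m)) \<in> mat_polys M p"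
proof -
  have "(\<lambda>XA\<in>mat_pairs M p. mat_trace (fst XA ^\<^sub>m m)) = (\<lambda>XA\<in>mat_pairs M p. \<Sum>i<M. (fst XA ^\<^sub>m m) $$ (i, i))"
    by (rule restrict_ext) (auto simp: mat_trace_def mat_pairs_iff)
  moreover have "(\<lambda>XA\<in>mat_pairs M p. \<Sum>i<M. (fst XA ^\<^sub>m m) $$ (i, i)) \<in> mat_polys M p"
    by (intro mat_polys_intros mat_polys_pow) auto
  ultimately show ?thesis by (simp only:)
qed

lemma mat_trace_comm:
  fixes A B :: "complex mat"
  assumes "A \<in> carrier_mat n m" "B \<in> carrier_mat m n"
  shows "mat_trace (A * B) = mat_trace (B * A)"
proof -
  have "mat_trace (A * B) = (\<Sum>i<n. \<Sum>j<m. A $$ (i, j) * B $$ (j, i))"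
    using assms by (auto simp: mat_trace_def scalar_prod_def atLeast0LessThan)
  also have "\<dots> = (\<Sum>j<m. \<Sum>i<n. B $$ (j, i) * A $$ (i, j))"
    by (subst sum.swap) (simp add: mult.commute)
  also have "\<dots> = mat_trace (B * A)"
    using assms by (auto simp: mat_trace_def scalar_prod_def atLeast0LessThan)
  finally show ?thesis .
qed

section \<open>Equivariant functions and the action of symmetric polynomials\<close>

definition inv_pair :: "nat \<Rightarrow> complex mat \<Rightarrow> complex mat \<Rightarrow> bool" where
  "inv_pair M g h \<longleftrightarrow> g \<in> carrier_mat M M \<and> h \<in> carrier_mat M M \<and> g * h = 1\<^sub>m M \<and> h * g = 1\<^sub>m M"

lemma \<H>_iff:
  "f \<in> \<H> M p l \<longleftrightarrow> f \<in> mat_polys M p \<and>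
     (\<forall>g h X A. inv_pair M g h \<longrightarrow> X \<in> carrier_mat M M \<longrightarrow> A \<in> carrier_mat p M \<longrightarrow>
        f (g * X * h, A * h) = inverse (det g ^ l) * f (X, A))"
proof (intro iffI conjI allI impI)
  assume f: "f \<in> \<H> M p l"
  then show "f \<in> mat_polys M p" unfolding \<H>_def by blast
  fix g h X A :: "complex mat"
  assume gh: "inv_pair M g h" and X: "X \<in> carrier_mat M M" and A: "A \<in> carrier_mat p M"
  have "inverts_mat g h \<and> inverts_mat h g" "g \<in> carrier_mat M M" "h \<in> carrier_mat M M"
    using gh by (auto simp: inv_pair_def inverts_mat_def)
  then have "\<forall>(X, A)\<in>mat_pairs M p. f (g * X * h, A * h) = inverse (det g ^ l) * f (X, A)"
    using f unfolding \<H>_def by blast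
  then show "f (g * X * h, A * h) = inverse (det g ^ l) * f (X, A)"
    using X A unfolding mat_pairs_def by blast
next
  assume R: "f \<in> mat_polys M p \<and>
     (\<forall>g h X A. inv_pair M g h \<longrightarrow> X \<in> carrier_mat M M \<longrightarrow> A \<in> carrier_mat p M \<longrightarrow>
        f (g * X * h, A * h) = inverse (det g ^ l) * f (X, A))"
  show "f \<in> \<H> M p l"
    unfolding \<H>_def
  proof (intro CollectI conjI ballI impI)
    show "f \<in> mat_polys M p" using R by blast
    fix g h :: "complex mat" and XA
    assume g: "g \<in> carrier_mat M M" and h: "h \<in> carrier_mat M M"
      and i: "inverts_mat g h \<and> inverts_mat h g" and XA: "XA \<in> mat_pairs M p"
    have "inv_pair M g h" using g h i by (auto simp: inv_pair_def inverts_mat_def)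
    then show "case XA of (X, A) \<Rightarrow> f (g * X * h, A * h) = inverse (det g ^ l) * f (X, A)"
      using R XA unfolding mat_pairs_def by blast
  qed
qed

lemma \<H>_mat_polys: "f \<in> \<H> M p l \<Longrightarrow> f \<in> mat_polys M p"
  by (simp add: \<H>_iff)

lemma \<H>_ext: "f \<in> \<H> M p l \<Longrightarrow> restrict f (mat_pairs M p) = f"
  by (simp add: \<H>_iff mat_polys_ext)

lemma \<H>_equivariant:
  "f \<in> \<H> M p l \<Longrightarrow> inv_pair M g h \<Longrightarrow> X \<in> carrier_mat M M \<Longrightarrow> A \<in> carrier_mat p M \<Longrightarrow>
     f (g * X * h, A * h) = inverse (det g ^ l) * f (X, A)"
  by (auto simp: \<H>_iff)

lemma inv_pair_pow:
  assumes gh: "inv_pair M g h" and X: "X \<in> carrier_mat M M"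
  shows "(g * X * h) ^\<^sub>m m = g * X ^\<^sub>m m * h"
proof -
  have "similar_mat_wit (g * X * h) X g h"
    using gh X by (auto simp: similar_mat_wit_def inv_pair_def Let_def)
  then have "similar_mat_wit ((g * X * h) ^\<^sub>m m) (X ^\<^sub>m m) g h" by (rule similar_mat_wit_pow)
  then show ?thesis by (auto simp: similar_mat_wit_def Let_def)
qed

lemma mat_trace_conj:
  assumes gh: "inv_pair M g h" and X: "X \<in> carrier_mat M M"
  shows "mat_trace ((g * X * h) ^\<^sub>m m) = mat_trace (X ^\<^sub>m m)"
proof -
  have c: "g \<in> carrier_mat M M" "h \<in> carrier_mat M M" "X ^\<^sub>m m \<in> carrier_mat M M" and hg: "h * g = 1\<^sub>m M"
    using gh pow_carrier[OF X] by (auto simp: inv_pair_def)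
  have "mat_trace (g * X ^\<^sub>m m * h) = mat_trace (h * (g * X ^\<^sub>m m))"
    using c by (intro mat_trace_comm[of _ M M]) auto
  also have "h * (g * X ^\<^sub>m m) = (h * g) * X ^\<^sub>m m" using c by (simp add: assoc_mult_mat)
  also have "\<dots> = X ^\<^sub>m m" unfolding hg by (rule left_mult_one_mat) (rule c)
  finally show ?thesis using gh X by (simp add: inv_pair_pow)
qed

lemma \<H>_restrictI:
  assumes poly: "restrict f (mat_pairs M p) \<in> mat_polys M p"
    and equi: "\<And>g h X A. inv_pair M g h \<Longrightarrow> X \<in> carrier_mat M M \<Longrightarrow> A \<in> carrier_mat p M \<Longrightarrow>
      f (g * X * h, A * h) = inverse (det g ^ l) * f (X, A)"
  shows "restrict f (mat_pairs M p) \<in> \<H> M p l"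
  unfolding \<H>_iff
proof (intro conjI allI impI poly)
  fix g h X A :: "complex mat"
  assume gh: "inv_pair M g h" and X: "X \<in> carrier_mat M M" and A: "A \<in> carrier_mat p M"
  then have "(g * X * h, A * h) \<in> mat_pairs M p" "(X, A) \<in> mat_pairs M p"
    by (auto simp: mat_pairs_def inv_pair_def)
  then show "restrict f (mat_pairs M p) (g * X * h, A * h)
    = inverse (det g ^ l) * restrict f (mat_pairs M p) (X, A)"
    using equi[OF gh X A] by simp
qed

lemma \<H>_poly: "f \<in> \<H> M p l \<Longrightarrow> restrict f (mat_pairs M p) \<in> mat_polys M p"
  by (simp only: \<H>_ext \<H>_mat_polys)

lemma \<H>_add: "f \<in> \<H> M p l \<Longrightarrow> g \<in> \<H> M p l \<Longrightarrow> (\<lambda>XA\<in>mat_pairs M p. f XA + g XA) \<in> \<H> M p l"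
  by (rule \<H>_restrictI, intro mat_polys_intros \<H>_poly) (auto simp: \<H>_equivariant distrib_left)

lemma \<H>_zero: "(\<lambda>XA\<in>mat_pairs M p. 0) \<in> \<H> M p l"
  by (rule \<H>_restrictI, intro mat_polys_intros) auto

lemma \<H>_mult_invariant:
  assumes f: "f \<in> \<H> M p l" and c: "(\<lambda>XA\<in>mat_pairs M p. c (fst XA)) \<in> mat_polys M p"
    and inv: "\<And>g h X. inv_pair M g h \<Longrightarrow> X \<in> carrier_mat M M \<Longrightarrow> c (g * X * h) = c X"
  shows "(\<lambda>XA\<in>mat_pairs M p. c (fst XA) * f XA) \<in> \<H> M p l"
  by (rule \<H>_restrictI[OF mat_polys_intros(3)[OF c \<H>_poly[OF f]]]) (simp add: \<H>_equivariant[OF f] inv)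

lemma \<H>_smult: "f \<in> \<H> M p l \<Longrightarrow> (\<lambda>XA\<in>mat_pairs M p. c * f XA) \<in> \<H> M p l"
  by (rule \<H>_mult_invariant) (auto intro: mat_polys_intros)

lemma \<H>_sum: "(\<And>i. i \<in> I \<Longrightarrow> f i \<in> \<H> M p l) \<Longrightarrow> (\<lambda>XA\<in>mat_pairs M p. \<Sum>i\<in>I. f i XA) \<in> \<H> M p l"
proof (induction I rule: infinite_finite_induct)
  case (insert x F)
  then have "(\<lambda>XA\<in>mat_pairs M p. f x XA + (\<lambda>XA\<in>mat_pairs M p. \<Sum>i\<in>F. f i XA) XA) \<in> \<H> M p l"
    by (intro \<H>_add) auto
  moreover have "(\<lambda>XA\<in>mat_pairs M p. f x XA + (\<lambda>XA\<in>mat_pairs M p. \<Sum>i\<in>F. f i XA) XA) =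
    (\<lambda>XA\<in>mat_pairs M p. \<Sum>i\<in>insert x F. f i XA)"
    using insert by (intro restrict_ext) simp
  ultimately show ?case by (simp only:)
qed (simp_all add: \<H>_zero)

definition trace_form :: "nat \<Rightarrow> complex \<Rightarrow> (complex vec \<Rightarrow> complex) \<Rightarrow> complex mat \<Rightarrow> complex" where
  "trace_form N c r X = power_sum_form N r (vec N (\<lambda>i. c * mat_trace (X ^\<^sub>m (i + 1))))"

lemma trace_form_conj:
  "inv_pair M g h \<Longrightarrow> X \<in> carrier_mat M M \<Longrightarrow> trace_form N c r (g * X * h) = trace_form N c r X"
  unfolding trace_form_def by (simp only: mat_trace_conj)

lemma trace_form_mat_polys:
  assumes "r \<in> sym_polys N"
  shows "(\<lambda>XA\<in>mat_pairs M p. trace_form N c r (fst XA)) \<in> mat_polys M p"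
  using power_sum_form_vec_polys[OF assms] unfolding trace_form_def vec_polys_def mat_polys_def
proof (rule poly_funs_compose)
  fix g :: "complex vec \<Rightarrow> complex" assume "g \<in> {(\<lambda>x. x $ i) | i. i < N}"
  then obtain i where i: "i < N" "g = (\<lambda>x. x $ i)" by auto
  have "(\<lambda>XA\<in>mat_pairs M p. c * mat_trace (fst XA ^\<^sub>m (i + 1))) \<in> mat_polys M p"
    by (intro mat_polys_intros mat_polys_trace)
  then show "(\<lambda>t\<in>mat_pairs M p. g (vec N (\<lambda>i. c * mat_trace (fst t ^\<^sub>m (i + 1)))))
    \<in> poly_funs (mat_pairs M p) ({\<lambda>(X, A). X $$ (i, j) |i j. i < M \<and> j < M} \<union> {\<lambda>(X, A). A $$ (a, j) |a j. a < p \<and> j < M})"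
    using i unfolding mat_polys_def by simp
qed auto

text \<open>For a fixed \<open>X\<close> the scalars of all \<open>r\<close> are values at one
  common point \<open>x\<close>, so the module axioms reduce to identities between functions at
  \<open>x\<close>.\<close>

lemma trace_form_point:
  obtains x where "x \<in> carrier_vec N" "\<And>r. r \<in> sym_polys N \<Longrightarrow> trace_form N c r X = r x"
  unfolding trace_form_def using power_sum_form_point by metis

lemma \<H>_module_smult:
  "module.smult (\<H>_module N c M p l) r f = (\<lambda>XA\<in>mat_pairs M p. trace_form N c r (fst XA) * f XA)"
  by (simp add: \<H>_module_def trace_form_def case_prod_unfold)

lemma \<H>_module_sel:
  "carrier (\<H>_module N c M p l) = \<H> M p l"
  "zero (\<H>_module N c M p l) = (\<lambda>XA\<in>mat_pairs M p. 0)"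
  "add (\<H>_module N c M p l) = (\<lambda>f g. \<lambda>XA\<in>mat_pairs M p. f XA + g XA)"
  by (simp_all add: \<H>_module_def)

lemma module_\<H>_module: "module (sym_ring N) (\<H>_module N c M p l)"
proof (rule moduleI)
  have sel: "carrier (sym_ring N) = sym_polys N" "mult (sym_ring N) = (\<lambda>r s. \<lambda>x\<in>carrier_vec N. r x * s x)"
    "one (sym_ring N) = (\<lambda>x\<in>carrier_vec N. 1)"
    "add (sym_ring N) = (\<lambda>r s. \<lambda>x\<in>carrier_vec N. r x + s x)"
    by (simp_all add: sym_ring_def)
  show "cring (sym_ring N)" by (rule cring_sym_ring)
  show "abelian_group (\<H>_module N c M p l)"
  proof (rule abelian_groupI)
    fix f assume f: "f \<in> carrier (\<H>_module N c M p l)"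
    then have "(\<lambda>XA\<in>mat_pairs M p. (-1) * f XA) \<in> \<H> M p l" by (intro \<H>_smult) (simp add: \<H>_module_sel)
    then show "\<exists>g\<in>carrier (\<H>_module N c M p l). g \<oplus>\<^bsub>\<H>_module N c M p l\<^esub> f = \<zero>\<^bsub>\<H>_module N c M p l\<^esub>"
      by (intro bexI[of _ "\<lambda>XA\<in>mat_pairs M p. (-1) * f XA"]) (auto simp: \<H>_module_sel restrict_def fun_eq_iff)
    show "\<zero>\<^bsub>\<H>_module N c M p l\<^esub> \<oplus>\<^bsub>\<H>_module N c M p l\<^esub> f = f"
      using f \<H>_ext[of f M p l] by (simp add: \<H>_module_sel cong: restrict_cong)
  qed (simp add: \<H>_module_sel \<H>_add | simp add: \<H>_module_sel \<H>_zero | auto simp: \<H>_module_sel restrict_def algebra_simps)+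
  fix f assume f: "f \<in> carrier (\<H>_module N c M p l)"
  have "trace_form N c \<one>\<^bsub>sym_ring N\<^esub> X = 1" for X
  proof -
    obtain x where x: "x \<in> carrier_vec N" "\<And>r. r \<in> sym_polys N \<Longrightarrow> trace_form N c r X = r x"
      using trace_form_point[of N c X] by blast
    show ?thesis using x(1) by (simp add: x(2) sel sym_polys_const)
  qed
  then show "\<one>\<^bsub>sym_ring N\<^esub> \<odot>\<^bsub>\<H>_module N c M p l\<^esub> f = f"
    using f \<H>_ext[of f M p l] by (simp add: \<H>_module_smult \<H>_module_sel)
  fix r assume r: "r \<in> carrier (sym_ring N)"
  show "r \<odot>\<^bsub>\<H>_module N c M p l\<^esub> f \<in> carrier (\<H>_module N c M p l)"
    using r f unfolding \<H>_module_smult unfolding \<H>_module_sel sel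
    by (intro \<H>_mult_invariant trace_form_mat_polys trace_form_conj)
  {
    fix s assume s: "s \<in> carrier (sym_ring N)"
    have m: "trace_form N c (r \<otimes>\<^bsub>sym_ring N\<^esub> s) X = trace_form N c r X * trace_form N c s X"
      and a: "trace_form N c (r \<oplus>\<^bsub>sym_ring N\<^esub> s) X = trace_form N c r X + trace_form N c s X" for X
    proof -
      obtain x where x: "x \<in> carrier_vec N" "\<And>r. r \<in> sym_polys N \<Longrightarrow> trace_form N c r X = r x"
        using trace_form_point[of N c X] by blast
      show "trace_form N c (r \<otimes>\<^bsub>sym_ring N\<^esub> s) X = trace_form N c r X * trace_form N c s X"
        using r s x(1) by (simp add: x(2) sel sym_polys_mult)
      show "trace_form N c (r \<oplus>\<^bsub>sym_ring N\<^esub> s) X = trace_form N c r X + trace_form N c s X"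
        using r s x(1) by (simp add: x(2) sel sym_polys_add)
    qed
    show "(r \<oplus>\<^bsub>sym_ring N\<^esub> s) \<odot>\<^bsub>\<H>_module N c M p l\<^esub> f =
      r \<odot>\<^bsub>\<H>_module N c M p l\<^esub> f \<oplus>\<^bsub>\<H>_module N c M p l\<^esub> s \<odot>\<^bsub>\<H>_module N c M p l\<^esub> f"
      by (auto simp: \<H>_module_smult a \<H>_module_sel distrib_right restrict_def fun_eq_iff)
    show "(r \<otimes>\<^bsub>sym_ring N\<^esub> s) \<odot>\<^bsub>\<H>_module N c M p l\<^esub> f =
      r \<odot>\<^bsub>\<H>_module N c M p l\<^esub> (s \<odot>\<^bsub>\<H>_module N c M p l\<^esub> f)"
      by (auto simp: \<H>_module_smult m restrict_def fun_eq_iff)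
  }
  fix g assume "g \<in> carrier (\<H>_module N c M p l)"
  show "r \<odot>\<^bsub>\<H>_module N c M p l\<^esub> (f \<oplus>\<^bsub>\<H>_module N c M p l\<^esub> g) =
    r \<odot>\<^bsub>\<H>_module N c M p l\<^esub> f \<oplus>\<^bsub>\<H>_module N c M p l\<^esub> r \<odot>\<^bsub>\<H>_module N c M p l\<^esub> g"
    by (auto simp: \<H>_module_smult \<H>_module_sel distrib_left restrict_def fun_eq_iff)
qed

subsection \<open>Density of the diagonalizable matrices\<close>

lemma jordan_matrix_ones:
  assumes "\<forall>x\<in>set n_as. fst x = 1"
  shows "jordan_matrix n_as = mat_diag (length n_as) (\<lambda>i. snd (n_as ! i))"
  using assms
proof (induction n_as)
  case Nil
  show ?case by (intro eq_matI) (simp_all add: jordan_matrix_def mat_diag_def)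
next
  case (Cons x n_as)
  obtain a where x: "x = (1, a)" using Cons.prems by (cases x) auto
  have IH: "jordan_matrix n_as = mat_diag (length n_as) (\<lambda>i. snd (n_as ! i))"
    using Cons by simp
  have "jordan_matrix (x # n_as) = four_block_mat (jordan_block 1 a) (0\<^sub>m 1 (length n_as)) (0\<^sub>m (length n_as) 1) (jordan_matrix n_as)"
    unfolding IH by (simp add: jordan_matrix_def x Let_def IH[unfolded jordan_matrix_def] mat_diag_def)
  also have "\<dots> = mat_diag (length (x # n_as)) (\<lambda>i. snd ((x # n_as) ! i))"
    unfolding IH by (intro eq_matI) (auto simp: mat_diag_def x nth_Cons')
  finally show ?case .
qed

text \<open>A Jordan block of size at least 2 would give the characteristic polynomial a double
  root, while its roots are the diagonal entries of \<open>T\<close>, which are distinct. All blocks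
  have size 1, so the Jordan form is diagonal.\<close>

lemma diagonalizable_of_distinct_eigenvalues:
  fixes T :: "complex mat"
  assumes T: "T \<in> carrier_mat M M" and ut: "upper_triangular T" and inj: "inj_on (\<lambda>i. T $$ (i, i)) {..<M}"
  shows "\<exists>P Q d. inv_pair M P Q \<and> T = P * mat_diag M d * Q"
proof -
  let ?f = "\<Prod>i<M. [:- T $$ (i, i), 1:]"
  obtain as where "char_poly T = (\<Prod>a\<leftarrow>as. [:- a, 1:])" using char_poly_factorized[OF T] by blast
  then obtain n_as where jnf: "jordan_nf T n_as" using jordan_nf_exists[OF T] by blast
  have "char_poly T = (\<Prod>a\<leftarrow>diag_mat T. [:- a, 1:])"
    by (rule char_poly_upper_triangular[OF T ut])
  also have "\<dots> = prod_list (map (\<lambda>i. [:- T $$ (i, i), 1:]) [0..<M])"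
    using T by (simp add: diag_mat_def o_def)
  also have "\<dots> = ?f"
    using prod.distinct_set_conv_list[of "[0..<M]" "\<lambda>i. [:- T $$ (i, i), 1:]"] by (simp add: atLeast0LessThan)
  finally have f: "?f = (\<Prod>(n, a)\<leftarrow>n_as. [:- a, 1:] ^ n)"
    using jordan_nf_char_poly[OF jnf] by simp
  have one: "fst x = 1" if x: "x \<in> set n_as" for x
  proof (rule ccontr)
    obtain n a where na: "x = (n, a)" by (cases x)
    assume "fst x \<noteq> 1"
    moreover have "0 \<notin> fst ` set n_as" using jnf by (simp add: jordan_nf_def)
    then have "fst x \<noteq> 0" using x by (metis imageI)
    ultimately have n: "2 \<le> n" using na by simp
    obtain xs ys where n_as: "n_as = xs @ x # ys" using x split_list by metis
    have "[:- a, 1:] ^ 2 dvd [:- a, 1:] ^ n" using n by (rule le_imp_power_dvd)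
    also have "\<dots> dvd ?f" unfolding f n_as by (simp add: na)
    finally obtain q where "?f = [:- a, 1:] ^ 2 * q" unfolding dvd_def by blast
    then have q: "?f = [:- a, 1:] * ([:- a, 1:] * q)" by (simp only: power2_eq_square mult.assoc)
    have "poly ?f a = 0" unfolding q by simp
    then obtain i where i: "i < M" "T $$ (i, i) = a" by (auto simp: poly_prod)
    have "?f = [:- a, 1:] * (\<Prod>j\<in>{..<M} - {i}. [:- T $$ (j, j), 1:])"
      using i by (subst prod.remove[of _ i]) auto
    then have "[:- a, 1:] * (\<Prod>j\<in>{..<M} - {i}. [:- T $$ (j, j), 1:]) = [:- a, 1:] * ([:- a, 1:] * q)"
      using q by (simp only:)
    then have "(\<Prod>j\<in>{..<M} - {i}. [:- T $$ (j, j), 1:]) = [:- a, 1:] * q"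
      by (subst (asm) mult_left_cancel) auto
    then have "poly (\<Prod>j\<in>{..<M} - {i}. [:- T $$ (j, j), 1:]) a = poly ([:- a, 1:] * q) a" by (simp only:)
    then have "(\<Prod>j\<in>{..<M} - {i}. a - T $$ (j, j)) = 0" by (simp add: poly_prod)
    then obtain j where "j < M" "j \<noteq> i" "T $$ (j, j) = a" by auto
    then show False using inj_onD[OF inj, of i j] i by simp
  qed
  have sim: "similar_mat T (jordan_matrix n_as)" using jnf by (simp add: jordan_nf_def)
  then obtain P Q where "similar_mat_wit T (jordan_matrix n_as) P Q" by (auto simp: similar_mat_def)
  then have PQ: "inv_pair M P Q" "T = P * jordan_matrix n_as * Q" "jordan_matrix n_as \<in> carrier_mat M M"
    using T by (auto simp: similar_mat_wit_def Let_def inv_pair_def)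
  have "jordan_matrix n_as = mat_diag (length n_as) (\<lambda>i. snd (n_as ! i))"
    using one by (intro jordan_matrix_ones) blast
  moreover from this have "length n_as = M" using PQ(3) by (auto simp: mat_diag_def)
  ultimately show ?thesis using PQ by metis
qed

lemma triangularizable:
  fixes X :: "complex mat"
  assumes X: "X \<in> carrier_mat M M"
  shows "\<exists>P Q T. inv_pair M P Q \<and> T \<in> carrier_mat M M \<and> upper_triangular T \<and> X = P * T * Q"
proof -
  obtain as where "char_poly X = (\<Prod>a\<leftarrow>as. [:- a, 1:])" using char_poly_factorized[OF X] by blast
  from schur_decomposition_exists[OF X this]
  obtain T where T: "T \<in> carrier_mat M M" "upper_triangular T" "similar_mat X T" by blast
  then obtain P Q where "similar_mat_wit X T P Q" by (auto simp: similar_mat_def)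
  then have "inv_pair M P Q" "X = P * T * Q"
    using X by (auto simp: similar_mat_wit_def Let_def inv_pair_def)
  then show ?thesis using T by blast
qed

text \<open>Equivariance transports zeros along conjugation; the second argument
  \<open>A * P\<close> is chosen so that \<open>A * P * Q = A\<close>.\<close>

lemma \<H>_conj_zero:
  assumes f: "f \<in> \<H> M p l" and PQ: "inv_pair M P Q" and D: "D \<in> carrier_mat M M"
    and A: "A \<in> carrier_mat p M" and z: "f (D, A * P) = 0"
  shows "f (P * D * Q, A) = 0"
proof -
  have c: "P \<in> carrier_mat M M" "Q \<in> carrier_mat M M" "P * Q = 1\<^sub>m M" using PQ by (auto simp: inv_pair_def)
  have "A * P * Q = A * (P * Q)" using c(1,2) A by (rule assoc_mult_mat[rotated])
  then have "A * P * Q = A" unfolding c(3) using A by simp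
  then have "f (P * D * Q, A) = f (P * D * Q, (A * P) * Q)" by simp
  also have "\<dots> = 0"
    using \<H>_equivariant[OF f PQ D, of "A * P"] A c(1) z by simp
  finally show ?thesis .
qed

lemma affine_poly_funs: "(\<lambda>t. a + t * b) \<in> poly_funs UNIV {\<lambda>t :: complex. t}"
proof -
  have "restrict (\<lambda>t. t) UNIV \<in> poly_funs UNIV {\<lambda>t :: complex. t}" by (rule poly_funs.coord) simp
  moreover have "restrict (\<lambda>t. c) UNIV \<in> poly_funs UNIV {\<lambda>t :: complex. t}" for c by (rule poly_funs.const)
  ultimately have "(\<lambda>t\<in>UNIV. a + t * b) \<in> poly_funs UNIV {\<lambda>t :: complex. t}"
    by (intro poly_funs_add' poly_funs_mult')
  then show ?thesis by simp
qed

text \<open>On a line through a triangular matrix along which the diagonal entries move apart, all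
  but finitely many points are diagonalizable. The function is polynomial on this line, so it also
  vanishes at the given matrix, and every complex matrix is conjugate to a triangular one.\<close>

lemma \<H>_vanish:
  assumes f: "f \<in> \<H> M p l" and diag: "\<And>z A. A \<in> carrier_mat p M \<Longrightarrow> f (mat_diag M z, A) = 0"
    and X: "X \<in> carrier_mat M M" and A: "A \<in> carrier_mat p M"
  shows "f (X, A) = 0"
proof -
  have tri: "f (T, B) = 0" if T: "T \<in> carrier_mat M M" and ut: "upper_triangular T" and B: "B \<in> carrier_mat p M" for T B
  proof -
    \<comment> \<open>The numbers \<open>i\<close> added on the diagonal are pairwise distinct, so
      any two diagonal entries coincide for exactly one \<open>t\<close>.\<close>
    define \<phi> where "\<phi> t = (mat M M (\<lambda>(i, j). T $$ (i, j) + t * (if i = j then of_nat i else 0)), B)" for t :: complex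
    have "(\<lambda>t\<in>UNIV. f (\<phi> t)) \<in> poly_funs UNIV {\<lambda>t :: complex. t}"
    proof (rule mat_polys_compose[OF \<H>_mat_polys[OF f]])
      fix i j assume "i < M" "j < M"
      then have "(\<lambda>t\<in>UNIV. fst (\<phi> t) $$ (i, j)) = (\<lambda>t. T $$ (i, j) + t * (if i = j then of_nat i else 0))"
        by (simp add: \<phi>_def fun_eq_iff)
      then show "(\<lambda>t\<in>UNIV. fst (\<phi> t) $$ (i, j)) \<in> poly_funs UNIV {\<lambda>t :: complex. t}"
        by (simp only: affine_poly_funs)
    next
      fix i j
      show "(\<lambda>t\<in>UNIV. snd (\<phi> t) $$ (i, j)) \<in> poly_funs UNIV {\<lambda>t :: complex. t}"
        unfolding \<phi>_def snd_conv by (rule poly_funs.const)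
    qed (use B in \<open>simp add: \<phi>_def mat_pairs_def\<close>)
    then have poly: "(\<lambda>t. f (\<phi> t)) \<in> poly_funs UNIV {\<lambda>t :: complex. t}" by simp
    have "finite {t. f (\<phi> t) \<noteq> 0}"
    proof (rule finite_subset)
      show "finite (\<Union>i<M. \<Union>j\<in>{..<M} - {i}. {(T $$ (j, j) - T $$ (i, i)) / (of_nat i - of_nat j)})"
        by (intro finite_UN_I) auto
      show "{t. f (\<phi> t) \<noteq> 0} \<subseteq> (\<Union>i<M. \<Union>j\<in>{..<M} - {i}. {(T $$ (j, j) - T $$ (i, i)) / (of_nat i - of_nat j)})"
      proof
        fix t assume "t \<in> {t. f (\<phi> t) \<noteq> 0}"
        then have nz: "f (\<phi> t) \<noteq> 0" by simp
        let ?T = "fst (\<phi> t)"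
        have Tc: "?T \<in> carrier_mat M M" by (simp add: \<phi>_def)
        have Tut: "upper_triangular ?T"
          using ut T by (auto simp: upper_triangular_def \<phi>_def)
        have "\<not> inj_on (\<lambda>i. ?T $$ (i, i)) {..<M}"
        proof
          assume "inj_on (\<lambda>i. ?T $$ (i, i)) {..<M}"
          from diagonalizable_of_distinct_eigenvalues[OF Tc Tut this]
          obtain P Q d where PQ: "inv_pair M P Q" and eq: "?T = P * mat_diag M d * Q" by blast
          have "B * P \<in> carrier_mat p M" using PQ B by (auto simp: inv_pair_def)
          then have "f (P * mat_diag M d * Q, B) = 0"
            using f PQ B diag by (intro \<H>_conj_zero[of f M p l]) auto
          then have "f (?T, B) = 0" unfolding eq .
          then show False using nz by (simp add: \<phi>_def)
        qed
        then obtain i j where ij: "i < M" "j < M" "i \<noteq> j" "?T $$ (i, i) = ?T $$ (j, j)"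
          by (auto simp: inj_on_def)
        then have "T $$ (i, i) + t * of_nat i = T $$ (j, j) + t * of_nat j" by (simp add: \<phi>_def)
        moreover have "of_nat i - of_nat j \<noteq> (0 :: complex)" using ij by simp
        ultimately have "t = (T $$ (j, j) - T $$ (i, i)) / (of_nat i - of_nat j)"
          by (simp add: field_simps)
        then show "t \<in> (\<Union>i<M. \<Union>j\<in>{..<M} - {i}. {(T $$ (j, j) - T $$ (i, i)) / (of_nat i - of_nat j)})"
          using ij by blast
      qed
    qed
    then have "f (\<phi> 0) = 0" by (rule poly_funs_univariate_vanish[OF poly])
    moreover have "\<phi> 0 = (T, B)" using T by (auto simp: \<phi>_def)
    ultimately show ?thesis by simp
  qed
  obtain P Q T where PQ: "inv_pair M P Q" and T: "T \<in> carrier_mat M M" "upper_triangular T" and XT: "X = P * T * Q"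
    using triangularizable[OF X] by blast
  have "A * P \<in> carrier_mat p M" using PQ A by (auto simp: inv_pair_def)
  then show ?thesis
    unfolding XT by (intro \<H>_conj_zero[OF f PQ T(1) A] tri T)
qed

lemma \<H>_eqI:
  assumes f: "f \<in> \<H> M p l" and g: "g \<in> \<H> M p l"
    and diag: "\<And>z A. A \<in> carrier_mat p M \<Longrightarrow> f (mat_diag M z, A) = g (mat_diag M z, A)"
  shows "f = g"
proof -
  let ?h = "\<lambda>XA\<in>mat_pairs M p. f XA + (\<lambda>XA\<in>mat_pairs M p. (-1) * g XA) XA"
  have h: "?h \<in> \<H> M p l" by (intro \<H>_add \<H>_smult f g)
  have "f XA = g XA" if mem: "XA \<in> mat_pairs M p" for XA
  proof -
    obtain X A where XA: "XA = (X, A)" "X \<in> carrier_mat M M" "A \<in> carrier_mat p M"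
      using mem unfolding mat_pairs_def by blast
    have "?h (X, A) = 0"
      by (rule \<H>_vanish[OF h _ XA(2,3)]) (simp add: mat_pairs_def diag)
    then show ?thesis using mem XA(1) by simp
  qed
  then have "restrict f (mat_pairs M p) = restrict g (mat_pairs M p)" by (rule restrict_ext)
  then show ?thesis using f g by (simp only: \<H>_ext)
qed

subsection \<open>Derivatives in the entries of \<open>A\<close>\<close>

definition set_entry :: "nat \<Rightarrow> nat \<Rightarrow> complex mat \<Rightarrow> nat \<Rightarrow> nat \<Rightarrow> complex \<Rightarrow> complex mat" where
  "set_entry p M A b j t = mat p M (\<lambda>ai. if ai = (b, j) then t else A $$ ai)"

lemma set_entry_carrier [simp]: "set_entry p M A b j t \<in> carrier_mat p M"
  by (simp add: set_entry_def)

lemma set_entry_index: "a < p \<Longrightarrow> i < M \<Longrightarrow> set_entry p M A b j t $$ (a, i) = (if a = b \<and> i = j then t else A $$ (a, i))"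
  by (simp add: set_entry_def)

lemma set_entry_self: "A \<in> carrier_mat p M \<Longrightarrow> b < p \<Longrightarrow> j < M \<Longrightarrow> set_entry p M A b j (A $$ (b, j)) = A"
  by (intro eq_matI) (auto simp: set_entry_def)

lemma partial_A_eq:
  "X \<in> carrier_mat M M \<Longrightarrow> A \<in> carrier_mat p M \<Longrightarrow>
   partial_A M p b j f (X, A) = deriv (\<lambda>t. f (X, set_entry p M A b j t)) (A $$ (b, j))"
  by (simp add: partial_A_def set_entry_def mat_pairs_def)

lemma partial_A_unique:
  "X \<in> carrier_mat M M \<Longrightarrow> A \<in> carrier_mat p M \<Longrightarrow>
   ((\<lambda>t. f (X, set_entry p M A b j t)) has_field_derivative D) (at (A $$ (b, j))) \<Longrightarrow>
   partial_A M p b j f (X, A) = D"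
  by (simp add: partial_A_eq DERIV_imp_deriv)

text \<open>\<open>deriv\<close> is total, so \<open>partial_A\<close> means a derivative only once
  differentiability is known; here the function is a polynomial in the single entry.\<close>

lemma partial_A_DERIV:
  assumes f: "f \<in> mat_polys M p" and X: "X \<in> carrier_mat M M" and A: "A \<in> carrier_mat p M"
  shows "((\<lambda>t. f (X, set_entry p M A b j t)) has_field_derivative partial_A M p b j f (X, A)) (at (A $$ (b, j)))"
proof -
  have "(\<lambda>t\<in>UNIV. f (X, set_entry p M A b j t)) \<in> poly_funs UNIV {\<lambda>t :: complex. t}"
  proof (rule mat_polys_compose[OF f])
    fix i l assume il: "i < p" "l < M"
    have id: "restrict (\<lambda>t. t) UNIV \<in> poly_funs UNIV {\<lambda>t :: complex. t}" by (rule poly_funs.coord) simp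
    show "(\<lambda>t\<in>UNIV. snd (X, set_entry p M A b j t) $$ (i, l)) \<in> poly_funs UNIV {\<lambda>t :: complex. t}"
    proof (cases "i = b \<and> l = j")
      case True
      then have "(\<lambda>t\<in>UNIV. snd (X, set_entry p M A b j t) $$ (i, l)) = restrict (\<lambda>t. t) UNIV"
        using set_entry_index[OF il] by simp
      then show ?thesis using id by (simp only:)
    next
      case False
      then have "(\<lambda>t\<in>UNIV. snd (X, set_entry p M A b j t) $$ (i, l)) = (\<lambda>t\<in>UNIV. A $$ (i, l))"
        using set_entry_index[OF il] by auto
      then show ?thesis by (simp only: poly_funs.const)
    qed
  next
    fix i l
    show "(\<lambda>t\<in>UNIV. fst (X, set_entry p M A b j t) $$ (i, l)) \<in> poly_funs UNIV {\<lambda>t :: complex. t}"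
      unfolding fst_conv by (rule poly_funs.const)
  qed (use X in \<open>simp add: mat_pairs_def\<close>)
  then obtain q where q: "\<And>t. f (X, set_entry p M A b j t) = poly q t"
    using poly_funs_univariate[of "\<lambda>t. f (X, set_entry p M A b j t)"] by auto
  then have "((\<lambda>t. f (X, set_entry p M A b j t)) has_field_derivative poly (pderiv q) (A $$ (b, j))) (at (A $$ (b, j)))"
    by (simp add: poly_DERIV)
  then show ?thesis using partial_A_unique[OF X A] by metis
qed

lemma partial_A_const:
  "X \<in> carrier_mat M M \<Longrightarrow> A \<in> carrier_mat p M \<Longrightarrow> partial_A M p b j (\<lambda>x\<in>mat_pairs M p. c) (X, A) = 0"
  by (rule partial_A_unique) (simp_all add: mat_pairs_def)

lemma partial_A_X:
  "X \<in> carrier_mat M M \<Longrightarrow> A \<in> carrier_mat p M \<Longrightarrow>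
   partial_A M p b j (\<lambda>x\<in>mat_pairs M p. (\<lambda>(X, A). c X) x) (X, A) = 0"
  by (rule partial_A_unique) (simp_all add: mat_pairs_def)

lemma partial_A_A:
  assumes "X \<in> carrier_mat M M" "A \<in> carrier_mat p M" "a < p" "l < M"
  shows "partial_A M p b j (\<lambda>x\<in>mat_pairs M p. (\<lambda>(X, A). A $$ (a, l)) x) (X, A) = (if a = b \<and> l = j then 1 else 0)"
proof (rule partial_A_unique[OF assms(1,2)])
  have "(\<lambda>t. (\<lambda>x\<in>mat_pairs M p. (\<lambda>(X, A). A $$ (a, l)) x) (X, set_entry p M A b j t)) =
    (\<lambda>t. if a = b \<and> l = j then t else A $$ (a, l))"
    using assms by (simp add: mat_pairs_def set_entry_index)
  then show "((\<lambda>t. (\<lambda>x\<in>mat_pairs M p. (\<lambda>(X, A). A $$ (a, l)) x) (X, set_entry p M A b j t))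
     has_field_derivative (if a = b \<and> l = j then 1 else 0)) (at (A $$ (b, j)))"
    by (cases "a = b \<and> l = j") auto
qed

lemma partial_A_add:
  assumes f: "f \<in> mat_polys M p" and g: "g \<in> mat_polys M p" and X: "X \<in> carrier_mat M M" and A: "A \<in> carrier_mat p M"
  shows "partial_A M p b j (\<lambda>x\<in>mat_pairs M p. f x + g x) (X, A) = partial_A M p b j f (X, A) + partial_A M p b j g (X, A)"
proof (rule partial_A_unique[OF X A])
  have "(\<lambda>t. (\<lambda>x\<in>mat_pairs M p. f x + g x) (X, set_entry p M A b j t)) =
    (\<lambda>t. f (X, set_entry p M A b j t) + g (X, set_entry p M A b j t))"
    using X by (simp add: mat_pairs_def)
  then show "((\<lambda>t. (\<lambda>x\<in>mat_pairs M p. f x + g x) (X, set_entry p M A b j t)) has_field_derivative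
     partial_A M p b j f (X, A) + partial_A M p b j g (X, A)) (at (A $$ (b, j)))"
    by (simp only: DERIV_add[OF partial_A_DERIV[OF f X A] partial_A_DERIV[OF g X A]])
qed

lemma partial_A_mult:
  assumes f: "f \<in> mat_polys M p" and g: "g \<in> mat_polys M p" and X: "X \<in> carrier_mat M M" and A: "A \<in> carrier_mat p M"
    and b: "b < p" and j: "j < M"
  shows "partial_A M p b j (\<lambda>x\<in>mat_pairs M p. f x * g x) (X, A) =
    partial_A M p b j f (X, A) * g (X, A) + partial_A M p b j g (X, A) * f (X, A)"
proof (rule partial_A_unique[OF X A])
  have "(\<lambda>t. (\<lambda>x\<in>mat_pairs M p. f x * g x) (X, set_entry p M A b j t)) =
    (\<lambda>t. f (X, set_entry p M A b j t) * g (X, set_entry p M A b j t))"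
    using X by (simp add: mat_pairs_def)
  then show "((\<lambda>t. (\<lambda>x\<in>mat_pairs M p. f x * g x) (X, set_entry p M A b j t)) has_field_derivative
     partial_A M p b j f (X, A) * g (X, A) + partial_A M p b j g (X, A) * f (X, A)) (at (A $$ (b, j)))"
    using DERIV_mult[OF partial_A_DERIV[OF f X A, of b j] partial_A_DERIV[OF g X A, of b j]]
    by (simp only: set_entry_self[OF A b j])
qed

lemma partial_A_ext:
  assumes "\<And>X A. X \<in> carrier_mat M M \<Longrightarrow> A \<in> carrier_mat p M \<Longrightarrow> partial_A M p b j f (X, A) = g (X, A)"
  shows "partial_A M p b j f = restrict g (mat_pairs M p)"
proof
  fix XA show "partial_A M p b j f XA = restrict g (mat_pairs M p) XA"
    using assms[of "fst XA" "snd XA"] by (cases "XA \<in> mat_pairs M p") (auto simp: mat_pairs_iff partial_A_def)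
qed

lemma partial_A_mat_polys:
  assumes "f \<in> mat_polys M p" and b: "b < p" and j: "j < M"
  shows "partial_A M p b j f \<in> mat_polys M p"
  using assms(1) unfolding mat_polys_def
proof (induction rule: poly_funs.induct)
  case (const c)
  have "partial_A M p b j (\<lambda>x\<in>mat_pairs M p. c) = (\<lambda>x\<in>mat_pairs M p. 0)"
    by (rule partial_A_ext) (rule partial_A_const)
  then show ?case by (simp only: poly_funs.const)
next
  case (coord g)
  then consider i l where "i < M" "l < M" "g = (\<lambda>(X, A). X $$ (i, l))" | a l where "a < p" "l < M" "g = (\<lambda>(X, A). A $$ (a, l))"
    by blast
  then show ?case
  proof cases
    case 1
    have "partial_A M p b j (\<lambda>x\<in>mat_pairs M p. g x) = (\<lambda>x\<in>mat_pairs M p. 0)"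
      unfolding 1(3) by (rule partial_A_ext) (rule partial_A_X)
    then show ?thesis by (simp only: poly_funs.const)
  next
    case 2
    have "partial_A M p b j (\<lambda>x\<in>mat_pairs M p. g x) = (\<lambda>x\<in>mat_pairs M p. if a = b \<and> l = j then 1 else 0)"
      unfolding 2(3) by (rule partial_A_ext) (rule partial_A_A[OF _ _ 2(1,2)])
    then show ?thesis by (simp only: poly_funs.const)
  qed
next
  case (add f g)
  have "partial_A M p b j (\<lambda>x\<in>mat_pairs M p. f x + g x) =
    (\<lambda>x\<in>mat_pairs M p. partial_A M p b j f x + partial_A M p b j g x)"
    by (rule partial_A_ext) (use add in \<open>simp add: partial_A_add mat_polys_def\<close>)
  then show ?case using poly_funs.add add.IH by (simp only:)
next
  case (mult f g)
  have "partial_A M p b j (\<lambda>x\<in>mat_pairs M p. f x * g x) =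
    (\<lambda>x\<in>mat_pairs M p. partial_A M p b j f x * g x + partial_A M p b j g x * f x)"
    by (rule partial_A_ext) (use mult b j in \<open>simp add: partial_A_mult mat_polys_def\<close>)
  moreover have "(\<lambda>x\<in>mat_pairs M p. partial_A M p b j f x * g x + partial_A M p b j g x * f x) \<in> mat_polys M p"
    using mult by (intro mat_polys_intros) (simp_all only: poly_funs_ext mat_polys_def)
  ultimately show ?case by (simp only: mat_polys_def)
qed

text \<open>The chain rule along a line, by induction on the polynomial, since both sides are
  derivations in \<open>f\<close>. It turns a first order differential operator into a derivative in
  one variable.\<close>

lemma directional_DERIV:
  assumes f: "f \<in> mat_polys M p" and X: "X \<in> carrier_mat M M" and A: "A \<in> carrier_mat p M"
  shows "((\<lambda>t. f (X, mat p M (\<lambda>(b, j). A $$ (b, j) + t * \<delta> b j))) has_field_derivative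
    (\<Sum>b<p. \<Sum>j<M. \<delta> b j * partial_A M p b j f (X, A))) (at 0)"
  using f unfolding mat_polys_def
proof (induction rule: poly_funs.induct)
  case (const c)
  have "(\<lambda>t. (\<lambda>x\<in>mat_pairs M p. c) (X, mat p M (\<lambda>(b, j). A $$ (b, j) + t * \<delta> b j))) = (\<lambda>t. c)"
    using X by (simp add: mat_pairs_def)
  then show ?case unfolding partial_A_const[OF X A] by simp
next
  case (coord g)
  let ?B = "\<lambda>t. mat p M (\<lambda>(b, j). A $$ (b, j) + t * \<delta> b j)"
  from coord consider i l where "i < M" "l < M" "g = (\<lambda>(X, A). X $$ (i, l))" | a l where "a < p" "l < M" "g = (\<lambda>(X, A). A $$ (a, l))"
    by blast
  then show ?case
  proof cases
    case 1
    have "(\<lambda>t. (\<lambda>x\<in>mat_pairs M p. g x) (X, ?B t)) = (\<lambda>t. X $$ (i, l))"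
      using X by (simp add: mat_pairs_def 1(3))
    then show ?thesis unfolding 1(3) partial_A_X[OF X A] by simp
  next
    case 2
    have "(\<lambda>t. (\<lambda>x\<in>mat_pairs M p. g x) (X, ?B t)) = (\<lambda>t. A $$ (a, l) + t * \<delta> a l)"
      using X 2(1,2) by (simp add: mat_pairs_def 2(3))
    moreover have "(\<Sum>b<p. \<Sum>j<M. \<delta> b j * partial_A M p b j (\<lambda>x\<in>mat_pairs M p. g x) (X, A)) = \<delta> a l"
    proof -
      have "(\<Sum>b<p. \<Sum>j<M. \<delta> b j * partial_A M p b j (\<lambda>x\<in>mat_pairs M p. g x) (X, A)) =
        (\<Sum>b<p. \<Sum>j<M. if a = b then (if l = j then \<delta> b j else 0) else 0)"
        unfolding 2(3) partial_A_A[OF X A 2(1,2)] by (intro sum.cong refl) auto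
      also have "\<dots> = (\<Sum>b<p. if a = b then (\<Sum>j<M. if l = j then \<delta> b j else 0) else 0)"
        by (intro sum.cong refl) auto
      also have "\<dots> = \<delta> a l" using 2(1,2) by (simp add: sum.delta')
      finally show ?thesis .
    qed
    moreover have "((\<lambda>t. A $$ (a, l) + t * \<delta> a l) has_field_derivative \<delta> a l) (at 0)"
      by (auto intro!: derivative_eq_intros)
    ultimately show ?thesis by (simp only:)
  qed
next
  case (add f g)
  let ?B = "\<lambda>t. mat p M (\<lambda>(b, j). A $$ (b, j) + t * \<delta> b j)"
  have "(\<lambda>t. (\<lambda>x\<in>mat_pairs M p. f x + g x) (X, ?B t)) = (\<lambda>t. f (X, ?B t) + g (X, ?B t))"
    using X by (simp add: mat_pairs_def)
  moreover have "(\<Sum>b<p. \<Sum>j<M. \<delta> b j * partial_A M p b j (\<lambda>x\<in>mat_pairs M p. f x + g x) (X, A)) =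
    (\<Sum>b<p. \<Sum>j<M. \<delta> b j * partial_A M p b j f (X, A)) + (\<Sum>b<p. \<Sum>j<M. \<delta> b j * partial_A M p b j g (X, A))"
    using add.hyps X A by (simp add: partial_A_add mat_polys_def distrib_left sum.distrib)
  ultimately show ?case using DERIV_add[OF add.IH] by (simp only:)
next
  case (mult f g)
  let ?B = "\<lambda>t. mat p M (\<lambda>(b, j). A $$ (b, j) + t * \<delta> b j)"
  have B0: "?B 0 = A" using A by (intro eq_matI) auto
  have "(\<lambda>t. (\<lambda>x\<in>mat_pairs M p. f x * g x) (X, ?B t)) = (\<lambda>t. f (X, ?B t) * g (X, ?B t))"
    using X by (simp add: mat_pairs_def)
  moreover have "(\<Sum>b<p. \<Sum>j<M. \<delta> b j * partial_A M p b j (\<lambda>x\<in>mat_pairs M p. f x * g x) (X, A)) =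
    (\<Sum>b<p. \<Sum>j<M. \<delta> b j * partial_A M p b j f (X, A)) * g (X, A) + (\<Sum>b<p. \<Sum>j<M. \<delta> b j * partial_A M p b j g (X, A)) * f (X, A)"
    using mult.hyps X A by (simp add: partial_A_mult mat_polys_def distrib_left sum.distrib sum_distrib_right mult.assoc)
  ultimately show ?case using DERIV_mult[OF mult.IH] by (simp only: B0)
qed

subsection \<open>The current algebra action\<close>

text \<open>The vector field on the space of matrices \<open>A\<close> by which \<open>Y\<close>
  acts: the coefficient of the partial derivative in the entry \<open>(b, j)\<close>.\<close>

definition gl_dir :: "nat \<Rightarrow> nat \<Rightarrow> complex poly mat \<Rightarrow> complex mat \<Rightarrow> complex mat \<Rightarrow> nat \<Rightarrow> nat \<Rightarrow> complex" where
  "gl_dir M p Y X A b j = (\<Sum>a<p. \<Sum>m\<le>degree (Y $$ (a, b)). coeff (Y $$ (a, b)) m * (\<Sum>i<M. A $$ (a, i) * (X ^\<^sub>m m) $$ (i, j)))"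

lemma gl_act_eq:
  "gl_act M p Y f = (\<lambda>XA\<in>mat_pairs M p. \<Sum>b<p. \<Sum>j<M. gl_dir M p Y (fst XA) (snd XA) b j * partial_A M p b j f XA)"
  unfolding gl_act_def case_prod_unfold
proof (rule restrict_ext)
  fix XA assume "XA \<in> mat_pairs M p"
  let ?X = "fst XA" and ?A = "snd XA"
  have "(\<Sum>a<p. \<Sum>b<p. \<Sum>m\<le>degree (Y $$ (a, b)). coeff (Y $$ (a, b)) m *
       (\<Sum>i<M. \<Sum>j<M. ?A $$ (a, i) * (?X ^\<^sub>m m) $$ (i, j) * partial_A M p b j f (?X, ?A))) =
     (\<Sum>b<p. \<Sum>a<p. \<Sum>m\<le>degree (Y $$ (a, b)). \<Sum>j<M. coeff (Y $$ (a, b)) m *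
       (\<Sum>i<M. ?A $$ (a, i) * (?X ^\<^sub>m m) $$ (i, j)) * partial_A M p b j f XA)"
    by (subst sum.swap, intro sum.cong refl, subst sum.swap) (simp add: sum_distrib_left sum_distrib_right mult.assoc)
  also have "\<dots> = (\<Sum>b<p. \<Sum>j<M. gl_dir M p Y ?X ?A b j * partial_A M p b j f XA)"
  proof (rule sum.cong[OF refl])
    fix b
    have "(\<Sum>a<p. \<Sum>m\<le>degree (Y $$ (a, b)). \<Sum>j<M. coeff (Y $$ (a, b)) m *
       (\<Sum>i<M. ?A $$ (a, i) * (?X ^\<^sub>m m) $$ (i, j)) * partial_A M p b j f XA) =
      (\<Sum>a<p. \<Sum>j<M. \<Sum>m\<le>degree (Y $$ (a, b)). coeff (Y $$ (a, b)) m *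
       (\<Sum>i<M. ?A $$ (a, i) * (?X ^\<^sub>m m) $$ (i, j)) * partial_A M p b j f XA)"
      by (rule sum.cong[OF refl], rule sum.swap)
    also have "\<dots> = (\<Sum>j<M. gl_dir M p Y ?X ?A b j * partial_A M p b j f XA)"
      by (subst sum.swap) (simp add: gl_dir_def sum_distrib_right)
    finally show "(\<Sum>a<p. \<Sum>m\<le>degree (Y $$ (a, b)). \<Sum>j<M. coeff (Y $$ (a, b)) m *
       (\<Sum>i<M. ?A $$ (a, i) * (?X ^\<^sub>m m) $$ (i, j)) * partial_A M p b j f XA) =
      (\<Sum>j<M. gl_dir M p Y ?X ?A b j * partial_A M p b j f XA)" .
  qed
  finally show "(\<Sum>a<p. \<Sum>b<p. \<Sum>m\<le>degree (Y $$ (a, b)). coeff (Y $$ (a, b)) m *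
       (\<Sum>i<M. \<Sum>j<M. ?A $$ (a, i) * (?X ^\<^sub>m m) $$ (i, j) * partial_A M p b j f (?X, ?A))) =
     (\<Sum>b<p. \<Sum>j<M. gl_dir M p Y ?X ?A b j * partial_A M p b j f XA)" .
qed

text \<open>The action becomes a derivative along a line in \<open>A\<close>. Later identities for
  \<open>gl_act\<close> follow by rewriting the function on this line and using uniqueness of
  derivatives.\<close>

lemma gl_act_DERIV:
  assumes f: "f \<in> mat_polys M p" and X: "X \<in> carrier_mat M M" and A: "A \<in> carrier_mat p M"
  shows "((\<lambda>t. f (X, mat p M (\<lambda>(b, j). A $$ (b, j) + t * gl_dir M p Y X A b j))) has_field_derivative
    gl_act M p Y f (X, A)) (at 0)"
  using directional_DERIV[OF assms, of "gl_dir M p Y X A"] X A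
  by (simp add: gl_act_eq mat_pairs_def)

lemma mult_mat_entry_sum:
  assumes "A \<in> carrier_mat p m" "B \<in> carrier_mat m q" "a < p" "j < q"
  shows "(A * B) $$ (a, j) = (\<Sum>i<m. A $$ (a, i) * B $$ (i, j))"
  using assms by (simp add: scalar_prod_def atLeast0LessThan)

lemma mult_pow_conj:
  assumes gh: "inv_pair M g h" and X: "X \<in> carrier_mat M M" and A: "A \<in> carrier_mat p M"
  shows "(A * h) * (g * X * h) ^\<^sub>m m = (A * X ^\<^sub>m m) * h"
proof -
  have c: "g \<in> carrier_mat M M" "h \<in> carrier_mat M M" "h * g = 1\<^sub>m M" using gh by (auto simp: inv_pair_def)
  have Xm: "X ^\<^sub>m m \<in> carrier_mat M M" by (rule pow_carrier[OF X])
  have "(A * h) * (g * X ^\<^sub>m m * h) = A * (h * (g * (X ^\<^sub>m m * h)))"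
    using c A Xm by (simp add: assoc_mult_mat[of _ _ M _ M _ M] assoc_mult_mat[of A p M h M _ M])
  also have "h * (g * (X ^\<^sub>m m * h)) = (h * g) * (X ^\<^sub>m m * h)"
    by (rule assoc_mult_mat[symmetric, of h M M g M _ M]) (use c Xm in auto)
  also have "(h * g) * (X ^\<^sub>m m * h) = X ^\<^sub>m m * h"
    unfolding c(3) by (rule left_mult_one_mat[OF mult_carrier_mat[OF Xm c(2)]])
  also have "A * (X ^\<^sub>m m * h) = (A * X ^\<^sub>m m) * h"
    using c A Xm by (simp add: assoc_mult_mat[of A p M _ M _ M])
  finally show ?thesis unfolding inv_pair_pow[OF gh X] .
qed

text \<open>\<open>(A * h) * (g * X * h) ^\<^sub>m m\<close> equals
  \<open>(A * X ^\<^sub>m m) * h\<close>, so the direction transforms by right multiplication with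
  \<open>h\<close>, just as \<open>A\<close> does.\<close>

lemma gl_dir_conj:
  assumes gh: "inv_pair M g h" and X: "X \<in> carrier_mat M M" and A: "A \<in> carrier_mat p M"
    and b: "b < p" and j: "j < M"
  shows "gl_dir M p Y (g * X * h) (A * h) b j = (\<Sum>l<M. gl_dir M p Y X A b l * h $$ (l, j))"
proof -
  have c: "g \<in> carrier_mat M M" "h \<in> carrier_mat M M" "h * g = 1\<^sub>m M" using gh by (auto simp: inv_pair_def)
  have main: "(\<Sum>i<M. (A * h) $$ (a, i) * ((g * X * h) ^\<^sub>m m) $$ (i, j)) =
      (\<Sum>l<M. (\<Sum>i<M. A $$ (a, i) * (X ^\<^sub>m m) $$ (i, l)) * h $$ (l, j))" if a: "a < p" for a m
  proof -
    have Xm: "X ^\<^sub>m m \<in> carrier_mat M M" by (rule pow_carrier[OF X])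
    have "g * X * h \<in> carrier_mat M M" using c X by simp
    then have "(\<Sum>i<M. (A * h) $$ (a, i) * ((g * X * h) ^\<^sub>m m) $$ (i, j)) = ((A * h) * (g * X * h) ^\<^sub>m m) $$ (a, j)"
      by (rule mult_mat_entry_sum[OF mult_carrier_mat[OF A c(2)] pow_carrier a j, symmetric])
    also have "\<dots> = ((A * X ^\<^sub>m m) * h) $$ (a, j)" by (simp only: mult_pow_conj[OF gh X A])
    also have "\<dots> = (\<Sum>l<M. (A * X ^\<^sub>m m) $$ (a, l) * h $$ (l, j))"
      using c A Xm a j by (subst mult_mat_entry_sum[of _ p M _ M]) auto
    also have "\<dots> = (\<Sum>l<M. (\<Sum>i<M. A $$ (a, i) * (X ^\<^sub>m m) $$ (i, l)) * h $$ (l, j))"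
      using A Xm a by (intro sum.cong refl) (subst mult_mat_entry_sum[of _ p M _ M], auto)
    finally show ?thesis .
  qed
  have "gl_dir M p Y (g * X * h) (A * h) b j = (\<Sum>a<p. \<Sum>m\<le>degree (Y $$ (a, b)). coeff (Y $$ (a, b)) m *
    (\<Sum>l<M. (\<Sum>i<M. A $$ (a, i) * (X ^\<^sub>m m) $$ (i, l)) * h $$ (l, j)))"
    unfolding gl_dir_def by (intro sum.cong refl) (simp add: main)
  also have "\<dots> = (\<Sum>a<p. \<Sum>m\<le>degree (Y $$ (a, b)). \<Sum>l<M. coeff (Y $$ (a, b)) m *
    (\<Sum>i<M. A $$ (a, i) * (X ^\<^sub>m m) $$ (i, l)) * h $$ (l, j))"
    by (intro sum.cong refl, subst sum_distrib_left) (simp only: mult.assoc)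
  also have "\<dots> = (\<Sum>a<p. \<Sum>l<M. \<Sum>m\<le>degree (Y $$ (a, b)). coeff (Y $$ (a, b)) m *
    (\<Sum>i<M. A $$ (a, i) * (X ^\<^sub>m m) $$ (i, l)) * h $$ (l, j))"
    by (rule sum.cong[OF refl], rule sum.swap)
  also have "\<dots> = (\<Sum>l<M. gl_dir M p Y X A b l * h $$ (l, j))"
    by (subst sum.swap) (simp only: gl_dir_def sum_distrib_right)
  finally show ?thesis .
qed

text \<open>Right multiplication by \<open>h\<close> maps the line through \<open>A\<close> in the
  direction of \<open>Y\<close> to the corresponding line through \<open>A * h\<close>. Equivariance
  of \<open>f\<close> along the line can therefore be differentiated.\<close>

lemma gl_act_\<H>:
  assumes f: "f \<in> \<H> M p l"
  shows "gl_act M p Y f \<in> \<H> M p l"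
proof -
  let ?G = "\<lambda>XA. \<Sum>b<p. \<Sum>j<M. gl_dir M p Y (fst XA) (snd XA) b j * partial_A M p b j f XA"
  have fp: "f \<in> mat_polys M p" by (rule \<H>_mat_polys[OF f])
  have "restrict ?G (mat_pairs M p) \<in> \<H> M p l"
  proof (rule \<H>_restrictI)
    have "restrict (partial_A M p b j f) (mat_pairs M p) \<in> mat_polys M p" if "b < p" "j < M" for b j
      using mat_polys_ext[OF partial_A_mat_polys[OF fp that]] partial_A_mat_polys[OF fp that] by (simp only:)
    then show "restrict ?G (mat_pairs M p) \<in> mat_polys M p"
      unfolding gl_dir_def by (intro mat_polys_intros mat_polys_pow mat_polys_A) auto
    fix g h X A :: "complex mat"
    assume gh: "inv_pair M g h" and X: "X \<in> carrier_mat M M" and A: "A \<in> carrier_mat p M"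
    have c: "g \<in> carrier_mat M M" "h \<in> carrier_mat M M" using gh by (auto simp: inv_pair_def)
    have X': "g * X * h \<in> carrier_mat M M" and A': "A * h \<in> carrier_mat p M" using c X A by auto
    let ?B = "\<lambda>t. mat p M (\<lambda>(b, j). A $$ (b, j) + t * gl_dir M p Y X A b j)"
    have "mat p M (\<lambda>(b, j). (A * h) $$ (b, j) + t * gl_dir M p Y (g * X * h) (A * h) b j) = ?B t * h" for t
    proof (rule eq_matI)
      fix b j assume "b < dim_row (?B t * h)" "j < dim_col (?B t * h)"
      then have bj: "b < p" "j < M" using c by auto
      have "(?B t * h) $$ (b, j) = (\<Sum>i<M. (A $$ (b, i) + t * gl_dir M p Y X A b i) * h $$ (i, j))"
        using c bj by (subst mult_mat_entry_sum[of _ p M _ M]) auto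
      also have "\<dots> = (\<Sum>i<M. A $$ (b, i) * h $$ (i, j)) + t * (\<Sum>i<M. gl_dir M p Y X A b i * h $$ (i, j))"
        by (simp add: distrib_right sum.distrib sum_distrib_left mult.assoc)
      also have "(\<Sum>i<M. A $$ (b, i) * h $$ (i, j)) = (A * h) $$ (b, j)"
        using mult_mat_entry_sum[OF A c(2) bj] by simp
      finally show "mat p M (\<lambda>(b, j). (A * h) $$ (b, j) + t * gl_dir M p Y (g * X * h) (A * h) b j) $$ (b, j) = (?B t * h) $$ (b, j)"
        using bj by (simp add: gl_dir_conj[OF gh X A bj])
    qed (use c in auto)
    then have "(\<lambda>t. f (g * X * h, mat p M (\<lambda>(b, j). (A * h) $$ (b, j) + t * gl_dir M p Y (g * X * h) (A * h) b j))) =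
      (\<lambda>t. inverse (det g ^ l) * f (X, ?B t))"
      using \<H>_equivariant[OF f gh X] by simp
    then have "((\<lambda>t. inverse (det g ^ l) * f (X, ?B t)) has_field_derivative gl_act M p Y f (g * X * h, A * h)) (at 0)"
      using gl_act_DERIV[OF fp X' A', of Y] by simp
    moreover have "((\<lambda>t. inverse (det g ^ l) * f (X, ?B t)) has_field_derivative inverse (det g ^ l) * gl_act M p Y f (X, A)) (at 0)"
      by (rule DERIV_cmult) (rule gl_act_DERIV[OF fp X A])
    ultimately have "gl_act M p Y f (g * X * h, A * h) = inverse (det g ^ l) * gl_act M p Y f (X, A)"
      by (rule DERIV_unique)
    then show "?G (g * X * h, A * h) = inverse (det g ^ l) * ?G (X, A)"
      unfolding gl_act_eq using X A X' A' by (simp add: mat_pairs_def)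
  qed
  then show ?thesis unfolding gl_act_eq .
qed

lemma mat_diag_pow: "mat_diag M (z :: nat \<Rightarrow> complex) ^\<^sub>m m = mat_diag M (\<lambda>i. z i ^ m)"
proof -
  have d: "dim_row (mat_diag M z) = M" by (simp add: mat_diag_def)
  show ?thesis by (induction m) (simp_all add: d mult.commute)
qed

lemma mat_diag_index: "i < M \<Longrightarrow> j < M \<Longrightarrow> mat_diag M z $$ (i, j) = (if i = j then z i else 0)"
  by (auto simp: mat_diag_def)

text \<open>Powers of a diagonal matrix multiply column \<open>j\<close> by powers of
  \<open>z j\<close>, so the formal variable of the current is evaluated at
  \<open>z j\<close>.\<close>

lemma gl_dir_diag:
  assumes "j < M"
  shows "gl_dir M p Y (mat_diag M z) A b j = (\<Sum>a<p. poly (Y $$ (a, b)) (z j) * A $$ (a, j))"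
proof -
  have "(\<Sum>i<M. A $$ (a, i) * (mat_diag M z ^\<^sub>m m) $$ (i, j)) = z j ^ m * A $$ (a, j)" for a m
  proof -
    have "(\<Sum>i<M. A $$ (a, i) * (mat_diag M z ^\<^sub>m m) $$ (i, j)) = (\<Sum>i<M. if i = j then A $$ (a, i) * z i ^ m else 0)"
      using assms by (intro sum.cong refl) (auto simp: mat_diag_pow mat_diag_index)
    then show ?thesis using assms by (simp add: mult.commute)
  qed
  then show ?thesis
    by (simp add: gl_dir_def poly_altdef sum_distrib_right mult.assoc)
qed

text \<open>A function of \<open>X\<close> alone is constant on the lines that define the
  action.\<close>

lemma gl_act_mult_invariant:
  assumes f: "f \<in> mat_polys M p" and X: "X \<in> carrier_mat M M" and A: "A \<in> carrier_mat p M"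
    and c: "(\<lambda>XA\<in>mat_pairs M p. c (fst XA)) \<in> mat_polys M p"
  shows "gl_act M p Y (\<lambda>XA\<in>mat_pairs M p. c (fst XA) * f XA) (X, A) = c X * gl_act M p Y f (X, A)"
proof -
  let ?cf = "\<lambda>XA\<in>mat_pairs M p. c (fst XA) * f XA"
  have cf: "?cf \<in> mat_polys M p"
    using mat_polys_intros(3)[OF c, of f] f mat_polys_ext[OF f] by (simp only:)
  let ?B = "\<lambda>t. mat p M (\<lambda>(b, j). A $$ (b, j) + t * gl_dir M p Y X A b j)"
  have "((\<lambda>t. c X * f (X, ?B t)) has_field_derivative c X * gl_act M p Y f (X, A)) (at 0)"
    by (rule DERIV_cmult) (rule gl_act_DERIV[OF f X A])
  moreover have eq: "(\<lambda>t. c X * f (X, ?B t)) = (\<lambda>t. ?cf (X, ?B t))" using X by (simp add: mat_pairs_def)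
  ultimately have "((\<lambda>t. ?cf (X, ?B t)) has_field_derivative c X * gl_act M p Y f (X, A)) (at 0)"
    by (simp only: eq)
  then show ?thesis by (rule DERIV_unique[OF gl_act_DERIV[OF cf X A]])
qed

subsection \<open>Expansion of functions homogeneous in the columns of \<open>A\<close>\<close>

lemma sum_PiE_Suc:
  "(\<Sum>w\<in>{..<Suc L} \<rightarrow>\<^sub>E S. F w) = (\<Sum>b\<in>S. \<Sum>w\<in>{..<L} \<rightarrow>\<^sub>E S. F (w(L := b)))"
proof -
  have "(\<Sum>b\<in>S. \<Sum>w\<in>{..<L} \<rightarrow>\<^sub>E S. F (w(L := b))) = (\<Sum>(b, w)\<in>S \<times> ({..<L} \<rightarrow>\<^sub>E S). F (w(L := b)))"
    by (rule sum.cartesian_product)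
  also have "\<dots> = (\<Sum>w\<in>{..<Suc L} \<rightarrow>\<^sub>E S. F w)"
  \<comment> \<open>Members of the smaller extensional function space take the value
    \<open>undefined\<close> at \<open>L\<close>, so resetting \<open>L\<close> to
    \<open>undefined\<close> undoes the update.\<close>
  proof (rule sum.reindex_bij_witness[where j="\<lambda>(b, w). w(L := b)" and i="\<lambda>w. (w L, w(L := undefined))"], goal_cases)
    case (1 w)
    obtain b v where w: "w = (b, v)" "b \<in> S" "v \<in> {..<L} \<rightarrow>\<^sub>E S" using 1 by auto
    have "v L = undefined" using PiE_arb[OF w(3), of L] by simp
    then have "v(L := undefined) = v" by (simp add: fun_upd_idem)
    then show ?case by (simp add: w(1))
  next
    case (2 w)
    then show ?case by (auto simp: PiE_def Pi_def extensional_def)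
  next
    case (3 w)
    then show ?case by simp
  next
    case (4 w)
    then show ?case by (auto simp: PiE_def Pi_def extensional_def)
  next
    case (5 w)
    then show ?case by auto
  qed
  finally show ?thesis by simp
qed

lemma mat_polys_diag:
  assumes f: "f \<in> mat_polys M p" and B: "B \<in> carrier_mat p M"
  shows "(\<lambda>z. f (mat_diag M z, B)) \<in> poly_maps M"
proof -
  have "(\<lambda>z\<in>UNIV. f (mat_diag M z, B)) \<in> poly_funs UNIV {(\<lambda>z. z i) | i. i < M}"
  proof (rule mat_polys_compose[OF f])
    fix i j assume ij: "i < M" "j < M"
    show "(\<lambda>z\<in>UNIV. fst (mat_diag M (z :: nat \<Rightarrow> complex), B) $$ (i, j)) \<in> poly_funs UNIV {(\<lambda>z. z i) | i. i < M}"
    proof (cases "i = j")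
      case True
      then have eq: "(\<lambda>z\<in>UNIV. fst (mat_diag M (z :: nat \<Rightarrow> complex), B) $$ (i, j)) = (\<lambda>z. z i)"
        using ij by (simp add: mat_diag_index)
      show ?thesis unfolding eq by (rule poly_maps_var[OF ij(1), unfolded poly_maps_def])
    next
      case False
      then have "(\<lambda>z\<in>UNIV. fst (mat_diag M (z :: nat \<Rightarrow> complex), B) $$ (i, j)) = (\<lambda>z\<in>UNIV. 0)"
        using ij by (simp add: mat_diag_index)
      then show ?thesis by (simp only: poly_funs.const)
    qed
  next
    fix i j
    show "(\<lambda>z\<in>UNIV. snd (mat_diag M (z :: nat \<Rightarrow> complex), B) $$ (i, j)) \<in> poly_funs UNIV {(\<lambda>z. z i) | i. i < M}"
      unfolding snd_conv by (rule poly_funs.const)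
  qed (use B in \<open>simp add: mat_pairs_def\<close>)
  then show ?thesis by (simp add: poly_maps_def)
qed

lemma prod_count_power: "(\<Prod>r<(L :: nat). if c r = j then t else 1) = (t :: complex) ^ card {r. r < L \<and> c r = j}"
proof -
  have "(\<Prod>r<L. if c r = j then t else 1) = (\<Prod>r\<in>{..<L} \<inter> {r. c r = j}. t)"
    by (subst prod.inter_restrict) auto
  also have "{..<L} \<inter> {r. c r = j} = {r. r < L \<and> c r = j}" by auto
  finally show ?thesis by simp
qed

definition scale_cols :: "nat \<Rightarrow> nat \<Rightarrow> complex mat \<Rightarrow> (nat \<Rightarrow> complex) \<Rightarrow> complex mat" where
  "scale_cols n N A u = mat n N (\<lambda>(a, j). A $$ (a, j) * u j)"

lemma scale_cols_carrier [simp]: "scale_cols n N A u \<in> carrier_mat n N"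
  by (simp add: scale_cols_def)

text \<open>Induction on the number of factors by Euler's identity in the column \<open>c L\<close>:
  \<open>d\<close> times \<open>f\<close> is the sum of \<open>A $$ (b, c L)\<close> times its
  partial derivatives, which are homogeneous for the sequence without its last entry. Here
  \<open>d\<close> counts the occurrences of that column.\<close>

lemma column_homogeneous_expansion:
  fixes L :: nat and c :: "nat \<Rightarrow> nat"
  assumes "f \<in> mat_polys N n" and "\<And>r. r < L \<Longrightarrow> c r < N"
    and "\<And>x A u. A \<in> carrier_mat n N \<Longrightarrow> (\<And>j. j < N \<Longrightarrow> u j \<noteq> 0) \<Longrightarrow>
      f (mat_diag N x, scale_cols n N A u) = (\<Prod>r<L. u (c r)) * f (mat_diag N x, A)"
  shows "\<exists>q. (\<forall>w. q w \<in> poly_maps N) \<and> (\<forall>x. \<forall>A\<in>carrier_mat n N.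
    f (mat_diag N x, A) = (\<Sum>w\<in>{..<L} \<rightarrow>\<^sub>E {..<n}. q w x * (\<Prod>r<L. A $$ (w r, c r))))"
  using assms
proof (induction L arbitrary: f )
  case 0
  note f = 0(1)
  \<comment> \<open>In degree 0 the function is constant on the line through 0 and \<open>A\<close>
    away from 0, hence also at 0.\<close>
  have "f (mat_diag N x, A) = f (mat_diag N x, 0\<^sub>m n N)" if A: "A \<in> carrier_mat n N" for x A
  proof -
    let ?g = "\<lambda>t. f (mat_diag N x, scale_cols n N A (\<lambda>_. t)) + (- f (mat_diag N x, A))"
    have "(\<lambda>t\<in>UNIV. f (mat_diag N x, scale_cols n N A (\<lambda>_. t))) \<in> poly_funs UNIV {\<lambda>t :: complex. t}"
    proof (rule mat_polys_compose[OF f])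
      fix i j assume ij: "i < n" "j < N"
      then have "(\<lambda>t\<in>UNIV. snd (mat_diag N x, scale_cols n N A (\<lambda>_. t)) $$ (i, j)) = (\<lambda>t. 0 + t * A $$ (i, j))"
        by (simp add: scale_cols_def mult.commute)
      then show "(\<lambda>t\<in>UNIV. snd (mat_diag N x, scale_cols n N A (\<lambda>_. t)) $$ (i, j)) \<in> poly_funs UNIV {\<lambda>t :: complex. t}"
        by (simp only: affine_poly_funs)
    next
      fix i j
      show "(\<lambda>t\<in>UNIV. fst (mat_diag N x, scale_cols n N A (\<lambda>_. t)) $$ (i, j)) \<in> poly_funs UNIV {\<lambda>t :: complex. t}"
        unfolding fst_conv by (rule poly_funs.const)
    qed (simp add: mat_pairs_def)
    then have g: "(\<lambda>t\<in>UNIV. ?g t) \<in> poly_funs UNIV {\<lambda>t :: complex. t}"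
      by (intro poly_funs_add' poly_funs.const)
    have "{t. ?g t \<noteq> 0} \<subseteq> {0}"
    proof
      fix t assume t: "t \<in> {t. ?g t \<noteq> 0}"
      show "t \<in> {0}"
      proof (rule ccontr)
        assume "t \<notin> {0}"
        then have "?g t = 0" using 0(3)[OF A, of "\<lambda>_. t" x] by simp
        then show False using t by simp
      qed
    qed
    then have "finite {t. ?g t \<noteq> 0}" by (rule finite_subset) simp
    then have "?g 0 = 0" using poly_funs_univariate_vanish[of ?g 0] g by simp
    moreover have "scale_cols n N A (\<lambda>_. 0) = 0\<^sub>m n N" by (intro eq_matI) (auto simp: scale_cols_def)
    ultimately show ?thesis by (simp add: eq_neg_iff_add_eq_0)
  qed
  note const = this
  show ?case
  proof (intro exI[of _ "\<lambda>w x. f (mat_diag N x, 0\<^sub>m n N)"] conjI allI ballI)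
    show "(\<lambda>x. f (mat_diag N x, 0\<^sub>m n N)) \<in> poly_maps N"
      by (rule mat_polys_diag[OF f]) simp
    fix x and A :: "complex mat" assume A: "A \<in> carrier_mat n N"
    show "f (mat_diag N x, A) =
      (\<Sum>w\<in>{..<0 :: nat} \<rightarrow>\<^sub>E {..<n}. f (mat_diag N x, 0\<^sub>m n N) * (\<Prod>r<0. A $$ (w r, c r)))"
      unfolding const[OF A, of x] by simp
  qed
next
  case (Suc L)
  note f = Suc.prems(1)
  let ?j = "c L"
  have j: "?j < N" using Suc.prems(2) by simp
  define d where "d = card {r. r < Suc L \<and> c r = ?j}"
  have d: "d \<noteq> 0" unfolding d_def by (subst card_0_eq) auto
  have euler: "of_nat d * f (mat_diag N x, A) = (\<Sum>b<n. A $$ (b, ?j) * partial_A N n b ?j f (mat_diag N x, A))"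
    if A: "A \<in> carrier_mat n N" for x A
  proof -
    \<comment> \<open>The Euler vector field of the single column \<open>c L\<close>.\<close>
    let ?\<delta> = "\<lambda>b l. if l = ?j then A $$ (b, ?j) else 0"
    let ?B = "\<lambda>t. mat n N (\<lambda>(b, l). A $$ (b, l) + t * ?\<delta> b l)"
    \<comment> \<open>Homogeneity is given for nonzero scalings, hence the exception
      \<open>t = -1\<close>, which does not affect the derivative at 0.\<close>
    have eq: "f (mat_diag N x, ?B t) = (1 + t) ^ d * f (mat_diag N x, A)" if t: "t \<in> - {-1}" for t
    proof -
      let ?u = "\<lambda>l. if l = ?j then 1 + t else 1"
      have "?B t = scale_cols n N A ?u"
        by (intro eq_matI) (auto simp: scale_cols_def algebra_simps)
      moreover have "1 + t \<noteq> 0" using t by (auto simp: eq_neg_iff_add_eq_0 add.commute)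
      ultimately show ?thesis
        using Suc.prems(3)[OF A, of ?u x] prod_count_power[of c ?j "1 + t" "Suc L"] by (simp add: d_def)
    qed
    have "((\<lambda>t. f (mat_diag N x, ?B t)) has_field_derivative
        (\<Sum>b<n. \<Sum>l<N. ?\<delta> b l * partial_A N n b l f (mat_diag N x, A))) (at 0)"
      by (rule directional_DERIV[OF f _ A]) simp
    moreover have "((\<lambda>t. f (mat_diag N x, ?B t)) has_field_derivative of_nat d * f (mat_diag N x, A)) (at 0)"
    proof (rule has_field_derivative_transform_within_open[where S="- {-1}"])
      show "((\<lambda>t. (1 + t) ^ d * f (mat_diag N x, A)) has_field_derivative of_nat d * f (mat_diag N x, A)) (at 0)"
        by (auto intro!: derivative_eq_intros)
    qed (use eq in auto)
    ultimately have "of_nat d * f (mat_diag N x, A) = (\<Sum>b<n. \<Sum>l<N. ?\<delta> b l * partial_A N n b l f (mat_diag N x, A))"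
      using DERIV_unique by blast
    also have "\<dots> = (\<Sum>b<n. \<Sum>l<N. if l = ?j then A $$ (b, ?j) * partial_A N n b l f (mat_diag N x, A) else 0)"
      by (intro sum.cong refl) simp
    also have "\<dots> = (\<Sum>b<n. A $$ (b, ?j) * partial_A N n b ?j f (mat_diag N x, A))"
      using j by simp
    finally show ?thesis .
  qed
  have "\<exists>q. (\<forall>w. q w \<in> poly_maps N) \<and> (\<forall>x. \<forall>A\<in>carrier_mat n N.
    partial_A N n b ?j f (mat_diag N x, A) = (\<Sum>w\<in>{..<L} \<rightarrow>\<^sub>E {..<n}. q w x * (\<Prod>r<L. A $$ (w r, c r))))"
    if b: "b < n" for b
  proof (rule Suc.IH)
    show "partial_A N n b ?j f \<in> mat_polys N n" by (rule partial_A_mat_polys[OF f b j])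
    show "\<And>r. r < L \<Longrightarrow> c r < N" using Suc.prems(2) by simp
    fix x and A :: "complex mat" and u :: "nat \<Rightarrow> complex" assume A: "A \<in> carrier_mat n N" and u: "\<And>j. j < N \<Longrightarrow> u j \<noteq> 0"
    let ?Au = "scale_cols n N A u"
    \<comment> \<open>Changing an entry before scaling the columns is changing it by
      \<open>u ?j\<close> times as much afterwards. By the chain rule the weight of the partial
      derivative loses one factor \<open>u ?j\<close>.\<close>
    have e: "scale_cols n N (set_entry n N A b ?j s) u = set_entry n N ?Au b ?j (u ?j * s)" for s
      using b j by (intro eq_matI) (auto simp: scale_cols_def set_entry_def mult.commute)
    have eq: "f (mat_diag N x, set_entry n N ?Au b ?j (u ?j * s)) = (\<Prod>r<Suc L. u (c r)) * f (mat_diag N x, set_entry n N A b ?j s)" for s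
      unfolding e[symmetric] by (rule Suc.prems(3)) (use u in auto)
    have 1: "((\<lambda>s. f (mat_diag N x, set_entry n N ?Au b ?j s)) has_field_derivative partial_A N n b ?j f (mat_diag N x, ?Au)) (at (u ?j * A $$ (b, ?j)))"
      using partial_A_DERIV[OF f, of "mat_diag N x" ?Au b ?j] b j by (simp add: scale_cols_def mult.commute)
    have "((\<lambda>s. u ?j * s) has_field_derivative u ?j) (at (A $$ (b, ?j)))"
      by (auto intro!: derivative_eq_intros)
    from DERIV_chain2[OF 1 this]
    have "((\<lambda>s. (\<Prod>r<Suc L. u (c r)) * f (mat_diag N x, set_entry n N A b ?j s)) has_field_derivative
      partial_A N n b ?j f (mat_diag N x, ?Au) * u ?j) (at (A $$ (b, ?j)))"
      unfolding eq .
    moreover have "((\<lambda>s. (\<Prod>r<Suc L. u (c r)) * f (mat_diag N x, set_entry n N A b ?j s)) has_field_derivative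
      (\<Prod>r<Suc L. u (c r)) * partial_A N n b ?j f (mat_diag N x, A)) (at (A $$ (b, ?j)))"
      by (rule DERIV_cmult) (rule partial_A_DERIV[OF f _ A], simp)
    ultimately have "partial_A N n b ?j f (mat_diag N x, ?Au) * u ?j = (\<Prod>r<Suc L. u (c r)) * partial_A N n b ?j f (mat_diag N x, A)"
      by (rule DERIV_unique)
    then show "partial_A N n b ?j f (mat_diag N x, ?Au) = (\<Prod>r<L. u (c r)) * partial_A N n b ?j f (mat_diag N x, A)"
      using u[OF j] by simp
  qed
  then have "\<forall>b\<in>{..<n}. \<exists>q. (\<forall>w. q w \<in> poly_maps N) \<and> (\<forall>x. \<forall>A\<in>carrier_mat n N.
    partial_A N n b ?j f (mat_diag N x, A) = (\<Sum>w\<in>{..<L} \<rightarrow>\<^sub>E {..<n}. q w x * (\<Prod>r<L. A $$ (w r, c r))))" by blast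
  from bchoice[OF this] obtain q where q: "\<forall>b\<in>{..<n}. (\<forall>w. q b w \<in> poly_maps N) \<and> (\<forall>x. \<forall>A\<in>carrier_mat n N.
    partial_A N n b ?j f (mat_diag N x, A) = (\<Sum>w\<in>{..<L} \<rightarrow>\<^sub>E {..<n}. q b w x * (\<Prod>r<L. A $$ (w r, c r))))" by blast
  have q: "\<And>b w. b < n \<Longrightarrow> q b w \<in> poly_maps N"
    "\<And>b x A. b < n \<Longrightarrow> A \<in> carrier_mat n N \<Longrightarrow>
    partial_A N n b ?j f (mat_diag N x, A) = (\<Sum>w\<in>{..<L} \<rightarrow>\<^sub>E {..<n}. q b w x * (\<Prod>r<L. A $$ (w r, c r)))"
    using q by blast+
  \<comment> \<open>The default 0 makes \<open>Q w\<close> a polynomial for every \<open>w\<close>,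
    also for those whose last letter is no row index.\<close>
  define Q where "Q w x = (if w L < n then (1 / of_nat d) * q (w L) (w(L := undefined)) x else 0)" for w x
  have "Q w \<in> poly_maps N" for w
  proof (cases "w L < n")
    case True
    then have "Q w = (\<lambda>x. (1 / of_nat d) * q (w L) (w(L := undefined)) x)" by (simp add: Q_def fun_eq_iff)
    then show ?thesis using q(1)[OF True] by (simp only: poly_maps_mult poly_maps_const)
  next
    case False
    then have "Q w = (\<lambda>x. 0)" by (simp add: Q_def fun_eq_iff)
    then show ?thesis by (simp only: poly_maps_const)
  qed
  moreover have "f (mat_diag N x, A) = (\<Sum>w\<in>{..<Suc L} \<rightarrow>\<^sub>E {..<n}. Q w x * (\<Prod>r<Suc L. A $$ (w r, c r)))"
    if A: "A \<in> carrier_mat n N" for x A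
  proof -
    have "(\<Sum>w\<in>{..<Suc L} \<rightarrow>\<^sub>E {..<n}. Q w x * (\<Prod>r<Suc L. A $$ (w r, c r))) =
      (\<Sum>b<n. \<Sum>w\<in>{..<L} \<rightarrow>\<^sub>E {..<n}. (1 / of_nat d) * (A $$ (b, ?j) * (q b w x * (\<Prod>r<L. A $$ (w r, c r)))))"
      unfolding sum_PiE_Suc
    proof (intro sum.cong refl)
      fix b w assume b: "b \<in> {..<n}" and w: "w \<in> {..<L} \<rightarrow>\<^sub>E {..<n}"
      have "w L = undefined" using PiE_arb[OF w, of L] by simp
      then have "w(L := undefined) = w" by (simp add: fun_upd_idem)
      then show "Q (w(L := b)) x * (\<Prod>r<Suc L. A $$ ((w(L := b)) r, c r)) =
        (1 / of_nat d) * (A $$ (b, ?j) * (q b w x * (\<Prod>r<L. A $$ (w r, c r))))"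
        using b by (simp add: Q_def)
    qed
    also have "\<dots> = (1 / of_nat d) * (\<Sum>b<n. A $$ (b, ?j) * partial_A N n b ?j f (mat_diag N x, A))"
      using A by (simp add: sum_distrib_left q(2))
    also have "\<dots> = (1 / of_nat d) * (of_nat d * f (mat_diag N x, A))" by (simp only: euler[OF A])
    also have "\<dots> = f (mat_diag N x, A)" using d by simp
    finally show ?thesis by simp
  qed
  ultimately show ?case by blast
qed

text \<open>Invertible diagonal matrices commute with \<open>mat_diag M z\<close>, so equivariance
  only rescales the columns of \<open>A\<close>.\<close>

lemma \<H>_torus:
  assumes f: "f \<in> \<H> M p l" and A: "A \<in> carrier_mat p M" and u: "\<And>j. j < M \<Longrightarrow> u j \<noteq> 0"
  shows "f (mat_diag M z, scale_cols p M A u) = (\<Prod>j<M. u j) ^ l * f (mat_diag M z, A)"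
proof -
  let ?g = "mat_diag M (\<lambda>j. inverse (u j))" and ?h = "mat_diag M u"
  have one: "mat_diag M (\<lambda>j. 1) = (1\<^sub>m M :: complex mat)" by (rule mat_diag_one)
  have "mat_diag M (\<lambda>i. inverse (u i) * u i) = 1\<^sub>m M" "mat_diag M (\<lambda>i. u i * inverse (u i)) = 1\<^sub>m M"
    using u by (auto intro!: eq_matI simp: mat_diag_def)
  then have gh: "inv_pair M ?g ?h" by (simp add: inv_pair_def)
  have X: "?g * mat_diag M z * ?h = mat_diag M z"
  proof -
    have "?g * mat_diag M z * ?h = mat_diag M (\<lambda>i. inverse (u i) * z i * u i)" by simp
    also have "\<dots> = mat_diag M z" using u by (auto intro!: eq_matI simp: mat_diag_def)
    finally show ?thesis .
  qed
  have "A * ?h = scale_cols p M A u"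
    unfolding scale_cols_def by (rule mat_diag_mult_right[OF A])
  then have "f (mat_diag M z, scale_cols p M A u) = inverse (det ?g ^ l) * f (mat_diag M z, A)"
    using \<H>_equivariant[OF f gh _ A, of "mat_diag M z"] X by simp
  moreover have "det ?g = (\<Prod>j<M. inverse (u j))"
  proof -
    have "upper_triangular ?g" by (auto simp: upper_triangular_def mat_diag_def)
    then have "det ?g = prod_list (diag_mat ?g)" by (rule det_upper_triangular[of _ M]) simp
    also have "\<dots> = (\<Prod>j<M. inverse (u j))"
      unfolding prod_list_diag_prod by (simp add: mat_diag_def atLeast0LessThan)
    finally show ?thesis .
  qed
  ultimately show ?thesis by (simp add: prod_inversef[unfolded o_def] power_inverse)
qed

text \<open>A permutation matrix permutes the eigenvalues and the columns of \<open>A\<close>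
  simultaneously, and its determinant, being a sign, is its own inverse.\<close>

lemma \<H>_permute:
  assumes f: "f \<in> \<H> M p l" and A: "A \<in> carrier_mat p M" and \<pi>: "\<pi> permutes {..<M}"
  shows "f (mat_diag M (\<lambda>i. z (\<pi> i)), mat p M (\<lambda>(a, j). A $$ (a, \<pi> j))) = signof \<pi> ^ l * f (mat_diag M z, A)"
proof -
  have lt: "\<pi> i < M" if "i < M" for i using permutes_in_image[OF \<pi>, of i] that by simp
  have inj: "\<pi> i = \<pi> j \<longleftrightarrow> i = j" for i j using permutes_inj[OF \<pi>] by (auto dest: injD)
  let ?g = "mat M M (\<lambda>(i, j). (1\<^sub>m M) $$ (\<pi> i, j)) :: complex mat"
  let ?h = "mat M M (\<lambda>(i, j). if i = \<pi> j then 1 else 0) :: complex mat"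
  have gc: "?g \<in> carrier_mat M M" and hc: "?h \<in> carrier_mat M M" by simp_all
  have ge: "?g $$ (i, j) = (if \<pi> i = j then 1 else 0)" if "i < M" "j < M" for i j using that lt by simp
  have right: "(B * ?h) $$ (i, j) = B $$ (i, \<pi> j)" if "B \<in> carrier_mat m M" "i < m" "j < M" for B :: "complex mat" and i j m
  proof -
    have "(B * ?h) $$ (i, j) = (\<Sum>l<M. B $$ (i, l) * ?h $$ (l, j))"
      using that by (intro mult_mat_entry_sum) auto
    also have "\<dots> = (\<Sum>l<M. if l = \<pi> j then B $$ (i, l) else 0)"
      using that by (intro sum.cong refl) auto
    finally show ?thesis using lt[OF that(3)] by simp
  qed
  have left: "(?g * B) $$ (i, j) = B $$ (\<pi> i, j)" if "B \<in> carrier_mat M M" "i < M" "j < M" for B :: "complex mat" and i j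
  proof -
    have "(?g * B) $$ (i, j) = (\<Sum>l<M. ?g $$ (i, l) * B $$ (l, j))"
      using that by (intro mult_mat_entry_sum) auto
    also have "\<dots> = (\<Sum>l<M. if l = \<pi> i then B $$ (l, j) else 0)"
      using that by (intro sum.cong refl) (subst ge, auto)
    finally show ?thesis using lt[OF that(2)] by simp
  qed
  have g1: "?g * ?h = 1\<^sub>m M"
    by (intro eq_matI) (auto simp: right[OF gc] ge lt inj simp del: index_mult_mat(1))
  have "?h * ?g = 1\<^sub>m M" by (rule mat_mult_left_right_inverse[OF gc hc g1])
  then have gh: "inv_pair M ?g ?h" unfolding inv_pair_def using gc hc g1 by blast
  have X: "?g * mat_diag M z * ?h = mat_diag M (\<lambda>i. z (\<pi> i))"
  proof (rule eq_matI)
    fix i j assume "i < dim_row (mat_diag M (\<lambda>i. z (\<pi> i)))" "j < dim_col (mat_diag M (\<lambda>i. z (\<pi> i)))"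
    then have ij: "i < M" "j < M" by (simp_all add: mat_diag_def)
    have "(?g * mat_diag M z * ?h) $$ (i, j) = (?g * mat_diag M z) $$ (i, \<pi> j)"
      by (rule right[OF mult_carrier_mat[OF gc mat_diag_dim] ij])
    also have "\<dots> = mat_diag M z $$ (\<pi> i, \<pi> j)" by (rule left[OF mat_diag_dim ij(1) lt[OF ij(2)]])
    finally show "(?g * mat_diag M z * ?h) $$ (i, j) = mat_diag M (\<lambda>i. z (\<pi> i)) $$ (i, j)"
      using ij lt by (simp add: mat_diag_index inj)
  qed (simp_all add: mat_diag_def)
  have Ah: "A * ?h = mat p M (\<lambda>(a, j). A $$ (a, \<pi> j))"
    using A by (intro eq_matI) (auto simp: right[OF A] simp del: index_mult_mat(1))
  have "det ?g = signof \<pi> * det (1\<^sub>m M)"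
    using \<pi> by (intro det_permute_rows) (simp_all add: lessThan_atLeast0)
  then have dg: "det ?g = signof \<pi>" by simp
  have "f (?g * mat_diag M z * ?h, A * ?h) = inverse (det ?g ^ l) * f (mat_diag M z, A)"
    by (rule \<H>_equivariant[OF f gh mat_diag_dim A])
  then have eq: "f (mat_diag M (\<lambda>i. z (\<pi> i)), mat p M (\<lambda>(a, j). A $$ (a, \<pi> j))) =
    inverse (signof \<pi> ^ l) * f (mat_diag M z, A)"
    unfolding X Ah dg .
  have "signof \<pi> = (1 :: complex) \<or> signof \<pi> = (- 1 :: complex)"
    by (simp add: sign_def)
  then have "inverse (signof \<pi> ^ l) = (signof \<pi> ^ l :: complex)"
    by (metis inverse_1 inverse_minus_eq power_inverse)
  then show ?thesis using eq by (simp only:)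
qed

subsection \<open>Antisymmetrized monomials\<close>

definition alt_val :: "nat \<Rightarrow> ((nat \<Rightarrow> complex) \<Rightarrow> complex) \<Rightarrow> (nat \<Rightarrow> nat) \<Rightarrow> (nat \<Rightarrow> complex) \<Rightarrow> complex mat \<Rightarrow> complex" where
  "alt_val M q w z A = (\<Sum>\<pi> | \<pi> permutes {..<M}. signof \<pi> * q (\<lambda>i. z (\<pi> i)) * (\<Prod>r<M. A $$ (w r, \<pi> r)))"

lemma det_eq_sum: "A \<in> carrier_mat M M \<Longrightarrow> det A = (\<Sum>\<pi> | \<pi> permutes {..<M}. signof \<pi> * (\<Prod>r<M. A $$ (r, \<pi> r)))"
  by (simp add: det_def' lessThan_atLeast0)

text \<open>At a diagonal \<open>X\<close> its determinant is the antisymmetrized monomial with word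
  \<open>w\<close> and exponents \<open>m\<close>; the formula itself makes sense for every
  \<open>X\<close>.\<close>

definition word_mat :: "nat \<Rightarrow> (nat \<Rightarrow> nat) \<Rightarrow> (nat \<Rightarrow> nat) \<Rightarrow> complex mat \<Rightarrow> complex mat \<Rightarrow> complex mat" where
  "word_mat M w m X A = mat M M (\<lambda>(r, j). (A * X ^\<^sub>m m r) $$ (w r, j))"

text \<open>Every row is a row of \<open>A * X ^\<^sub>m m r\<close> and so is multiplied by
  \<open>h\<close> from the right; the determinant changes by \<open>det h\<close>, the inverse of
  \<open>det g\<close>.\<close>

lemma det_word_mat_\<H>:
  assumes w: "\<And>r. r < M \<Longrightarrow> w r < p"
  shows "(\<lambda>XA\<in>mat_pairs M p. det (word_mat M w m (fst XA) (snd XA))) \<in> \<H> M p 1"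
proof (rule \<H>_restrictI)
  let ?F = "\<lambda>XA. \<Sum>\<pi> | \<pi> permutes {..<M}. signof \<pi> * (\<Prod>r<M. \<Sum>l<M. snd XA $$ (w r, l) * (fst XA ^\<^sub>m m r) $$ (l, \<pi> r))"
  have "restrict ?F (mat_pairs M p) \<in> mat_polys M p"
    by (intro mat_polys_intros mat_polys_pow mat_polys_A) (auto simp: w dest: permutes_in_image)
  moreover have "(\<lambda>XA\<in>mat_pairs M p. det (word_mat M w m (fst XA) (snd XA))) = restrict ?F (mat_pairs M p)"
  proof (rule restrict_ext)
    fix XA assume "XA \<in> mat_pairs M p"
    then have X: "fst XA \<in> carrier_mat M M" and A: "snd XA \<in> carrier_mat p M" by (simp_all add: mat_pairs_iff)
    have "det (word_mat M w m (fst XA) (snd XA)) =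
      (\<Sum>\<pi> | \<pi> permutes {..<M}. signof \<pi> * (\<Prod>r<M. word_mat M w m (fst XA) (snd XA) $$ (r, \<pi> r)))"
      by (rule det_eq_sum) (simp add: word_mat_def)
    also have "\<dots> = ?F XA"
    proof (intro sum.cong refl arg_cong2[where f="(*)"] prod.cong)
      fix \<pi> r assume "\<pi> \<in> {\<pi>. \<pi> permutes {..<M}}" "r \<in> {..<M}"
      then have "r < M" "\<pi> r < M" using permutes_in_image[of \<pi> "{..<M}" r] by auto
      then show "word_mat M w m (fst XA) (snd XA) $$ (r, \<pi> r) = (\<Sum>l<M. snd XA $$ (w r, l) * (fst XA ^\<^sub>m m r) $$ (l, \<pi> r))"
        using mult_mat_entry_sum[OF A pow_carrier[OF X, of "m r"], of "w r" "\<pi> r"] w by (simp add: word_mat_def)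
    qed
    finally show "det (word_mat M w m (fst XA) (snd XA)) = ?F XA" .
  qed
  ultimately show "(\<lambda>XA\<in>mat_pairs M p. det (word_mat M w m (fst XA) (snd XA))) \<in> mat_polys M p" by (simp only:)
next
  fix g h X A :: "complex mat"
  assume gh: "inv_pair M g h" and X: "X \<in> carrier_mat M M" and A: "A \<in> carrier_mat p M"
  have c: "g \<in> carrier_mat M M" "h \<in> carrier_mat M M" "g * h = 1\<^sub>m M" using gh by (auto simp: inv_pair_def)
  have W: "word_mat M w m X A \<in> carrier_mat M M" by (simp add: word_mat_def)
  have AX: "A * X ^\<^sub>m m r \<in> carrier_mat p M" for r using A pow_carrier[OF X] by auto
  have "word_mat M w m (g * X * h) (A * h) = word_mat M w m X A * h"
  proof (rule eq_matI)
    fix r j assume "r < dim_row (word_mat M w m X A * h)" "j < dim_col (word_mat M w m X A * h)"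
    then have rj: "r < M" "j < M" using W c by auto
    have "word_mat M w m (g * X * h) (A * h) $$ (r, j) = ((A * X ^\<^sub>m m r) * h) $$ (w r, j)"
      using rj by (simp add: word_mat_def mult_pow_conj[OF gh X A] del: index_mult_mat)
    also have "\<dots> = (\<Sum>l<M. (A * X ^\<^sub>m m r) $$ (w r, l) * h $$ (l, j))"
      by (rule mult_mat_entry_sum[OF AX c(2) w[OF rj(1)] rj(2)])
    also have "\<dots> = (\<Sum>l<M. word_mat M w m X A $$ (r, l) * h $$ (l, j))"
      using rj by (intro sum.cong refl) (simp add: word_mat_def del: index_mult_mat)
    also have "\<dots> = (word_mat M w m X A * h) $$ (r, j)"
      by (rule mult_mat_entry_sum[OF W c(2) rj, symmetric])
    finally show "word_mat M w m (g * X * h) (A * h) $$ (r, j) = (word_mat M w m X A * h) $$ (r, j)" .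
  qed (use W c in \<open>auto simp: word_mat_def\<close>)
  then have "det (word_mat M w m (g * X * h) (A * h)) = det (word_mat M w m X A) * det h"
    using det_mult[OF W c(2)] by simp
  moreover have "det g * det h = 1" using det_mult[OF c(1,2)] c(3) by simp
  then have "det h = inverse (det g)" by (metis inverse_unique)
  ultimately show "det (word_mat M w m (fst (g * X * h, A * h)) (snd (g * X * h, A * h))) =
    inverse (det g ^ 1) * det (word_mat M w m (fst (X, A)) (snd (X, A)))"
    by simp
qed

lemma det_word_mat_diag:
  assumes w: "\<And>r. r < M \<Longrightarrow> w r < p" and A: "A \<in> carrier_mat p M"
  shows "det (word_mat M w m (mat_diag M z) A) = alt_val M (\<lambda>z. \<Prod>r<M. z r ^ m r) w z A"
proof -
  have "det (word_mat M w m (mat_diag M z) A) =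
    (\<Sum>\<pi> | \<pi> permutes {..<M}. signof \<pi> * (\<Prod>r<M. word_mat M w m (mat_diag M z) A $$ (r, \<pi> r)))"
    by (rule det_eq_sum) (simp add: word_mat_def)
  also have "\<dots> = alt_val M (\<lambda>z. \<Prod>r<M. z r ^ m r) w z A"
    unfolding alt_val_def
  proof (rule sum.cong[OF refl])
    fix \<pi> assume "\<pi> \<in> {\<pi>. \<pi> permutes {..<M}}"
    then have lt: "\<pi> r < M" if "r < M" for r using permutes_in_image[of \<pi> "{..<M}" r] that by auto
    have "(\<Prod>r<M. word_mat M w m (mat_diag M z) A $$ (r, \<pi> r)) = (\<Prod>r<M. z (\<pi> r) ^ m r * A $$ (w r, \<pi> r))"
    proof (rule prod.cong[OF refl])
      fix r assume "r \<in> {..<M}"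
      then have r: "r < M" by simp
      have "(A * mat_diag M z ^\<^sub>m m r) $$ (w r, \<pi> r) = A $$ (w r, \<pi> r) * z (\<pi> r) ^ m r"
        unfolding mat_diag_pow mat_diag_mult_right[OF A] using w[OF r] lt[OF r] by simp
      then show "word_mat M w m (mat_diag M z) A $$ (r, \<pi> r) = z (\<pi> r) ^ m r * A $$ (w r, \<pi> r)"
        using r lt[OF r] by (simp add: word_mat_def mult.commute del: index_mult_mat)
    qed
    then show "signof \<pi> * (\<Prod>r<M. word_mat M w m (mat_diag M z) A $$ (r, \<pi> r)) =
      signof \<pi> * (\<Prod>r<M. z (\<pi> r) ^ m r) * (\<Prod>r<M. A $$ (w r, \<pi> r))"
      by (simp add: prod.distrib mult.assoc)
  qed
  finally show ?thesis .
qed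

text \<open>The determinants of \<open>word_mat\<close> extend the antisymmetrized monomials from
  diagonal \<open>X\<close> to all \<open>X\<close> polynomially; the general case follows by
  linearity in \<open>q\<close>.\<close>

lemma alt_exists:
  assumes "q \<in> poly_maps M" and w: "\<And>r. r < M \<Longrightarrow> w r < p"
  shows "\<exists>f\<in>\<H> M p 1. \<forall>z. \<forall>A\<in>carrier_mat p M. f (mat_diag M z, A) = alt_val M q w z A"
  using assms(1)
proof (induction rule: poly_maps_monomial_induct)
  case (monomial c m)
  let ?d = "\<lambda>XA\<in>mat_pairs M p. det (word_mat M w m (fst XA) (snd XA))"
  have "(\<lambda>XA\<in>mat_pairs M p. c * ?d XA) (mat_diag M z, A) = alt_val M (\<lambda>z. c * (\<Prod>i<M. z i ^ m i)) w z A"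
    if A: "A \<in> carrier_mat p M" for z A
  proof -
    have "(\<lambda>XA\<in>mat_pairs M p. c * ?d XA) (mat_diag M z, A) = c * alt_val M (\<lambda>z. \<Prod>r<M. z r ^ m r) w z A"
      using A by (simp add: mat_pairs_iff det_word_mat_diag[OF w])
    then show ?thesis by (simp add: alt_val_def sum_distrib_left mult_ac)
  qed
  then show ?case by (intro bexI[OF _ \<H>_smult[where c=c, OF det_word_mat_\<H>[where w=w and M=M and m=m, OF w]]] allI ballI)
next
  case (add f g)
  obtain F where F: "F \<in> \<H> M p 1" "\<forall>z. \<forall>A\<in>carrier_mat p M. F (mat_diag M z, A) = alt_val M f w z A"
    using add(1) by (elim bexE)
  obtain G where G: "G \<in> \<H> M p 1" "\<forall>z. \<forall>A\<in>carrier_mat p M. G (mat_diag M z, A) = alt_val M g w z A"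
    using add(2) by (elim bexE)
  have "(\<lambda>XA\<in>mat_pairs M p. F XA + G XA) (mat_diag M z, A) = alt_val M (\<lambda>z. f z + g z) w z A"
    if A: "A \<in> carrier_mat p M" for z A
    using A F(2) G(2) by (simp add: mat_pairs_iff alt_val_def algebra_simps sum.distrib)
  then show ?case by (intro bexI[OF _ \<H>_add[OF F(1) G(1)]] allI ballI)
qed

text \<open>For a polynomial \<open>q\<close> and a word of row indices, the choice is of a unique
  object: \<open>alt_exists\<close> provides it and its values at diagonal \<open>X\<close>
  determine it, see \<open>alt_unique\<close>.\<close>

definition alt :: "nat \<Rightarrow> nat \<Rightarrow> ((nat \<Rightarrow> complex) \<Rightarrow> complex) \<Rightarrow> (nat \<Rightarrow> nat) \<Rightarrow> complex mat \<times> complex mat \<Rightarrow> complex" where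
  "alt M p q w = (SOME f. f \<in> \<H> M p 1 \<and> (\<forall>z. \<forall>A\<in>carrier_mat p M. f (mat_diag M z, A) = alt_val M q w z A))"

lemma alt_props:
  assumes "q \<in> poly_maps M" "\<And>r. r < M \<Longrightarrow> w r < p"
  shows "alt M p q w \<in> \<H> M p 1 \<and> (\<forall>z. \<forall>A\<in>carrier_mat p M. alt M p q w (mat_diag M z, A) = alt_val M q w z A)"
proof -
  have "\<exists>f. f \<in> \<H> M p 1 \<and> (\<forall>z. \<forall>A\<in>carrier_mat p M. f (mat_diag M z, A) = alt_val M q w z A)"
    using alt_exists[where w=w and p=p, OF assms(1) assms(2)] by blast
  from someI_ex[OF this] show ?thesis unfolding alt_def .
qed

lemma alt_\<H>: "q \<in> poly_maps M \<Longrightarrow> (\<And>r. r < M \<Longrightarrow> w r < p) \<Longrightarrow> alt M p q w \<in> \<H> M p 1"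
  using alt_props by blast

lemma alt_diag:
  "q \<in> poly_maps M \<Longrightarrow> (\<And>r. r < M \<Longrightarrow> w r < p) \<Longrightarrow> A \<in> carrier_mat p M \<Longrightarrow>
    alt M p q w (mat_diag M z, A) = alt_val M q w z A"
  using alt_props by blast

lemma alt_unique:
  assumes "q \<in> poly_maps M" "\<And>r. r < M \<Longrightarrow> w r < p" "f \<in> \<H> M p 1"
    and "\<And>z A. A \<in> carrier_mat p M \<Longrightarrow> f (mat_diag M z, A) = alt_val M q w z A"
  shows "alt M p q w = f"
  by (rule \<H>_eqI[OF alt_\<H>[OF assms(1,2)] assms(3)]) (simp_all add: alt_diag[OF assms(1,2)] assms(4))

lemma alt_cong:
  assumes "q \<in> poly_maps M" "\<And>r. r < M \<Longrightarrow> w r < p" "\<And>r. r < M \<Longrightarrow> w r = w' r"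
  shows "alt M p q w = alt M p q w'"
proof (rule alt_unique[OF assms(1,2)])
  have w': "w' r < p" if "r < M" for r using assms(2,3) that by metis
  show "alt M p q w' \<in> \<H> M p 1" by (rule alt_\<H>[OF assms(1) w'])
  show "alt M p q w' (mat_diag M z, A) = alt_val M q w z A" if "A \<in> carrier_mat p M" for z A
    using assms(3) by (simp add: alt_diag[OF assms(1) w' that] alt_val_def)
qed

lemma alt_val_add: "alt_val M (\<lambda>z. f z + g z) w z A = alt_val M f w z A + alt_val M g w z A"
  by (simp add: alt_val_def algebra_simps sum.distrib)

lemma alt_val_cmult: "alt_val M (\<lambda>z. c * f z) w z A = c * alt_val M f w z A"
  by (simp add: alt_val_def sum_distrib_left mult_ac)

lemma alt_val_sum: "alt_val M (\<lambda>z. \<Sum>i\<in>I. f i z) w z A = (\<Sum>i\<in>I. alt_val M (f i) w z A)"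
  unfolding alt_val_def by (subst sum.swap) (simp add: sum_distrib_left sum_distrib_right)

lemma alt_sum:
  assumes "\<And>i. i \<in> I \<Longrightarrow> f i \<in> poly_maps M" and w: "\<And>r. r < M \<Longrightarrow> w r < p"
  shows "alt M p (\<lambda>z. \<Sum>i\<in>I. f i z) w = (\<lambda>XA\<in>mat_pairs M p. \<Sum>i\<in>I. alt M p (f i) w XA)"
proof (rule alt_unique[OF _ w])
  show "(\<lambda>z. \<Sum>i\<in>I. f i z) \<in> poly_maps M" using assms(1) by (rule poly_maps_sum)
  show "(\<lambda>XA\<in>mat_pairs M p. \<Sum>i\<in>I. alt M p (f i) w XA) \<in> \<H> M p 1"
    using assms by (intro \<H>_sum alt_\<H>) auto
  show "(\<lambda>XA\<in>mat_pairs M p. \<Sum>i\<in>I. alt M p (f i) w XA) (mat_diag M z, A) = alt_val M (\<lambda>z. \<Sum>i\<in>I. f i z) w z A"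
    if "A \<in> carrier_mat p M" for z A
    using that by (simp add: mat_pairs_iff alt_val_sum alt_diag[OF assms(1) w])
qed

lemma alt_add:
  assumes "f \<in> poly_maps M" "g \<in> poly_maps M" and w: "\<And>r. r < M \<Longrightarrow> w r < p"
  shows "alt M p (\<lambda>z. f z + g z) w = (\<lambda>XA\<in>mat_pairs M p. alt M p f w XA + alt M p g w XA)"
proof (rule alt_unique[OF poly_maps_add[OF assms(1,2)] w])
  show "(\<lambda>XA\<in>mat_pairs M p. alt M p f w XA + alt M p g w XA) \<in> \<H> M p 1"
    by (intro \<H>_add alt_\<H> assms)
  show "(\<lambda>XA\<in>mat_pairs M p. alt M p f w XA + alt M p g w XA) (mat_diag M z, A) = alt_val M (\<lambda>z. f z + g z) w z A"
    if "A \<in> carrier_mat p M" for z A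
    using that by (simp add: mat_pairs_iff alt_val_add alt_diag[OF assms(1) w] alt_diag[OF assms(2) w])
qed

lemma alt_cmult:
  assumes "f \<in> poly_maps M" and w: "\<And>r. r < M \<Longrightarrow> w r < p"
  shows "alt M p (\<lambda>z. c * f z) w = (\<lambda>XA\<in>mat_pairs M p. c * alt M p f w XA)"
proof (rule alt_unique[OF poly_maps_mult[OF poly_maps_const assms(1)] w])
  show "(\<lambda>XA\<in>mat_pairs M p. c * alt M p f w XA) \<in> \<H> M p 1"
    by (intro \<H>_smult alt_\<H> assms)
  show "(\<lambda>XA\<in>mat_pairs M p. c * alt M p f w XA) (mat_diag M z, A) = alt_val M (\<lambda>z. c * f z) w z A"
    if "A \<in> carrier_mat p M" for z A
    using that by (simp add: mat_pairs_iff alt_val_cmult alt_diag[OF assms(1) w])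
qed

text \<open>An invariant function of \<open>X\<close> is symmetric in the eigenvalues, and a
  symmetric factor passes through the antisymmetrization.\<close>

lemma alt_mult_invariant:
  assumes q: "q \<in> poly_maps M" and w: "\<And>r. r < M \<Longrightarrow> w r < p"
    and c: "(\<lambda>XA\<in>mat_pairs M p. c (fst XA)) \<in> mat_polys M p"
    and inv: "\<And>g h X. inv_pair M g h \<Longrightarrow> X \<in> carrier_mat M M \<Longrightarrow> c (g * X * h) = c X"
    and s: "s \<in> poly_maps M" "\<And>z. c (mat_diag M z) = s z"
    and sym: "\<And>\<pi> z. \<pi> permutes {..<M} \<Longrightarrow> s (\<lambda>i. z (\<pi> i)) = s z"
  shows "(\<lambda>XA\<in>mat_pairs M p. c (fst XA) * alt M p q w XA) = alt M p (\<lambda>z. s z * q z) w"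
proof (rule alt_unique[symmetric, OF _ w])
  show "(\<lambda>z. s z * q z) \<in> poly_maps M" using s(1) q by (rule poly_maps_mult)
  show "(\<lambda>XA\<in>mat_pairs M p. c (fst XA) * alt M p q w XA) \<in> \<H> M p 1"
    by (rule \<H>_mult_invariant[OF alt_\<H>[OF q w] c inv])
  fix z and A :: "complex mat" assume A: "A \<in> carrier_mat p M"
  have "alt_val M (\<lambda>z. s z * q z) w z A = s z * alt_val M q w z A"
    unfolding alt_val_def sum_distrib_left by (intro sum.cong refl) (simp add: sym mult_ac)
  then show "(\<lambda>XA\<in>mat_pairs M p. c (fst XA) * alt M p q w XA) (mat_diag M z, A) = alt_val M (\<lambda>z. s z * q z) w z A"
    using A by (simp add: mat_pairs_iff s(2) alt_diag[OF q w])
qed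

lemma permutes_finite_permutation: "\<pi> permutes {..<(M :: nat)} \<Longrightarrow> permutation \<pi>"
  by (rule permutes_imp_permutation[of "{..<M}"]) auto

lemma alt_val_permute:
  assumes \<sigma>: "\<sigma> permutes {..<M}"
  shows "alt_val M q w z A = signof \<sigma> * alt_val M (\<lambda>z. q (\<lambda>i. z (inv_into UNIV \<sigma> i))) (\<lambda>r. w (\<sigma> r)) z A"
proof -
  let ?F = "\<lambda>\<pi>. signof \<pi> * q (\<lambda>i. z (\<pi> i)) * (\<Prod>r<M. A $$ (w r, \<pi> r))"
  have "alt_val M q w z A = (\<Sum>\<rho> | \<rho> permutes {..<M}. ?F (\<rho> \<circ> inv_into UNIV \<sigma>))"
    unfolding alt_val_def
    by (rule sum.reindex_bij_witness[where i="\<lambda>\<rho>. \<rho> \<circ> inv_into UNIV \<sigma>" and j="\<lambda>\<pi>. \<pi> \<circ> \<sigma>"])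
      (auto simp: o_assoc[symmetric] permutes_inv_o[OF \<sigma>] intro: permutes_compose \<sigma> permutes_inv)
  also have "\<dots> = (\<Sum>\<rho> | \<rho> permutes {..<M}. signof \<sigma> * (signof \<rho> * q (\<lambda>i. z (\<rho> (inv_into UNIV \<sigma> i))) * (\<Prod>r<M. A $$ (w (\<sigma> r), \<rho> r))))"
  proof (rule sum.cong[OF refl])
    fix \<rho> assume "\<rho> \<in> {\<rho>. \<rho> permutes {..<M}}"
    then have \<rho>: "\<rho> permutes {..<M}" by simp
    have "sign (\<rho> \<circ> inv_into UNIV \<sigma>) = sign \<rho> * sign \<sigma>"
      using \<rho> \<sigma> permutes_inv[OF \<sigma>] by (simp add: sign_compose sign_inverse permutes_finite_permutation)
    moreover have "(\<Prod>r<M. A $$ (w r, (\<rho> \<circ> inv_into UNIV \<sigma>) r)) = (\<Prod>r<M. A $$ (w (\<sigma> r), \<rho> r))"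
    proof -
      have "(\<Prod>r<M. A $$ (w r, (\<rho> \<circ> inv_into UNIV \<sigma>) r)) = (\<Prod>r<M. A $$ (w (\<sigma> r), (\<rho> \<circ> inv_into UNIV \<sigma>) (\<sigma> r)))"
        by (rule prod.reindex_bij_betw[symmetric]) (rule permutes_imp_bij[OF \<sigma>])
      then show ?thesis by (simp add: permutes_inverses[OF \<sigma>])
    qed
    ultimately show "?F (\<rho> \<circ> inv_into UNIV \<sigma>) = signof \<sigma> * (signof \<rho> * q (\<lambda>i. z (\<rho> (inv_into UNIV \<sigma> i))) * (\<Prod>r<M. A $$ (w (\<sigma> r), \<rho> r)))"
      by simp
  qed
  finally show ?thesis by (simp add: alt_val_def sum_distrib_left)
qed

lemma permutes_less: "\<sigma> permutes {..<(M :: nat)} \<Longrightarrow> r < M \<Longrightarrow> \<sigma> r < M"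
  using permutes_in_image[of \<sigma> "{..<M}" r] by simp

lemma poly_maps_permute:
  assumes "q \<in> poly_maps M" "\<sigma> permutes {..<M}"
  shows "(\<lambda>z. q (\<lambda>i. z (\<sigma> i))) \<in> poly_maps M"
  by (rule poly_maps_comp[OF assms(1) permutes_less[OF assms(2)]])

text \<open>Positions may be relabelled: the letters and the variables move together, at the price
  of a sign.\<close>

lemma alt_permute:
  assumes q: "q \<in> poly_maps M" and w: "\<And>r. r < M \<Longrightarrow> w r < p" and \<sigma>: "\<sigma> permutes {..<M}"
  shows "alt M p q w = (\<lambda>XA\<in>mat_pairs M p. signof \<sigma> * alt M p (\<lambda>z. q (\<lambda>i. z (inv_into UNIV \<sigma> i))) (\<lambda>r. w (\<sigma> r)) XA)"
proof (rule alt_unique[OF q w])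
  have q': "(\<lambda>z. q (\<lambda>i. z (inv_into UNIV \<sigma> i))) \<in> poly_maps M" by (rule poly_maps_permute[OF q permutes_inv[OF \<sigma>]])
  have w': "w (\<sigma> r) < p" if "r < M" for r by (rule w[OF permutes_less[OF \<sigma> that]])
  show "(\<lambda>XA\<in>mat_pairs M p. signof \<sigma> * alt M p (\<lambda>z. q (\<lambda>i. z (inv_into UNIV \<sigma> i))) (\<lambda>r. w (\<sigma> r)) XA) \<in> \<H> M p 1"
    by (rule \<H>_smult[OF alt_\<H>[OF q' w']])
  show "(\<lambda>XA\<in>mat_pairs M p. signof \<sigma> * alt M p (\<lambda>z. q (\<lambda>i. z (inv_into UNIV \<sigma> i))) (\<lambda>r. w (\<sigma> r)) XA) (mat_diag M z, A) =
    alt_val M q w z A" if "A \<in> carrier_mat p M" for z A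
    using that by (simp add: mat_pairs_iff alt_diag[OF q' w'] alt_val_permute[OF \<sigma>, of q w])
qed

text \<open>The torus makes the function multilinear in the columns of \<open>A\<close>, which gives
  an expansion in words. Averaging it over the permutation matrices, with signs, turns each term
  into an \<open>alt\<close>; this is the origin of \<open>1 / fact M\<close>.\<close>

lemma \<H>_alt_expansion:
  assumes f: "f \<in> \<H> M p 1"
  shows "\<exists>q. (\<forall>w. q w \<in> poly_maps M) \<and>
    f = (\<lambda>XA\<in>mat_pairs M p. \<Sum>w\<in>{..<M} \<rightarrow>\<^sub>E {..<p}. alt M p (q w) w XA)"
proof -
  have "\<exists>q. (\<forall>w. q w \<in> poly_maps M) \<and> (\<forall>z. \<forall>A\<in>carrier_mat p M.
    f (mat_diag M z, A) = (\<Sum>w\<in>{..<M} \<rightarrow>\<^sub>E {..<p}. q w z * (\<Prod>r<M. A $$ (w r, r))))"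
  proof (rule column_homogeneous_expansion[OF \<H>_mat_polys[OF f]])
    fix z and A :: "complex mat" and u :: "nat \<Rightarrow> complex"
    assume "A \<in> carrier_mat p M" "\<And>j. j < M \<Longrightarrow> u j \<noteq> 0"
    then show "f (mat_diag M z, scale_cols p M A u) = (\<Prod>r<M. u r) * f (mat_diag M z, A)"
      using \<H>_torus[OF f, of A u z] by simp
  qed
  then obtain q where q: "\<And>w. q w \<in> poly_maps M" and fq: "\<And>z A. A \<in> carrier_mat p M \<Longrightarrow>
    f (mat_diag M z, A) = (\<Sum>w\<in>{..<M} \<rightarrow>\<^sub>E {..<p}. q w z * (\<Prod>r<M. A $$ (w r, r)))" by blast
  define Q where "Q w = (\<lambda>z. (1 / fact M) * q w z)" for w
  have Q: "Q w \<in> poly_maps M" for w unfolding Q_def by (intro poly_maps_mult poly_maps_const q)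
  have wv: "w r < p" if "w \<in> {..<M} \<rightarrow>\<^sub>E {..<p}" "r < M" for w r using that by auto
  have "f = (\<lambda>XA\<in>mat_pairs M p. \<Sum>w\<in>{..<M} \<rightarrow>\<^sub>E {..<p}. alt M p (Q w) w XA)"
  proof (rule \<H>_eqI[OF f])
    show "(\<lambda>XA\<in>mat_pairs M p. \<Sum>w\<in>{..<M} \<rightarrow>\<^sub>E {..<p}. alt M p (Q w) w XA) \<in> \<H> M p 1"
      by (intro \<H>_sum alt_\<H> Q wv)
    fix z and A :: "complex mat" assume A: "A \<in> carrier_mat p M"
    let ?A = "\<lambda>\<pi>. mat p M (\<lambda>(a, j). A $$ (a, \<pi> j))"
    have "f (mat_diag M z, A) = (1 / fact M) * (\<Sum>\<pi> | \<pi> permutes {..<M}. f (mat_diag M z, A))"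
      by (simp add: card_permutations[OF refl])
    also have "(\<Sum>\<pi> | \<pi> permutes {..<M}. f (mat_diag M z, A)) =
      (\<Sum>\<pi> | \<pi> permutes {..<M}. \<Sum>w\<in>{..<M} \<rightarrow>\<^sub>E {..<p}. signof \<pi> * q w (\<lambda>i. z (\<pi> i)) * (\<Prod>r<M. A $$ (w r, \<pi> r)))"
    proof (rule sum.cong[OF refl])
      fix \<pi> assume "\<pi> \<in> {\<pi>. \<pi> permutes {..<M}}"
      then have \<pi>: "\<pi> permutes {..<M}" by simp
      have s: "signof \<pi> * signof \<pi> = (1 :: complex)" by (simp add: sign_def)
      have "f (mat_diag M z, A) = signof \<pi> * (signof \<pi> * f (mat_diag M z, A))"
        using s by (simp add: mult.assoc[symmetric])
      also have "\<dots> = signof \<pi> * f (mat_diag M (\<lambda>i. z (\<pi> i)), ?A \<pi>)"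
        using \<H>_permute[OF f A \<pi>, of z] by simp
      also have "\<dots> = (\<Sum>w\<in>{..<M} \<rightarrow>\<^sub>E {..<p}. signof \<pi> * q w (\<lambda>i. z (\<pi> i)) * (\<Prod>r<M. A $$ (w r, \<pi> r)))"
      proof -
        have "f (mat_diag M (\<lambda>i. z (\<pi> i)), ?A \<pi>) =
          (\<Sum>w\<in>{..<M} \<rightarrow>\<^sub>E {..<p}. q w (\<lambda>i. z (\<pi> i)) * (\<Prod>r<M. ?A \<pi> $$ (w r, r)))"
          by (rule fq) simp
        also have "\<dots> = (\<Sum>w\<in>{..<M} \<rightarrow>\<^sub>E {..<p}. q w (\<lambda>i. z (\<pi> i)) * (\<Prod>r<M. A $$ (w r, \<pi> r)))"
          using wv by (intro sum.cong refl arg_cong2[where f="(*)"] prod.cong) auto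
        finally show ?thesis by (simp add: sum_distrib_left mult.assoc)
      qed
      finally show "f (mat_diag M z, A) =
        (\<Sum>w\<in>{..<M} \<rightarrow>\<^sub>E {..<p}. signof \<pi> * q w (\<lambda>i. z (\<pi> i)) * (\<Prod>r<M. A $$ (w r, \<pi> r)))" .
    qed
    also have "(1 / fact M) * \<dots> = (\<Sum>w\<in>{..<M} \<rightarrow>\<^sub>E {..<p}. (1 / fact M) * alt_val M (q w) w z A)"
      unfolding alt_val_def sum_distrib_left by (rule sum.swap)
    also have "\<dots> = (\<Sum>w\<in>{..<M} \<rightarrow>\<^sub>E {..<p}. alt_val M (Q w) w z A)"
      unfolding Q_def alt_val_cmult ..
    also have "\<dots> = (\<Sum>w\<in>{..<M} \<rightarrow>\<^sub>E {..<p}. alt M p (Q w) w (mat_diag M z, A))"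
      using wv A by (intro sum.cong refl alt_diag[symmetric] Q) auto
    also have "\<dots> = (\<lambda>XA\<in>mat_pairs M p. \<Sum>w\<in>{..<M} \<rightarrow>\<^sub>E {..<p}. alt M p (Q w) w XA) (mat_diag M z, A)"
      using A by (simp add: mat_pairs_iff)
    finally show "f (mat_diag M z, A) = (\<lambda>XA\<in>mat_pairs M p. \<Sum>w\<in>{..<M} \<rightarrow>\<^sub>E {..<p}. alt M p (Q w) w XA) (mat_diag M z, A)" .
  qed
  then show ?thesis using Q by blast
qed

lemma poly_maps_poly: "r < M \<Longrightarrow> (\<lambda>z. poly P (z r)) \<in> poly_maps M"
  unfolding poly_altdef by (intro poly_maps_sum poly_maps_mult poly_maps_const poly_maps_power poly_maps_var)

text \<open>The Leibniz rule: \<open>Y\<close> replaces one letter at a time and multiplies by an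
  entry of \<open>Y\<close> at the variable of that position, as on a tensor product of evaluation
  representations at the points \<open>z r\<close>.\<close>

lemma gl_act_alt:
  assumes q: "q \<in> poly_maps M" and w: "\<And>r. r < M \<Longrightarrow> w r < p"
  shows "gl_act M p Y (alt M p q w) = (\<lambda>XA\<in>mat_pairs M p.
    \<Sum>r<M. \<Sum>a<p. alt M p (\<lambda>z. q z * poly (Y $$ (a, w r)) (z r)) (w(r := a)) XA)"
proof (rule \<H>_eqI)
  have q': "(\<lambda>z. q z * poly (Y $$ (a, w r)) (z r)) \<in> poly_maps M" if "r < M" for r a
    by (intro poly_maps_mult q poly_maps_poly that)
  have w': "(w(r := a)) r' < p" if "a < p" "r' < M" for r a r' using w that by simp
  have fH: "alt M p q w \<in> \<H> M p 1" by (rule alt_\<H>[OF q w])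
  then show "gl_act M p Y (alt M p q w) \<in> \<H> M p 1" by (rule gl_act_\<H>)
  show "(\<lambda>XA\<in>mat_pairs M p. \<Sum>r<M. \<Sum>a<p. alt M p (\<lambda>z. q z * poly (Y $$ (a, w r)) (z r)) (w(r := a)) XA) \<in> \<H> M p 1"
  proof -
    have "(\<lambda>XA\<in>mat_pairs M p. \<Sum>r<M. (\<lambda>XA\<in>mat_pairs M p. \<Sum>a<p.
      alt M p (\<lambda>z. q z * poly (Y $$ (a, w r)) (z r)) (w(r := a)) XA) XA) \<in> \<H> M p 1"
      using w' by (intro \<H>_sum alt_\<H> q') auto
    moreover have "(\<lambda>XA\<in>mat_pairs M p. \<Sum>r<M. (\<lambda>XA\<in>mat_pairs M p. \<Sum>a<p.
      alt M p (\<lambda>z. q z * poly (Y $$ (a, w r)) (z r)) (w(r := a)) XA) XA) =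
      (\<lambda>XA\<in>mat_pairs M p. \<Sum>r<M. \<Sum>a<p. alt M p (\<lambda>z. q z * poly (Y $$ (a, w r)) (z r)) (w(r := a)) XA)"
      by (rule restrict_ext) simp
    ultimately show ?thesis by (simp only:)
  qed
  fix z and A :: "complex mat" assume A: "A \<in> carrier_mat p M"
  let ?\<delta> = "gl_dir M p Y (mat_diag M z) A"
  let ?B = "\<lambda>t. mat p M (\<lambda>(b, j). A $$ (b, j) + t * ?\<delta> b j)"
  let ?D = "\<lambda>\<pi>. signof \<pi> * q (\<lambda>i. z (\<pi> i)) * (\<Sum>r<M. ?\<delta> (w r) (\<pi> r) * (\<Prod>r'\<in>{..<M} - {r}. A $$ (w r', \<pi> r')))"
  have "((\<lambda>t. alt M p q w (mat_diag M z, ?B t)) has_field_derivative gl_act M p Y (alt M p q w) (mat_diag M z, A)) (at 0)"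
    by (rule gl_act_DERIV[OF \<H>_mat_polys[OF fH] mat_diag_dim A])
  moreover have "((\<lambda>t. alt M p q w (mat_diag M z, ?B t)) has_field_derivative (\<Sum>\<pi> | \<pi> permutes {..<M}. ?D \<pi>)) (at 0)"
  proof -
    have "alt M p q w (mat_diag M z, ?B t) = (\<Sum>\<pi> | \<pi> permutes {..<M}. signof \<pi> * q (\<lambda>i. z (\<pi> i)) *
      (\<Prod>r<M. A $$ (w r, \<pi> r) + t * ?\<delta> (w r) (\<pi> r)))" for t
    proof -
      have "alt M p q w (mat_diag M z, ?B t) = alt_val M q w z (?B t)" by (rule alt_diag[OF q w mat_carrier])
      also have "\<dots> = (\<Sum>\<pi> | \<pi> permutes {..<M}. signof \<pi> * q (\<lambda>i. z (\<pi> i)) *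
        (\<Prod>r<M. A $$ (w r, \<pi> r) + t * ?\<delta> (w r) (\<pi> r)))"
        unfolding alt_val_def
      proof (intro sum.cong refl arg_cong2[where f="(*)"] prod.cong)
        fix \<pi> r assume "\<pi> \<in> {\<pi>. \<pi> permutes {..<M}}" "r \<in> {..<M}"
        then have "r < M" "\<pi> r < M" using permutes_in_image[of \<pi> "{..<M}" r] by auto
        then show "?B t $$ (w r, \<pi> r) = A $$ (w r, \<pi> r) + t * ?\<delta> (w r) (\<pi> r)" using w by simp
      qed
      finally show ?thesis .
    qed
    moreover have "((\<lambda>t. \<Sum>\<pi> | \<pi> permutes {..<M}. signof \<pi> * q (\<lambda>i. z (\<pi> i)) *
      (\<Prod>r<M. A $$ (w r, \<pi> r) + t * ?\<delta> (w r) (\<pi> r))) has_field_derivative (\<Sum>\<pi> | \<pi> permutes {..<M}. ?D \<pi>)) (at 0)"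
    proof (intro DERIV_sum DERIV_cmult)
      fix \<pi>
      have "((\<lambda>t. \<Prod>r<M. A $$ (w r, \<pi> r) + t * ?\<delta> (w r) (\<pi> r)) has_field_derivative
        (\<Sum>r<M. ?\<delta> (w r) (\<pi> r) * (\<Prod>r'\<in>{..<M} - {r}. A $$ (w r', \<pi> r') + 0 * ?\<delta> (w r') (\<pi> r')))) (at 0)"
        by (rule has_field_derivative_prod) (auto intro!: derivative_eq_intros)
      then show "((\<lambda>t. \<Prod>r<M. A $$ (w r, \<pi> r) + t * ?\<delta> (w r) (\<pi> r)) has_field_derivative
        (\<Sum>r<M. ?\<delta> (w r) (\<pi> r) * (\<Prod>r'\<in>{..<M} - {r}. A $$ (w r', \<pi> r')))) (at 0)" by simp
    qed
    ultimately show ?thesis by (simp only:)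
  qed
  ultimately have "gl_act M p Y (alt M p q w) (mat_diag M z, A) = (\<Sum>\<pi> | \<pi> permutes {..<M}. ?D \<pi>)"
    by (rule DERIV_unique)
  also have "\<dots> = (\<Sum>\<pi> | \<pi> permutes {..<M}. \<Sum>r<M. \<Sum>a<p. signof \<pi> * (q (\<lambda>i. z (\<pi> i)) * poly (Y $$ (a, w r)) (z (\<pi> r))) *
      (\<Prod>r'<M. A $$ ((w(r := a)) r', \<pi> r')))"
  proof (rule sum.cong[OF refl])
    fix \<pi> assume "\<pi> \<in> {\<pi>. \<pi> permutes {..<M}}"
    then have \<pi>: "\<pi> permutes {..<M}" by simp
    have "?\<delta> (w r) (\<pi> r) * (\<Prod>r'\<in>{..<M} - {r}. A $$ (w r', \<pi> r')) =
      (\<Sum>a<p. poly (Y $$ (a, w r)) (z (\<pi> r)) * (\<Prod>r'<M. A $$ ((w(r := a)) r', \<pi> r')))" if r: "r < M" for r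
    proof -
      have "\<pi> r < M" using permutes_in_image[OF \<pi>, of r] r by simp
      then have "?\<delta> (w r) (\<pi> r) = (\<Sum>a<p. poly (Y $$ (a, w r)) (z (\<pi> r)) * A $$ (a, \<pi> r))" by (rule gl_dir_diag)
      moreover have "(\<Prod>r'<M. A $$ ((w(r := a)) r', \<pi> r')) = A $$ (a, \<pi> r) * (\<Prod>r'\<in>{..<M} - {r}. A $$ (w r', \<pi> r'))" for a
        using r by (subst prod.remove[of _ r]) auto
      ultimately show ?thesis by (simp add: sum_distrib_right mult.assoc)
    qed
    then show "?D \<pi> = (\<Sum>r<M. \<Sum>a<p. signof \<pi> * (q (\<lambda>i. z (\<pi> i)) * poly (Y $$ (a, w r)) (z (\<pi> r))) *
      (\<Prod>r'<M. A $$ ((w(r := a)) r', \<pi> r')))"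
      by (simp add: sum_distrib_left mult.assoc)
  qed
  also have "\<dots> = (\<Sum>r<M. \<Sum>a<p. alt_val M (\<lambda>z. q z * poly (Y $$ (a, w r)) (z r)) (w(r := a)) z A)"
    unfolding alt_val_def by (subst sum.swap, intro sum.cong refl, rule sum.swap)
  also have "\<dots> = (\<Sum>r<M. \<Sum>a<p. alt M p (\<lambda>z. q z * poly (Y $$ (a, w r)) (z r)) (w(r := a)) (mat_diag M z, A))"
    using w' A by (intro sum.cong refl alt_diag[symmetric] q') auto
  also have "\<dots> = (\<lambda>XA\<in>mat_pairs M p. \<Sum>r<M. \<Sum>a<p. alt M p (\<lambda>z. q z * poly (Y $$ (a, w r)) (z r)) (w(r := a)) XA) (mat_diag M z, A)"
    using A by (simp add: mat_pairs_iff)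
  finally show "gl_act M p Y (alt M p q w) (mat_diag M z, A) =
    (\<lambda>XA\<in>mat_pairs M p. \<Sum>r<M. \<Sum>a<p. alt M p (\<lambda>z. q z * poly (Y $$ (a, w r)) (z r)) (w(r := a)) XA) (mat_diag M z, A)" .
qed

subsection \<open>Kronecker products with the identity\<close>

lemma sum_blocks:
  fixes f :: "nat \<Rightarrow> 'a :: comm_monoid_add"
  assumes "k > 0"
  shows "(\<Sum>r<k * N. f r) = (\<Sum>i<N. \<Sum>a<k. f (i * k + a))"
proof -
  have "(\<Sum>i<N. \<Sum>a<k. f (i * k + a)) = (\<Sum>i<N. sum f {i * k..<i * k + k})"
  proof (rule sum.cong[OF refl])
    fix i
    show "(\<Sum>a<k. f (i * k + a)) = sum f {i * k..<i * k + k}"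
      by (rule sum.reindex_bij_witness[where i="\<lambda>r. r - i * k" and j="\<lambda>a. i * k + a"]) auto
  qed
  then show ?thesis by (simp only: sum.nat_group mult.commute[of k N])
qed

lemma prod_blocks:
  fixes f :: "nat \<Rightarrow> 'a :: comm_monoid_mult"
  assumes "k > 0"
  shows "(\<Prod>r<k * N. f r) = (\<Prod>i<N. \<Prod>a<k. f (i * k + a))"
proof -
  have "(\<Prod>i<N. \<Prod>a<k. f (i * k + a)) = (\<Prod>i<N. prod f {i * k..<i * k + k})"
  proof (rule prod.cong[OF refl])
    fix i
    show "(\<Prod>a<k. f (i * k + a)) = prod f {i * k..<i * k + k}"
      by (rule prod.reindex_bij_witness[where i="\<lambda>r. r - i * k" and j="\<lambda>a. i * k + a"]) auto
  qed
  then show ?thesis by (simp only: prod.nat_group mult.commute[of k N])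
qed

lemma block_index_less: "i < N \<Longrightarrow> a < k \<Longrightarrow> i * k + a < k * (N :: nat)"
proof -
  assume i: "i < N" and a: "a < k"
  have "i * k + a < Suc i * k" using a by simp
  also have "\<dots> \<le> N * k" using i by (intro mult_le_mono1) simp
  finally show ?thesis by (simp add: mult.commute)
qed

lemma block_div_less: "r < k * N \<Longrightarrow> r div k < (N :: nat)"
  by (simp add: less_mult_imp_div_less mult.commute)

lemma kron_one_carrier: "B \<in> carrier_mat a b \<Longrightarrow> B \<otimes>\<^sub>K 1\<^sub>m k \<in> carrier_mat (k * a) (k * b)"
  by (simp add: kron_def mult.commute)

lemma kron_one_index:
  fixes B :: "complex mat"
  assumes "B \<in> carrier_mat a b" "i < k * a" "j < k * b"
  shows "(B \<otimes>\<^sub>K 1\<^sub>m k) $$ (i, j) = (if i mod k = j mod k then B $$ (i div k, j div k) else 0)"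
proof -
  have k: "k > 0" using assms(2) by (cases k) auto
  show ?thesis using assms k by (simp add: kron_def mult.commute)
qed

lemma kron_one_mult:
  fixes B C :: "complex mat"
  assumes B: "B \<in> carrier_mat a b" and C: "C \<in> carrier_mat b c" and k: "k > 0"
  shows "(B \<otimes>\<^sub>K 1\<^sub>m k) * (C \<otimes>\<^sub>K 1\<^sub>m k) = (B * C) \<otimes>\<^sub>K 1\<^sub>m k"
proof (rule eq_matI)
  have BC: "B * C \<in> carrier_mat a c" using B C by simp
  note cB = kron_one_carrier[OF B, of k] and cC = kron_one_carrier[OF C, of k] and cBC = kron_one_carrier[OF BC, of k]
  fix i j assume "i < dim_row ((B * C) \<otimes>\<^sub>K 1\<^sub>m k)" "j < dim_col ((B * C) \<otimes>\<^sub>K 1\<^sub>m k)"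
  then have ij: "i < k * a" "j < k * c" using cBC by auto
  have "((B \<otimes>\<^sub>K 1\<^sub>m k) * (C \<otimes>\<^sub>K 1\<^sub>m k)) $$ (i, j) = (\<Sum>r<k * b. (B \<otimes>\<^sub>K 1\<^sub>m k) $$ (i, r) * (C \<otimes>\<^sub>K 1\<^sub>m k) $$ (r, j))"
    by (rule mult_mat_entry_sum[OF cB cC ij])
  also have "\<dots> = (\<Sum>l<b. \<Sum>e<k. (B \<otimes>\<^sub>K 1\<^sub>m k) $$ (i, l * k + e) * (C \<otimes>\<^sub>K 1\<^sub>m k) $$ (l * k + e, j))"
    by (rule sum_blocks[OF k])
  also have "\<dots> = (\<Sum>l<b. \<Sum>e<k. if e = i mod k then (if i mod k = j mod k then B $$ (i div k, l) * C $$ (l, j div k) else 0) else 0)"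
  proof (intro sum.cong refl)
    fix l e assume "l \<in> {..<b}" "e \<in> {..<k}"
    then have le: "l < b" "e < k" by auto
    then have "l * k + e < k * b" by (rule block_index_less)
    then show "(B \<otimes>\<^sub>K 1\<^sub>m k) $$ (i, l * k + e) * (C \<otimes>\<^sub>K 1\<^sub>m k) $$ (l * k + e, j) =
      (if e = i mod k then (if i mod k = j mod k then B $$ (i div k, l) * C $$ (l, j div k) else 0) else 0)"
      using le ij by (simp add: kron_one_index[OF B] kron_one_index[OF C])
  qed
  also have "\<dots> = (\<Sum>l<b. if i mod k = j mod k then B $$ (i div k, l) * C $$ (l, j div k) else 0)"
    using k by simp
  also have "\<dots> = (if i mod k = j mod k then (\<Sum>l<b. B $$ (i div k, l) * C $$ (l, j div k)) else 0)"
    by simp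
  also have "\<dots> = ((B * C) \<otimes>\<^sub>K 1\<^sub>m k) $$ (i, j)"
    using mult_mat_entry_sum[OF B C block_div_less[OF ij(1)] block_div_less[OF ij(2)]]
    by (simp add: kron_one_index[OF BC ij] del: index_mult_mat)
  finally show "((B \<otimes>\<^sub>K 1\<^sub>m k) * (C \<otimes>\<^sub>K 1\<^sub>m k)) $$ (i, j) = ((B * C) \<otimes>\<^sub>K 1\<^sub>m k) $$ (i, j)" .
qed (use B C in \<open>auto simp: kron_def\<close>)

lemma kron_one_one: "k > 0 \<Longrightarrow> (1\<^sub>m a :: complex mat) \<otimes>\<^sub>K 1\<^sub>m k = 1\<^sub>m (k * a)"
proof (rule eq_matI)
  fix i j assume k: "k > 0" and "i < dim_row (1\<^sub>m (k * a) :: complex mat)" "j < dim_col (1\<^sub>m (k * a) :: complex mat)"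
  then have ij: "i < k * a" "j < k * a" by auto
  have "i = j \<longleftrightarrow> i div k = j div k \<and> i mod k = j mod k" by (metis div_mult_mod_eq)
  then show "((1\<^sub>m a :: complex mat) \<otimes>\<^sub>K 1\<^sub>m k) $$ (i, j) = 1\<^sub>m (k * a) $$ (i, j)"
    using ij block_div_less[OF ij(1)] block_div_less[OF ij(2)] by (simp add: kron_one_index[of _ a a])
qed (auto simp: kron_def mult.commute)

lemma kron_one_pow:
  fixes X :: "complex mat"
  assumes X: "X \<in> carrier_mat a a" and k: "k > 0"
  shows "(X \<otimes>\<^sub>K 1\<^sub>m k) ^\<^sub>m m = X ^\<^sub>m m \<otimes>\<^sub>K 1\<^sub>m k"
proof (induction m)
  case 0
  show ?case using X kron_one_carrier[OF X, of k] kron_one_one[OF k, of a] by simp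
next
  case (Suc m)
  show ?case by (simp only: pow_mat.simps Suc kron_one_mult[OF pow_carrier[OF X] X k])
qed

lemma kron_one_trace:
  fixes X :: "complex mat"
  assumes X: "X \<in> carrier_mat a a" and k: "k > 0"
  shows "mat_trace (X \<otimes>\<^sub>K 1\<^sub>m k) = of_nat k * mat_trace X"
proof -
  have "mat_trace (X \<otimes>\<^sub>K 1\<^sub>m k) = (\<Sum>r<k * a. (X \<otimes>\<^sub>K 1\<^sub>m k) $$ (r, r))"
    using kron_one_carrier[OF X, of k] by (simp add: mat_trace_def)
  also have "\<dots> = (\<Sum>r<k * a. X $$ (r div k, r div k))"
    by (intro sum.cong refl) (simp add: kron_one_index[OF X])
  also have "\<dots> = of_nat k * mat_trace X"
    unfolding sum_blocks[OF k] using X by (simp add: mat_trace_def sum_distrib_left)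
  finally show ?thesis .
qed

lemma inv_pair_kron_one:
  assumes gh: "inv_pair a g h" and k: "k > 0"
  shows "inv_pair (k * a) (g \<otimes>\<^sub>K 1\<^sub>m k) (h \<otimes>\<^sub>K 1\<^sub>m k)"
proof -
  have c: "g \<in> carrier_mat a a" "h \<in> carrier_mat a a" "g * h = 1\<^sub>m a" "h * g = 1\<^sub>m a"
    using gh by (auto simp: inv_pair_def)
  show ?thesis
    unfolding inv_pair_def kron_one_mult[OF c(1,2) k] kron_one_mult[OF c(2,1) k] c(3,4) kron_one_one[OF k]
    using kron_one_carrier[OF c(1), of k] kron_one_carrier[OF c(2), of k] by blast
qed

lemma inv_pair_det: "inv_pair a g h \<Longrightarrow> det g * det h = 1"
  using det_mult[of g a h] by (simp add: inv_pair_def)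

text \<open>After triangularizing \<open>g\<close>, its Kronecker product with the identity is again
  triangular, with every diagonal entry repeated \<open>k\<close> times.\<close>

lemma det_kron_one:
  fixes g :: "complex mat"
  assumes g: "g \<in> carrier_mat a a" and k: "k > 0"
  shows "det (g \<otimes>\<^sub>K 1\<^sub>m k) = det g ^ k"
proof -
  obtain P Q T where PQ: "inv_pair a P Q" and T: "T \<in> carrier_mat a a" and ut: "upper_triangular T" and eq: "g = P * T * Q"
    using triangularizable[OF g] by blast
  have c: "P \<in> carrier_mat a a" "Q \<in> carrier_mat a a" using PQ by (auto simp: inv_pair_def)
  have PT: "P * T \<in> carrier_mat a a" using c T by simp
  have "det g = det P * det T * det Q"
    unfolding eq det_mult[OF PT c(2)] det_mult[OF c(1) T] ..
  then have dg: "det g = det T" using inv_pair_det[OF PQ] by (simp add: mult_ac)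
  have "g \<otimes>\<^sub>K 1\<^sub>m k = (P \<otimes>\<^sub>K 1\<^sub>m k) * (T \<otimes>\<^sub>K 1\<^sub>m k) * (Q \<otimes>\<^sub>K 1\<^sub>m k)"
    unfolding kron_one_mult[OF c(1) T k] kron_one_mult[OF PT c(2) k] eq ..
  then have "det (g \<otimes>\<^sub>K 1\<^sub>m k) = det (P \<otimes>\<^sub>K 1\<^sub>m k) * det (T \<otimes>\<^sub>K 1\<^sub>m k) * det (Q \<otimes>\<^sub>K 1\<^sub>m k)"
    using det_mult[OF mult_carrier_mat[OF kron_one_carrier[OF c(1)] kron_one_carrier[OF T]] kron_one_carrier[OF c(2)]]
      det_mult[OF kron_one_carrier[OF c(1)] kron_one_carrier[OF T]] by simp
  then have dk: "det (g \<otimes>\<^sub>K 1\<^sub>m k) = det (T \<otimes>\<^sub>K 1\<^sub>m k)"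
    using inv_pair_det[OF inv_pair_kron_one[OF PQ k]] by (simp add: mult_ac)
  have "upper_triangular (T \<otimes>\<^sub>K 1\<^sub>m k)"
    unfolding upper_triangular_def
  proof (intro allI impI)
    fix i j assume i: "i < dim_row (T \<otimes>\<^sub>K 1\<^sub>m k)" and j: "j < i"
    have ij: "i < k * a" "j < k * a" using i j kron_one_carrier[OF T, of k] by auto
    show "(T \<otimes>\<^sub>K 1\<^sub>m k) $$ (i, j) = 0"
    proof (cases "i mod k = j mod k")
      case True
      have "j div k < i div k"
      proof (rule ccontr)
        assume "\<not> j div k < i div k"
        then have "i div k * k + i mod k \<le> j div k * k + j mod k"
          using True by (intro add_mono mult_le_mono1) auto
        then show False using j by (simp only: div_mult_mod_eq)
      qed
      then have "T $$ (i div k, j div k) = 0"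
        using ut T block_div_less[OF ij(1)] by (simp add: upper_triangular_def)
      then show ?thesis using True by (simp add: kron_one_index[OF T ij])
    qed (simp add: kron_one_index[OF T ij])
  qed
  then have "det (T \<otimes>\<^sub>K 1\<^sub>m k) = prod_list (diag_mat (T \<otimes>\<^sub>K 1\<^sub>m k))"
    using kron_one_carrier[OF T, of k] by (rule det_upper_triangular)
  also have "\<dots> = (\<Prod>r<k * a. (T \<otimes>\<^sub>K 1\<^sub>m k) $$ (r, r))"
    unfolding prod_list_diag_prod using kron_one_carrier[OF T, of k] by (simp add: atLeast0LessThan)
  also have "\<dots> = (\<Prod>r<k * a. T $$ (r div k, r div k))"
    by (intro prod.cong refl) (simp add: kron_one_index[OF T])
  also have "\<dots> = (\<Prod>i<a. T $$ (i, i)) ^ k"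
    unfolding prod_blocks[OF k] by (simp add: prod_power_distrib)
  also have "(\<Prod>i<a. T $$ (i, i)) = det T"
    unfolding det_upper_triangular[OF ut T] prod_list_diag_prod using T by (simp add: atLeast0LessThan)
  finally show ?thesis unfolding dk dg .
qed

lemma kron_one_diag: "k > 0 \<Longrightarrow> mat_diag N x \<otimes>\<^sub>K 1\<^sub>m k = mat_diag (k * N) (\<lambda>r. x (r div k) :: complex)"
proof (rule eq_matI)
  fix i j assume k: "k > 0" and "i < dim_row (mat_diag (k * N) (\<lambda>r. x (r div k)))" "j < dim_col (mat_diag (k * N) (\<lambda>r. x (r div k)))"
  then have ij: "i < k * N" "j < k * N" by (auto simp: mat_diag_def)
  have "i = j \<longleftrightarrow> i div k = j div k \<and> i mod k = j mod k" by (metis div_mult_mod_eq)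
  then show "(mat_diag N x \<otimes>\<^sub>K 1\<^sub>m k) $$ (i, j) = mat_diag (k * N) (\<lambda>r. x (r div k)) $$ (i, j)"
    using ij block_div_less[OF ij(1)] block_div_less[OF ij(2)]
    by (simp add: kron_one_index[OF mat_diag_dim ij] mat_diag_index)
qed (auto simp: kron_def mat_diag_def mult.commute)

subsection \<open>The level-rank map\<close>

lemma level_rank_apply:
  "X \<in> carrier_mat N N \<Longrightarrow> A \<in> carrier_mat n N \<Longrightarrow> level_rank k n N f (X, A) = f (X \<otimes>\<^sub>K 1\<^sub>m k, A \<otimes>\<^sub>K 1\<^sub>m k)"
  by (simp add: level_rank_def mat_pairs_def)

lemma level_rank_\<H>:
  assumes f: "f \<in> \<H> (k * N) (k * n) 1" and k: "k > 0"
  shows "level_rank k n N f \<in> \<H> N n k"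
proof -
  let ?F = "\<lambda>XA. f (fst XA \<otimes>\<^sub>K 1\<^sub>m k, snd XA \<otimes>\<^sub>K 1\<^sub>m k)"
  have entry: "(\<lambda>XA\<in>mat_pairs N n. (P XA \<otimes>\<^sub>K 1\<^sub>m k) $$ (i, j)) \<in> mat_polys N n"
    if P: "\<And>XA. XA \<in> mat_pairs N n \<Longrightarrow> P XA \<in> carrier_mat a N"
      and poly: "\<And>i j. i < a \<Longrightarrow> j < N \<Longrightarrow> (\<lambda>XA\<in>mat_pairs N n. P XA $$ (i, j)) \<in> mat_polys N n"
      and ij: "i < k * a" "j < k * N" for P a i j
  proof (cases "i mod k = j mod k")
    case True
    have "(\<lambda>XA\<in>mat_pairs N n. (P XA \<otimes>\<^sub>K 1\<^sub>m k) $$ (i, j)) = (\<lambda>XA\<in>mat_pairs N n. P XA $$ (i div k, j div k))"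
      by (rule restrict_ext) (simp add: kron_one_index[OF P ij] True)
    then show ?thesis using poly[OF block_div_less[OF ij(1)] block_div_less[OF ij(2)]] by (simp only:)
  next
    case False
    have "(\<lambda>XA\<in>mat_pairs N n. (P XA \<otimes>\<^sub>K 1\<^sub>m k) $$ (i, j)) = (\<lambda>XA\<in>mat_pairs N n. 0)"
      by (rule restrict_ext) (simp add: kron_one_index[OF P ij] False)
    then show ?thesis using mat_polys_intros(1) by (simp only:)
  qed
  have "restrict ?F (mat_pairs N n) \<in> \<H> N n k"
  proof (rule \<H>_restrictI)
    show "restrict ?F (mat_pairs N n) \<in> mat_polys N n"
      unfolding mat_polys_def
    proof (rule mat_polys_compose[OF \<H>_mat_polys[OF f]])
      show "(fst t \<otimes>\<^sub>K 1\<^sub>m k, snd t \<otimes>\<^sub>K 1\<^sub>m k) \<in> mat_pairs (k * N) (k * n)" if "t \<in> mat_pairs N n" for t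
        using that kron_one_carrier[of "fst t" N N k] kron_one_carrier[of "snd t" n N k] by (simp add: mat_pairs_iff)
    next
      fix i j assume "i < k * N" "j < k * N"
      from entry[OF _ _ this, of fst] mat_polys_X[of _ N _ n]
      show "(\<lambda>t\<in>mat_pairs N n. fst (fst t \<otimes>\<^sub>K 1\<^sub>m k, snd t \<otimes>\<^sub>K 1\<^sub>m k) $$ (i, j))
        \<in> poly_funs (mat_pairs N n) ({\<lambda>(X, A). X $$ (i, j) |i j. i < N \<and> j < N} \<union> {\<lambda>(X, A). A $$ (a, j) |a j. a < n \<and> j < N})"
        unfolding mat_polys_def fst_conv by (simp add: mat_pairs_iff)
    next
      fix i j assume "i < k * n" "j < k * N"
      from entry[OF _ _ this, of snd] mat_polys_A[of _ n _ N]
      show "(\<lambda>t\<in>mat_pairs N n. snd (fst t \<otimes>\<^sub>K 1\<^sub>m k, snd t \<otimes>\<^sub>K 1\<^sub>m k) $$ (i, j))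
        \<in> poly_funs (mat_pairs N n) ({\<lambda>(X, A). X $$ (i, j) |i j. i < N \<and> j < N} \<union> {\<lambda>(X, A). A $$ (a, j) |a j. a < n \<and> j < N})"
        unfolding mat_polys_def snd_conv by (simp add: mat_pairs_iff)
    qed
  next
    fix g h X A :: "complex mat"
    assume gh: "inv_pair N g h" and X: "X \<in> carrier_mat N N" and A: "A \<in> carrier_mat n N"
    have c: "g \<in> carrier_mat N N" "h \<in> carrier_mat N N" using gh by (auto simp: inv_pair_def)
    have gX: "g * X \<in> carrier_mat N N" using c X by simp
    have "(g * X * h) \<otimes>\<^sub>K 1\<^sub>m k = (g \<otimes>\<^sub>K 1\<^sub>m k) * (X \<otimes>\<^sub>K 1\<^sub>m k) * (h \<otimes>\<^sub>K 1\<^sub>m k)"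
      unfolding kron_one_mult[OF c(1) X k] kron_one_mult[OF gX c(2) k] ..
    moreover have "(A * h) \<otimes>\<^sub>K 1\<^sub>m k = (A \<otimes>\<^sub>K 1\<^sub>m k) * (h \<otimes>\<^sub>K 1\<^sub>m k)"
      unfolding kron_one_mult[OF A c(2) k] ..
    ultimately show "?F (g * X * h, A * h) = inverse (det g ^ k) * ?F (X, A)"
      using \<H>_equivariant[OF f inv_pair_kron_one[OF gh k] kron_one_carrier[OF X] kron_one_carrier[OF A]]
      by (simp add: det_kron_one[OF c(1) k])
  qed
  then show ?thesis by (simp add: level_rank_def case_prod_unfold)
qed

lemma trace_form_kron_one:
  assumes X: "X \<in> carrier_mat N N" and k: "k > 0"
  shows "trace_form N (1 / of_nat k) r (X \<otimes>\<^sub>K 1\<^sub>m k) = trace_form N 1 r X"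
  using k unfolding trace_form_def kron_one_pow[OF X k] kron_one_trace[OF pow_carrier[OF X] k] by simp

text \<open>The derivative of the determinant at the identity is the trace. A permutation other than
  \<open>id\<close> moves at least two indices, so after differentiating one factor another factor
  is still 0.\<close>

lemma det_one_plus_DERIV:
  "((\<lambda>t. det (mat M M (\<lambda>(i, j). (if i = j then 1 else 0) + t * Z i j))) has_field_derivative (\<Sum>r<M. Z r r :: complex)) (at 0)"
proof -
  have "det (mat M M (\<lambda>(i, j). (if i = j then 1 else 0) + t * Z i j)) =
    (\<Sum>\<pi> | \<pi> permutes {..<M}. signof \<pi> * (\<Prod>r<M. (if r = \<pi> r then 1 else 0) + t * Z r (\<pi> r)))" for t :: complex
  proof -
    have "det (mat M M (\<lambda>(i, j). (if i = j then 1 else 0) + t * Z i j)) =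
      (\<Sum>\<pi> | \<pi> permutes {..<M}. signof \<pi> * (\<Prod>r<M. mat M M (\<lambda>(i, j). (if i = j then 1 else 0) + t * Z i j) $$ (r, \<pi> r)))"
      by (rule det_eq_sum) simp
    also have "\<dots> = (\<Sum>\<pi> | \<pi> permutes {..<M}. signof \<pi> * (\<Prod>r<M. (if r = \<pi> r then 1 else 0) + t * Z r (\<pi> r)))"
    proof (intro sum.cong refl arg_cong2[where f="(*)"] prod.cong)
      fix \<pi> r assume "\<pi> \<in> {\<pi>. \<pi> permutes {..<M}}" "r \<in> {..<M}"
      then have "r < M" "\<pi> r < M" using permutes_less[of \<pi> M r] by auto
      then show "mat M M (\<lambda>(i, j). (if i = j then 1 else 0) + t * Z i j) $$ (r, \<pi> r) = (if r = \<pi> r then 1 else 0) + t * Z r (\<pi> r)"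
        by simp
    qed
    finally show ?thesis .
  qed
  moreover have "((\<lambda>t. \<Sum>\<pi> | \<pi> permutes {..<M}. signof \<pi> * (\<Prod>r<M. (if r = \<pi> r then 1 else 0) + t * Z r (\<pi> r))) has_field_derivative
    (\<Sum>\<pi> | \<pi> permutes {..<M}. signof \<pi> * (\<Sum>r<M. Z r (\<pi> r) * (\<Prod>r'\<in>{..<M} - {r}. (if r' = \<pi> r' then 1 else 0) + 0 * Z r' (\<pi> r'))))) (at 0)"
    by (intro DERIV_sum DERIV_cmult has_field_derivative_prod) (auto intro!: derivative_eq_intros)
  moreover have "(\<Sum>\<pi> | \<pi> permutes {..<M}. signof \<pi> * (\<Sum>r<M. Z r (\<pi> r) * (\<Prod>r'\<in>{..<M} - {r}. (if r' = \<pi> r' then 1 else 0) + 0 * Z r' (\<pi> r'))))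
    = (\<Sum>\<pi> | \<pi> permutes {..<M}. if \<pi> = id then (\<Sum>r<M. Z r r) else 0)"
  proof (rule sum.cong[OF refl])
    fix \<pi> assume "\<pi> \<in> {\<pi>. \<pi> permutes {..<M}}"
    then have \<pi>: "\<pi> permutes {..<M}" by simp
    show "signof \<pi> * (\<Sum>r<M. Z r (\<pi> r) * (\<Prod>r'\<in>{..<M} - {r}. (if r' = \<pi> r' then 1 else 0) + 0 * Z r' (\<pi> r'))) =
      (if \<pi> = id then (\<Sum>r<M. Z r r) else 0)"
    proof (cases "\<pi> = id")
      case True
      then show ?thesis by (simp add: sign_id)
    next
      case False
      have z: "(\<Prod>r'\<in>{..<M} - {r}. (if r' = \<pi> r' then 1 else 0) + 0 * Z r' (\<pi> r')) = 0" if r: "r < M" for r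
      proof -
        have "\<exists>r'\<in>{..<M} - {r}. \<pi> r' \<noteq> r'"
        proof (rule ccontr)
          assume "\<not> ?thesis"
          then have fix_all: "\<pi> r' = r'" if "r' \<noteq> r" for r' using that \<pi> by (cases "r' < M") (auto simp: permutes_def)
          have "\<pi> r = r" using fix_all permutes_inj[OF \<pi>] by (metis injD)
          then have "\<pi> x = x" for x using fix_all[of x] by (cases "x = r") auto
          then have "\<pi> = id" by (simp add: fun_eq_iff)
          then show False using False by simp
        qed
        then obtain r' where r': "r' \<in> {..<M} - {r}" "\<pi> r' \<noteq> r'" by blast
        show ?thesis by (rule prod_zero) (use r' in \<open>auto intro!: bexI[of _ r']\<close>)
      qed
      have "(\<Sum>r<M. Z r (\<pi> r) * (\<Prod>r'\<in>{..<M} - {r}. (if r' = \<pi> r' then 1 else 0) + 0 * Z r' (\<pi> r'))) = 0"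
        by (intro sum.neutral ballI) (simp only: lessThan_iff z mult_zero_right)
      then show ?thesis using False by (simp only: if_False mult_zero_right)
    qed
  qed
  moreover have "(\<Sum>\<pi> | \<pi> permutes {..<M}. if \<pi> = id then (\<Sum>r<M. Z r r) else 0) = (\<Sum>r<M. Z r r)"
    by (simp add: sum.delta finite_permutations permutes_id)
  ultimately show ?thesis by (simp only:)
qed

lemma current_index:
  assumes y: "y \<in> carrier_mat k k" and ab: "a < k * n" "b < k * n"
  shows "(1\<^sub>m n \<otimes>\<^sub>K y) $$ (a, b) = (if a div k = b div k then y $$ (a mod k, b mod k) else 0 :: complex poly)"
proof -
  have "k > 0" using ab by (cases k) auto
  then show ?thesis
    using y ab block_div_less[OF ab(1)] block_div_less[OF ab(2)] by (simp add: kron_def mult.commute)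
qed

text \<open>
  At a point \<open>(X \<otimes> 1, A \<otimes> 1)\<close> the action of \<open>y\<close> is an infinitesimal change of basis
  \<open>1 + tZ\<close> that commutes with \<open>X \<otimes> 1\<close> and has \<open>tr Z = 0\<close>.
\<close>

lemma level_rank_gl_act_diag:
  assumes f: "f \<in> \<H> (k * N) (k * n) 1" and k: "k > 0" and y: "y \<in> sl_current k" and A: "A \<in> carrier_mat n N"
  shows "gl_act (k * N) (k * n) (1\<^sub>m n \<otimes>\<^sub>K y) f (mat_diag N x \<otimes>\<^sub>K 1\<^sub>m k, A \<otimes>\<^sub>K 1\<^sub>m k) = 0"
proof -
  define M where "M = k * N"
  define p where "p = k * n"
  define z where "z r = x (r div k)" for r
  define A' where "A' = A \<otimes>\<^sub>K 1\<^sub>m k"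
  \<comment> \<open>An action on the rows of \<open>A'\<close> through \<open>y\<close> is right
    multiplication by the transpose of \<open>y\<close>, taken at the eigenvalue of each site; hence
    the order of the two indices of \<open>y\<close>.\<close>
  define Z where "Z r j = (if r div k = j div k then poly (y $$ (j mod k, r mod k)) (z j) else 0)" for r j
  define h where "h t = mat M M (\<lambda>(i, j). (if i = j then 1 else 0) + t * Z i j)" for t :: complex
  let ?Y = "1\<^sub>m n \<otimes>\<^sub>K y"
  have yc: "y \<in> carrier_mat k k" and tr: "mat_trace y = 0" using y by (auto simp: sl_current_def)
  have fH: "f \<in> \<H> M p 1" using f by (simp add: M_def p_def)
  have A': "A' \<in> carrier_mat p M" unfolding A'_def M_def p_def by (rule kron_one_carrier[OF A])
  have hc: "h t \<in> carrier_mat M M" for t by (simp add: h_def)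
  have A'i: "A' $$ (b, j) = (if b mod k = j mod k then A $$ (b div k, j div k) else 0)" if "b < p" "j < M" for b j
    using kron_one_index[OF A] that by (simp add: A'_def M_def p_def)
  have dir: "gl_dir M p ?Y (mat_diag M z) A' b j = (\<Sum>r<M. A' $$ (b, r) * Z r j)" if b: "b < p" and j: "j < M" for b j
  proof -
    have bn: "b div k < n" and jN: "j div k < N" and mk: "b mod k < k" "j mod k < k"
      using block_div_less b j k by (auto simp: p_def M_def)
    have "gl_dir M p ?Y (mat_diag M z) A' b j = (\<Sum>a<p. poly (?Y $$ (a, b)) (z j) * A' $$ (a, j))"
      by (rule gl_dir_diag[OF j])
    also have "\<dots> = (\<Sum>b'<n. \<Sum>e<k. poly (?Y $$ (b' * k + e, b)) (z j) * A' $$ (b' * k + e, j))"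
      unfolding p_def by (rule sum_blocks[OF k])
    also have "\<dots> = (\<Sum>b'<n. \<Sum>e<k. if b' = b div k then (if e = j mod k then poly (y $$ (e, b mod k)) (z j) * A $$ (b', j div k) else 0) else 0)"
    proof (intro sum.cong refl)
      fix b' e assume "b' \<in> {..<n}" "e \<in> {..<k}"
      then have be: "b' < n" "e < k" by auto
      have i: "b' * k + e < p" unfolding p_def by (rule block_index_less[OF be])
      show "poly (?Y $$ (b' * k + e, b)) (z j) * A' $$ (b' * k + e, j) =
        (if b' = b div k then (if e = j mod k then poly (y $$ (e, b mod k)) (z j) * A $$ (b', j div k) else 0) else 0)"
        using be i b current_index[OF yc, of "b' * k + e" n b] by (simp add: A'i[OF i j] p_def)
    qed
    also have "\<dots> = (\<Sum>b'<n. if b' = b div k then (\<Sum>e<k. if e = j mod k then poly (y $$ (e, b mod k)) (z j) * A $$ (b', j div k) else 0) else 0)"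
      by (intro sum.cong refl) simp
    also have "\<dots> = poly (y $$ (j mod k, b mod k)) (z j) * A $$ (b div k, j div k)"
      using bn mk by simp
    also have "\<dots> = (\<Sum>l<N. if l = j div k then (\<Sum>e<k. if e = b mod k then A $$ (b div k, l) * poly (y $$ (j mod k, e)) (z j) else 0) else 0)"
      using jN mk by simp
    also have "\<dots> = (\<Sum>l<N. \<Sum>e<k. A' $$ (b, l * k + e) * Z (l * k + e) j)"
    proof (rule sum.cong[OF refl])
      fix l assume l: "l \<in> {..<N}"
      have "(\<Sum>e<k. A' $$ (b, l * k + e) * Z (l * k + e) j) =
        (\<Sum>e<k. if l = j div k then (if e = b mod k then A $$ (b div k, l) * poly (y $$ (j mod k, e)) (z j) else 0) else 0)"
      proof (rule sum.cong[OF refl])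
        fix e assume "e \<in> {..<k}"
        then have e: "e < k" by simp
        have i: "l * k + e < M" using l e block_index_less[of l N e k] by (simp add: M_def)
        show "A' $$ (b, l * k + e) * Z (l * k + e) j =
          (if l = j div k then (if e = b mod k then A $$ (b div k, l) * poly (y $$ (j mod k, e)) (z j) else 0) else 0)"
          using e by (simp add: A'i[OF b i] Z_def)
      qed
      then show "(if l = j div k then (\<Sum>e<k. if e = b mod k then A $$ (b div k, l) * poly (y $$ (j mod k, e)) (z j) else 0) else 0)
        = (\<Sum>e<k. A' $$ (b, l * k + e) * Z (l * k + e) j)" by simp
    qed
    also have "\<dots> = (\<Sum>r<M. A' $$ (b, r) * Z r j)"
      unfolding M_def by (rule sum_blocks[OF k, symmetric])
    finally show ?thesis .
  qed
  let ?B = "\<lambda>t. mat p M (\<lambda>(b, j). A' $$ (b, j) + t * gl_dir M p ?Y (mat_diag M z) A' b j)"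
  have B: "?B t = A' * h t" for t
  proof (rule eq_matI)
    fix b j assume "b < dim_row (A' * h t)" "j < dim_col (A' * h t)"
    then have bj: "b < p" "j < M" using A' hc[of t] by auto
    have "(A' * h t) $$ (b, j) = (\<Sum>r<M. A' $$ (b, r) * h t $$ (r, j))"
      by (rule mult_mat_entry_sum[OF A' hc bj])
    also have "\<dots> = (\<Sum>r<M. (if r = j then A' $$ (b, r) else 0) + t * (A' $$ (b, r) * Z r j))"
      using bj by (intro sum.cong refl) (simp add: h_def algebra_simps)
    also have "\<dots> = A' $$ (b, j) + t * (\<Sum>r<M. A' $$ (b, r) * Z r j)"
      using bj by (simp add: sum.distrib sum_distrib_left)
    finally show "?B t $$ (b, j) = (A' * h t) $$ (b, j)" using bj by (simp add: dir)
  qed (use A' hc[of t] in auto)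
  \<comment> \<open>\<open>Z\<close> links only columns over the same site, and these have equal
    eigenvalues.\<close>
  have comm: "mat_diag M z * h t = h t * mat_diag M z" for t
    unfolding mat_diag_mult_left[OF hc] mat_diag_mult_right[OF hc]
    by (intro eq_matI) (auto simp: h_def Z_def z_def)
  have eq: "f (mat_diag M z, ?B t) = det (h t) * f (mat_diag M z, A')" if nz: "det (h t) \<noteq> 0" for t
  proof -
    obtain g where g: "inv_pair M g (h t)"
    proof -
      obtain g where "g \<in> carrier_mat M M" "h t * g = 1\<^sub>m M" "g * h t = 1\<^sub>m M"
        using det_non_zero_imp_unit[OF hc nz, of undefined] by (auto simp: Units_def ring_mat_def)
      then show ?thesis using that hc by (auto simp: inv_pair_def)
    qed
    have gc: "g \<in> carrier_mat M M" "g * h t = 1\<^sub>m M" using g by (auto simp: inv_pair_def)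
    have "g * mat_diag M z * h t = g * (h t * mat_diag M z)"
      unfolding comm[symmetric] by (rule assoc_mult_mat[OF gc(1) mat_diag_dim hc])
    also have "\<dots> = (g * h t) * mat_diag M z" by (rule assoc_mult_mat[OF gc(1) hc mat_diag_dim, symmetric])
    also have "\<dots> = mat_diag M z" unfolding gc(2) by (rule left_mult_one_mat[OF mat_diag_dim])
    finally have X: "g * mat_diag M z * h t = mat_diag M z" .
    have "f (mat_diag M z, A' * h t) = inverse (det g ^ 1) * f (mat_diag M z, A')"
      using \<H>_equivariant[OF fH g mat_diag_dim[of M z] A'] unfolding X .
    moreover have "inverse (det g) = det (h t)" using inv_pair_det[OF g] by (metis inverse_unique)
    ultimately show ?thesis by (simp add: B)
  qed
  have deth: "((\<lambda>t. det (h t)) has_field_derivative 0) (at 0)"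
  proof -
    have "(\<Sum>r<M. Z r r) = (\<Sum>i<N. \<Sum>e<k. poly (y $$ (e, e)) (x i))"
      unfolding M_def sum_blocks[OF k] by (intro sum.cong refl) (simp add: Z_def z_def)
    also have "\<dots> = (\<Sum>i<N. poly (mat_trace y) (x i))"
      using yc by (simp add: mat_trace_def poly_sum)
    also have "\<dots> = 0" by (simp add: tr)
    finally show ?thesis using det_one_plus_DERIV[of M Z] by (simp add: h_def)
  qed
  have h0: "det (h 0) = 1"
  proof -
    have "h 0 = 1\<^sub>m M" by (intro eq_matI) (auto simp: h_def)
    then show ?thesis by simp
  qed
  \<comment> \<open>The change of basis \<open>h t\<close> is known to be invertible only near
    \<open>t = 0\<close>, so \<open>eq\<close> is used as an identity on a neighbourhood, which
    suffices for the derivative.\<close>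
  have "isCont (\<lambda>t. det (h t)) 0" using deth by (rule DERIV_isCont)
  then have "((\<lambda>t. det (h t)) \<longlongrightarrow> det (h 0)) (nhds 0)"
    by (simp only: tendsto_nhds_iff[of "\<lambda>t. det (h t)"] isCont_def)
  then have "eventually (\<lambda>t. det (h t) \<noteq> 0) (nhds 0)"
    by (rule tendsto_imp_eventually_ne) (simp add: h0)
  then have ev: "eventually (\<lambda>t. f (mat_diag M z, ?B t) = det (h t) * f (mat_diag M z, A')) (nhds 0)"
    by (rule eventually_mono) (rule eq)
  have "((\<lambda>t. det (h t) * f (mat_diag M z, A')) has_field_derivative 0 * f (mat_diag M z, A')) (at 0)"
    by (rule DERIV_cmult_right[OF deth])
  then have "((\<lambda>t. f (mat_diag M z, ?B t)) has_field_derivative 0) (at 0)"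
    using DERIV_cong_ev[OF refl ev refl] by simp
  moreover have "((\<lambda>t. f (mat_diag M z, ?B t)) has_field_derivative gl_act M p ?Y f (mat_diag M z, A')) (at 0)"
    by (rule gl_act_DERIV[OF \<H>_mat_polys[OF fH] mat_diag_dim A'])
  ultimately have "gl_act M p ?Y f (mat_diag M z, A') = 0" using DERIV_unique by blast
  moreover have "mat_diag N x \<otimes>\<^sub>K 1\<^sub>m k = mat_diag M z"
    unfolding kron_one_diag[OF k] by (simp add: M_def z_def[abs_def])
  ultimately show ?thesis by (simp add: M_def p_def A'_def)
qed

lemma alt_zero:
  assumes w: "\<And>r. r < M \<Longrightarrow> w r < p" and XA: "XA \<in> mat_pairs M p"
  shows "alt M p (\<lambda>z. 0) w XA = 0"
proof -
  have "alt M p (\<lambda>z. 0 * 0) w = (\<lambda>XA\<in>mat_pairs M p. 0 * alt M p (\<lambda>z. 0) w XA)"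
    by (rule alt_cmult[OF poly_maps_const w])
  then show ?thesis using XA by simp
qed

lemma sum_lessThan_add: "(\<Sum>i<a + b. f i) = (\<Sum>i<a. f i) + (\<Sum>i<b. f (a + i) :: 'a :: comm_monoid_add)" for a b :: nat
  by (induction b) (simp_all add: add.assoc)

section \<open>Functions that vanish in the coinvariants\<close>

locale level_rank_setting =
  fixes k n N :: nat
  assumes k_pos: "k > 0" and n_pos: "n > 0" and N_pos: "N > 0"
begin

abbreviation M :: nat where "M \<equiv> k * N"
abbreviation p :: nat where "p \<equiv> k * n"

text \<open>Restricting first allows sums and differences written as plain abstractions, which are
  not extensional.\<close>

definition negligible :: "(complex mat \<times> complex mat \<Rightarrow> complex) \<Rightarrow> bool" where
  "negligible f \<longleftrightarrow> restrict f (mat_pairs M p) \<in> sl_image k n N"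

lemma negligible_cong:
  "negligible f \<Longrightarrow> (\<And>XA. XA \<in> mat_pairs M p \<Longrightarrow> g XA = f XA) \<Longrightarrow> negligible g"
  unfolding negligible_def by (metis restrict_ext)

lemma negligibleI:
  fixes s :: nat
  assumes "\<And>i. i < s \<Longrightarrow> y i \<in> sl_current k \<and> f i \<in> \<H> M p 1"
  shows "negligible (\<lambda>XA. \<Sum>i<s. gl_act M p (1\<^sub>m n \<otimes>\<^sub>K y i) (f i) XA)"
  unfolding negligible_def sl_image_def using assms by blast

lemma negligibleE:
  assumes "negligible g"
  obtains s :: nat and y f where "\<forall>i<s. y i \<in> sl_current k \<and> f i \<in> \<H> M p 1"
    "\<forall>XA\<in>mat_pairs M p. g XA = (\<Sum>i<s. gl_act M p (1\<^sub>m n \<otimes>\<^sub>K y i) (f i) XA)"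
proof -
  obtain s :: nat and y f where syf: "\<forall>i<s. y i \<in> sl_current k \<and> f i \<in> \<H> M p 1"
    "restrict g (mat_pairs M p) = (\<lambda>XA\<in>mat_pairs M p. \<Sum>i<s. gl_act M p (1\<^sub>m n \<otimes>\<^sub>K y i) (f i) XA)"
    using assms unfolding negligible_def sl_image_def by blast
  have "g XA = (\<Sum>i<s. gl_act M p (1\<^sub>m n \<otimes>\<^sub>K y i) (f i) XA)" if "XA \<in> mat_pairs M p" for XA
    using fun_cong[OF syf(2), of XA] that by simp
  then show ?thesis using syf(1) that by blast
qed

lemma negligible_gl_act:
  assumes "y \<in> sl_current k" "f \<in> \<H> M p 1"
  shows "negligible (gl_act M p (1\<^sub>m n \<otimes>\<^sub>K y) f)"
  by (rule negligible_cong[OF negligibleI[of 1 "\<lambda>_. y" "\<lambda>_. f"]]) (use assms in auto)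

lemma negligible_zero: "negligible (\<lambda>XA. 0)"
  by (rule negligible_cong[OF negligibleI[of 0]]) auto

lemma negligible_add:
  assumes "negligible g" "negligible h"
  shows "negligible (\<lambda>XA. g XA + h XA)"
proof -
  obtain s :: nat and y f where "\<forall>i<s. y i \<in> sl_current k \<and> f i \<in> \<H> M p 1"
    "\<forall>XA\<in>mat_pairs M p. g XA = (\<Sum>i<s. gl_act M p (1\<^sub>m n \<otimes>\<^sub>K y i) (f i) XA)"
    by (rule negligibleE[OF assms(1)])
  note 1 = this[rule_format]
  obtain s' :: nat and y' f' where "\<forall>i<s'. y' i \<in> sl_current k \<and> f' i \<in> \<H> M p 1"
    "\<forall>XA\<in>mat_pairs M p. h XA = (\<Sum>i<s'. gl_act M p (1\<^sub>m n \<otimes>\<^sub>K y' i) (f' i) XA)"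
    by (rule negligibleE[OF assms(2)])
  note 2 = this[rule_format]
  let ?y = "\<lambda>i. if i < s then y i else y' (i - s)" and ?f = "\<lambda>i. if i < s then f i else f' (i - s)"
  show ?thesis
  proof (rule negligible_cong[OF negligibleI[of "s + s'" ?y ?f]])
    show "?y i \<in> sl_current k \<and> ?f i \<in> \<H> M p 1" if "i < s + s'" for i
      using that 1(1)[of i] 2(1)[of "i - s"] by (cases "i < s") auto
    show "g XA + h XA = (\<Sum>i<s + s'. gl_act M p (1\<^sub>m n \<otimes>\<^sub>K ?y i) (?f i) XA)" if XA: "XA \<in> mat_pairs M p" for XA
      unfolding sum_lessThan_add 1(2)[OF XA] 2(2)[OF XA] by simp
  qed
qed

text \<open>Multiplication by an invariant function of \<open>X\<close> commutes with all currents
  and preserves \<open>\<H> M p 1\<close>, so it can be moved into the summands. This makes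
  \<open>sl_image\<close> a submodule.\<close>

lemma negligible_mult_invariant:
  assumes "negligible g" and c: "(\<lambda>XA\<in>mat_pairs M p. c (fst XA)) \<in> mat_polys M p"
    and inv: "\<And>g h X. inv_pair M g h \<Longrightarrow> X \<in> carrier_mat M M \<Longrightarrow> c (g * X * h) = c X"
  shows "negligible (\<lambda>XA. c (fst XA) * g XA)"
proof -
  obtain s :: nat and y f where "\<forall>i<s. y i \<in> sl_current k \<and> f i \<in> \<H> M p 1"
    "\<forall>XA\<in>mat_pairs M p. g XA = (\<Sum>i<s. gl_act M p (1\<^sub>m n \<otimes>\<^sub>K y i) (f i) XA)"
    by (rule negligibleE[OF assms(1)])
  note 1 = this[rule_format]
  let ?f = "\<lambda>i. \<lambda>XA\<in>mat_pairs M p. c (fst XA) * f i XA"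
  show ?thesis
  proof (rule negligible_cong[OF negligibleI[of s y ?f]])
    show "y i \<in> sl_current k \<and> ?f i \<in> \<H> M p 1" if "i < s" for i
      using 1(1)[OF that] \<H>_mult_invariant[of "f i", OF _ c inv] by blast
    fix XA assume XA: "XA \<in> mat_pairs M p"
    then obtain X A where XA': "XA = (X, A)" "X \<in> carrier_mat M M" "A \<in> carrier_mat p M"
      unfolding mat_pairs_def by blast
    have "gl_act M p (1\<^sub>m n \<otimes>\<^sub>K y i) (?f i) XA = c (fst XA) * gl_act M p (1\<^sub>m n \<otimes>\<^sub>K y i) (f i) XA" if "i < s" for i
      using gl_act_mult_invariant[OF \<H>_mat_polys XA'(2,3) c, of "f i" 1 "1\<^sub>m n \<otimes>\<^sub>K y i"] 1(1)[OF that] by (simp add: XA'(1))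
    then show "c (fst XA) * g XA = (\<Sum>i<s. gl_act M p (1\<^sub>m n \<otimes>\<^sub>K y i) (?f i) XA)"
      unfolding 1(2)[OF XA] sum_distrib_left by (intro sum.cong refl) simp
  qed
qed

lemma negligible_cmult: "negligible g \<Longrightarrow> negligible (\<lambda>XA. c * g XA)"
  by (rule negligible_mult_invariant) (auto intro: mat_polys_intros)

lemma negligible_diff: "negligible g \<Longrightarrow> negligible h \<Longrightarrow> negligible (\<lambda>XA. g XA - h XA)"
  by (rule negligible_cong[OF negligible_add[OF _ negligible_cmult[of h "-1"]]]) auto

lemma negligible_sum: "(\<And>i. i \<in> A \<Longrightarrow> negligible (f i)) \<Longrightarrow> negligible (\<lambda>XA. \<Sum>i\<in>A. f i XA)"
  by (induction A rule: infinite_finite_induct) (auto intro: negligible_zero negligible_add)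

text \<open>By \<open>\<H>_eqI\<close> diagonal \<open>X\<close> suffice, where
  \<open>level_rank_gl_act_diag\<close> kills every summand. This makes the map on the coinvariants
  well defined.\<close>

lemma negligible_level_rank:
  assumes "negligible g"
  shows "level_rank k n N (restrict g (mat_pairs M p)) = (\<lambda>XA\<in>mat_pairs N n. 0)"
proof (rule \<H>_eqI)
  obtain s :: nat and y f where "\<forall>i<s. y i \<in> sl_current k \<and> f i \<in> \<H> M p 1"
    "\<forall>XA\<in>mat_pairs M p. g XA = (\<Sum>i<s. gl_act M p (1\<^sub>m n \<otimes>\<^sub>K y i) (f i) XA)"
    by (rule negligibleE[OF assms(1)])
  note 1 = this[rule_format]
  have "restrict g (mat_pairs M p) = (\<lambda>XA\<in>mat_pairs M p. \<Sum>i<s. gl_act M p (1\<^sub>m n \<otimes>\<^sub>K y i) (f i) XA)"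
    by (rule restrict_ext) (rule 1(2))
  moreover have "(\<lambda>XA\<in>mat_pairs M p. \<Sum>i<s. gl_act M p (1\<^sub>m n \<otimes>\<^sub>K y i) (f i) XA) \<in> \<H> M p 1"
    using 1(1) by (intro \<H>_sum gl_act_\<H>) simp
  ultimately show "level_rank k n N (restrict g (mat_pairs M p)) \<in> \<H> N n k"
    using level_rank_\<H> k_pos by simp
  show "(\<lambda>XA\<in>mat_pairs N n. 0) \<in> \<H> N n k" by (rule \<H>_zero)
  fix x and A :: "complex mat" assume A: "A \<in> carrier_mat n N"
  have mem: "(mat_diag N x \<otimes>\<^sub>K 1\<^sub>m k, A \<otimes>\<^sub>K 1\<^sub>m k) \<in> mat_pairs M p"
    using kron_one_carrier[OF mat_diag_dim[of N x], of k] kron_one_carrier[OF A, of k] by (simp add: mat_pairs_iff)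
  have "g (mat_diag N x \<otimes>\<^sub>K 1\<^sub>m k, A \<otimes>\<^sub>K 1\<^sub>m k) = 0"
    unfolding 1(2)[OF mem] using 1(1) level_rank_gl_act_diag[OF _ k_pos _ A] by (intro sum.neutral) auto
  then show "level_rank k n N (restrict g (mat_pairs M p)) (mat_diag N x, A) = (\<lambda>XA\<in>mat_pairs N n. 0) (mat_diag N x, A)"
    using A mem by (simp add: level_rank_apply mat_pairs_iff[of _ N n])
qed

subsection \<open>The ideal of relations in the coinvariants\<close>

text \<open>
  Columns and rows of colour \<open>c\<close> are those with index \<open>c\<close> modulo \<open>k\<close>. The word \<open>standard b\<close>
  has colour \<open>r mod k\<close> at position \<open>r\<close>.
\<close>

definition valid_rows :: "(nat \<Rightarrow> nat) \<Rightarrow> bool" where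
  "valid_rows b \<longleftrightarrow> (\<forall>r<M. b r < n)"

definition standard :: "(nat \<Rightarrow> nat) \<Rightarrow> nat \<Rightarrow> nat" where
  "standard b r = b r * k + r mod k"

lemma valid_rowsD: "valid_rows b \<Longrightarrow> r < M \<Longrightarrow> b r < n"
  by (simp add: valid_rows_def)

lemma standard_less: "valid_rows b \<Longrightarrow> r < M \<Longrightarrow> standard b r < p"
  unfolding standard_def using k_pos by (intro block_index_less) (auto simp: valid_rows_def)

abbreviation elt :: "((nat \<Rightarrow> complex) \<Rightarrow> complex) \<Rightarrow> (nat \<Rightarrow> nat) \<Rightarrow> complex mat \<times> complex mat \<Rightarrow> complex" where
  "elt q b \<equiv> alt M p q (standard b)"

lemma elt_add:
  "f \<in> poly_maps M \<Longrightarrow> g \<in> poly_maps M \<Longrightarrow> valid_rows b \<Longrightarrow> XA \<in> mat_pairs M p \<Longrightarrow>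
    elt (\<lambda>z. f z + g z) b XA = elt f b XA + elt g b XA"
  by (simp add: alt_add standard_less)

lemma elt_cmult:
  "f \<in> poly_maps M \<Longrightarrow> valid_rows b \<Longrightarrow> XA \<in> mat_pairs M p \<Longrightarrow> elt (\<lambda>z. c * f z) b XA = c * elt f b XA"
  by (simp add: alt_cmult standard_less)

lemma elt_sum:
  assumes "\<And>i. i \<in> A \<Longrightarrow> f i \<in> poly_maps M" "valid_rows b" "XA \<in> mat_pairs M p"
  shows "elt (\<lambda>z. \<Sum>i\<in>A. f i z) b XA = (\<Sum>i\<in>A. elt (f i) b XA)"
  using assms(3) alt_sum[of A f M "standard b" p, OF assms(1) standard_less[OF assms(2)]] by simp

lemma elt_diff:
  assumes "f \<in> poly_maps M" "g \<in> poly_maps M" "valid_rows b" "XA \<in> mat_pairs M p"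
  shows "elt (\<lambda>z. f z - g z) b XA = elt f b XA - elt g b XA"
proof -
  have "elt (\<lambda>z. f z + (-1) * g z) b XA = elt f b XA + (-1) * elt g b XA"
    using assms by (simp only: elt_add elt_cmult poly_maps_mult poly_maps_const)
  then show ?thesis by simp
qed

text \<open>The quantifier over cofactors \<open>q\<close> makes this an ideal of
  \<open>poly_maps M\<close> by construction, so that relations in the coinvariants can be handled
  by commutative algebra in the variables \<open>z\<close>.\<close>

definition rel_ideal :: "((nat \<Rightarrow> complex) \<Rightarrow> complex) set" where
  "rel_ideal = {g \<in> poly_maps M. \<forall>q\<in>poly_maps M. \<forall>b. valid_rows b \<longrightarrow> negligible (elt (\<lambda>z. g z * q z) b)}"

lemma rel_ideal_poly_maps: "g \<in> rel_ideal \<Longrightarrow> g \<in> poly_maps M"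
  by (simp add: rel_ideal_def)

lemma rel_idealD: "g \<in> rel_ideal \<Longrightarrow> q \<in> poly_maps M \<Longrightarrow> valid_rows b \<Longrightarrow> negligible (elt (\<lambda>z. g z * q z) b)"
  by (simp add: rel_ideal_def)

lemma rel_ideal_negligible: "g \<in> rel_ideal \<Longrightarrow> valid_rows b \<Longrightarrow> negligible (elt g b)"
  using rel_idealD[of g "\<lambda>_. 1" b] by (simp add: poly_maps_const)

lemma rel_idealI:
  "g \<in> poly_maps M \<Longrightarrow> (\<And>q b. q \<in> poly_maps M \<Longrightarrow> valid_rows b \<Longrightarrow> negligible (elt (\<lambda>z. g z * q z) b)) \<Longrightarrow> g \<in> rel_ideal"
  by (simp add: rel_ideal_def)

lemma rel_ideal_zero: "(\<lambda>z. 0) \<in> rel_ideal"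
proof (rule rel_idealI)
  show "(\<lambda>z. 0) \<in> poly_maps M" by (rule poly_maps_const)
  show "negligible (elt (\<lambda>z. 0 * q z) b)" if "valid_rows b" for q b
    by (rule negligible_cong[OF negligible_zero]) (simp add: alt_zero standard_less that)
qed

lemma rel_ideal_add:
  assumes f: "f \<in> rel_ideal" and g: "g \<in> rel_ideal"
  shows "(\<lambda>z. f z + g z) \<in> rel_ideal"
proof (rule rel_idealI)
  note fp = rel_ideal_poly_maps[OF f] and gp = rel_ideal_poly_maps[OF g]
  show "(\<lambda>z. f z + g z) \<in> poly_maps M" by (rule poly_maps_add[OF fp gp])
  fix q b assume q: "q \<in> poly_maps M" and b: "valid_rows b"
  show "negligible (elt (\<lambda>z. (f z + g z) * q z) b)"
    unfolding distrib_right
    by (rule negligible_cong[OF negligible_add[OF rel_idealD[OF f q b] rel_idealD[OF g q b]]])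
      (rule elt_add[OF poly_maps_mult[OF fp q] poly_maps_mult[OF gp q] b])
qed

lemma rel_ideal_mult:
  assumes f: "f \<in> rel_ideal" and g: "g \<in> poly_maps M"
  shows "(\<lambda>z. f z * g z) \<in> rel_ideal"
proof (rule rel_idealI)
  show "(\<lambda>z. f z * g z) \<in> poly_maps M" by (rule poly_maps_mult[OF rel_ideal_poly_maps[OF f] g])
  fix q b assume q: "q \<in> poly_maps M" and b: "valid_rows b"
  show "negligible (elt (\<lambda>z. f z * g z * q z) b)"
    unfolding mult.assoc by (rule rel_idealD[OF f poly_maps_mult[OF g q] b])
qed

lemma rel_ideal_mult_left:
  "f \<in> rel_ideal \<Longrightarrow> g \<in> poly_maps M \<Longrightarrow> (\<lambda>z. g z * f z) \<in> rel_ideal"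
  using rel_ideal_mult[of f g] by (simp only: mult.commute)

lemma rel_ideal_sum: "(\<And>i. i \<in> A \<Longrightarrow> f i \<in> rel_ideal) \<Longrightarrow> (\<lambda>z. \<Sum>i\<in>A. f i z) \<in> rel_ideal"
  by (induction A rule: infinite_finite_induct) (auto intro: rel_ideal_zero rel_ideal_add)

lemma rel_ideal_diff: "f \<in> rel_ideal \<Longrightarrow> g \<in> rel_ideal \<Longrightarrow> (\<lambda>z. f z - g z) \<in> rel_ideal"
  using rel_ideal_add[OF _ rel_ideal_mult_left[OF _ poly_maps_const[of "-1"]], of f g] by simp

text \<open>The matrix \<open>1\<^sub>m n \<otimes>\<^sub>K y\<close> is block diagonal: in a letter
  it keeps the block \<open>w r div k\<close> and changes only the colour
  \<open>w r mod k\<close>.\<close>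

lemma gl_act_current:
  assumes q: "q \<in> poly_maps M" and w: "\<And>r. r < M \<Longrightarrow> w r < p" and y: "y \<in> carrier_mat k k" and XA: "XA \<in> mat_pairs M p"
  shows "gl_act M p (1\<^sub>m n \<otimes>\<^sub>K y) (alt M p q w) XA =
    (\<Sum>r<M. \<Sum>e<k. alt M p (\<lambda>z. q z * poly (y $$ (e, w r mod k)) (z r)) (w(r := w r div k * k + e)) XA)"
proof -
  let ?Y = "1\<^sub>m n \<otimes>\<^sub>K y"
  have "gl_act M p ?Y (alt M p q w) XA =
    (\<Sum>r<M. \<Sum>c<p. alt M p (\<lambda>z. q z * poly (?Y $$ (c, w r)) (z r)) (w(r := c)) XA)"
    using XA by (simp add: gl_act_alt[OF q w])
  also have "\<dots> = (\<Sum>r<M. \<Sum>e<k. alt M p (\<lambda>z. q z * poly (y $$ (e, w r mod k)) (z r)) (w(r := w r div k * k + e)) XA)"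
  proof (rule sum.cong[OF refl])
    fix r assume "r \<in> {..<M}"
    then have r: "r < M" by simp
    have wr: "w r div k < n" using block_div_less[OF w[OF r]] .
    have "(\<Sum>c<p. alt M p (\<lambda>z. q z * poly (?Y $$ (c, w r)) (z r)) (w(r := c)) XA) =
      (\<Sum>b<n. \<Sum>e<k. alt M p (\<lambda>z. q z * poly (?Y $$ (b * k + e, w r)) (z r)) (w(r := b * k + e)) XA)"
      by (rule sum_blocks[OF k_pos])
    also have "\<dots> = (\<Sum>b<n. if b = w r div k then
        (\<Sum>e<k. alt M p (\<lambda>z. q z * poly (y $$ (e, w r mod k)) (z r)) (w(r := b * k + e)) XA) else 0)"
    proof (rule sum.cong[OF refl])
      fix b assume "b \<in> {..<n}"
      then have b: "b < n" by simp
      have Y: "?Y $$ (b * k + e, w r) = (if b = w r div k then y $$ (e, w r mod k) else 0)" if e: "e < k" for e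
        using current_index[OF y block_index_less[OF b e] w[OF r]] e by simp
      show "(\<Sum>e<k. alt M p (\<lambda>z. q z * poly (?Y $$ (b * k + e, w r)) (z r)) (w(r := b * k + e)) XA) =
        (if b = w r div k then (\<Sum>e<k. alt M p (\<lambda>z. q z * poly (y $$ (e, w r mod k)) (z r)) (w(r := b * k + e)) XA) else 0)"
      proof (cases "b = w r div k")
        case True
        then have "?Y $$ (b * k + e, w r) = y $$ (e, w r mod k)" if "e < k" for e
          using Y[OF that] by (simp only: if_True simp_thms)
        then show ?thesis unfolding if_P[OF True] by (intro sum.cong refl) (simp only: lessThan_iff)
      next
        case False
        have "alt M p (\<lambda>z. q z * poly (?Y $$ (b * k + e, w r)) (z r)) (w(r := b * k + e)) XA = 0" if e: "e < k" for e
        proof -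
          have "(w(r := b * k + e)) r' < p" if "r' < M" for r'
            using w[OF that] block_index_less[OF b e] by simp
          then show ?thesis using alt_zero[of M "w(r := b * k + e)" p XA] XA by (simp add: Y[OF e] False)
        qed
        then show ?thesis using False by simp
      qed
    qed
    also have "\<dots> = (\<Sum>e<k. alt M p (\<lambda>z. q z * poly (y $$ (e, w r mod k)) (z r)) (w(r := w r div k * k + e)) XA)"
      using wr by simp
    finally show "(\<Sum>c<p. alt M p (\<lambda>z. q z * poly (?Y $$ (c, w r)) (z r)) (w(r := c)) XA) =
      (\<Sum>e<k. alt M p (\<lambda>z. q z * poly (y $$ (e, w r mod k)) (z r)) (w(r := w r div k * k + e)) XA)" .
  qed
  finally show ?thesis .
qed

text \<open>The Cartan current \<open>E_aa - E_a'a'\<close> times \<open>z ^ m\<close>; both terms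
  cancel if \<open>a = a'\<close>.\<close>

definition diag_current :: "nat \<Rightarrow> nat \<Rightarrow> nat \<Rightarrow> complex poly mat" where
  "diag_current a a' m = mat k k (\<lambda>(i, j). if i = j then (if i = a then monom 1 m else 0) - (if i = a' then monom 1 m else 0) else 0)"

lemma diag_current_sl:
  assumes "a < k" "a' < k"
  shows "diag_current a a' m \<in> sl_current k"
  using assms by (simp add: diag_current_def sl_current_def mat_trace_def sum_subtractf)

text \<open>A diagonal current leaves every word unchanged, so it acts as multiplication by a
  polynomial: the power sum over the positions with letters of colour \<open>a\<close> minus that
  for \<open>a'\<close>.\<close>

lemma gl_act_diag_current:
  assumes q: "q \<in> poly_maps M" and w: "\<And>r. r < M \<Longrightarrow> w r < p" and XA: "XA \<in> mat_pairs M p"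
  shows "gl_act M p (1\<^sub>m n \<otimes>\<^sub>K diag_current a a' m) (alt M p q w) XA =
    alt M p (\<lambda>z. (\<Sum>r<M. (if w r mod k = a then z r ^ m else 0) - (if w r mod k = a' then z r ^ m else 0)) * q z) w XA"
proof -
  let ?h = "\<lambda>r z. (if w r mod k = a then z r ^ m else 0) - (if w r mod k = a' then z r ^ m else 0)"
  let ?y = "diag_current a a' m"
  have y: "?y \<in> carrier_mat k k" by (simp add: diag_current_def)
  have if_poly: "(\<lambda>z. if c then f z else 0) \<in> poly_maps M" if "f \<in> poly_maps M" for c f
    using that poly_maps_const by (cases c) simp_all
  have hp: "(\<lambda>z. ?h r z) \<in> poly_maps M" if "r < M" for r
    by (intro poly_maps_diff if_poly poly_maps_power poly_maps_var that)
  have "gl_act M p (1\<^sub>m n \<otimes>\<^sub>K ?y) (alt M p q w) XA =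
    (\<Sum>r<M. \<Sum>e<k. alt M p (\<lambda>z. q z * poly (?y $$ (e, w r mod k)) (z r)) (w(r := w r div k * k + e)) XA)"
    by (rule gl_act_current[OF q w y XA])
  also have "\<dots> = (\<Sum>r<M. \<Sum>e<k. if e = w r mod k then alt M p (\<lambda>z. ?h r z * q z) w XA else 0)"
  proof (intro sum.cong refl)
    fix r e assume "r \<in> {..<M}" "e \<in> {..<k}"
    then have r: "r < M" and e: "e < k" by auto
    have m: "w r mod k < k" using k_pos by simp
    show "alt M p (\<lambda>z. q z * poly (?y $$ (e, w r mod k)) (z r)) (w(r := w r div k * k + e)) XA =
      (if e = w r mod k then alt M p (\<lambda>z. ?h r z * q z) w XA else 0)"
    proof (cases "e = w r mod k")
      case True
      have "w(r := w r div k * k + e) = w" unfolding True by simp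
      moreover have "(\<lambda>z. q z * poly (?y $$ (e, w r mod k)) (z r)) = (\<lambda>z. ?h r z * q z)"
        using m by (simp add: True diag_current_def poly_monom fun_eq_iff)
      ultimately show ?thesis using True by (simp only: if_True simp_thms)
    next
      case False
      have "w r div k * k + e < p" by (rule block_index_less[OF block_div_less[OF w[OF r]] e])
      then have "(w(r := w r div k * k + e)) r' < p" if "r' < M" for r'
        using w[OF that] by simp
      then have "alt M p (\<lambda>z. 0) (w(r := w r div k * k + e)) XA = 0"
        using XA by (rule alt_zero)
      moreover have "(\<lambda>z. q z * poly (?y $$ (e, w r mod k)) (z r)) = (\<lambda>z. 0)"
        using m e False by (simp add: diag_current_def fun_eq_iff)
      ultimately show ?thesis using False by (simp only: if_False)
    qed
  qed
  also have "\<dots> = (\<Sum>r<M. alt M p (\<lambda>z. ?h r z * q z) w XA)"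
    using k_pos by simp
  also have "\<dots> = alt M p (\<lambda>z. \<Sum>r<M. ?h r z * q z) w XA"
    using alt_sum[of "{..<M}" "\<lambda>r z. ?h r z * q z" M w p] XA w poly_maps_mult[OF hp q] by simp
  also have "(\<lambda>z. \<Sum>r<M. ?h r z * q z) = (\<lambda>z. (\<Sum>r<M. ?h r z) * q z)"
    by (simp only: sum_distrib_right)
  finally show ?thesis .
qed

abbreviation colour_vars :: "nat \<Rightarrow> (nat \<Rightarrow> complex) \<Rightarrow> nat \<Rightarrow> complex" where
  "colour_vars a z i \<equiv> z (i * k + a)"

lemma sum_of_colour:
  assumes "a < k"
  shows "(\<Sum>r<M. if r mod k = a then g r else 0) = (\<Sum>i<N. g (i * k + a) :: complex)"
  unfolding sum_blocks[OF k_pos] using assms by (intro sum.cong refl) simp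

text \<open>In a standard word the letters of colour \<open>a\<close> occupy the positions
  \<open>i * k + a\<close>, so the Cartan current of degree \<open>m\<close> multiplies by exactly
  this difference.\<close>

lemma psum_diff_rel_ideal:
  assumes a: "a < k" and a': "a' < k"
  shows "(\<lambda>z. psum N (colour_vars a z) m - psum N (colour_vars a' z) m) \<in> rel_ideal"
proof (rule rel_idealI)
  show "(\<lambda>z. psum N (colour_vars a z) m - psum N (colour_vars a' z) m) \<in> poly_maps M"
    unfolding psum_def using a a'
    by (intro poly_maps_diff poly_maps_sum poly_maps_power poly_maps_var block_index_less) auto
  fix q b assume q: "q \<in> poly_maps M" and b: "valid_rows b"
  have "standard b r mod k = r mod k" for r by (simp add: standard_def)
  then have eq: "(\<Sum>r<M. (if standard b r mod k = a then z r ^ m else 0) - (if standard b r mod k = a' then z r ^ m else 0)) =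
    psum N (colour_vars a z) m - psum N (colour_vars a' z) m" for z :: "nat \<Rightarrow> complex"
    by (simp add: sum_subtractf sum_of_colour[OF a] sum_of_colour[OF a'] psum_def)
  show "negligible (elt (\<lambda>z. (psum N (colour_vars a z) m - psum N (colour_vars a' z) m) * q z) b)"
    using negligible_gl_act[OF diag_current_sl[OF a a', of m] alt_\<H>[OF q standard_less[OF b]]]
  proof (rule negligible_cong)
    fix XA assume XA: "XA \<in> mat_pairs M p"
    show "elt (\<lambda>z. (psum N (colour_vars a z) m - psum N (colour_vars a' z) m) * q z) b XA =
      gl_act M p (1\<^sub>m n \<otimes>\<^sub>K diag_current a a' m) (elt q b) XA"
      using gl_act_diag_current[where w="standard b", OF q standard_less[OF b] XA, of a a' m] by (simp only: eq)
  qed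
qed

text \<open>\<open>P u - P v\<close> lies in the ideal generated by the differences
  \<open>u i - v i\<close>, by induction on \<open>P\<close>. The cofactor \<open>E\<close> allows
  congruences that hold only after multiplication by \<open>E\<close>.\<close>

lemma poly_diff_ideal:
  assumes P: "P \<in> poly_maps L" and u: "\<And>i. i < L \<Longrightarrow> u i \<in> poly_maps M" and v: "\<And>i. i < L \<Longrightarrow> v i \<in> poly_maps M"
    and E: "E \<in> poly_maps M" and uv: "\<And>i. i < L \<Longrightarrow> (\<lambda>z. (u i z - v i z) * E z) \<in> rel_ideal"
  shows "(\<lambda>z. (P (\<lambda>i. u i z) - P (\<lambda>i. v i z)) * E z) \<in> rel_ideal"
  using P
proof (induction rule: poly_maps_induct)
  case (const c)
  then show ?case using rel_ideal_zero by simp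
next
  case (var i)
  then show ?case by (rule uv)
next
  case (add f g)
  have "(\<lambda>z. (f (\<lambda>i. u i z) + g (\<lambda>i. u i z) - (f (\<lambda>i. v i z) + g (\<lambda>i. v i z))) * E z) =
    (\<lambda>z. (f (\<lambda>i. u i z) - f (\<lambda>i. v i z)) * E z + (g (\<lambda>i. u i z) - g (\<lambda>i. v i z)) * E z)"
    by (simp add: fun_eq_iff algebra_simps)
  then show ?case using rel_ideal_add[OF add.IH] by (simp only:)
next
  case (mult f g)
  have "(\<lambda>z. (f (\<lambda>i. u i z) * g (\<lambda>i. u i z) - f (\<lambda>i. v i z) * g (\<lambda>i. v i z)) * E z) =
    (\<lambda>z. ((f (\<lambda>i. u i z) - f (\<lambda>i. v i z)) * E z) * g (\<lambda>i. u i z) + ((g (\<lambda>i. u i z) - g (\<lambda>i. v i z)) * E z) * f (\<lambda>i. v i z))"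
    by (simp add: fun_eq_iff algebra_simps)
  moreover have "(\<lambda>z. g (\<lambda>i. u i z)) \<in> poly_maps M" "(\<lambda>z. f (\<lambda>i. v i z)) \<in> poly_maps M"
    using poly_maps_subst[OF mult.hyps(2), of u] u poly_maps_subst[OF mult.hyps(1), of v] v by simp_all
  ultimately show ?case
    using rel_ideal_add[OF rel_ideal_mult[OF mult.IH(1)] rel_ideal_mult[OF mult.IH(2)]] by (simp only:)
qed

lemma colour_var_poly_maps: "a < k \<Longrightarrow> i < N \<Longrightarrow> (\<lambda>z. colour_vars a z i) \<in> poly_maps M"
  by (rule poly_maps_var) (rule block_index_less)

lemma psum_colour_poly_maps: "a < k \<Longrightarrow> (\<lambda>z. psum N (colour_vars a z) m) \<in> poly_maps M"
  unfolding psum_def by (intro poly_maps_sum poly_maps_power colour_var_poly_maps) auto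

lemma psum_alg_diff_rel_ideal:
  assumes s: "s \<in> psum_alg N" and a: "a < k" and a': "a' < k"
  shows "(\<lambda>z. s (colour_vars a z) - s (colour_vars a' z)) \<in> rel_ideal"
proof -
  obtain P where P: "P \<in> poly_maps N" "\<And>x. s x = P (\<lambda>i. psum N x (Suc i))"
    using s by (auto simp: psum_alg_def)
  have "(\<lambda>z. (P (\<lambda>i. psum N (colour_vars a z) (Suc i)) - P (\<lambda>i. psum N (colour_vars a' z) (Suc i))) * 1) \<in> rel_ideal"
    by (rule poly_diff_ideal[OF P(1)])
      (simp_all add: psum_colour_poly_maps a a' poly_maps_const psum_diff_rel_ideal)
  then show ?thesis by (simp add: P(2))
qed

text \<open>\<open>z r\<close> is a root of the polynomial belonging to its own colour. The
  coefficients of that polynomial are symmetric functions, so modulo the ideal they agree with those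
  belonging to the colour \<open>a\<close>.\<close>

lemma root_rel_ideal:
  assumes r: "r < M" and a: "a < k"
  shows "(\<lambda>z. \<Prod>i<N. z r - colour_vars a z i) \<in> rel_ideal"
proof -
  let ?a = "r mod k"
  have a': "?a < k" using k_pos by simp
  have "(\<lambda>z. \<Sum>l\<le>N. (coeff (root_poly N (colour_vars a z)) l - coeff (root_poly N (colour_vars ?a z)) l) * z r ^ l) \<in> rel_ideal"
    by (intro rel_ideal_sum rel_ideal_mult psum_alg_diff_rel_ideal coeff_root_poly_psum_alg a a' poly_maps_power poly_maps_var r)
  moreover have "(\<Sum>l\<le>N. (coeff (root_poly N (colour_vars a z)) l - coeff (root_poly N (colour_vars ?a z)) l) * z r ^ l) =
    (\<Prod>i<N. z r - colour_vars a z i)" for z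
  proof -
    have "(\<Sum>l\<le>N. (coeff (root_poly N (colour_vars a z)) l - coeff (root_poly N (colour_vars ?a z)) l) * z r ^ l) =
      poly (root_poly N (colour_vars a z)) (z r) - poly (root_poly N (colour_vars ?a z)) (z r)"
      by (simp add: poly_altdef degree_root_poly left_diff_distrib sum_subtractf)
    also have "poly (root_poly N (colour_vars ?a z)) (z r) = 0"
    proof -
      have "colour_vars ?a z (r div k) = z r" by simp
      then show ?thesis unfolding poly_root_poly
        by (intro prod_zero bexI[of _ "r div k"]) (simp_all add: block_div_less[OF r])
    qed
    finally show ?thesis by (simp add: poly_root_poly)
  qed
  ultimately show ?thesis by (simp only:)
qed

lemma ordered_disc_psum_alg: "ordered_disc N \<in> psum_alg N"
  by (rule symmetric_poly_psum_alg[OF ordered_disc_poly_maps ordered_disc_permute])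

end

section \<open>Lagrange interpolation with cleared denominators\<close>

definition node_diff :: "nat \<Rightarrow> (nat \<Rightarrow> complex) \<Rightarrow> nat \<Rightarrow> complex" where
  "node_diff N y i = (\<Prod>j\<in>{..<N} - {i}. y i - y j)"

text \<open>The quotient of \<open>ordered_disc N y\<close> by \<open>node_diff N y i\<close>,
  written as a polynomial.\<close>

definition node_coeff :: "nat \<Rightarrow> (nat \<Rightarrow> complex) \<Rightarrow> nat \<Rightarrow> complex" where
  "node_coeff N y i = (\<Prod>i'\<in>{..<N} - {i}. node_diff N y i')"

lemma ordered_disc_node_diff: "ordered_disc N y = (\<Prod>i<N. node_diff N y i)"
  by (simp add: ordered_disc_def node_diff_def)

text \<open>Interpolation of the constant 1 at the nodes \<open>y\<close>, multiplied by the
  discriminant to clear denominators. The second factor of the discriminant makes the identity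
  trivial for coinciding nodes; for distinct ones the difference of both sides has more roots than
  its degree permits.\<close>

lemma lagrange_identity:
  assumes N: "N > 0"
  shows "(\<Sum>i<N. ordered_disc N y * node_coeff N y i * (\<Prod>j\<in>{..<N} - {i}. t - y j)) = ordered_disc N y ^ 2"
proof (cases "ordered_disc N y = 0")
  case True
  then show ?thesis by simp
next
  case False
  define P where "P = (\<Sum>i<N. smult (node_coeff N y i) (\<Prod>j\<in>{..<N} - {i}. [:- y j, 1:])) - [:ordered_disc N y:]"
  have inj: "inj_on y {..<N}"
  proof (rule inj_onI, rule ccontr)
    fix i j assume ij: "i \<in> {..<N}" "j \<in> {..<N}" "y i = y j" "i \<noteq> j"
    then have "node_diff N y i = 0" unfolding node_diff_def by (intro prod_zero) auto
    then have "ordered_disc N y = 0" unfolding ordered_disc_node_diff using ij by (intro prod_zero) auto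
    then show False using False by simp
  qed
  have root: "poly P (y j) = 0" if j: "j < N" for j
  proof -
    have "(\<Sum>i<N. node_coeff N y i * (\<Prod>l\<in>{..<N} - {i}. y j - y l)) = (\<Sum>i<N. if i = j then ordered_disc N y else 0)"
    proof (rule sum.cong[OF refl])
      fix i assume i: "i \<in> {..<N}"
      show "node_coeff N y i * (\<Prod>l\<in>{..<N} - {i}. y j - y l) = (if i = j then ordered_disc N y else 0)"
      proof (cases "i = j")
        case True
        have "ordered_disc N y = node_diff N y j * node_coeff N y j"
          unfolding ordered_disc_node_diff node_coeff_def using j by (intro prod.remove) auto
        then show ?thesis using True by (simp add: node_diff_def mult.commute)
      next
        case False
        have "(\<Prod>l\<in>{..<N} - {i}. y j - y l) = 0" using j False by (intro prod_zero) auto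
        then show ?thesis using False by simp
      qed
    qed
    then show ?thesis using j by (simp add: P_def poly_sum poly_prod)
  qed
  have "P = 0"
  proof (rule ccontr)
    assume "P \<noteq> 0"
    have "degree (\<Prod>j\<in>{..<N} - {i}. [:- y j, 1:]) \<le> N - 1" if "i < N" for i
      using that by (subst degree_prod_eq_sum_degree) auto
    then have "degree (smult (node_coeff N y i) (\<Prod>j\<in>{..<N} - {i}. [:- y j, 1:])) \<le> N - 1" if "i < N" for i
      using that by (intro order_trans[OF degree_smult_le])
    then have "degree P \<le> N - 1"
      unfolding P_def by (intro degree_diff_le degree_sum_le) auto
    have "y ` {..<N} \<subseteq> {x. poly P x = 0}" using root by auto
    then have "card (y ` {..<N}) \<le> card {x. poly P x = 0}"
      using poly_roots_finite[OF \<open>P \<noteq> 0\<close>] by (rule card_mono[rotated])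
    also have "\<dots> \<le> degree P" using \<open>P \<noteq> 0\<close> by (rule card_poly_roots_bound)
    finally show False using \<open>degree P \<le> N - 1\<close> N by (simp add: card_image[OF inj])
  qed
  then have "poly P t = 0" by simp
  then have "(\<Sum>i<N. node_coeff N y i * (\<Prod>j\<in>{..<N} - {i}. t - y j)) = ordered_disc N y"
    by (simp add: P_def poly_sum poly_prod)
  then have "ordered_disc N y * (\<Sum>i<N. node_coeff N y i * (\<Prod>j\<in>{..<N} - {i}. t - y j)) = ordered_disc N y ^ 2"
    by (simp add: power2_eq_square)
  then show ?thesis by (simp only: sum_distrib_left mult.assoc)
qed

lemma node_diff_poly_maps: "i < N \<Longrightarrow> (\<lambda>y. node_diff N y i) \<in> poly_maps N"
  unfolding node_diff_def by (intro poly_maps_prod poly_maps_diff poly_maps_var) auto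

lemma node_coeff_poly_maps: "(\<lambda>y. node_coeff N y i) \<in> poly_maps N"
  unfolding node_coeff_def by (intro poly_maps_prod node_diff_poly_maps) auto

context level_rank_setting
begin

subsection \<open>Points of the coinvariants away from the discriminant\<close>

text \<open>
  Where the discriminant of the colour 0 variables \<open>x\<close> is nonzero, the zeros of the ideal are
  the points \<open>x \<circ> s\<close> for these \<open>s\<close>.
\<close>

definition good :: "(nat \<Rightarrow> nat) \<Rightarrow> bool" where
  "good s \<longleftrightarrow> (\<forall>r<M. s r < N) \<and> (\<forall>a<k. inj_on (\<lambda>i. s (i * k + a)) {..<N}) \<and> (\<forall>i<N. s (i * k) = i)"

definition vanishing :: "((nat \<Rightarrow> complex) \<Rightarrow> complex) \<Rightarrow> bool" where
  "vanishing h \<longleftrightarrow> h \<in> poly_maps M \<and> (\<forall>x s. good s \<longrightarrow> h (\<lambda>r. x (s r)) = 0)"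

abbreviation base :: "(nat \<Rightarrow> complex) \<Rightarrow> nat \<Rightarrow> complex" where
  "base z i \<equiv> z (i * k)"

lemma base_index_less: "i < N \<Longrightarrow> i * k < M"
  using block_index_less[of i N 0 k] k_pos by simp

lemma base_poly_maps: "q \<in> poly_maps N \<Longrightarrow> (\<lambda>z. q (base z)) \<in> poly_maps M"
  by (rule poly_maps_comp[where s="\<lambda>i. i * k", OF _ base_index_less])

lemma ordered_disc_diff_rel_ideal:
  assumes "a < k"
  shows "(\<lambda>z. ordered_disc N (base z) - ordered_disc N (colour_vars a z)) \<in> rel_ideal"
  using psum_alg_diff_rel_ideal[OF ordered_disc_psum_alg k_pos assms] by simp

lemma root_base_rel_ideal:
  assumes "r < M"
  shows "(\<lambda>z. \<Prod>i<N. z r - base z i) \<in> rel_ideal"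
  using root_rel_ideal[OF assms k_pos] by simp

text \<open>A product of Lagrange basis polynomials, one for each variable \<open>z r\<close> at the
  node \<open>s r\<close>: up to powers of the discriminant, the indicator of the point
  \<open>x \<circ> s\<close>.\<close>

definition sheet :: "(nat \<Rightarrow> nat) \<Rightarrow> (nat \<Rightarrow> complex) \<Rightarrow> complex" where
  "sheet s z = (\<Prod>r<M. ordered_disc N (base z) * node_coeff N (base z) (s r) * (\<Prod>j\<in>{..<N} - {s r}. z r - base z j))"

lemma sheet_factor_poly_maps:
  assumes "r < M"
  shows "(\<lambda>z. ordered_disc N (base z) * node_coeff N (base z) i * (\<Prod>j\<in>{..<N} - {i}. z r - base z j)) \<in> poly_maps M"
  by (intro poly_maps_mult base_poly_maps[OF ordered_disc_poly_maps] base_poly_maps[OF node_coeff_poly_maps]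
      poly_maps_prod poly_maps_diff poly_maps_var assms base_index_less) auto

lemma sheet_poly_maps: "sheet s \<in> poly_maps M"
  unfolding sheet_def[abs_def] by (intro poly_maps_prod sheet_factor_poly_maps) auto

text \<open>A partition of unity up to a discriminant power: multiply the Lagrange identities of all
  \<open>M\<close> variables and expand. Each contributes a square.\<close>

lemma sum_sheets: "(\<Sum>s\<in>{..<M} \<rightarrow>\<^sub>E {..<N}. sheet s z) = ordered_disc N (base z) ^ (2 * M)"
proof -
  have "(\<Sum>s\<in>{..<M} \<rightarrow>\<^sub>E {..<N}. sheet s z) =
    (\<Prod>r<M. \<Sum>i<N. ordered_disc N (base z) * node_coeff N (base z) i * (\<Prod>j\<in>{..<N} - {i}. z r - base z j))"
    unfolding sheet_def by (rule prod_sum_PiE[symmetric]) auto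
  also have "\<dots> = (\<Prod>r<M. ordered_disc N (base z) ^ 2)"
    by (simp only: lagrange_identity[OF N_pos])
  finally show ?thesis by (simp only: prod_constant card_lessThan power_mult)
qed

text \<open>The factor of \<open>sheet s\<close> at \<open>r\<close> is, up to constants in
  \<open>z r\<close>, the root polynomial of the colour 0 variables without one linear factor;
  restoring that factor gives an element of the ideal.\<close>

lemma sheet_root_rel_ideal:
  assumes r: "r < M" and sr: "s r < N"
  shows "(\<lambda>z. (z r - base z (s r)) * sheet s z) \<in> rel_ideal"
proof -
  let ?F = "\<lambda>r z. ordered_disc N (base z) * node_coeff N (base z) (s r) * (\<Prod>j\<in>{..<N} - {s r}. z r - base z j)"
  let ?G = "\<lambda>z. (\<Prod>r'\<in>{..<M} - {r}. ?F r' z) * (ordered_disc N (base z) * node_coeff N (base z) (s r))"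
  have "(z r - base z (s r)) * sheet s z = (\<Prod>i<N. z r - base z i) * ?G z" for z
  proof -
    have "sheet s z = ?F r z * (\<Prod>r'\<in>{..<M} - {r}. ?F r' z)"
      unfolding sheet_def using r by (intro prod.remove) auto
    moreover have "(\<Prod>i<N. z r - base z i) = (z r - base z (s r)) * (\<Prod>j\<in>{..<N} - {s r}. z r - base z j)"
      using sr by (intro prod.remove) auto
    ultimately show ?thesis by (simp only: mult_ac)
  qed
  moreover have "?G \<in> poly_maps M"
    by (intro poly_maps_mult poly_maps_prod sheet_factor_poly_maps base_poly_maps[OF ordered_disc_poly_maps] base_poly_maps[OF node_coeff_poly_maps]) auto
  ultimately show ?thesis using rel_ideal_mult[OF root_base_rel_ideal[OF r]] by (simp only:)
qed

text \<open>Modulo the ideal, on this sheet each \<open>z r\<close> may be replaced by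
  \<open>base z (s r)\<close>, and there \<open>g\<close> is 0.\<close>

lemma good_sheet_rel_ideal:
  assumes s: "good s" and g: "vanishing g"
  shows "(\<lambda>z. g z * sheet s z) \<in> rel_ideal"
proof -
  have gp: "g \<in> poly_maps M" and g0: "g (\<lambda>r. x (s r)) = 0" for x
    using g s by (auto simp: vanishing_def)
  have sl: "s r < N" if "r < M" for r using s that by (simp add: good_def)
  have "(\<lambda>z. (g (\<lambda>r. z r) - g (\<lambda>r. base z (s r))) * sheet s z) \<in> rel_ideal"
    by (rule poly_diff_ideal[OF gp])
      (simp_all add: poly_maps_var base_index_less sl sheet_poly_maps sheet_root_rel_ideal)
  moreover have "g (\<lambda>r. base z (s r)) = 0" for z by (rule g0)
  ultimately show ?thesis by simp
qed

text \<open>If \<open>s\<close> moves a colour 0 position off its site, the sheet has a zero factor.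
  Otherwise \<open>s\<close> identifies two variables of one colour; their difference divides the
  discriminant of that colour, which agrees modulo the ideal with the one for colour 0. This is
  where one more discriminant factor is spent.\<close>

lemma bad_sheet_rel_ideal:
  assumes s: "s \<in> {..<M} \<rightarrow>\<^sub>E {..<N}" and bad: "\<not> good s"
  shows "(\<lambda>z. ordered_disc N (base z) * sheet s z) \<in> rel_ideal"
proof -
  have sl: "s r < N" if "r < M" for r using s that by auto
  consider i where "i < N" "s (i * k) \<noteq> i" | a i j where "a < k" "i < N" "j < N" "i \<noteq> j" "s (i * k + a) = s (j * k + a)"
    using bad sl by (auto simp: good_def inj_on_def)
  then show ?thesis
  proof cases
    case 1
    have "sheet s z = 0" for z
    proof -
      have "(\<Prod>j\<in>{..<N} - {s (i * k)}. base z i - base z j) = 0"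
        using 1 by (intro prod_zero) auto
      then show ?thesis unfolding sheet_def
        using base_index_less[OF 1(1)] by (intro prod_zero bexI[of _ "i * k"]) auto
    qed
    then show ?thesis by (simp add: rel_ideal_zero)
  next
    case 2
    let ?r = "i * k + a" and ?r' = "j * k + a"
    have r: "?r < M" "?r' < M" using 2 block_index_less by auto
    have "(\<lambda>z. (z ?r - base z (s ?r)) * sheet s z - (z ?r' - base z (s ?r')) * sheet s z) \<in> rel_ideal"
      by (intro rel_ideal_diff sheet_root_rel_ideal r sl)
    then have d: "(\<lambda>z. (z ?r - z ?r') * sheet s z) \<in> rel_ideal"
      unfolding 2(5) by (simp add: algebra_simps)
    \<comment> \<open>The cofactor of \<open>x i - x j\<close> in the ordered discriminant.\<close>
    let ?H = "\<lambda>x. (\<Prod>i'\<in>{..<N} - {i}. node_diff N x i') * (\<Prod>j'\<in>{..<N} - {i} - {j}. x i - x j')"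
    have H: "ordered_disc N x = (x i - x j) * ?H x" for x
    proof -
      have "ordered_disc N x = node_diff N x i * (\<Prod>i'\<in>{..<N} - {i}. node_diff N x i')"
        unfolding ordered_disc_node_diff using 2 by (intro prod.remove) auto
      moreover have "node_diff N x i = (x i - x j) * (\<Prod>j'\<in>{..<N} - {i} - {j}. x i - x j')"
        unfolding node_diff_def using 2 by (intro prod.remove) auto
      ultimately show ?thesis by (simp only: mult_ac)
    qed
    have "?H \<in> poly_maps N"
      using 2 by (intro poly_maps_mult poly_maps_prod node_diff_poly_maps poly_maps_diff poly_maps_var) auto
    then have Hp: "(\<lambda>z. ?H (colour_vars a z)) \<in> poly_maps M"
      by (rule poly_maps_comp) (rule block_index_less[OF _ 2(1)])
    have "(\<lambda>z. (z ?r - z ?r') * sheet s z * ?H (colour_vars a z)) \<in> rel_ideal"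
      by (rule rel_ideal_mult[OF d Hp])
    moreover have "(z ?r - z ?r') * sheet s z * ?H (colour_vars a z) = ordered_disc N (colour_vars a z) * sheet s z" for z
      unfolding H[of "colour_vars a z"] by (simp only: mult_ac)
    ultimately have "(\<lambda>z. ordered_disc N (colour_vars a z) * sheet s z) \<in> rel_ideal" by (simp only:)
    moreover have "(\<lambda>z. (ordered_disc N (base z) - ordered_disc N (colour_vars a z)) * sheet s z) \<in> rel_ideal"
      by (rule rel_ideal_mult[OF ordered_disc_diff_rel_ideal[OF 2(1)] sheet_poly_maps])
    ultimately have "(\<lambda>z. (ordered_disc N (base z) - ordered_disc N (colour_vars a z)) * sheet s z + ordered_disc N (colour_vars a z) * sheet s z) \<in> rel_ideal"
      by (rule rel_ideal_add[rotated])
    then show ?thesis by (simp add: left_diff_distrib)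
  qed
qed

lemma vanishing_poly_maps: "vanishing g \<Longrightarrow> g \<in> poly_maps M"
  by (simp add: vanishing_def)

lemma vanishing_ordered_disc_rel_ideal:
  assumes g: "vanishing g"
  shows "(\<lambda>z. ordered_disc N (base z) ^ (2 * M + 1) * g z) \<in> rel_ideal"
proof -
  note gp = vanishing_poly_maps[OF g]
  have dp: "(\<lambda>z. ordered_disc N (base z)) \<in> poly_maps M" by (rule base_poly_maps[OF ordered_disc_poly_maps])
  have "(\<lambda>z. \<Sum>s\<in>{..<M} \<rightarrow>\<^sub>E {..<N}. ordered_disc N (base z) * sheet s z * g z) \<in> rel_ideal"
  proof (rule rel_ideal_sum)
    fix s assume s: "s \<in> {..<M} \<rightarrow>\<^sub>E {..<N}"
    show "(\<lambda>z. ordered_disc N (base z) * sheet s z * g z) \<in> rel_ideal"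
    proof (cases "good s")
      case True
      from rel_ideal_mult_left[OF good_sheet_rel_ideal[OF True g] dp]
      show ?thesis by (simp only: mult_ac)
    next
      case False
      show ?thesis by (rule rel_ideal_mult[OF bad_sheet_rel_ideal[OF s False] gp])
    qed
  qed
  moreover have "(\<Sum>s\<in>{..<M} \<rightarrow>\<^sub>E {..<N}. ordered_disc N (base z) * sheet s z * g z) = ordered_disc N (base z) ^ (2 * M + 1) * g z" for z
  proof -
    have "(\<Sum>s\<in>{..<M} \<rightarrow>\<^sub>E {..<N}. ordered_disc N (base z) * sheet s z * g z) =
      ordered_disc N (base z) * (\<Sum>s\<in>{..<M} \<rightarrow>\<^sub>E {..<N}. sheet s z) * g z"
      by (simp only: sum_distrib_left sum_distrib_right)
    then show ?thesis unfolding sum_sheets by simp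
  qed
  ultimately show ?thesis by (simp only:)
qed

text \<open>The scalar by which \<open>Disc N\<close> acts on the source at a diagonal matrix. It is
  symmetric in all \<open>M\<close> variables, unlike \<open>ordered_disc N (base z)\<close>, and so
  is compatible with \<open>alt\<close> and with relabelling positions.\<close>

definition disc_fun :: "(nat \<Rightarrow> complex) \<Rightarrow> complex" where
  "disc_fun z = trace_form N (1 / of_nat k) (Disc N) (mat_diag M z)"

text \<open>
  In \<open>vanishing_ordered_disc_rel_ideal\<close>, the sheets sum to the power \<open>2 * M\<close>, and the sheets
  that are not good need one more factor.
\<close>

definition disc_exp :: nat where "disc_exp = 2 * M + 1"

lemma disc_fun_eq: "disc_fun z = power_sum_form N (Disc N) (vec N (\<lambda>i. 1 / of_nat k * psum M z (Suc i)))"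
  unfolding disc_fun_def trace_form_def mat_diag_pow by (simp add: mat_trace_def mat_diag_def psum_def)

lemma disc_fun_poly: "\<exists>Q\<in>poly_maps N. (\<forall>z. disc_fun z = Q (\<lambda>i. 1 / of_nat k * psum M z (Suc i))) \<and>
    (\<forall>x. Disc N (vec N x) = Q (\<lambda>i. psum N x (Suc i)))"
proof (intro bexI conjI allI)
  show "(\<lambda>x. power_sum_form N (Disc N) (vec N x)) \<in> poly_maps N"
    by (intro vec_polys_poly_maps power_sum_form_vec_polys Disc_sym_polys)
qed (simp_all add: disc_fun_eq power_sum_form_psum Disc_sym_polys)

lemma disc_fun_poly_maps: "disc_fun \<in> poly_maps M"
proof -
  obtain Q where Q: "Q \<in> poly_maps N" "\<And>z. disc_fun z = Q (\<lambda>i. 1 / of_nat k * psum M z (Suc i))" using disc_fun_poly by blast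
  have "(\<lambda>z. Q (\<lambda>i. 1 / of_nat k * psum M z (Suc i))) \<in> poly_maps M"
    unfolding psum_def
    by (intro poly_maps_subst[OF Q(1)] poly_maps_mult poly_maps_const poly_maps_sum poly_maps_power poly_maps_var) auto
  then show ?thesis by (simp add: Q(2)[abs_def] flip: Q(2))
qed

lemma disc_fun_permute:
  assumes "\<pi> permutes {..<M}"
  shows "disc_fun (\<lambda>i. z (\<pi> i)) = disc_fun z"
proof -
  have "psum M (\<lambda>i. z (\<pi> i)) m = psum M z m" for m
    unfolding psum_def by (rule sum.reindex_bij_betw[OF permutes_imp_bij[OF assms]])
  then show ?thesis by (simp add: disc_fun_eq)
qed

text \<open>\<open>1 / k\<close> times the power sum of all variables is the average of the power
  sums of the \<open>k\<close> colours, and each of these agrees with that of colour 0 modulo the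
  ideal. The sign \<open>e\<close> relates \<open>Disc\<close> to
  \<open>ordered_disc\<close>.\<close>

lemma disc_fun_rel_ideal: "\<exists>e. e * e = 1 \<and> (\<lambda>z. disc_fun z - e * ordered_disc N (base z)) \<in> rel_ideal"
proof -
  obtain e where e: "e * e = 1" "\<And>x. Disc N (vec N x) = e * ordered_disc N x" using ordered_disc_eq by blast
  obtain Q where Q: "Q \<in> poly_maps N" "\<And>z. disc_fun z = Q (\<lambda>i. 1 / of_nat k * psum M z (Suc i))"
    "\<And>x. Disc N (vec N x) = Q (\<lambda>i. psum N x (Suc i))" using disc_fun_poly by blast
  have pM: "psum M z m = (\<Sum>a<k. psum N (colour_vars a z) m)" for z m
    unfolding psum_def sum_blocks[OF k_pos] by (rule sum.swap)
  have up: "(\<lambda>z. 1 / of_nat k * psum M z m) \<in> poly_maps M" for m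
    unfolding psum_def by (intro poly_maps_mult poly_maps_const poly_maps_sum poly_maps_power poly_maps_var) auto
  have vp: "(\<lambda>z. psum N (base z) m) \<in> poly_maps M" for m
    using psum_colour_poly_maps[OF k_pos] by simp
  have "(\<lambda>z. 1 / of_nat k * psum M z m - psum N (base z) m) \<in> rel_ideal" for m
  proof -
    have "(\<lambda>z. 1 / of_nat k * (\<Sum>a<k. psum N (colour_vars a z) m - psum N (colour_vars 0 z) m)) \<in> rel_ideal"
      by (intro rel_ideal_mult_left poly_maps_const rel_ideal_sum psum_diff_rel_ideal k_pos) simp
    moreover have "1 / of_nat k * (\<Sum>a<k. psum N (colour_vars a z) m - psum N (colour_vars 0 z) m) =
      1 / of_nat k * psum M z m - psum N (base z) m" for z
      using k_pos by (simp add: pM sum_subtractf right_diff_distrib)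
    ultimately show ?thesis by (simp only:)
  qed
  then have "(\<lambda>z. (Q (\<lambda>i. 1 / of_nat k * psum M z (Suc i)) - Q (\<lambda>i. psum N (base z) (Suc i))) * 1) \<in> rel_ideal"
    by (intro poly_diff_ideal[OF Q(1)] up vp poly_maps_const) simp
  then have "(\<lambda>z. disc_fun z - e * ordered_disc N (base z)) \<in> rel_ideal"
    by (simp only: Q(2)[symmetric] Q(3)[symmetric] e(2) mult_1_right)
  then show ?thesis using e(1) by blast
qed

lemma disc_fun_power_rel_ideal: "\<exists>e. e * e = 1 \<and> (\<forall>m. (\<lambda>z. disc_fun z ^ m - (e * ordered_disc N (base z)) ^ m) \<in> rel_ideal)"
proof -
  obtain e where e: "e * e = 1" "(\<lambda>z. disc_fun z - e * ordered_disc N (base z)) \<in> rel_ideal" using disc_fun_rel_ideal by blast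
  have vp: "(\<lambda>z. e * ordered_disc N (base z)) \<in> poly_maps M"
    by (intro poly_maps_mult poly_maps_const base_poly_maps[OF ordered_disc_poly_maps])
  have "(\<lambda>z. (disc_fun z ^ m - (e * ordered_disc N (base z)) ^ m) * 1) \<in> rel_ideal" for m :: nat
  proof (rule poly_diff_ideal[where L=1 and P="\<lambda>x. x 0 ^ m" and u="\<lambda>i. disc_fun" and v="\<lambda>i z. e * ordered_disc N (base z)" and E="\<lambda>z. 1"])
    show "(\<lambda>x. x 0 ^ m) \<in> poly_maps 1" by (intro poly_maps_power poly_maps_var) simp
    show "(\<lambda>z. (disc_fun z - e * ordered_disc N (base z)) * 1) \<in> rel_ideal" using e(2) by (simp only: mult_1_right)
  qed (rule disc_fun_poly_maps vp poly_maps_const)+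
  then have "(\<lambda>z. disc_fun z ^ m - (e * ordered_disc N (base z)) ^ m) \<in> rel_ideal" for m :: nat
    by (simp only: mult_1_right)
  then show ?thesis using e(1) by blast
qed

lemma vanishing_rel_ideal:
  assumes g: "vanishing g"
  shows "(\<lambda>z. disc_fun z ^ disc_exp * g z) \<in> rel_ideal"
proof -
  obtain e where e: "(\<lambda>z. disc_fun z ^ disc_exp - (e * ordered_disc N (base z)) ^ disc_exp) \<in> rel_ideal"
    using disc_fun_power_rel_ideal by blast
  note gp = vanishing_poly_maps[OF g]
  have "(\<lambda>z. (disc_fun z ^ disc_exp - (e * ordered_disc N (base z)) ^ disc_exp) * g z + e ^ disc_exp * (ordered_disc N (base z) ^ disc_exp * g z)) \<in> rel_ideal"
    unfolding disc_exp_def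
    by (intro rel_ideal_add rel_ideal_mult[OF e[unfolded disc_exp_def] gp] rel_ideal_mult_left poly_maps_const
        vanishing_ordered_disc_rel_ideal g)
  then show ?thesis by (simp add: left_diff_distrib power_mult_distrib mult.assoc)
qed

lemma vanishing_negligible:
  "vanishing g \<Longrightarrow> valid_rows b \<Longrightarrow> negligible (elt (\<lambda>z. disc_fun z ^ disc_exp * g z) b)"
  by (rule rel_ideal_negligible[OF vanishing_rel_ideal])

subsection \<open>Separating the sites\<close>

text \<open>The site of the position \<open>r\<close> is \<open>r div k\<close>.\<close>

definition sep :: "(nat \<Rightarrow> complex) \<Rightarrow> complex" where
  "sep z = (\<Prod>r<M. \<Prod>r'\<in>{r'. r' < M \<and> r' div k \<noteq> r div k}. z r - z r')"

lemma sep_poly_maps: "sep \<in> poly_maps M"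
  unfolding sep_def[abs_def] by (intro poly_maps_prod poly_maps_diff poly_maps_var) auto

lemma sep_eq_0:
  assumes "r < M" "r' < M" "r div k \<noteq> r' div k" "z r = z r'"
  shows "sep z = 0"
proof -
  have "(\<Prod>r'\<in>{r'. r' < M \<and> r' div k \<noteq> r div k}. z r - z r') = 0"
    using assms by (intro prod_zero) auto
  then have "\<exists>r\<in>{..<M}. (\<Prod>r'\<in>{r'. r' < M \<and> r' div k \<noteq> r div k}. z r - z r') = 0"
    using assms(1) by (intro bexI[of _ r]) (simp_all only: lessThan_iff)
  then show ?thesis unfolding sep_def by (intro prod_zero finite_lessThan)
qed

text \<open>The factors of \<open>sep\<close> belong to the ordered pairs of positions over distinct
  sites, and such a \<open>\<sigma>\<close> permutes these pairs.\<close>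

lemma sep_permute:
  assumes \<sigma>: "\<sigma> permutes {..<M}" and site: "\<And>r r'. r < M \<Longrightarrow> r' < M \<Longrightarrow> \<sigma> r div k = \<sigma> r' div k \<longleftrightarrow> r div k = r' div k"
  shows "sep (\<lambda>r. z (\<sigma> r)) = sep z"
proof -
  have "(\<Prod>r'\<in>{r'. r' < M \<and> r' div k \<noteq> r div k}. z (\<sigma> r) - z (\<sigma> r')) =
    (\<Prod>r'\<in>{r'. r' < M \<and> r' div k \<noteq> \<sigma> r div k}. z (\<sigma> r) - z r')" if r: "r < M" for r
  proof (rule prod.reindex_bij_betw[of \<sigma>])
    show "bij_betw \<sigma> {r'. r' < M \<and> r' div k \<noteq> r div k} {r'. r' < M \<and> r' div k \<noteq> \<sigma> r div k}"
    proof (rule bij_betw_imageI)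
      show "inj_on \<sigma> {r'. r' < M \<and> r' div k \<noteq> r div k}" by (rule permutes_inj_on[OF \<sigma>])
      show "\<sigma> ` {r'. r' < M \<and> r' div k \<noteq> r div k} = {r'. r' < M \<and> r' div k \<noteq> \<sigma> r div k}"
      proof (intro equalityI subsetI)
        fix v assume "v \<in> \<sigma> ` {r'. r' < M \<and> r' div k \<noteq> r div k}"
        then obtain u where "v = \<sigma> u" "u < M" "u div k \<noteq> r div k" by blast
        then show "v \<in> {r'. r' < M \<and> r' div k \<noteq> \<sigma> r div k}"
          using site[of u r] r permutes_less[OF \<sigma>, of u] by simp
      next
        fix v assume v: "v \<in> {r'. r' < M \<and> r' div k \<noteq> \<sigma> r div k}"
        obtain u where u: "u < M" "\<sigma> u = v"
          using permutes_image[OF \<sigma>] v by (metis (no_types, lifting) imageE lessThan_iff mem_Collect_eq)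
        then show "v \<in> \<sigma> ` {r'. r' < M \<and> r' div k \<noteq> r div k}"
          using site[of u r] r v by (intro image_eqI[of _ _ u]) auto
      qed
    qed
  qed
  then have "sep (\<lambda>r. z (\<sigma> r)) = (\<Prod>r<M. \<Prod>r'\<in>{r'. r' < M \<and> r' div k \<noteq> \<sigma> r div k}. z (\<sigma> r) - z r')"
    unfolding sep_def by (intro prod.cong[OF refl, of "{..<M}"]) (simp only: lessThan_iff)
  also have "\<dots> = sep z"
    unfolding sep_def by (rule prod.reindex_bij_betw) (rule permutes_imp_bij[OF \<sigma>])
  finally show ?thesis .
qed

text \<open>Each ordered pair of distinct sites is met by \<open>k * k\<close> ordered pairs of
  positions.\<close>

lemma sep_sites: "sep (\<lambda>r. u (r div k)) = ordered_disc N u ^ (k * k)"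
proof -
  have "(\<Prod>r'\<in>{r'. r' < M \<and> r' div k \<noteq> i}. u i - u (r' div k)) = (\<Prod>j\<in>{..<N} - {i}. u i - u j) ^ k" for i
  proof -
    have "(\<Prod>r'\<in>{r'. r' < M \<and> r' div k \<noteq> i}. u i - u (r' div k)) =
      (\<Prod>r'\<in>{..<M} \<inter> {r'. r' div k \<noteq> i}. u i - u (r' div k))" by (rule prod.cong) auto
    also have "\<dots> = (\<Prod>r'<M. if r' div k \<noteq> i then u i - u (r' div k) else 1)"
      by (subst prod.inter_restrict) auto
    also have "\<dots> = (\<Prod>j<N. if j \<noteq> i then u i - u j else 1) ^ k"
    proof -
      have "(\<Prod>r'<M. if r' div k \<noteq> i then u i - u (r' div k) else 1) = (\<Prod>j<N. \<Prod>a<k. if j \<noteq> i then u i - u j else 1)"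
        unfolding prod_blocks[OF k_pos] by (intro prod.cong refl) simp
      then show ?thesis by (simp only: prod_constant card_lessThan prod_power_distrib)
    qed
    also have "(\<Prod>j<N. if j \<noteq> i then u i - u j else 1) = (\<Prod>j\<in>{..<N} \<inter> {j. j \<noteq> i}. u i - u j)"
      by (subst prod.inter_restrict) auto
    also have "{..<N} \<inter> {j. j \<noteq> i} = {..<N} - {i}" by auto
    finally show ?thesis .
  qed
  then have "sep (\<lambda>r. u (r div k)) = (\<Prod>r<M. (\<Prod>j\<in>{..<N} - {r div k}. u (r div k) - u j) ^ k)"
    by (simp add: sep_def)
  also have "\<dots> = (\<Prod>i<N. ((\<Prod>j\<in>{..<N} - {i}. u i - u j) ^ k) ^ k)"
  proof -
    have "(\<Prod>r<M. (\<Prod>j\<in>{..<N} - {r div k}. u (r div k) - u j) ^ k) = (\<Prod>i<N. \<Prod>a<k. (\<Prod>j\<in>{..<N} - {i}. u i - u j) ^ k)"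
      unfolding prod_blocks[OF k_pos] by (intro prod.cong refl) simp
    then show ?thesis by (simp only: prod_constant card_lessThan)
  qed
  finally show ?thesis by (simp add: ordered_disc_def prod_power_distrib power_mult)
qed

text \<open>If \<open>s r\<close> is not the site of \<open>r\<close>, then \<open>r\<close> and the
  colour 0 position over the site \<open>s r\<close> lie over different sites but have the same
  value under \<open>s\<close>, so a factor of \<open>sep\<close> is 0.\<close>

lemma good_sep:
  assumes s: "good s" and nz: "sep (\<lambda>r. x (s r)) \<noteq> 0" and r: "r < M"
  shows "s r = r div k"
proof (rule ccontr)
  assume ne: "s r \<noteq> r div k"
  have sr: "s r < N" using s r by (simp add: good_def)
  have "s (s r * k) = s r" using s sr by (simp add: good_def)
  then have "sep (\<lambda>r. x (s r)) = 0"
    using ne k_pos by (intro sep_eq_0[OF r base_index_less[OF sr]]) auto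
  then show False using nz by simp
qed

text \<open>Multiplication by \<open>sep\<close> leaves one point to be checked, the one with
  \<open>s r = r div k\<close>. Hence a factor next to \<open>sep\<close> may be exchanged for any
  polynomial with the same values there.\<close>

lemma vanishing_sep:
  assumes h: "h \<in> poly_maps M" and z: "\<And>x. h (\<lambda>r. x (r div k)) = 0"
  shows "vanishing (\<lambda>z. sep z * h z)"
  unfolding vanishing_def
proof (intro conjI allI impI)
  show "(\<lambda>z. sep z * h z) \<in> poly_maps M" by (rule poly_maps_mult[OF sep_poly_maps h])
  fix x s assume s: "good s"
  show "sep (\<lambda>r. x (s r)) * h (\<lambda>r. x (s r)) = 0"
  proof (cases "sep (\<lambda>r. x (s r)) = 0")
    case False
    have "h (\<lambda>r. x (s r)) = h (\<lambda>r. x (r div k))"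
      by (rule poly_maps_cong[OF h]) (simp add: good_sep[OF s False])
    then show ?thesis using z by simp
  qed simp
qed

end

text \<open>Dedekind's independence of characters: translate the relation by \<open>a0\<close> and
  subtract \<open>f0 a0\<close> times the original, which removes \<open>f0\<close> and multiplies
  the coefficient of \<open>g\<close> by \<open>g a0 - f0 a0\<close>.\<close>

lemma multiplicative_independent:
  fixes c :: "('a \<Rightarrow> complex) \<Rightarrow> complex"
  assumes "finite F" "\<And>f a b. f \<in> F \<Longrightarrow> f (m a b) = f a * f b" "\<And>f. f \<in> F \<Longrightarrow> \<exists>a. f a \<noteq> 0"
    and "\<And>a. (\<Sum>f\<in>F. c f * f a) = 0" and "f \<in> F"
  shows "c f = 0"
  using assms
proof (induction F arbitrary: c f rule: finite_induct)
  case empty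
  then show ?case by simp
next
  case (insert f0 F)
  have F: "c g = 0" if g: "g \<in> F" for g
  proof -
    have "g \<noteq> f0" using g insert.hyps by auto
    then obtain a0 where a0: "g a0 \<noteq> f0 a0" by blast
    have "(\<Sum>f\<in>F. (c f * (f a0 - f0 a0)) * f a) = 0" for a
    proof -
      have "(\<Sum>f\<in>insert f0 F. c f * f (m a0 a)) - f0 a0 * (\<Sum>f\<in>insert f0 F. c f * f a) = 0"
        by (simp only: insert.prems(3)) simp
      moreover have "(\<Sum>f\<in>insert f0 F. c f * f (m a0 a)) = (\<Sum>f\<in>insert f0 F. c f * (f a0 * f a))"
        by (rule sum.cong[OF refl]) (simp only: insert.prems(1))
      ultimately have "(\<Sum>f\<in>insert f0 F. c f * (f a0 * f a) - f0 a0 * (c f * f a)) = 0"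
        by (simp only: sum_subtractf sum_distrib_left)
      then show ?thesis using insert.hyps by (simp add: algebra_simps)
    qed
    from insert.IH[OF _ _ this g] have "c g * (g a0 - f0 a0) = 0"
      using insert.prems(1,2) by simp
    then show ?thesis using a0 by simp
  qed
  have "c f0 * f0 a = 0" for a
    using insert.prems(3)[of a] insert.hyps F by simp
  then have "c f0 = 0" using insert.prems(2)[of f0] by auto
  then show ?case using F insert.prems(4) by auto
qed

context level_rank_setting
begin

subsection \<open>The spanning elements of the localized coinvariants\<close>

text \<open>The discriminant power is built in so that relations hold in the coinvariants
  themselves. At the point selected by \<open>sep\<close> all variables over a site agree, so a
  polynomial in the colour 0 variables is enough.\<close>

definition sep_elt :: "((nat \<Rightarrow> complex) \<Rightarrow> complex) \<Rightarrow> (nat \<Rightarrow> nat) \<Rightarrow> complex mat \<times> complex mat \<Rightarrow> complex" where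
  "sep_elt q b = elt (\<lambda>z. disc_fun z ^ disc_exp * (sep z * q (base z))) b"

lemma sep_elt_poly_maps: "q \<in> poly_maps N \<Longrightarrow> (\<lambda>z. disc_fun z ^ disc_exp * (sep z * q (base z))) \<in> poly_maps M"
  by (intro poly_maps_mult poly_maps_power disc_fun_poly_maps sep_poly_maps base_poly_maps)

lemma transpose_permutes: "r < M \<Longrightarrow> r' < M \<Longrightarrow> Transposition.transpose r r' permutes {..<M}"
  by (rule permutes_swap_id) auto

lemma valid_rows_transpose:
  assumes "valid_rows b" "r < M" "r' < M"
  shows "valid_rows (\<lambda>i. b (Transposition.transpose r r' i))"
  unfolding valid_rows_def
proof (intro allI impI)
  fix i assume "i < M"
  then show "b (Transposition.transpose r r' i) < n"
    using valid_rowsD[OF assms(1)] permutes_less[OF transpose_permutes[OF assms(2,3)]] by blast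
qed

text \<open>Exchanging the colours of two letters of a standard word is the same as transposing the
  two positions and exchanging their rows; the transposition has sign -1, and
  \<open>disc_fun\<close> is symmetric.\<close>

lemma alt_recolour:
  assumes h: "h \<in> poly_maps M" and b: "valid_rows b" and r: "r < M" and r': "r' < M" and c: "r mod k \<noteq> r' mod k"
    and XA: "XA \<in> mat_pairs M p"
  shows "alt M p (\<lambda>z. disc_fun z ^ disc_exp * h z) ((standard b)(r := b r * k + r' mod k, r' := b r' * k + r mod k)) XA =
    - elt (\<lambda>z. disc_fun z ^ disc_exp * h (\<lambda>i. z (Transposition.transpose r r' i))) (\<lambda>i. b (Transposition.transpose r r' i)) XA"
proof -
  let ?w = "(standard b)(r := b r * k + r' mod k, r' := b r' * k + r mod k)"
  let ?\<sigma> = "Transposition.transpose r r'"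
  have ne: "r \<noteq> r'" using c by auto
  note \<sigma> = transpose_permutes[OF r r']
  have w: "?w i < p" if "i < M" for i
    using that standard_less[OF b] block_index_less valid_rowsD[OF b] r r' k_pos by simp
  have q: "(\<lambda>z. disc_fun z ^ disc_exp * h z) \<in> poly_maps M"
    by (intro poly_maps_mult poly_maps_power disc_fun_poly_maps h)
  have inv: "inv_into UNIV ?\<sigma> = ?\<sigma>" by (rule inv_transpose_eq)
  have sg: "signof ?\<sigma> = (-1 :: complex)" using ne by (simp add: sign_swap_id)
  have word: "?w (?\<sigma> i) = standard (\<lambda>i. b (?\<sigma> i)) i" for i
    using ne by (cases "i = r"; cases "i = r'") (simp_all add: standard_def)
  have "alt M p (\<lambda>z. disc_fun z ^ disc_exp * h z) ?w XA =
    signof ?\<sigma> * alt M p (\<lambda>z. disc_fun (\<lambda>i. z (?\<sigma> i)) ^ disc_exp * h (\<lambda>i. z (?\<sigma> i))) (\<lambda>i. ?w (?\<sigma> i)) XA"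
    using fun_cong[OF alt_permute[where w="?w", OF q w \<sigma>], of XA] XA by (simp only: restrict_apply inv if_True)
  also have "\<dots> = - elt (\<lambda>z. disc_fun z ^ disc_exp * h (\<lambda>i. z (?\<sigma> i))) (\<lambda>i. b (?\<sigma> i)) XA"
    unfolding word sg disc_fun_permute[OF \<sigma>] by simp
  finally show ?thesis .
qed

text \<open>As \<open>s\<close> is bijective on the colour of \<open>r\<close>, some position of
  this colour has the value \<open>s r'\<close>. If it is \<open>r\<close>, take \<open>r'\<close>
  instead, since the transposition exchanges them; otherwise it lies over another site than
  \<open>r\<close> and is not moved. Either way a position over a different site receives the same
  value as \<open>r\<close>, and a factor of \<open>sep\<close> is 0.\<close>

lemma vanishing_other_site:
  assumes q: "q \<in> poly_maps N" and r: "r < M" and r': "r' < M" and c: "r mod k \<noteq> r' mod k" and site: "r div k \<noteq> r' div k"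
  shows "vanishing (\<lambda>z. sep (\<lambda>i. z (Transposition.transpose r r' i)) * q (\<lambda>i. z (Transposition.transpose r r' (i * k))))"
  unfolding vanishing_def
proof (intro conjI allI impI)
  let ?\<sigma> = "Transposition.transpose r r'"
  note \<sigma> = transpose_permutes[OF r r']
  show "(\<lambda>z. sep (\<lambda>i. z (?\<sigma> i)) * q (\<lambda>i. z (?\<sigma> (i * k)))) \<in> poly_maps M"
    using poly_maps_mult[OF poly_maps_permute[OF sep_poly_maps \<sigma>] poly_maps_permute[OF base_poly_maps[OF q] \<sigma>]] .
  fix x s assume s: "good s"
  let ?a = "r mod k"
  have a: "?a < k" using k_pos by simp
  have "inj_on (\<lambda>i. s (i * k + ?a)) {..<N}" using s a by (simp add: good_def)
  moreover have "(\<lambda>i. s (i * k + ?a)) ` {..<N} \<subseteq> {..<N}" using s block_index_less[OF _ a] by (auto simp: good_def)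
  ultimately have "(\<lambda>i. s (i * k + ?a)) ` {..<N} = {..<N}" by (simp add: endo_inj_surj)
  moreover have "s r' < N" using s r' by (simp add: good_def)
  ultimately obtain j where j: "j < N" "s r' = s (j * k + ?a)" by (metis (no_types, lifting) imageE lessThan_iff)
  let ?r2 = "j * k + ?a"
  have r2: "?r2 < M" "?r2 div k = j" "?r2 mod k = ?a" using block_index_less[OF j(1) a] a by simp_all
  have "\<exists>t<M. r div k \<noteq> t div k \<and> s (?\<sigma> t) = s r'"
  proof (cases "?r2 = r")
    case True
    then show ?thesis using r' site j(2) by (intro exI[of _ r']) (simp del: mod_div_mult_eq)
  next
    case False
    have "r div k \<noteq> j" using False by (metis div_mult_mod_eq)
    moreover have "?r2 \<noteq> r'" using r2(3) c by metis
    ultimately show ?thesis using r2 False j(2) by (intro exI[of _ ?r2]) simp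
  qed
  then obtain t where t: "t < M" "r div k \<noteq> t div k" "s (?\<sigma> t) = s r'" by blast
  have "sep (\<lambda>i. x (s (?\<sigma> i))) = 0"
    by (rule sep_eq_0[OF r t(1,2)]) (simp add: t(3))
  then show "sep (\<lambda>i. x (s (?\<sigma> i))) * q (\<lambda>i. x (s (?\<sigma> (i * k)))) = 0" by simp
qed

lemma transpose_site:
  assumes "r div k = r' div k"
  shows "Transposition.transpose r r' i div k = i div k"
  using assms by (cases "i = r"; cases "i = r'") simp_all

text \<open>The matrix unit \<open>E_aa'\<close> in degree 0, a root vector of
  \<open>\<ss>\<ll>\<^sub>k\<close> for \<open>a \<noteq> a'\<close>.\<close>

definition unit_current :: "nat \<Rightarrow> nat \<Rightarrow> complex poly mat" where
  "unit_current a a' = mat k k (\<lambda>(i, j). if i = a \<and> j = a' then 1 else 0)"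

lemma unit_current_sl: "a \<noteq> a' \<Longrightarrow> unit_current a a' \<in> sl_current k"
  unfolding unit_current_def sl_current_def mat_trace_def by (auto intro!: sum.neutral)

text \<open>The matrix unit turns the colour \<open>a'\<close> into \<open>a\<close>, in one letter
  at a time.\<close>

lemma gl_act_unit_current:
  assumes q: "q \<in> poly_maps M" and w: "\<And>r. r < M \<Longrightarrow> w r < p" and XA: "XA \<in> mat_pairs M p" and a: "a < k"
  shows "gl_act M p (1\<^sub>m n \<otimes>\<^sub>K unit_current a a') (alt M p q w) XA =
    (\<Sum>r | r < M \<and> w r mod k = a'. alt M p q (w(r := w r div k * k + a)) XA)"
proof -
  let ?y = "unit_current a a'"
  have y: "?y \<in> carrier_mat k k" by (simp add: unit_current_def)
  have "gl_act M p (1\<^sub>m n \<otimes>\<^sub>K ?y) (alt M p q w) XA =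
    (\<Sum>r<M. \<Sum>e<k. alt M p (\<lambda>z. q z * poly (?y $$ (e, w r mod k)) (z r)) (w(r := w r div k * k + e)) XA)"
    by (rule gl_act_current[OF q w y XA])
  also have "\<dots> = (\<Sum>r<M. \<Sum>e<k. if e = a then (if w r mod k = a' then alt M p q (w(r := w r div k * k + a)) XA else 0) else 0)"
  proof (intro sum.cong refl)
    fix r e assume "r \<in> {..<M}" "e \<in> {..<k}"
    then have r: "r < M" and e: "e < k" by auto
    have m: "w r mod k < k" using k_pos by simp
    show "alt M p (\<lambda>z. q z * poly (?y $$ (e, w r mod k)) (z r)) (w(r := w r div k * k + e)) XA =
      (if e = a then (if w r mod k = a' then alt M p q (w(r := w r div k * k + a)) XA else 0) else 0)"
    proof (cases "e = a \<and> w r mod k = a'")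
      case True
      have "(\<lambda>z. q z * poly (?y $$ (e, w r mod k)) (z r)) = q"
        using m e True by (simp add: unit_current_def)
      then show ?thesis using True by (simp only: if_True simp_thms)
    next
      case False
      have "w r div k * k + e < p" by (rule block_index_less[OF block_div_less[OF w[OF r]] e])
      then have "(w(r := w r div k * k + e)) r' < p" if "r' < M" for r'
        using w[OF that] by simp
      then have "alt M p (\<lambda>z. 0) (w(r := w r div k * k + e)) XA = 0"
        using XA by (rule alt_zero)
      moreover have "(\<lambda>z. q z * poly (?y $$ (e, w r mod k)) (z r)) = (\<lambda>z. 0)"
        using m e False by (auto simp: unit_current_def fun_eq_iff)
      ultimately show ?thesis using False by auto
    qed
  qed
  also have "\<dots> = (\<Sum>r<M. if w r mod k = a' then alt M p q (w(r := w r div k * k + a)) XA else 0)"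
    using a by simp
  also have "\<dots> = (\<Sum>r\<in>{..<M} \<inter> {r. w r mod k = a'}. alt M p q (w(r := w r div k * k + a)) XA)"
    by (simp add: sum.inter_restrict)
  also have "{..<M} \<inter> {r. w r mod k = a'} = {r. r < M \<and> w r mod k = a'}" by auto
  finally show ?thesis .
qed

text \<open>Apply a root vector to a word that is standard except at \<open>r\<close>. Of the terms
  obtained, the one recolouring \<open>r\<close> restores the standard word, the one recolouring
  \<open>r'\<close> is minus the element with the two rows exchanged, and those over other sites are
  negligible by \<open>vanishing_other_site\<close>.\<close>

lemma sep_elt_swap:
  assumes q: "q \<in> poly_maps N" and b: "valid_rows b" and r: "r < M" and r': "r' < M" and ne: "r \<noteq> r'" and site: "r div k = r' div k"
  shows "negligible (\<lambda>XA. sep_elt q b XA - sep_elt q (\<lambda>i. b (Transposition.transpose r r' i)) XA)"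
proof -
  let ?a = "r mod k" and ?a' = "r' mod k" and ?\<sigma> = "Transposition.transpose r r'"
  let ?h = "\<lambda>z. sep z * q (base z)"
  let ?g = "\<lambda>z. disc_fun z ^ disc_exp * ?h z"
  \<comment> \<open>Position \<open>r\<close> has been given the colour of \<open>r'\<close>, so
    this word has one letter too many of that colour, and one recolouring balances it.\<close>
  let ?u = "(standard b)(r := b r * k + ?a')"
  let ?T = "\<lambda>\<rho>. alt M p ?g (?u(\<rho> := ?u \<rho> div k * k + ?a))"
  note \<sigma> = transpose_permutes[OF r r'] and valid_rows' = valid_rows_transpose[OF b r r']
  have a: "?a < k" "?a' < k" using k_pos by simp_all
  have aa: "?a \<noteq> ?a'" using ne site by (metis div_mult_mod_eq)
  have h: "?h \<in> poly_maps M" by (intro poly_maps_mult sep_poly_maps base_poly_maps q)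
  note g = sep_elt_poly_maps[OF q]
  have u: "?u i < p" if "i < M" for i
    using that standard_less[OF b] block_index_less valid_rowsD[OF b] r a by simp
  have um: "?u \<rho> mod k = (if \<rho> = r then ?a' else \<rho> mod k)" for \<rho> by (simp add: standard_def)
  have ud: "?u \<rho> div k = b \<rho>" for \<rho> using k_pos by (simp add: standard_def)
  let ?R = "{\<rho>. \<rho> < M \<and> ?u \<rho> mod k = ?a'}"
  have R: "r \<in> ?R" "r' \<in> ?R" "finite ?R" using r r' by (auto simp: um standard_def)
  have Tr: "?T r = sep_elt q b"
  proof -
    have "?u(r := ?u r div k * k + ?a) = standard b" unfolding ud by (simp add: fun_eq_iff standard_def)
    then show ?thesis by (simp only: sep_elt_def)
  qed
  have T: "?T \<rho> XA = - elt (\<lambda>z. disc_fun z ^ disc_exp * (sep (\<lambda>i. z (Transposition.transpose r \<rho> i)) * q (\<lambda>i. z (Transposition.transpose r \<rho> (i * k))))) (\<lambda>i. b (Transposition.transpose r \<rho> i)) XA"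
    if "\<rho> < M" "\<rho> mod k = ?a'" "XA \<in> mat_pairs M p" for \<rho> XA
    using alt_recolour[OF h b r that(1) _ that(3)] aa unfolding ud that(2) by simp
  have other: "negligible (?T \<rho>)" if \<rho>: "\<rho> \<in> ?R - {r} - {r'}" for \<rho>
  proof -
    have \<rho>': "\<rho> < M" "\<rho> mod k = ?a'" "\<rho> \<noteq> r'" using \<rho> by (auto simp: standard_def)
    then have "r div k \<noteq> \<rho> div k" using site by (metis div_mult_mod_eq)
    then have v: "vanishing (\<lambda>z. sep (\<lambda>i. z (Transposition.transpose r \<rho> i)) * q (\<lambda>i. z (Transposition.transpose r \<rho> (i * k))))"
      using vanishing_other_site[OF q r \<rho>'(1)] aa \<rho>'(2) by simp
    show ?thesis
      by (rule negligible_cong[OF negligible_cmult[OF vanishing_negligible[OF v valid_rows_transpose[OF b r \<rho>'(1)]], of "-1"]])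
        (simp only: T[OF \<rho>'(1,2)] mult_minus1)
  qed
  \<comment> \<open>The transposition may move a colour 0 position, but only within its site, where
    the selected point does not distinguish positions.\<close>
  have v: "vanishing (\<lambda>z. sep z * (q (base z) - q (\<lambda>i. z (?\<sigma> (i * k)))))"
  proof (rule vanishing_sep)
    show "(\<lambda>z. q (base z) - q (\<lambda>i. z (?\<sigma> (i * k)))) \<in> poly_maps M"
      using poly_maps_diff[OF base_poly_maps[OF q] poly_maps_permute[OF base_poly_maps[OF q] \<sigma>]] .
    show "q (\<lambda>i. x (i * k div k)) - q (\<lambda>i. x (?\<sigma> (i * k) div k)) = 0" for x
      by (simp add: transpose_site[OF site])
  qed
  have sep\<sigma>: "sep (\<lambda>i. z (?\<sigma> i)) = sep z" for z
    by (rule sep_permute[OF \<sigma>]) (simp add: transpose_site[OF site])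
  have p1: "(\<lambda>z. disc_fun z ^ disc_exp * (sep z * q (\<lambda>i. z (?\<sigma> (i * k))))) \<in> poly_maps M"
    using poly_maps_mult[OF poly_maps_power[OF disc_fun_poly_maps] poly_maps_mult[OF sep_poly_maps poly_maps_permute[OF base_poly_maps[OF q] \<sigma>]]] .
  have same: "negligible (\<lambda>XA. ?T r' XA + sep_elt q (\<lambda>i. b (?\<sigma> i)) XA)"
  proof (rule negligible_cong[OF vanishing_negligible[OF v valid_rows']])
    fix XA assume XA: "XA \<in> mat_pairs M p"
    have "elt (\<lambda>z. disc_fun z ^ disc_exp * (sep z * q (base z)) - disc_fun z ^ disc_exp * (sep z * q (\<lambda>i. z (?\<sigma> (i * k))))) (\<lambda>i. b (?\<sigma> i)) XA =
      ?T r' XA + sep_elt q (\<lambda>i. b (?\<sigma> i)) XA"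
      unfolding elt_diff[OF g p1 valid_rows' XA] T[OF r' refl XA] sep\<sigma> sep_elt_def by simp
    then show "?T r' XA + sep_elt q (\<lambda>i. b (?\<sigma> i)) XA = elt (\<lambda>z. disc_fun z ^ disc_exp * (sep z * (q (base z) - q (\<lambda>i. z (?\<sigma> (i * k)))))) (\<lambda>i. b (?\<sigma> i)) XA"
      by (simp only: right_diff_distrib)
  qed
  have total: "negligible (gl_act M p (1\<^sub>m n \<otimes>\<^sub>K unit_current ?a ?a') (alt M p ?g ?u))"
    by (rule negligible_gl_act[OF unit_current_sl[OF aa] alt_\<H>[OF g u]])
  have "negligible (\<lambda>XA. gl_act M p (1\<^sub>m n \<otimes>\<^sub>K unit_current ?a ?a') (alt M p ?g ?u) XA -
    ((\<Sum>\<rho>\<in>?R - {r} - {r'}. ?T \<rho> XA) + (?T r' XA + sep_elt q (\<lambda>i. b (?\<sigma> i)) XA)))"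
    by (intro negligible_diff[OF total] negligible_add[OF _ same] negligible_sum other)
  then show ?thesis
  proof (rule negligible_cong)
    fix XA assume XA: "XA \<in> mat_pairs M p"
    have "gl_act M p (1\<^sub>m n \<otimes>\<^sub>K unit_current ?a ?a') (alt M p ?g ?u) XA = (\<Sum>\<rho>\<in>?R. ?T \<rho> XA)"
      by (rule gl_act_unit_current[where w="?u", OF g u XA a(1)])
    also have "\<dots> = ?T r XA + (\<Sum>\<rho>\<in>?R - {r}. ?T \<rho> XA)" by (rule sum.remove[OF R(3,1)])
    also have "(\<Sum>\<rho>\<in>?R - {r}. ?T \<rho> XA) = ?T r' XA + (\<Sum>\<rho>\<in>?R - {r} - {r'}. ?T \<rho> XA)"
      using R ne by (intro sum.remove) auto
    finally have "gl_act M p (1\<^sub>m n \<otimes>\<^sub>K unit_current ?a ?a') (alt M p ?g ?u) XA =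
      sep_elt q b XA + (?T r' XA + (\<Sum>\<rho>\<in>?R - {r} - {r'}. ?T \<rho> XA))" unfolding Tr .
    moreover have "G = A + (B + C) \<Longrightarrow> A - D = G - (C + (B + D))" for A B C D G :: complex by simp
    ultimately show "sep_elt q b XA - sep_elt q (\<lambda>i. b (?\<sigma> i)) XA = gl_act M p (1\<^sub>m n \<otimes>\<^sub>K unit_current ?a ?a') (alt M p ?g ?u) XA -
      ((\<Sum>\<rho>\<in>?R - {r} - {r'}. ?T \<rho> XA) + (?T r' XA + sep_elt q (\<lambda>i. b (?\<sigma> i)) XA))"
      by blast
  qed
qed

text \<open>
  The function \<open>content b\<close> records the multiset of the \<open>b r\<close> over each site; as these functions
  are multiplicative in \<open>A\<close>, distinct ones are linearly independent.
\<close>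

definition content :: "(nat \<Rightarrow> nat) \<Rightarrow> (nat \<Rightarrow> nat \<Rightarrow> complex) \<Rightarrow> complex" where
  "content b A = (\<Prod>r<M. A (b r) (r div k))"

lemma content_transpose:
  assumes "r < M" "r' < M" "r div k = r' div k"
  shows "content (\<lambda>i. b (Transposition.transpose r r' i)) = content b"
proof
  fix A
  have "content b A = (\<Prod>i<M. A (b (Transposition.transpose r r' i)) (Transposition.transpose r r' i div k))"
    unfolding content_def
    by (rule prod.reindex_bij_betw[symmetric]) (rule permutes_imp_bij[OF transpose_permutes[OF assms(1,2)]])
  then show "content (\<lambda>i. b (Transposition.transpose r r' i)) A = content b A"
    by (simp add: content_def transpose_site[OF assms(3)])
qed

text \<open>Evaluate at the array with entry 2 in place \<open>(c, i)\<close> and 1 elsewhere; the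
  exponent of 2 is the number sought.\<close>

lemma content_card:
  assumes "content b = content b'"
  shows "card {r. r < M \<and> b r = c \<and> r div k = i} = card {r. r < M \<and> b' r = c \<and> r div k = i}"
proof -
  let ?A = "\<lambda>c' i'. if c' = c \<and> i' = i then 2 else 1 :: complex"
  have "content b ?A = 2 ^ card {r. r < M \<and> b r = c \<and> r div k = i}" for b
  proof -
    have "content b ?A = (\<Prod>r\<in>{..<M} \<inter> {r. b r = c \<and> r div k = i}. 2)"
      unfolding content_def by (subst prod.inter_restrict) auto
    also have "{..<M} \<inter> {r. b r = c \<and> r div k = i} = {r. r < M \<and> b r = c \<and> r div k = i}" by auto
    finally show ?thesis by simp
  qed
  then have "(2 :: complex) ^ card {r. r < M \<and> b r = c \<and> r div k = i} = 2 ^ card {r. r < M \<and> b' r = c \<and> r div k = i}"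
    using fun_cong[OF assms, of ?A] by simp
  then have "of_nat (2 ^ card {r. r < M \<and> b r = c \<and> r div k = i}) =
    (of_nat (2 ^ card {r. r < M \<and> b' r = c \<and> r div k = i}) :: complex)"
    by (simp only: of_nat_power of_nat_numeral)
  then have "(2 :: nat) ^ card {r. r < M \<and> b r = c \<and> r div k = i} = 2 ^ card {r. r < M \<and> b' r = c \<and> r div k = i}"
    by (simp only: of_nat_eq_iff)
  then show ?thesis by simp
qed

text \<open>Induction on the number of disagreements. If \<open>b\<close> and \<open>b'\<close>
  differ at \<open>r\<close>, equal content yields a position \<open>r'\<close> over the same site
  where \<open>b\<close> has the row wanted at \<open>r\<close> and \<open>b'\<close> has a
  different one. Exchanging the two rows repairs \<open>r\<close>, and \<open>r'\<close> was wrong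
  before.\<close>

lemma sep_elt_content:
  assumes q: "q \<in> poly_maps N" and b': "valid_rows b'" and "valid_rows b" "content b = content b'"
  shows "negligible (\<lambda>XA. sep_elt q b XA - sep_elt q b' XA)"
  using assms(3-)
proof (induction "card {r. r < M \<and> b r \<noteq> b' r}" arbitrary: b rule: less_induct)
  case less
  show ?case
  proof (cases "\<forall>r<M. b r = b' r")
    case True
    have "sep_elt q b = sep_elt q b'"
      unfolding sep_elt_def
      by (rule alt_cong[OF sep_elt_poly_maps[OF q] standard_less[OF less.prems(1)]]) (use True in \<open>simp_all add: standard_def\<close>)
    then show ?thesis using negligible_zero by simp
  next
    case False
    then obtain r where r: "r < M" "b r \<noteq> b' r" by blast
    let ?B = "\<lambda>b. {r'. r' < M \<and> b r' = b' r \<and> r' div k = r div k}"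
    have "\<not> ?B b \<subseteq> ?B b'"
    proof
      assume sub: "?B b \<subseteq> ?B b'"
      have fin: "finite (?B b')" by simp
      have "?B b = ?B b'" by (rule card_subset_eq[OF fin sub content_card[OF less.prems(2)]])
      moreover have "r \<in> ?B b'" "r \<notin> ?B b" using r by auto
      ultimately show False by blast
    qed
    then obtain r' where r': "r' < M" "b r' = b' r" "r' div k = r div k" "b' r' \<noteq> b' r" by blast
    have ne: "r \<noteq> r'" using r' by auto
    let ?b = "\<lambda>i. b (Transposition.transpose r r' i)"
    have "{i. i < M \<and> ?b i \<noteq> b' i} \<subset> {i. i < M \<and> b i \<noteq> b' i}"
    proof (rule psubsetI)
      show "{i. i < M \<and> ?b i \<noteq> b' i} \<subseteq> {i. i < M \<and> b i \<noteq> b' i}"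
      proof
        fix i assume "i \<in> {i. i < M \<and> ?b i \<noteq> b' i}"
        then show "i \<in> {i. i < M \<and> b i \<noteq> b' i}"
          using r r' by (cases "i = r"; cases "i = r'") auto
      qed
      have "r \<in> {i. i < M \<and> b i \<noteq> b' i}" "r \<notin> {i. i < M \<and> ?b i \<noteq> b' i}" using r r' by simp_all
      then show "{i. i < M \<and> ?b i \<noteq> b' i} \<noteq> {i. i < M \<and> b i \<noteq> b' i}" by blast
    qed
    then have "card {i. i < M \<and> ?b i \<noteq> b' i} < card {i. i < M \<and> b i \<noteq> b' i}"
      by (intro psubset_card_mono) auto
    from less.hyps[OF this valid_rows_transpose[OF less.prems(1) r(1) r'(1)]]
    have "negligible (\<lambda>XA. sep_elt q ?b XA - sep_elt q b' XA)"
      using content_transpose[OF r(1) r'(1) r'(3)[symmetric]] less.prems(2) by simp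
    from negligible_add[OF sep_elt_swap[OF q less.prems(1) r(1) r'(1) ne r'(3)[symmetric]] this]
    show ?thesis by simp
  qed
qed

text \<open>Independence of the content functions forces the coefficients of equal content to sum to
  0. The elements of equal content agree up to negligible ones, so each group can be moved to one
  representative, where its coefficients cancel.\<close>

lemma sep_elt_independent:
  fixes q :: "'t \<Rightarrow> (nat \<Rightarrow> complex) \<Rightarrow> complex"
  assumes fin: "finite T" and q: "\<And>t. t \<in> T \<Longrightarrow> q t \<in> poly_maps N" and b: "\<And>t. t \<in> T \<Longrightarrow> valid_rows (b t)"
    and z: "\<And>x A. (\<Sum>t\<in>T. q t x * content (b t) A) = 0"
  shows "negligible (\<lambda>XA. \<Sum>t\<in>T. sep_elt (q t) (b t) XA)"
proof -
  let ?F = "(\<lambda>t. content (b t)) ` T"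
  let ?Tf = "\<lambda>f. {t \<in> T. content (b t) = f}"
  have fiber: "(\<Sum>t\<in>?Tf f. q t x) = 0" if f: "f \<in> ?F" for f x
  proof (rule multiplicative_independent[where F="?F" and m="\<lambda>A B c i. A c i * B c i" and c="\<lambda>f. \<Sum>t\<in>?Tf f. q t x", OF _ _ _ _ f])
    show "finite ?F" using fin by simp
    show "f (\<lambda>c i. A c i * B c i) = f A * f B" if "f \<in> ?F" for f A B
      using that by (auto simp: content_def prod.distrib)
    show "\<exists>A. f A \<noteq> 0" if "f \<in> ?F" for f
      using that by (intro exI[of _ "\<lambda>_ _. 1"]) (auto simp: content_def)
    show "(\<Sum>f\<in>?F. (\<Sum>t\<in>?Tf f. q t x) * f A) = 0" for A
    proof -
      have "(\<Sum>f\<in>?F. (\<Sum>t\<in>?Tf f. q t x) * f A) = (\<Sum>f\<in>?F. \<Sum>t\<in>?Tf f. q t x * content (b t) A)"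
        unfolding sum_distrib_right by (intro sum.cong refl) auto
      also have "\<dots> = (\<Sum>t\<in>T. q t x * content (b t) A)" by (rule sum.image_gen[OF fin, symmetric])
      finally show ?thesis unfolding z .
    qed
  qed
  have fiber_sum: "negligible (\<lambda>XA. \<Sum>t\<in>?Tf f. sep_elt (q t) (b t) XA)" if f: "f \<in> ?F" for f
  proof -
    obtain s where s: "s \<in> T" "f = content (b s)" using f by blast
    have "negligible (\<lambda>XA. \<Sum>t\<in>?Tf f. sep_elt (q t) (b t) XA - sep_elt (q t) (b s) XA)"
      using q b s by (intro negligible_sum sep_elt_content) auto
    then show ?thesis
    proof (rule negligible_cong)
      fix XA assume XA: "XA \<in> mat_pairs M p"
      have "(\<Sum>t\<in>?Tf f. sep_elt (q t) (b s) XA) = elt (\<lambda>z. \<Sum>t\<in>?Tf f. disc_fun z ^ disc_exp * (sep z * q t (base z))) (b s) XA"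
        unfolding sep_elt_def using q by (intro elt_sum[OF _ b[OF s(1)] XA, symmetric] sep_elt_poly_maps) auto
      also have "(\<lambda>z. \<Sum>t\<in>?Tf f. disc_fun z ^ disc_exp * (sep z * q t (base z))) = (\<lambda>z. disc_fun z ^ disc_exp * (sep z * (\<Sum>t\<in>?Tf f. q t (base z))))"
        by (simp only: sum_distrib_left)
      also have "\<dots> = (\<lambda>z. 0)" by (simp only: fiber[OF f] mult_zero_right)
      also have "elt (\<lambda>z. 0) (b s) XA = 0" by (rule alt_zero[where w="standard (b s)", OF standard_less[OF b[OF s(1)]] XA])
      finally show "(\<Sum>t\<in>?Tf f. sep_elt (q t) (b t) XA) = (\<Sum>t\<in>?Tf f. sep_elt (q t) (b t) XA - sep_elt (q t) (b s) XA)"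
        by (simp add: sum_subtractf)
    qed
  qed
  have "negligible (\<lambda>XA. \<Sum>f\<in>?F. \<Sum>t\<in>?Tf f. sep_elt (q t) (b t) XA)" by (intro negligible_sum fiber_sum)
  then show ?thesis by (simp only: sum.image_gen[OF fin, of _ "\<lambda>t. content (b t)"])
qed

end

lemma count_mset_map_upt: "count (mset (map f [0..<m])) a = (\<Sum>r<m. if f r = a then 1 else 0)"
  by (induction m) auto

lemma exists_permutation_eq_counts:
  fixes f g :: "nat \<Rightarrow> 'a"
  assumes "\<And>a. (\<Sum>r<m. if f r = a then 1 else 0 :: nat) = (\<Sum>r<m. if g r = a then 1 else 0)"
  obtains \<sigma> where "\<sigma> permutes {..<m}" "\<forall>r<m. f (\<sigma> r) = g r"
proof -
  have "mset (map g [0..<m]) = mset (map f [0..<m])"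
    by (rule multiset_eqI) (simp only: count_mset_map_upt assms)
  then obtain \<sigma> where \<sigma>: "\<sigma> permutes {..<length (map f [0..<m])}" "permute_list \<sigma> (map f [0..<m]) = map g [0..<m]"
    by (rule mset_eq_permutation)
  have \<sigma>': "\<sigma> permutes {..<m}" using \<sigma>(1) by simp
  have "f (\<sigma> r) = g r" if r: "r < m" for r
  proof -
    have "permute_list \<sigma> (map f [0..<m]) ! r = map f [0..<m] ! \<sigma> r"
      using r by (intro permute_list_nth[OF \<sigma>(1)]) simp
    then show ?thesis using r permutes_less[OF \<sigma>' r] by (simp add: \<sigma>(2))
  qed
  then show ?thesis using that \<sigma>' by blast
qed

context level_rank_setting
begin

subsection \<open>Colour preserving permutations\<close>

text \<open>These are the permutations that contribute to the value of a standard element at a point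
  \<open>A \<otimes>\<^sub>K 1\<^sub>m k\<close>.\<close>

definition colour_perms :: "(nat \<Rightarrow> nat) set" where
  "colour_perms = {\<pi>. \<pi> permutes {..<M} \<and> (\<forall>r<M. \<pi> r mod k = r mod k)}"

text \<open>Those that move whole sites: over every site, all positions follow the one of colour
  0.\<close>

definition site_perms :: "(nat \<Rightarrow> nat) set" where
  "site_perms = {\<pi> \<in> colour_perms. \<forall>r<M. \<pi> r div k = \<pi> (r div k * k) div k}"

lemma finite_colour_perms: "finite colour_perms"
  unfolding colour_perms_def by (rule finite_subset[OF _ finite_permutations[of "{..<M}"]]) auto

lemma colour_perms_permutes: "\<pi> \<in> colour_perms \<Longrightarrow> \<pi> permutes {..<M}"
  and colour_perms_mod: "\<pi> \<in> colour_perms \<Longrightarrow> r < M \<Longrightarrow> \<pi> r mod k = r mod k"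
  by (simp_all add: colour_perms_def)

lemma colour_perms_less: "\<pi> \<in> colour_perms \<Longrightarrow> r < M \<Longrightarrow> \<pi> r < M"
  by (rule permutes_less[OF colour_perms_permutes])

lemma colour_perms_div_less: "\<pi> \<in> colour_perms \<Longrightarrow> r < M \<Longrightarrow> \<pi> r div k < N"
  by (rule block_div_less) (rule colour_perms_less)

lemma colour_perms_comp: "\<pi> \<in> colour_perms \<Longrightarrow> \<rho> \<in> colour_perms \<Longrightarrow> \<pi> \<circ> \<rho> \<in> colour_perms"
  unfolding colour_perms_def using permutes_less by (auto intro: permutes_compose)

lemma colour_perms_inv: "\<pi> \<in> colour_perms \<Longrightarrow> inv_into UNIV \<pi> \<in> colour_perms"
proof -
  assume \<pi>: "\<pi> \<in> colour_perms"
  note p = colour_perms_permutes[OF \<pi>]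
  have "inv_into UNIV \<pi> r mod k = r mod k" if r: "r < M" for r
    using colour_perms_mod[OF \<pi> permutes_less[OF permutes_inv[OF p] r]] permutes_inverses(1)[OF p, of r] by simp
  then show ?thesis using permutes_inv[OF p] by (simp add: colour_perms_def)
qed

lemma colour_perms_sum_inv: "(\<Sum>\<pi>\<in>colour_perms. F (inv_into UNIV \<pi>)) = (\<Sum>\<pi>\<in>colour_perms. F \<pi> :: complex)"
proof (rule sum.reindex_bij_betw)
  show "bij_betw (inv_into UNIV) colour_perms colour_perms"
    by (rule bij_betw_byWitness[where f'="inv_into UNIV"])
      (auto simp: colour_perms_inv permutes_inv_inv[OF colour_perms_permutes])
qed

lemma colour_perms_sum_comp:
  assumes P: "P \<in> colour_perms"
  shows "(\<Sum>\<pi>\<in>colour_perms. F (P \<circ> \<pi>)) = (\<Sum>\<pi>\<in>colour_perms. F \<pi> :: complex)"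
proof (rule sum.reindex_bij_betw)
  have inj: "inj_on ((\<circ>) P) colour_perms"
    using permutes_inj[OF colour_perms_permutes[OF P]] by (intro inj_onI) (simp add: fun.inj_map_strong inj_def fun_eq_iff)
  moreover have "(\<circ>) P ` colour_perms \<subseteq> colour_perms" using colour_perms_comp[OF P] by blast
  ultimately show "bij_betw ((\<circ>) P) colour_perms colour_perms" using endo_inj_surj[OF finite_colour_perms] by (simp add: bij_betw_def)
qed

text \<open>Some \<open>r\<close> is separated from the colour 0 position over its site. The place
  of its colour over the image of the latter is taken by a position from another site, and this
  coincidence makes a factor of \<open>sep\<close> equal to 0.\<close>

lemma sep_colour_perms_eq_0:
  assumes \<pi>: "\<pi> \<in> colour_perms" and n: "\<pi> \<notin> site_perms"
  shows "sep (\<lambda>r. x (\<pi> r div k)) = 0"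
proof -
  obtain r where r: "r < M" "\<pi> r div k \<noteq> \<pi> (r div k * k) div k" using \<pi> n by (auto simp: site_perms_def)
  let ?i = "r div k" and ?c = "r mod k"
  have iM: "?i * k < M" by (rule base_index_less[OF block_div_less[OF r(1)]])
  let ?v = "\<pi> (?i * k) div k"
  have c: "?c < k" using k_pos by simp
  have v: "?v * k + ?c < M" by (rule block_index_less[OF colour_perms_div_less[OF \<pi> iM] c])
  let ?t = "inv_into UNIV \<pi> (?v * k + ?c)"
  have t: "?t < M" "\<pi> ?t = ?v * k + ?c"
    using permutes_less[OF permutes_inv[OF colour_perms_permutes[OF \<pi>]] v] permutes_inverses(1)[OF colour_perms_permutes[OF \<pi>]] by simp_all
  have tm: "?t mod k = ?c" using colour_perms_mod[OF \<pi> t(1)] by (simp only: t(2) mod_mult_self3 mod_mod_trivial)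
  have tv: "\<pi> ?t div k = ?v" unfolding t(2) using c by simp
  have "?t div k \<noteq> ?i"
  proof
    assume "?t div k = ?i"
    then have "?t = r" using tm by (metis div_mult_mod_eq)
    then show False using r(2) tv by simp
  qed
  then have "?i * k div k \<noteq> ?t div k" using k_pos by simp
  then show ?thesis by (rule sep_eq_0[OF iM t(1)]) (simp only: tv)
qed

text \<open>The images of the colour 0 positions define the permutation of the sites; its value
  \<open>i\<close> from \<open>N\<close> on is what \<open>permutes\<close> demands.\<close>

lemma site_perms_site_permutation:
  assumes \<pi>: "\<pi> \<in> site_perms"
  obtains \<sigma> where "\<sigma> permutes {..<N}" "\<forall>r<M. \<pi> r = \<sigma> (r div k) * k + r mod k"
proof -
  have \<pi>': "\<pi> \<in> colour_perms" and site: "\<And>r. r < M \<Longrightarrow> \<pi> r div k = \<pi> (r div k * k) div k" using \<pi> by (auto simp: site_perms_def)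
  let ?\<sigma> = "\<lambda>i. if i < N then \<pi> (i * k) div k else i"
  have inj: "inj_on ?\<sigma> {..<N}"
  proof (rule inj_onI)
    fix i j assume ij: "i \<in> {..<N}" "j \<in> {..<N}" "?\<sigma> i = ?\<sigma> j"
    then have m: "i * k < M" "j * k < M" using base_index_less by auto
    have "\<pi> (i * k) mod k = \<pi> (j * k) mod k" using colour_perms_mod[OF \<pi>'] m by simp
    moreover have "\<pi> (i * k) div k = \<pi> (j * k) div k" using ij by simp
    ultimately have "\<pi> (i * k) = \<pi> (j * k)" by (metis div_mult_mod_eq)
    then have "i * k = j * k" by (rule injD[OF permutes_inj[OF colour_perms_permutes[OF \<pi>']]])
    then show "i = j" using k_pos by simp
  qed
  have "?\<sigma> ` {..<N} \<subseteq> {..<N}" using colour_perms_div_less[OF \<pi>' base_index_less] by auto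
  then have "?\<sigma> ` {..<N} = {..<N}" using inj by (intro endo_inj_surj) auto
  then have p: "?\<sigma> permutes {..<N}" using inj by (intro bij_imp_permutes) (auto simp: bij_betw_def)
  have "\<pi> r = ?\<sigma> (r div k) * k + r mod k" if r: "r < M" for r
  proof -
    have "\<pi> r = \<pi> r div k * k + \<pi> r mod k" by simp
    then show ?thesis unfolding colour_perms_mod[OF \<pi>' r] site[OF r] using block_div_less[OF r] by simp
  qed
  with p show ?thesis using that[of ?\<sigma>] by blast
qed

lemma sep_site_perms:
  assumes \<pi>: "\<pi> \<in> site_perms"
  shows "sep (\<lambda>r. x (\<pi> r div k)) = ordered_disc N x ^ (k * k)"
proof -
  obtain \<sigma> where \<sigma>: "\<sigma> permutes {..<N}" "\<forall>r<M. \<pi> r = \<sigma> (r div k) * k + r mod k"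
    by (rule site_perms_site_permutation[OF \<pi>])
  have "sep (\<lambda>r. x (\<pi> r div k)) = sep (\<lambda>r. x (\<sigma> (r div k)))"
    by (rule poly_maps_cong[OF sep_poly_maps]) (use \<sigma>(2) k_pos in simp)
  also have "\<dots> = ordered_disc N x ^ (k * k)"
    using sep_sites[of "\<lambda>i. x (\<sigma> i)"] by (simp only: ordered_disc_permute[OF \<sigma>(1)])
  finally show ?thesis .
qed

lemma colour_perms_id: "id \<in> colour_perms" by (simp add: colour_perms_def permutes_id)

lemma card_site_perms: "card site_perms > 0"
proof -
  have "id \<in> site_perms" using colour_perms_id k_pos by (simp add: site_perms_def)
  moreover have "finite site_perms" by (rule finite_subset[OF _ finite_colour_perms]) (auto simp: site_perms_def)
  ultimately show ?thesis by (auto simp: card_gt_0_iff)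
qed

text \<open>The factor \<open>sep\<close> annihilates the permutations that tear a site apart and is
  the same power of the discriminant at all others.\<close>

lemma sum_colour_perms_sep: "(\<Sum>\<pi>\<in>colour_perms. sep (\<lambda>r. x (\<pi> r div k)) * F \<pi>) = ordered_disc N x ^ (k * k) * (\<Sum>\<pi>\<in>site_perms. F \<pi>)"
proof -
  have "(\<Sum>\<pi>\<in>colour_perms. sep (\<lambda>r. x (\<pi> r div k)) * F \<pi>) = (\<Sum>\<pi>\<in>site_perms. sep (\<lambda>r. x (\<pi> r div k)) * F \<pi>)"
    by (rule sum.mono_neutral_right[OF finite_colour_perms]) (auto simp: site_perms_def[THEN arg_cong[where f="\<lambda>A. A \<subseteq> colour_perms"]] sep_colour_perms_eq_0 site_perms_def)
  also have "\<dots> = (\<Sum>\<pi>\<in>site_perms. ordered_disc N x ^ (k * k) * F \<pi>)"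
    by (rule sum.cong[OF refl]) (simp only: sep_site_perms)
  finally show ?thesis by (simp only: sum_distrib_left)
qed

text \<open>A sum of rearranged selecting factors that is nevertheless a positive integer times a
  discriminant power, see \<open>theta_eq\<close>. It permits the passage from arbitrary standard
  elements to the \<open>sep_elt\<close> ones.\<close>

definition theta :: "(nat \<Rightarrow> complex) \<Rightarrow> complex" where
  "theta x = (\<Sum>\<pi>\<in>colour_perms. sep (\<lambda>r. x (\<pi> r div k)))"

lemma theta_eq: "theta x = of_nat (card site_perms) * ordered_disc N x ^ (k * k)"
  using sum_colour_perms_sep[of x "\<lambda>_. 1"] by (simp add: theta_def)

lemma theta_poly_maps: "theta \<in> poly_maps N"
  unfolding theta_def[abs_def]
  by (intro poly_maps_sum poly_maps_comp[OF sep_poly_maps] colour_perms_div_less)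

text \<open>For \<open>good s\<close>, moving each position to the one of its colour over the site
  \<open>s r\<close> is a colour preserving permutation \<open>?P\<close>. So the sum at
  \<open>x \<circ> s\<close> is that at the selected point, reindexed by composition with
  \<open>?P\<close>.\<close>

lemma vanishing_theta: "vanishing (\<lambda>z. theta (base z) - (\<Sum>\<pi>\<in>colour_perms. sep (\<lambda>i. z (\<pi> i))))"
  unfolding vanishing_def
proof (intro conjI allI impI)
  show "(\<lambda>z. theta (base z) - (\<Sum>\<pi>\<in>colour_perms. sep (\<lambda>i. z (\<pi> i)))) \<in> poly_maps M"
    by (intro poly_maps_diff base_poly_maps[OF theta_poly_maps] poly_maps_sum poly_maps_permute[OF sep_poly_maps] colour_perms_permutes)
  fix x s assume s: "good s"
  let ?P = "\<lambda>r. if r < M then s r * k + r mod k else r"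
  have sl: "s r < N" if "r < M" for r using s that by (simp add: good_def)
  have mk: "r mod k < k" for r using k_pos by simp
  have lt: "s r * k + r mod k < M" if "r < M" for r by (rule block_index_less[OF sl[OF that] mk])
  have inj: "inj_on ?P {..<M}"
  proof (rule inj_onI)
    fix r r' assume r: "r \<in> {..<M}" "r' \<in> {..<M}" "?P r = ?P r'"
    then have e: "s r * k + r mod k = s r' * k + r' mod k" by simp
    from arg_cong[OF e, of "\<lambda>m. m mod k"] have c: "r mod k = r' mod k" by simp
    from e c have "s r = s r'" using k_pos by simp
    moreover have "r div k * k + r mod k = r" "r' div k * k + r mod k = r'" by (simp, simp only: c div_mult_mod_eq)
    ultimately have "s (r div k * k + r mod k) = s (r' div k * k + r mod k)" by (simp only:)
    moreover have "inj_on (\<lambda>i. s (i * k + r mod k)) {..<N}" using s mk by (simp add: good_def)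
    ultimately have "r div k = r' div k"
      using r block_div_less[of r k N] block_div_less[of r' k N] by (elim inj_onD) auto
    then show "r = r'" using c by (metis div_mult_mod_eq)
  qed
  have "?P ` {..<M} \<subseteq> {..<M}" using lt by auto
  then have "?P ` {..<M} = {..<M}" using inj by (intro endo_inj_surj) auto
  then have "?P permutes {..<M}" using inj by (intro bij_imp_permutes) (auto simp: bij_betw_def)
  then have P: "?P \<in> colour_perms" by (simp add: colour_perms_def)
  have "sep (\<lambda>i. x (s (\<pi> i))) = sep (\<lambda>i. x ((?P \<circ> \<pi>) i div k))" if \<pi>: "\<pi> \<in> colour_perms" for \<pi>
    by (rule poly_maps_cong[OF sep_poly_maps]) (simp add: colour_perms_less[OF \<pi>] k_pos)
  then have "(\<Sum>\<pi>\<in>colour_perms. sep (\<lambda>i. x (s (\<pi> i)))) = (\<Sum>\<pi>\<in>colour_perms. sep (\<lambda>i. x ((?P \<circ> \<pi>) i div k)))"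
    by (rule sum.cong[OF refl])
  also have "\<dots> = theta x" unfolding theta_def by (rule colour_perms_sum_comp[OF P])
  also have "theta x = theta (\<lambda>i. x (s (i * k)))"
    by (rule poly_maps_cong[OF theta_poly_maps]) (use s in \<open>simp add: good_def\<close>)
  finally show "theta (\<lambda>i. x (s (i * k))) - (\<Sum>\<pi>\<in>colour_perms. sep (\<lambda>i. x (s (\<pi> i)))) = 0" by simp
qed

subsection \<open>The kernel of the level-rank map\<close>

text \<open>An entry of \<open>A \<otimes>\<^sub>K 1\<^sub>m k\<close> is 0 unless row and column
  have the same colour, so only colour preserving permutations survive in the
  antisymmetrization.\<close>

lemma level_rank_elt:
  assumes q: "q \<in> poly_maps M" and b: "valid_rows b" and A: "A \<in> carrier_mat n N"
  shows "level_rank k n N (elt q b) (mat_diag N x, A) =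
    (\<Sum>\<pi>\<in>colour_perms. signof \<pi> * q (\<lambda>r. x (\<pi> r div k)) * (\<Prod>r<M. A $$ (b r, \<pi> r div k)))"
proof -
  let ?F = "\<lambda>\<pi>. signof \<pi> * q (\<lambda>r. x (\<pi> r div k)) * (\<Prod>r<M. (A \<otimes>\<^sub>K 1\<^sub>m k) $$ (standard b r, \<pi> r))"
  have idx: "(A \<otimes>\<^sub>K 1\<^sub>m k) $$ (standard b r, c) = (if r mod k = c mod k then A $$ (b r, c div k) else 0)" if r: "r < M" and c: "c < M" for r c
    unfolding kron_one_index[OF A standard_less[OF b r] c] using k_pos by (simp add: standard_def)
  have "level_rank k n N (elt q b) (mat_diag N x, A) = alt_val M q (standard b) (\<lambda>r. x (r div k)) (A \<otimes>\<^sub>K 1\<^sub>m k)"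
    unfolding level_rank_apply[OF mat_diag_dim A] kron_one_diag[OF k_pos]
    by (rule alt_diag[OF q standard_less[OF b] kron_one_carrier[OF A]])
  also have "\<dots> = (\<Sum>\<pi> | \<pi> permutes {..<M}. ?F \<pi>)" by (simp only: alt_val_def)
  also have "\<dots> = (\<Sum>\<pi>\<in>colour_perms. ?F \<pi>)"
  proof (rule sum.mono_neutral_right)
    show "finite {\<pi>. \<pi> permutes {..<M}}" by (rule finite_permutations) simp
    show "colour_perms \<subseteq> {\<pi>. \<pi> permutes {..<M}}" by (auto simp: colour_perms_def)
    show "\<forall>\<pi>\<in>{\<pi>. \<pi> permutes {..<M}} - colour_perms. ?F \<pi> = 0"
    proof
      fix \<pi> assume "\<pi> \<in> {\<pi>. \<pi> permutes {..<M}} - colour_perms"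
      then obtain r where \<pi>: "\<pi> permutes {..<M}" and r: "r < M" "\<pi> r mod k \<noteq> r mod k" by (auto simp: colour_perms_def)
      have "(A \<otimes>\<^sub>K 1\<^sub>m k) $$ (standard b r, \<pi> r) = 0"
        using idx[OF r(1) permutes_less[OF \<pi> r(1)]] r(2) by simp
      then have "(\<Prod>r<M. (A \<otimes>\<^sub>K 1\<^sub>m k) $$ (standard b r, \<pi> r)) = 0" using r(1) by (intro prod_zero) auto
      then show "?F \<pi> = 0" by (simp only: mult_zero_right)
    qed
  qed
  also have "\<dots> = (\<Sum>\<pi>\<in>colour_perms. signof \<pi> * q (\<lambda>r. x (\<pi> r div k)) * (\<Prod>r<M. A $$ (b r, \<pi> r div k)))"
  proof (rule sum.cong[OF refl])
    fix \<pi> assume \<pi>: "\<pi> \<in> colour_perms"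
    have "(A \<otimes>\<^sub>K 1\<^sub>m k) $$ (standard b r, \<pi> r) = A $$ (b r, \<pi> r div k)" if "r < M" for r
      using idx[OF that colour_perms_less[OF \<pi> that]] colour_perms_mod[OF \<pi> that] by simp
    then have "(\<Prod>r<M. (A \<otimes>\<^sub>K 1\<^sub>m k) $$ (standard b r, \<pi> r)) = (\<Prod>r<M. A $$ (b r, \<pi> r div k))"
      by (intro prod.cong[OF refl]) (simp only: lessThan_iff)
    then show "?F \<pi> = signof \<pi> * q (\<lambda>r. x (\<pi> r div k)) * (\<Prod>r<M. A $$ (b r, \<pi> r div k))" by (simp only:)
  qed
  finally show ?thesis .
qed

lemma vanishing_mult: "vanishing g \<Longrightarrow> q \<in> poly_maps M \<Longrightarrow> vanishing (\<lambda>z. g z * q z)"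
  by (simp add: vanishing_def poly_maps_mult)

text \<open>What remains of \<open>Q\<close> after relabelling positions by \<open>\<pi>\<close> and
  restricting to the selected point, where the variable at position \<open>i\<close> is that of the
  site \<open>i div k\<close>.\<close>

definition sep_elt_part :: "((nat \<Rightarrow> complex) \<Rightarrow> complex) \<Rightarrow> (nat \<Rightarrow> nat) \<Rightarrow> (nat \<Rightarrow> complex) \<Rightarrow> complex" where
  "sep_elt_part Q \<pi> = (\<lambda>x. signof \<pi> * Q (\<lambda>i. x (inv_into UNIV \<pi> i div k)))"

lemma sep_elt_part_poly_maps:
  assumes Q: "Q \<in> poly_maps M" and \<pi>: "\<pi> \<in> colour_perms"
  shows "sep_elt_part Q \<pi> \<in> poly_maps N"
  unfolding sep_elt_part_def
  by (intro poly_maps_mult poly_maps_const poly_maps_comp[OF Q] colour_perms_div_less[OF colour_perms_inv[OF \<pi>]])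

lemma valid_rows_colour_perms: "valid_rows b \<Longrightarrow> \<pi> \<in> colour_perms \<Longrightarrow> valid_rows (\<lambda>r. b (\<pi> r))"
  unfolding valid_rows_def using colour_perms_less by blast

text \<open>Relabelling by \<open>\<pi>\<close> turns the rearranged factor back into
  \<open>sep\<close>, and the word stays standard because colours are preserved. Next to
  \<open>sep\<close>, \<open>Q\<close> may be replaced by its values at the selected point.\<close>

lemma elt_sep_colour_perms:
  assumes Q: "Q \<in> poly_maps M" and b: "valid_rows b" and \<pi>: "\<pi> \<in> colour_perms"
  shows "negligible (\<lambda>XA. elt (\<lambda>z. disc_fun z ^ disc_exp * (sep (\<lambda>i. z (\<pi> i)) * Q z)) b XA - sep_elt (sep_elt_part Q \<pi>) (\<lambda>r. b (\<pi> r)) XA)"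
proof -
  note p = colour_perms_permutes[OF \<pi>] and p' = permutes_inv[OF colour_perms_permutes[OF \<pi>]]
  let ?i = "inv_into UNIV \<pi>"
  let ?q = "\<lambda>z. disc_fun z ^ disc_exp * (sep (\<lambda>i. z (\<pi> i)) * Q z)"
  let ?b = "\<lambda>r. b (\<pi> r)"
  have okb: "valid_rows ?b" by (rule valid_rows_colour_perms[OF b \<pi>])
  have dp: "(\<lambda>z. disc_fun z ^ disc_exp) \<in> poly_maps M" by (intro poly_maps_power disc_fun_poly_maps)
  have qp: "?q \<in> poly_maps M"
    by (intro poly_maps_mult dp poly_maps_permute[OF sep_poly_maps p] Q)
  have Qi: "(\<lambda>z. Q (\<lambda>i. z (?i i))) \<in> poly_maps M" by (rule poly_maps_permute[OF Q p'])
  have q'p: "(\<lambda>z. disc_fun z ^ disc_exp * (sep z * Q (\<lambda>i. z (?i i)))) \<in> poly_maps M"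
    by (rule poly_maps_mult[OF dp poly_maps_mult[OF sep_poly_maps Qi]])
  have perm: "elt ?q b XA = signof \<pi> * elt (\<lambda>z. disc_fun z ^ disc_exp * (sep z * Q (\<lambda>i. z (?i i)))) ?b XA" if XA: "XA \<in> mat_pairs M p" for XA
  proof -
    have "elt ?q b XA = signof \<pi> * alt M p (\<lambda>z. disc_fun (\<lambda>i. z (?i i)) ^ disc_exp * (sep (\<lambda>i. z (?i (\<pi> i))) * Q (\<lambda>i. z (?i i)))) (\<lambda>r. standard b (\<pi> r)) XA"
      using fun_cong[OF alt_permute[where w="standard b", OF qp standard_less[OF b] p], of XA] XA by (simp only: restrict_apply if_True)
    also have "(\<lambda>z. disc_fun (\<lambda>i. z (?i i)) ^ disc_exp * (sep (\<lambda>i. z (?i (\<pi> i))) * Q (\<lambda>i. z (?i i)))) =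
      (\<lambda>z. disc_fun z ^ disc_exp * (sep z * Q (\<lambda>i. z (?i i))))"
      by (simp only: disc_fun_permute[OF p'] permutes_inverses(2)[OF p])
    also have "alt M p (\<lambda>z. disc_fun z ^ disc_exp * (sep z * Q (\<lambda>i. z (?i i)))) (\<lambda>r. standard b (\<pi> r)) = elt (\<lambda>z. disc_fun z ^ disc_exp * (sep z * Q (\<lambda>i. z (?i i)))) ?b"
    proof (rule alt_cong[OF q'p])
      show "standard b (\<pi> r) < p" if "r < M" for r by (rule standard_less[OF b colour_perms_less[OF \<pi> that]])
      show "standard b (\<pi> r) = standard ?b r" if "r < M" for r by (simp add: standard_def colour_perms_mod[OF \<pi> that])
    qed
    finally show ?thesis .
  qed
  let ?h = "\<lambda>z. signof \<pi> * Q (\<lambda>i. z (?i i)) - sep_elt_part Q \<pi> (base z)"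
  have sQ: "(\<lambda>z. signof \<pi> * Q (\<lambda>i. z (?i i))) \<in> poly_maps M" by (intro poly_maps_mult poly_maps_const Qi)
  have v: "vanishing (\<lambda>z. sep z * ?h z)"
  proof (rule vanishing_sep)
    show "?h \<in> poly_maps M" by (rule poly_maps_diff[OF sQ base_poly_maps[OF sep_elt_part_poly_maps[OF Q \<pi>]]])
    show "signof \<pi> * Q (\<lambda>i. x (?i i div k)) - sep_elt_part Q \<pi> (\<lambda>i. x (i * k div k)) = 0" for x
      using k_pos by (simp add: sep_elt_part_def)
  qed
  show ?thesis
  proof (rule negligible_cong[OF vanishing_negligible[OF v okb]])
    fix XA assume XA: "XA \<in> mat_pairs M p"
    have "elt (\<lambda>z. disc_fun z ^ disc_exp * (sep z * ?h z)) ?b XA =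
      elt (\<lambda>z. signof \<pi> * (disc_fun z ^ disc_exp * (sep z * Q (\<lambda>i. z (?i i)))) - disc_fun z ^ disc_exp * (sep z * sep_elt_part Q \<pi> (base z))) ?b XA"
      by (simp only: right_diff_distrib mult_ac)
    also have "\<dots> = elt (\<lambda>z. signof \<pi> * (disc_fun z ^ disc_exp * (sep z * Q (\<lambda>i. z (?i i))))) ?b XA - sep_elt (sep_elt_part Q \<pi>) ?b XA"
      unfolding sep_elt_def
      by (rule elt_diff[OF poly_maps_mult[OF poly_maps_const q'p] sep_elt_poly_maps[OF sep_elt_part_poly_maps[OF Q \<pi>]] okb XA])
    also have "elt (\<lambda>z. signof \<pi> * (disc_fun z ^ disc_exp * (sep z * Q (\<lambda>i. z (?i i))))) ?b XA = elt ?q b XA"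
      unfolding perm[OF XA] by (rule elt_cmult[OF q'p okb XA])
    finally show "elt ?q b XA - sep_elt (sep_elt_part Q \<pi>) ?b XA = elt (\<lambda>z. disc_fun z ^ disc_exp * (sep z * ?h z)) ?b XA" by simp
  qed
qed

text \<open>Modulo polynomials that vanish at all admissible points, \<open>theta\<close> is the sum
  of the rearranged selecting factors, each of which contributes one \<open>sep_elt\<close>.\<close>

lemma elt_theta:
  assumes Q: "Q \<in> poly_maps M" and b: "valid_rows b"
  shows "negligible (\<lambda>XA. elt (\<lambda>z. disc_fun z ^ disc_exp * (theta (base z) * Q z)) b XA - (\<Sum>\<pi>\<in>colour_perms. sep_elt (sep_elt_part Q \<pi>) (\<lambda>r. b (\<pi> r)) XA))"
proof -
  let ?t = "\<lambda>\<pi> z. disc_fun z ^ disc_exp * (sep (\<lambda>i. z (\<pi> i)) * Q z)"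
  have dp: "(\<lambda>z. disc_fun z ^ disc_exp) \<in> poly_maps M" by (intro poly_maps_power disc_fun_poly_maps)
  have tp: "?t \<pi> \<in> poly_maps M" if "\<pi> \<in> colour_perms" for \<pi>
    by (intro poly_maps_mult dp poly_maps_permute[OF sep_poly_maps colour_perms_permutes[OF that]] Q)
  have thp: "(\<lambda>z. disc_fun z ^ disc_exp * (theta (base z) * Q z)) \<in> poly_maps M"
    by (intro poly_maps_mult dp base_poly_maps[OF theta_poly_maps] Q)
  have "negligible (\<lambda>XA. elt (\<lambda>z. disc_fun z ^ disc_exp * ((theta (base z) - (\<Sum>\<pi>\<in>colour_perms. sep (\<lambda>i. z (\<pi> i)))) * Q z)) b XA +
      (\<Sum>\<pi>\<in>colour_perms. elt (?t \<pi>) b XA - sep_elt (sep_elt_part Q \<pi>) (\<lambda>r. b (\<pi> r)) XA))"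
    by (intro negligible_add vanishing_negligible[OF vanishing_mult[OF vanishing_theta Q] b] negligible_sum elt_sep_colour_perms Q b)
  then show ?thesis
  proof (rule negligible_cong)
    fix XA assume XA: "XA \<in> mat_pairs M p"
    have "elt (\<lambda>z. disc_fun z ^ disc_exp * ((theta (base z) - (\<Sum>\<pi>\<in>colour_perms. sep (\<lambda>i. z (\<pi> i)))) * Q z)) b XA =
      elt (\<lambda>z. disc_fun z ^ disc_exp * (theta (base z) * Q z) - (\<Sum>\<pi>\<in>colour_perms. ?t \<pi> z)) b XA"
      by (simp only: left_diff_distrib right_diff_distrib sum_distrib_left sum_distrib_right)
    also have "\<dots> = elt (\<lambda>z. disc_fun z ^ disc_exp * (theta (base z) * Q z)) b XA - (\<Sum>\<pi>\<in>colour_perms. elt (?t \<pi>) b XA)"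
    proof -
      have "(\<lambda>z. \<Sum>\<pi>\<in>colour_perms. ?t \<pi> z) \<in> poly_maps M" by (intro poly_maps_sum tp)
      moreover have "elt (\<lambda>z. \<Sum>\<pi>\<in>colour_perms. ?t \<pi> z) b XA = (\<Sum>\<pi>\<in>colour_perms. elt (?t \<pi>) b XA)" by (rule elt_sum[OF tp b XA])
      ultimately show ?thesis using elt_diff[OF thp _ b XA, of "\<lambda>z. \<Sum>\<pi>\<in>colour_perms. ?t \<pi> z"] by (simp only:)
    qed
    finally show "elt (\<lambda>z. disc_fun z ^ disc_exp * (theta (base z) * Q z)) b XA - (\<Sum>\<pi>\<in>colour_perms. sep_elt (sep_elt_part Q \<pi>) (\<lambda>r. b (\<pi> r)) XA) =
      elt (\<lambda>z. disc_fun z ^ disc_exp * ((theta (base z) - (\<Sum>\<pi>\<in>colour_perms. sep (\<lambda>i. z (\<pi> i)))) * Q z)) b XA +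
      (\<Sum>\<pi>\<in>colour_perms. elt (?t \<pi>) b XA - sep_elt (sep_elt_part Q \<pi>) (\<lambda>r. b (\<pi> r)) XA)"
      by (simp add: sum_subtractf)
  qed
qed

text \<open>Vanishing of the level-rank values is exactly the linear relation between content
  functions that \<open>sep_elt_independent\<close> asks for, with the family indexed by
  \<open>T \<times> colour_perms\<close>.\<close>

lemma elt_kernel:
  fixes Q :: "'t \<Rightarrow> (nat \<Rightarrow> complex) \<Rightarrow> complex"
  assumes fin: "finite T" and Q: "\<And>t. t \<in> T \<Longrightarrow> Q t \<in> poly_maps M" and b: "\<And>t. t \<in> T \<Longrightarrow> valid_rows (b t)"
    and z: "\<And>x A. A \<in> carrier_mat n N \<Longrightarrow> (\<Sum>t\<in>T. level_rank k n N (elt (Q t) (b t)) (mat_diag N x, A)) = 0"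
  shows "negligible (\<lambda>XA. \<Sum>t\<in>T. elt (\<lambda>z. disc_fun z ^ disc_exp * (theta (base z) * Q t z)) (b t) XA)"
proof -
  have "negligible (\<lambda>XA. \<Sum>u\<in>T \<times> colour_perms. sep_elt (case u of (t, \<pi>) \<Rightarrow> sep_elt_part (Q t) \<pi>) (case u of (t, \<pi>) \<Rightarrow> \<lambda>r. b t (\<pi> r)) XA)"
  proof (rule sep_elt_independent)
    show "finite (T \<times> colour_perms)" using fin finite_colour_perms by simp
    show "(case u of (t, \<pi>) \<Rightarrow> sep_elt_part (Q t) \<pi>) \<in> poly_maps N" if "u \<in> T \<times> colour_perms" for u
      using that Q sep_elt_part_poly_maps by auto
    show "valid_rows (case u of (t, \<pi>) \<Rightarrow> \<lambda>r. b t (\<pi> r))" if "u \<in> T \<times> colour_perms" for u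
      using that b valid_rows_colour_perms by auto
    fix x :: "nat \<Rightarrow> complex" and A :: "nat \<Rightarrow> nat \<Rightarrow> complex"
    let ?A = "mat n N (\<lambda>(c, i). A c i)"
    have "level_rank k n N (elt (Q t) (b t)) (mat_diag N x, ?A) = (\<Sum>\<pi>\<in>colour_perms. sep_elt_part (Q t) \<pi> x * content (\<lambda>r. b t (\<pi> r)) A)" if t: "t \<in> T" for t
    proof -
      let ?F = "\<lambda>\<pi>. signof \<pi> * Q t (\<lambda>r. x (\<pi> r div k)) * (\<Prod>r<M. ?A $$ (b t r, \<pi> r div k))"
      have "level_rank k n N (elt (Q t) (b t)) (mat_diag N x, ?A) = (\<Sum>\<pi>\<in>colour_perms. ?F \<pi>)"
        by (rule level_rank_elt[OF Q[OF t] b[OF t]]) simp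
      \<comment> \<open>Passing to inverses lets the permutation act on the rows instead of the
        sites, which is the shape of \<open>content\<close>.\<close>
      also have "\<dots> = (\<Sum>\<pi>\<in>colour_perms. ?F (inv_into UNIV \<pi>))" by (rule colour_perms_sum_inv[symmetric])
      also have "\<dots> = (\<Sum>\<pi>\<in>colour_perms. sep_elt_part (Q t) \<pi> x * content (\<lambda>r. b t (\<pi> r)) A)"
      proof (rule sum.cong[OF refl])
        fix \<pi> assume \<pi>: "\<pi> \<in> colour_perms"
        note p = colour_perms_permutes[OF \<pi>]
        have "(\<Prod>r<M. ?A $$ (b t r, inv_into UNIV \<pi> r div k)) = (\<Prod>r<M. ?A $$ (b t (\<pi> r), inv_into UNIV \<pi> (\<pi> r) div k))"
          by (rule prod.reindex_bij_betw[OF permutes_imp_bij[OF p], symmetric])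
        also have "\<dots> = content (\<lambda>r. b t (\<pi> r)) A"
          unfolding content_def permutes_inverses(2)[OF p]
          by (rule prod.cong[OF refl]) (simp add: valid_rowsD[OF b[OF t]] colour_perms_less[OF \<pi>] block_div_less)
        finally have "(\<Prod>r<M. ?A $$ (b t r, inv_into UNIV \<pi> r div k)) = content (\<lambda>r. b t (\<pi> r)) A" .
        moreover have "sign (inv_into UNIV \<pi>) = sign \<pi>" by (rule sign_inverse[OF permutes_finite_permutation[OF p]])
        ultimately show "?F (inv_into UNIV \<pi>) = sep_elt_part (Q t) \<pi> x * content (\<lambda>r. b t (\<pi> r)) A"
          by (simp only: sep_elt_part_def)
      qed
      finally show ?thesis .
    qed
    then have "(\<Sum>t\<in>T. \<Sum>\<pi>\<in>colour_perms. sep_elt_part (Q t) \<pi> x * content (\<lambda>r. b t (\<pi> r)) A) = 0"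
      using z[of ?A x] by simp
    then show "(\<Sum>u\<in>T \<times> colour_perms. (case u of (t, \<pi>) \<Rightarrow> sep_elt_part (Q t) \<pi>) x * content (case u of (t, \<pi>) \<Rightarrow> \<lambda>r. b t (\<pi> r)) A) = 0"
      unfolding sum.cartesian_product by (simp add: case_prod_unfold)
  qed
  moreover have "(\<Sum>u\<in>T \<times> colour_perms. sep_elt (case u of (t, \<pi>) \<Rightarrow> sep_elt_part (Q t) \<pi>) (case u of (t, \<pi>) \<Rightarrow> \<lambda>r. b t (\<pi> r)) XA) =
    (\<Sum>t\<in>T. \<Sum>\<pi>\<in>colour_perms. sep_elt (sep_elt_part (Q t) \<pi>) (\<lambda>r. b t (\<pi> r)) XA)" for XA
    unfolding sum.cartesian_product by (simp add: case_prod_unfold)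
  ultimately have "negligible (\<lambda>XA. \<Sum>t\<in>T. \<Sum>\<pi>\<in>colour_perms. sep_elt (sep_elt_part (Q t) \<pi>) (\<lambda>r. b t (\<pi> r)) XA)" by (simp only:)
  moreover have "negligible (\<lambda>XA. \<Sum>t\<in>T. elt (\<lambda>z. disc_fun z ^ disc_exp * (theta (base z) * Q t z)) (b t) XA -
      (\<Sum>\<pi>\<in>colour_perms. sep_elt (sep_elt_part (Q t) \<pi>) (\<lambda>r. b t (\<pi> r)) XA))"
    by (intro negligible_sum elt_theta Q b)
  ultimately have "negligible (\<lambda>XA. (\<Sum>t\<in>T. elt (\<lambda>z. disc_fun z ^ disc_exp * (theta (base z) * Q t z)) (b t) XA -
      (\<Sum>\<pi>\<in>colour_perms. sep_elt (sep_elt_part (Q t) \<pi>) (\<lambda>r. b t (\<pi> r)) XA)) + (\<Sum>t\<in>T. \<Sum>\<pi>\<in>colour_perms. sep_elt (sep_elt_part (Q t) \<pi>) (\<lambda>r. b t (\<pi> r)) XA))"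
    by (rule negligible_add[rotated])
  then show ?thesis by (simp add: sum_subtractf)
qed

end

section \<open>Signs of block permutations and powers of scalars\<close>

lemma det_permutation_mat:
  assumes \<sigma>: "\<sigma> permutes {..<m}"
  shows "det (mat m m (\<lambda>(i, j). if \<sigma> i = j then 1 else 0) :: complex mat) = signof \<sigma>"
proof -
  let ?B = "mat m m (\<lambda>(i, j). if \<sigma> i = j then 1 else 0) :: complex mat"
  have "det ?B = (\<Sum>\<rho> | \<rho> permutes {..<m}. signof \<rho> * (\<Prod>r<m. ?B $$ (r, \<rho> r)))"
    by (rule det_eq_sum) simp
  also have "\<dots> = (\<Sum>\<rho>\<in>{\<sigma>}. signof \<rho> * (\<Prod>r<m. ?B $$ (r, \<rho> r)))"
  proof (rule sum.mono_neutral_right)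
    show "finite {\<rho>. \<rho> permutes {..<m}}" by (rule finite_permutations) simp
    show "{\<sigma>} \<subseteq> {\<rho>. \<rho> permutes {..<m}}" using \<sigma> by simp
    show "\<forall>\<rho>\<in>{\<rho>. \<rho> permutes {..<m}} - {\<sigma>}. signof \<rho> * (\<Prod>r<m. ?B $$ (r, \<rho> r)) = 0"
    proof
      fix \<rho> assume \<rho>: "\<rho> \<in> {\<rho>. \<rho> permutes {..<m}} - {\<sigma>}"
      then obtain r where r: "\<rho> r \<noteq> \<sigma> r" by auto
      then have rm: "r < m" using \<rho> \<sigma> by (metis DiffE lessThan_iff mem_Collect_eq permutes_not_in)
      have "?B $$ (r, \<rho> r) = 0" using rm r \<rho> permutes_less[of \<rho> m r] by simp
      then have "(\<Prod>r<m. ?B $$ (r, \<rho> r)) = 0" using rm by (intro prod_zero) auto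
      then show "signof \<rho> * (\<Prod>r<m. ?B $$ (r, \<rho> r)) = 0" by (simp only: mult_zero_right)
    qed
  qed
  also have "\<dots> = signof \<sigma>" using permutes_less[OF \<sigma>] by simp
  finally show ?thesis .
qed

text \<open>The permutation matrix of \<open>\<pi>\<close> is that of \<open>\<sigma>\<close>
  tensored with the identity of size \<open>k\<close>, so the signs are compared as
  determinants.\<close>

lemma signof_block_permutation:
  fixes k :: nat
  assumes \<sigma>: "\<sigma> permutes {..<N}" and \<pi>: "\<pi> permutes {..<k * N}" and eq: "\<And>r. r < k * N \<Longrightarrow> \<pi> r = \<sigma> (r div k) * k + r mod k" and k: "k > 0"
  shows "(signof \<pi> :: complex) = signof \<sigma> ^ k"
proof -
  let ?B = "mat N N (\<lambda>(i, j). if \<sigma> i = j then 1 else 0) :: complex mat"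
  let ?C = "mat (k * N) (k * N) (\<lambda>(i, j). if \<pi> i = j then 1 else 0) :: complex mat"
  have B: "?B \<in> carrier_mat N N" by simp
  have "?B \<otimes>\<^sub>K 1\<^sub>m k = ?C"
  proof (rule eq_matI)
    fix i j assume "i < dim_row ?C" "j < dim_col ?C"
    then have ij: "i < k * N" "j < k * N" by auto
    have "\<pi> i = j \<longleftrightarrow> \<sigma> (i div k) = j div k \<and> i mod k = j mod k"
    proof
      assume "\<pi> i = j"
      then have j: "j = \<sigma> (i div k) * k + i mod k" using eq[OF ij(1)] by simp
      show "\<sigma> (i div k) = j div k \<and> i mod k = j mod k" unfolding j using k by simp
    next
      assume "\<sigma> (i div k) = j div k \<and> i mod k = j mod k"
      then show "\<pi> i = j" using eq[OF ij(1)] by simp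
    qed
    then show "(?B \<otimes>\<^sub>K 1\<^sub>m k) $$ (i, j) = ?C $$ (i, j)"
      using ij block_div_less[OF ij(1)] block_div_less[OF ij(2)] by (simp add: kron_one_index[OF B ij])
  qed (use kron_one_carrier[OF B, of k] in auto)
  then show ?thesis
    using det_kron_one[OF B k] by (simp only: det_permutation_mat[OF \<sigma>] det_permutation_mat[OF \<pi>])
qed

lemma sym_ring_pow:
  assumes "x \<in> carrier_vec N"
  shows "(r [^]\<^bsub>sym_ring N\<^esub> (m :: nat)) x = r x ^ m"
  using assms by (induction m) (simp_all add: nat_pow_def sym_ring_def)

lemma trace_form_pow:
  assumes r: "r \<in> sym_polys N"
  shows "trace_form N c (r [^]\<^bsub>sym_ring N\<^esub> (m :: nat)) X = trace_form N c r X ^ m"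
proof -
  interpret cring "sym_ring N" by (rule cring_sym_ring)
  have "r [^]\<^bsub>sym_ring N\<^esub> m \<in> sym_polys N" using nat_pow_closed[of r m] r by (simp add: sym_ring_def)
  moreover obtain x where "x \<in> carrier_vec N" "\<forall>r\<in>sym_polys N. trace_form N c r X = r x"
  proof (rule trace_form_point[where N=N and c=c and X=X])
    fix x assume "x \<in> carrier_vec N" "\<And>r. r \<in> sym_polys N \<Longrightarrow> trace_form N c r X = r x"
    then show thesis by (intro that ballI)
  qed
  ultimately show ?thesis using r by (simp add: sym_ring_pow)
qed

section \<open>Reduction to standard words and torsion of the kernel\<close>

context level_rank_setting
begin

definition colour_count :: "(nat \<Rightarrow> nat) \<Rightarrow> nat \<Rightarrow> nat" where
  "colour_count w a = (\<Sum>r<M. if w r mod k = a then 1 else 0)"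

text \<open>A constant Cartan element acts by the difference of the two colour counts. This number
  is nonzero, so the element is a multiple of its own image.\<close>

lemma unbalanced_negligible:
  assumes q: "q \<in> poly_maps M" and w: "\<And>r. r < M \<Longrightarrow> w r < p" and a: "a < k" "a' < k"
    and ne: "colour_count w a \<noteq> colour_count w a'"
  shows "negligible (alt M p q w)"
proof -
  let ?c = "of_nat (colour_count w a) - of_nat (colour_count w a') :: complex"
  have c: "?c \<noteq> 0" using ne by simp
  have ccount: "(of_nat (colour_count w a) :: complex) = (\<Sum>r<M. if w r mod k = a then 1 else 0)" for a
    unfolding colour_count_def of_nat_sum by (intro sum.cong refl) simp
  have eq: "(\<Sum>r<M. (if w r mod k = a then z r ^ 0 else 0) - (if w r mod k = a' then z r ^ 0 else 0)) = ?c" for z :: "nat \<Rightarrow> complex"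
    unfolding ccount by (simp only: power_0 sum_subtractf)
  show ?thesis
  proof (rule negligible_cong)
    show "negligible (\<lambda>XA. 1 / ?c * gl_act M p (1\<^sub>m n \<otimes>\<^sub>K diag_current a a' 0) (alt M p q w) XA)"
      by (rule negligible_cmult[OF negligible_gl_act[OF diag_current_sl[OF a] alt_\<H>[OF q w]]])
    fix XA assume XA: "XA \<in> mat_pairs M p"
    have "gl_act M p (1\<^sub>m n \<otimes>\<^sub>K diag_current a a' 0) (alt M p q w) XA = alt M p (\<lambda>z. ?c * q z) w XA"
      using gl_act_diag_current[where a=a and a'=a' and m=0 and w=w, OF q w XA] by (simp only: eq)
    also have "\<dots> = ?c * alt M p q w XA"
      using fun_cong[OF alt_cmult[where c="?c" and w=w, OF q w], of XA] XA by (simp only: restrict_apply if_True)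
    finally show "alt M p q w XA = 1 / ?c * gl_act M p (1\<^sub>m n \<otimes>\<^sub>K diag_current a a' 0) (alt M p q w) XA"
      using c by simp
  qed
qed

lemma sum_colour_count: "(\<Sum>a<k. colour_count w a) = M"
proof -
  have "(\<Sum>a<k. colour_count w a) = (\<Sum>r<M. \<Sum>a<k. if w r mod k = a then 1 else 0)"
    unfolding colour_count_def by (rule sum.swap)
  also have "\<dots> = (\<Sum>r<M. 1)" using k_pos by (intro sum.cong refl) simp
  finally show ?thesis by simp
qed

lemma colour_count_id: "a < k \<Longrightarrow> colour_count (\<lambda>r. r) a = N"
  unfolding colour_count_def sum_blocks[OF k_pos] by simp

text \<open>If all colours occur equally often, each occurs \<open>N\<close> times and a permutation
  of positions brings the colours into standard order, at the price of a sign. Any other word is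
  negligible and is represented by a zero coefficient.\<close>

lemma alt_standard:
  assumes q: "q \<in> poly_maps M" and w: "\<And>r. r < M \<Longrightarrow> w r < p"
  shows "\<exists>Q b. Q \<in> poly_maps M \<and> valid_rows b \<and> negligible (\<lambda>XA. alt M p q w XA - elt Q b XA)"
proof (cases "\<forall>a<k. \<forall>a'<k. colour_count w a = colour_count w a'")
  case False
  then obtain a a' where a: "a < k" "a' < k" "colour_count w a \<noteq> colour_count w a'" by blast
  \<comment> \<open>A placeholder for the rows of the zero element; row 0 exists because
    \<open>n > 0\<close>.\<close>
  have valid_rows: "valid_rows (\<lambda>_. 0)" using n_pos by (simp add: valid_rows_def)
  have "negligible (\<lambda>XA. alt M p q w XA - elt (\<lambda>z. 0) (\<lambda>_. 0) XA)"
  proof (rule negligible_cong[OF unbalanced_negligible[where w=w, OF q w a]])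
    fix XA assume XA: "XA \<in> mat_pairs M p"
    show "alt M p q w XA - elt (\<lambda>z. 0) (\<lambda>_. 0) XA = alt M p q w XA"
      using alt_zero[where w="standard (\<lambda>_. 0)", OF standard_less[OF valid_rows] XA] by simp
  qed
  then show ?thesis using poly_maps_const valid_rows by blast
next
  case True
  have count: "colour_count w a = colour_count (\<lambda>r. r) a" for a
  proof (cases "a < k")
    case a: True
    have "(\<Sum>a'<k. colour_count w a') = (\<Sum>a'<k. colour_count w a)"
    proof (rule sum.cong[OF refl])
      fix a' assume "a' \<in> {..<k}"
      then show "colour_count w a' = colour_count w a" using True a by blast
    qed
    then have "k * N = k * colour_count w a" by (simp only: sum_colour_count sum_constant card_lessThan of_nat_id)
    then have "N = colour_count w a" using k_pos by (simp only: nat_mult_eq_cancel1)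
    then show ?thesis by (metis colour_count_id[OF a])
  next
    case False
    then have "r mod k \<noteq> a" for r using mod_less_divisor[OF k_pos, of r] by linarith
    then show ?thesis by (simp add: colour_count_def)
  qed
  obtain \<sigma> where \<sigma>: "\<sigma> permutes {..<M}" "\<forall>r<M. w (\<sigma> r) mod k = r mod k"
    by (rule exists_permutation_eq_counts[where m=M and f="\<lambda>r. w r mod k" and g="\<lambda>r. r mod k", OF count[unfolded colour_count_def]])
  let ?b = "\<lambda>r. w (\<sigma> r) div k"
  let ?q = "\<lambda>z. q (\<lambda>i. z (inv_into UNIV \<sigma> i))"
  have w': "w (\<sigma> r) < p" if "r < M" for r by (rule w[OF permutes_less[OF \<sigma>(1) that]])
  have valid_rows: "valid_rows ?b" unfolding valid_rows_def using block_div_less[OF w'] by blast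
  have qp: "?q \<in> poly_maps M" by (rule poly_maps_permute[OF q permutes_inv[OF \<sigma>(1)]])
  have word: "alt M p ?q (\<lambda>r. w (\<sigma> r)) = elt ?q ?b"
  proof (rule alt_cong[OF qp w'])
    show "w (\<sigma> r) = standard ?b r" if "r < M" for r
      using \<sigma>(2) that div_mult_mod_eq[of "w (\<sigma> r)" k] by (simp add: standard_def)
  qed
  have "negligible (\<lambda>XA. alt M p q w XA - elt (\<lambda>z. signof \<sigma> * ?q z) ?b XA)"
  proof (rule negligible_cong[OF negligible_zero])
    fix XA assume XA: "XA \<in> mat_pairs M p"
    have "alt M p q w XA = signof \<sigma> * elt ?q ?b XA"
      using fun_cong[OF alt_permute[where w=w, OF q w \<sigma>(1)], of XA] XA by (simp only: restrict_apply if_True word)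
    also have "\<dots> = elt (\<lambda>z. signof \<sigma> * ?q z) ?b XA" by (rule elt_cmult[OF qp valid_rows XA, symmetric])
    finally show "alt M p q w XA - elt (\<lambda>z. signof \<sigma> * ?q z) ?b XA = 0" by simp
  qed
  moreover have "(\<lambda>z. signof \<sigma> * ?q z) \<in> poly_maps M" by (intro poly_maps_mult poly_maps_const qp)
  ultimately show ?thesis using valid_rows by blast
qed

lemma \<H>_standard_expansion:
  assumes f: "f \<in> \<H> M p 1"
  obtains T :: "(nat \<Rightarrow> nat) set" and Q b where "finite T" "\<forall>w\<in>T. Q w \<in> poly_maps M \<and> valid_rows (b w)"
    "negligible (\<lambda>XA. f XA - (\<Sum>w\<in>T. elt (Q w) (b w) XA))"
proof -
  let ?W = "{..<M} \<rightarrow>\<^sub>E {..<p}"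
  obtain q where q: "\<forall>w. q w \<in> poly_maps M" "f = (\<lambda>XA\<in>mat_pairs M p. \<Sum>w\<in>?W. alt M p (q w) w XA)"
    using \<H>_alt_expansion[OF f] by blast
  have "\<exists>Qb. fst Qb \<in> poly_maps M \<and> valid_rows (snd Qb) \<and> negligible (\<lambda>XA. alt M p (q w) w XA - elt (fst Qb) (snd Qb) XA)"
    if "w \<in> ?W" for w
  proof -
    have "w r < p" if "r < M" for r using \<open>w \<in> ?W\<close> that by auto
    from alt_standard[where w=w, OF q(1)[rule_format] this] show ?thesis by force
  qed
  then have "\<forall>w\<in>?W. \<exists>Qb. fst Qb \<in> poly_maps M \<and> valid_rows (snd Qb) \<and> negligible (\<lambda>XA. alt M p (q w) w XA - elt (fst Qb) (snd Qb) XA)"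
    by blast
  from bchoice[OF this] obtain Qb where
    "\<forall>w\<in>?W. fst (Qb w) \<in> poly_maps M \<and> valid_rows (snd (Qb w)) \<and> negligible (\<lambda>XA. alt M p (q w) w XA - elt (fst (Qb w)) (snd (Qb w)) XA)"
    by blast
  note Qb = this[rule_format]
  have "negligible (\<lambda>XA. \<Sum>w\<in>?W. alt M p (q w) w XA - elt (fst (Qb w)) (snd (Qb w)) XA)"
    using Qb by (intro negligible_sum) blast
  then have neg: "negligible (\<lambda>XA. f XA - (\<Sum>w\<in>?W. elt (fst (Qb w)) (snd (Qb w)) XA))"
    by (rule negligible_cong) (simp add: q(2) sum_subtractf)
  have fin: "finite ?W" by (intro finite_PiE) auto
  show ?thesis using Qb by (intro that[OF fin _ neg]) blast
qed

definition disc_trace :: "nat \<Rightarrow> complex mat \<Rightarrow> complex" where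
  "disc_trace m X = trace_form N (1 / of_nat k) (Disc N) X ^ m"

lemma disc_trace_mat_polys: "(\<lambda>XA\<in>mat_pairs M p. disc_trace m (fst XA)) \<in> mat_polys M p"
  unfolding disc_trace_def by (intro mat_polys_intros trace_form_mat_polys Disc_sym_polys)

lemma disc_trace_conj: "inv_pair M g h \<Longrightarrow> X \<in> carrier_mat M M \<Longrightarrow> disc_trace m (g * X * h) = disc_trace m X"
  unfolding disc_trace_def by (simp only: trace_form_conj)

lemma disc_trace_elt:
  assumes Q: "Q \<in> poly_maps M" and b: "valid_rows b" and XA: "XA \<in> mat_pairs M p"
  shows "disc_trace m (fst XA) * elt Q b XA = elt (\<lambda>z. disc_fun z ^ m * Q z) b XA"
proof -
  have "(\<lambda>XA\<in>mat_pairs M p. disc_trace m (fst XA) * elt Q b XA) = elt (\<lambda>z. disc_fun z ^ m * Q z) b"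
  proof (rule alt_mult_invariant[where w="standard b", OF Q standard_less[OF b] disc_trace_mat_polys disc_trace_conj])
    show "(\<lambda>z. disc_fun z ^ m) \<in> poly_maps M" by (rule poly_maps_power[OF disc_fun_poly_maps])
  qed (simp_all add: disc_trace_def disc_fun_def[symmetric] disc_fun_permute)
  from fun_cong[OF this, of XA] show ?thesis using XA by (simp only: restrict_apply if_True)
qed

text \<open>Modulo the ideal, \<open>k * k\<close> factors of \<open>disc_fun\<close> may be traded
  for \<open>theta\<close>. The constant undoes the number of site permutations in
  \<open>theta\<close> and the sign between the two forms of the discriminant.\<close>

lemma elt_dsc_theta:
  assumes e: "(\<lambda>z. disc_fun z ^ (k * k) - (e * ordered_disc N (base z)) ^ (k * k)) \<in> rel_ideal" and Q: "Q \<in> poly_maps M" and b: "valid_rows b"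
  shows "negligible (\<lambda>XA. elt (\<lambda>z. disc_fun z ^ (disc_exp + k * k) * Q z) b XA -
    e ^ (k * k) / of_nat (card site_perms) * elt (\<lambda>z. disc_fun z ^ disc_exp * (theta (base z) * Q z)) b XA)"
proof -
  let ?c = "e ^ (k * k) / of_nat (card site_perms)"
  have dp: "(\<lambda>z. disc_fun z ^ m) \<in> poly_maps M" for m by (intro poly_maps_power disc_fun_poly_maps)
  have p1: "(\<lambda>z. disc_fun z ^ (disc_exp + k * k) * Q z) \<in> poly_maps M" by (intro poly_maps_mult dp Q)
  have p2: "(\<lambda>z. disc_fun z ^ disc_exp * (theta (base z) * Q z)) \<in> poly_maps M"
    by (intro poly_maps_mult dp base_poly_maps[OF theta_poly_maps] Q)
  have p3: "(\<lambda>z. ?c * (disc_fun z ^ disc_exp * (theta (base z) * Q z))) \<in> poly_maps M"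
    by (intro poly_maps_mult poly_maps_const p2)
  have "negligible (elt (\<lambda>z. (disc_fun z ^ (k * k) - (e * ordered_disc N (base z)) ^ (k * k)) * (disc_fun z ^ disc_exp * Q z)) b)"
    by (intro rel_idealD[OF e _ b] poly_maps_mult dp Q)
  then show "negligible (\<lambda>XA. elt (\<lambda>z. disc_fun z ^ (disc_exp + k * k) * Q z) b XA - ?c * elt (\<lambda>z. disc_fun z ^ disc_exp * (theta (base z) * Q z)) b XA)"
  proof (rule negligible_cong)
    fix XA assume XA: "XA \<in> mat_pairs M p"
    have "(e * ordered_disc N (base z)) ^ (k * k) * (disc_fun z ^ disc_exp * Q z) = ?c * (disc_fun z ^ disc_exp * (theta (base z) * Q z))" for z
      using card_site_perms by (simp add: theta_eq power_mult_distrib)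
    moreover have "disc_fun z ^ (disc_exp + k * k) * Q z = disc_fun z ^ (k * k) * (disc_fun z ^ disc_exp * Q z)" for z by (simp add: power_add)
    ultimately have "(\<lambda>z. (disc_fun z ^ (k * k) - (e * ordered_disc N (base z)) ^ (k * k)) * (disc_fun z ^ disc_exp * Q z)) =
      (\<lambda>z. disc_fun z ^ (disc_exp + k * k) * Q z - ?c * (disc_fun z ^ disc_exp * (theta (base z) * Q z)))"
      by (simp only: left_diff_distrib)
    then show "elt (\<lambda>z. disc_fun z ^ (disc_exp + k * k) * Q z) b XA - ?c * elt (\<lambda>z. disc_fun z ^ disc_exp * (theta (base z) * Q z)) b XA =
      elt (\<lambda>z. (disc_fun z ^ (k * k) - (e * ordered_disc N (base z)) ^ (k * k)) * (disc_fun z ^ disc_exp * Q z)) b XA"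
      using elt_diff[OF p1 p3 b XA] elt_cmult[OF p2 b XA, of ?c] by (simp only:)
  qed
qed

text \<open>In the exponent, \<open>disc_exp\<close> makes vanishing polynomials negligible and the
  further \<open>k * k\<close> factors are traded for \<open>theta\<close>, after which
  \<open>elt_kernel\<close> applies to a standard expansion of \<open>f\<close>.\<close>

lemma level_rank_kernel:
  assumes f: "f \<in> \<H> M p 1" and z: "level_rank k n N f = (\<lambda>XA\<in>mat_pairs N n. 0)"
  shows "negligible (\<lambda>XA. disc_trace (disc_exp + k * k) (fst XA) * f XA)"
proof -
  obtain T :: "(nat \<Rightarrow> nat) set" and Q b where fin: "finite T" and "\<forall>w\<in>T. Q w \<in> poly_maps M \<and> valid_rows (b w)"
    and neg: "negligible (\<lambda>XA. f XA - (\<Sum>w\<in>T. elt (Q w) (b w) XA))"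
    by (rule \<H>_standard_expansion[OF f])
  then have Q: "Q w \<in> poly_maps M" and b: "valid_rows (b w)" if "w \<in> T" for w using that by auto
  have "(\<Sum>w\<in>T. level_rank k n N (elt (Q w) (b w)) (mat_diag N x, A)) = 0" if A: "A \<in> carrier_mat n N" for x and A :: "complex mat"
  proof -
    let ?P = "(mat_diag N x \<otimes>\<^sub>K 1\<^sub>m k, A \<otimes>\<^sub>K 1\<^sub>m k)"
    have mem: "?P \<in> mat_pairs M p"
      using kron_one_carrier[OF mat_diag_dim[of N x], of k] kron_one_carrier[OF A, of k] by (simp add: mat_pairs_iff)
    have A': "(mat_diag N x, A) \<in> mat_pairs N n" using A by (simp add: mat_pairs_iff)
    have "f ?P = 0"
      using fun_cong[OF z, of "(mat_diag N x, A)"] A' level_rank_apply[OF mat_diag_dim A, of k f x] by simp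
    moreover have "f ?P - (\<Sum>w\<in>T. elt (Q w) (b w) ?P) = 0"
      using fun_cong[OF negligible_level_rank[OF neg], of "(mat_diag N x, A)"] A' mem
        level_rank_apply[OF mat_diag_dim A, of k "restrict (\<lambda>XA. f XA - (\<Sum>w\<in>T. elt (Q w) (b w) XA)) (mat_pairs M p)" x]
      by simp
    ultimately show ?thesis by (simp add: level_rank_apply[OF mat_diag_dim A])
  qed
  then have ker: "negligible (\<lambda>XA. \<Sum>w\<in>T. elt (\<lambda>z. disc_fun z ^ disc_exp * (theta (base z) * Q w z)) (b w) XA)"
    using elt_kernel[where T=T and Q=Q and b=b, OF fin Q b] by blast
  let ?F = "\<lambda>w. elt (\<lambda>z. disc_fun z ^ (disc_exp + k * k) * Q w z) (b w)" and ?G = "\<lambda>w. elt (\<lambda>z. disc_fun z ^ disc_exp * (theta (base z) * Q w z)) (b w)"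
  obtain e where e: "(\<lambda>z. disc_fun z ^ (k * k) - (e * ordered_disc N (base z)) ^ (k * k)) \<in> rel_ideal"
    using disc_fun_power_rel_ideal by blast
  let ?c = "e ^ (k * k) / of_nat (card site_perms)"
  have "negligible (\<lambda>XA. (\<Sum>w\<in>T. ?F w XA - ?c * ?G w XA) + ?c * (\<Sum>w\<in>T. ?G w XA))"
    by (intro negligible_add[OF negligible_sum negligible_cmult[OF ker]] elt_dsc_theta[OF e Q b])
  then have "negligible (\<lambda>XA. \<Sum>w\<in>T. ?F w XA)"
    by (simp add: sum_subtractf sum_distrib_left)
  from negligible_add[OF negligible_mult_invariant[OF neg disc_trace_mat_polys disc_trace_conj, of "disc_exp + k * k"] this]
  show ?thesis
  proof (rule negligible_cong)
    fix XA assume XA: "XA \<in> mat_pairs M p"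
    have "(\<Sum>w\<in>T. ?F w XA) = disc_trace (disc_exp + k * k) (fst XA) * (\<Sum>w\<in>T. elt (Q w) (b w) XA)"
      unfolding sum_distrib_left by (rule sum.cong[OF refl]) (rule disc_trace_elt[OF Q b XA, symmetric])
    then show "disc_trace (disc_exp + k * k) (fst XA) * f XA =
      disc_trace (disc_exp + k * k) (fst XA) * (f XA - (\<Sum>w\<in>T. elt (Q w) (b w) XA)) + (\<Sum>w\<in>T. ?F w XA)"
      by (simp add: right_diff_distrib)
  qed
qed

subsection \<open>The image of the level-rank map\<close>

lemma site_perms_sign:
  assumes \<pi>: "\<pi> \<in> site_perms" and \<sigma>: "\<sigma> permutes {..<N}" "\<forall>r<M. \<pi> r = \<sigma> (r div k) * k + r mod k"
  shows "(signof \<pi> :: complex) = signof \<sigma> ^ k"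
  using \<pi> \<sigma> k_pos by (intro signof_block_permutation) (auto simp: site_perms_def colour_perms_permutes)

text \<open>At level \<open>k\<close> the torus scales by the \<open>k\<close>-th power of the
  product of the column weights, so every column occurs \<open>k\<close> times; the columns are
  listed as \<open>r div k\<close>, to match the positions of the source.\<close>

lemma \<H>_site_expansion:
  assumes h: "h \<in> \<H> N n k"
  shows "\<exists>q. (\<forall>w. q w \<in> poly_maps N) \<and> (\<forall>x. \<forall>A\<in>carrier_mat n N.
    h (mat_diag N x, A) = (\<Sum>w\<in>{..<M} \<rightarrow>\<^sub>E {..<n}. q w x * (\<Prod>r<M. A $$ (w r, r div k))))"
proof (rule column_homogeneous_expansion[OF \<H>_mat_polys[OF h]])
  show "r div k < N" if "r < M" for r by (rule block_div_less[OF that])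
  fix x and A :: "complex mat" and u :: "nat \<Rightarrow> complex" assume A: "A \<in> carrier_mat n N" and u: "\<And>j. j < N \<Longrightarrow> u j \<noteq> 0"
  have "(\<Prod>r<M. u (r div k)) = (\<Prod>i<N. \<Prod>a<k. u i)"
    unfolding prod_blocks[OF k_pos] by (intro prod.cong refl) simp
  also have "\<dots> = (\<Prod>i<N. u i) ^ k" by (simp add: prod_power_distrib)
  finally show "h (mat_diag N x, scale_cols n N A u) = (\<Prod>r<M. u (r div k)) * h (mat_diag N x, A)"
    using \<H>_torus[OF h A, of u x] u by simp
qed

text \<open>Each term of a site expansion of \<open>h\<close> is lifted to a standard element with
  the factor \<open>sep\<close>. In the value only site permutations remain. Each contributes
  \<open>h\<close> itself: its sign is the \<open>k\<close>-th power of that of the site permutation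
  and cancels against the sign in the equivariance of \<open>h\<close>.\<close>

lemma level_rank_image:
  assumes h: "h \<in> \<H> N n k"
  shows "\<exists>f\<in>\<H> M p 1. level_rank k n N f = (\<lambda>XA\<in>mat_pairs N n. trace_form N 1 (Disc N) (fst XA) ^ (k * k) * h XA)"
proof -
  let ?W = "{..<M} \<rightarrow>\<^sub>E {..<n}"
  obtain q where "\<forall>w. q w \<in> poly_maps N" and "\<forall>x. \<forall>A\<in>carrier_mat n N.
    h (mat_diag N x, A) = (\<Sum>w\<in>?W. q w x * (\<Prod>r<M. A $$ (w r, r div k)))"
    using \<H>_site_expansion[OF h] by blast
  note q = this[rule_format]
  obtain e where "\<forall>x. Disc N (vec N x) = e * ordered_disc N x" using ordered_disc_eq by blast
  note e = this[rule_format]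
  have disc: "trace_form N 1 (Disc N) (mat_diag N x) = e * ordered_disc N x" for x
  proof -
    have "trace_form N 1 (Disc N) (mat_diag N x) = power_sum_form N (Disc N) (vec N (\<lambda>i. psum N x (Suc i)))"
      unfolding trace_form_def mat_diag_pow by (simp add: mat_trace_def mat_diag_def psum_def)
    then show ?thesis by (simp only: power_sum_form_psum[OF Disc_sym_polys] e)
  qed
  let ?q = "\<lambda>w z. sep z * q w (base z)"
  \<comment> \<open>The denominator removes the number of equal contributions of the site
    permutations; the numerator turns \<open>ordered_disc\<close> into \<open>Disc\<close>.\<close>
  let ?c = "e ^ (k * k) / of_nat (card site_perms)"
  let ?f = "\<lambda>XA\<in>mat_pairs M p. ?c * (\<lambda>XA\<in>mat_pairs M p. \<Sum>w\<in>?W. elt (?q w) w XA) XA"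
  have qp: "?q w \<in> poly_maps M" for w by (intro poly_maps_mult sep_poly_maps base_poly_maps q(1))
  have valid_rows: "valid_rows w" if "w \<in> ?W" for w unfolding valid_rows_def using that by auto
  have f: "?f \<in> \<H> M p 1"
    by (intro \<H>_smult \<H>_sum alt_\<H>[OF qp] standard_less valid_rows)
  have value_sum: "(\<Sum>w\<in>?W. level_rank k n N (elt (?q w) w) (mat_diag N x, A)) =
      of_nat (card site_perms) * (ordered_disc N x ^ (k * k) * h (mat_diag N x, A))"
    if A: "A \<in> carrier_mat n N" for x and A :: "complex mat"
  proof -
    let ?t = "\<lambda>w \<pi>. signof \<pi> * (q w (\<lambda>i. x (\<pi> (i * k) div k)) * (\<Prod>r<M. A $$ (w r, \<pi> r div k)))"
    have "level_rank k n N (elt (?q w) w) (mat_diag N x, A) = ordered_disc N x ^ (k * k) * (\<Sum>\<pi>\<in>site_perms. ?t w \<pi>)" if w: "w \<in> ?W" for w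
    proof -
      have "level_rank k n N (elt (?q w) w) (mat_diag N x, A) = (\<Sum>\<pi>\<in>colour_perms. sep (\<lambda>r. x (\<pi> r div k)) * ?t w \<pi>)"
        unfolding level_rank_elt[OF qp valid_rows[OF w] A] by (intro sum.cong refl) (simp only: mult_ac)
      then show ?thesis by (simp only: sum_colour_perms_sep[of x])
    qed
    then have "(\<Sum>w\<in>?W. level_rank k n N (elt (?q w) w) (mat_diag N x, A)) = (\<Sum>w\<in>?W. ordered_disc N x ^ (k * k) * (\<Sum>\<pi>\<in>site_perms. ?t w \<pi>))"
      by (rule sum.cong[OF refl])
    also have "\<dots> = ordered_disc N x ^ (k * k) * (\<Sum>\<pi>\<in>site_perms. \<Sum>w\<in>?W. ?t w \<pi>)"
      unfolding sum_distrib_left[of "ordered_disc N x ^ (k * k)", symmetric] by (subst sum.swap) (rule refl)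
    also have "(\<Sum>\<pi>\<in>site_perms. \<Sum>w\<in>?W. ?t w \<pi>) = (\<Sum>\<pi>\<in>site_perms. h (mat_diag N x, A))"
    proof (rule sum.cong[OF refl])
      fix \<pi> assume \<pi>: "\<pi> \<in> site_perms"
      obtain \<sigma> where \<sigma>: "\<sigma> permutes {..<N}" "\<forall>r<M. \<pi> r = \<sigma> (r div k) * k + r mod k"
        by (rule site_perms_site_permutation[OF \<pi>])
      have site: "\<pi> r div k = \<sigma> (r div k)" if "r < M" for r using \<sigma>(2) that k_pos by simp
      let ?A = "mat n N (\<lambda>(a, j). A $$ (a, \<sigma> j))"
      have t: "?t w \<pi> = signof \<pi> * (q w (\<lambda>i. x (\<sigma> i)) * (\<Prod>r<M. ?A $$ (w r, r div k)))" if w: "w \<in> ?W" for w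
      proof -
        have "q w (\<lambda>i. x (\<pi> (i * k) div k)) = q w (\<lambda>i. x (\<sigma> i))"
          by (rule poly_maps_cong[OF q(1)]) (use site[OF base_index_less] k_pos in simp)
        moreover have "(\<Prod>r<M. A $$ (w r, \<pi> r div k)) = (\<Prod>r<M. ?A $$ (w r, r div k))"
          using valid_rowsD[OF valid_rows[OF w]] by (intro prod.cong refl) (simp add: site block_div_less)
        ultimately show ?thesis by (simp only:)
      qed
      have "(\<Sum>w\<in>?W. ?t w \<pi>) = (\<Sum>w\<in>?W. signof \<pi> * (q w (\<lambda>i. x (\<sigma> i)) * (\<Prod>r<M. ?A $$ (w r, r div k))))"
        by (rule sum.cong[OF refl t])
      also have "\<dots> = signof \<pi> * h (mat_diag N (\<lambda>i. x (\<sigma> i)), ?A)"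
        unfolding sum_distrib_left[symmetric] q(2)[OF mat_carrier] ..
      also have "\<dots> = signof \<sigma> ^ k * (signof \<sigma> ^ k * h (mat_diag N x, A))"
        by (simp only: site_perms_sign[OF \<pi> \<sigma>] \<H>_permute[OF h A \<sigma>(1)])
      also have "\<dots> = (signof \<sigma> * signof \<sigma>) ^ k * h (mat_diag N x, A)"
        by (simp only: power_mult_distrib mult.assoc)
      also have "(signof \<sigma> * signof \<sigma> :: complex) = 1" by (simp add: sign_def)
      finally show "(\<Sum>w\<in>?W. ?t w \<pi>) = h (mat_diag N x, A)" by simp
    qed
    finally show ?thesis by (simp add: mult.left_commute)
  qed
  have "level_rank k n N ?f = (\<lambda>XA\<in>mat_pairs N n. trace_form N 1 (Disc N) (fst XA) ^ (k * k) * h XA)"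
  proof (rule \<H>_eqI)
    show "level_rank k n N ?f \<in> \<H> N n k" by (rule level_rank_\<H>[OF f k_pos])
    show "(\<lambda>XA\<in>mat_pairs N n. trace_form N 1 (Disc N) (fst XA) ^ (k * k) * h XA) \<in> \<H> N n k"
      by (rule \<H>_mult_invariant[OF h, where c="\<lambda>X. trace_form N 1 (Disc N) X ^ (k * k)"])
        (intro mat_polys_intros trace_form_mat_polys Disc_sym_polys, simp only: trace_form_conj)
    fix x :: "nat \<Rightarrow> complex" and A :: "complex mat" assume A: "A \<in> carrier_mat n N"
    let ?P = "(mat_diag N x \<otimes>\<^sub>K 1\<^sub>m k, A \<otimes>\<^sub>K 1\<^sub>m k)"
    have mem: "?P \<in> mat_pairs M p"
      using kron_one_carrier[OF mat_diag_dim[of N x], of k] kron_one_carrier[OF A, of k] by (simp add: mat_pairs_iff)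
    have A': "(mat_diag N x, A) \<in> mat_pairs N n" using A by (simp add: mat_pairs_iff)
    have "level_rank k n N ?f (mat_diag N x, A) = ?c * (\<Sum>w\<in>?W. elt (?q w) w ?P)"
      unfolding level_rank_apply[OF mat_diag_dim A] using mem by (simp only: restrict_apply if_True)
    also have "(\<Sum>w\<in>?W. elt (?q w) w ?P) = of_nat (card site_perms) * (ordered_disc N x ^ (k * k) * h (mat_diag N x, A))"
      using value_sum[OF A, of x] by (simp only: level_rank_apply[OF mat_diag_dim A])
    also have "?c * \<dots> = (e * ordered_disc N x) ^ (k * k) * h (mat_diag N x, A)"
      using card_site_perms by (simp add: power_mult_distrib)
    finally have eq: "level_rank k n N ?f (mat_diag N x, A) = (e * ordered_disc N x) ^ (k * k) * h (mat_diag N x, A)" .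
    have "(\<lambda>XA\<in>mat_pairs N n. trace_form N 1 (Disc N) (fst XA) ^ (k * k) * h XA) (mat_diag N x, A) =
      (e * ordered_disc N x) ^ (k * k) * h (mat_diag N x, A)"
      using A' by (simp only: restrict_apply if_True fst_conv disc)
    then show "level_rank k n N ?f (mat_diag N x, A) =
      (\<lambda>XA\<in>mat_pairs N n. trace_form N 1 (Disc N) (fst XA) ^ (k * k) * h XA) (mat_diag N x, A)"
      by (rule trans[OF eq sym])
  qed
  with f show ?thesis by blast
qed

end

section \<open>The reduced level-rank map after localization\<close>

context level_rank_setting
begin

lemma negligible_\<H>: "f \<in> \<H> M p 1 \<Longrightarrow> negligible f \<longleftrightarrow> f \<in> sl_image k n N"
  by (simp add: negligible_def \<H>_ext)

lemma sl_image_\<H>: "sl_image k n N \<subseteq> \<H> M p 1"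
proof
  fix g assume "g \<in> sl_image k n N"
  then obtain s :: nat and y f where
    "g = (\<lambda>XA\<in>mat_pairs M p. \<Sum>i<s. gl_act M p (1\<^sub>m n \<otimes>\<^sub>K y i) (f i) XA)" "\<forall>i<s. y i \<in> sl_current k \<and> f i \<in> \<H> M p 1"
    unfolding sl_image_def by blast
  then show "g \<in> \<H> M p 1" by (simp only:) (intro \<H>_sum gl_act_\<H>, blast)
qed

lemma quotient_of_module_sl_image:
  "quotient_of_module (sym_ring N) (\<H>_module N (1 / of_nat k) M p 1) (sl_image k n N)"
proof (intro quotient_of_module.intro quotient_of_module_axioms.intro module_\<H>_module)
  let ?H = "\<H>_module N (1 / of_nat k) M p 1"
  have neg: "negligible f" if "f \<in> sl_image k n N" for f
    using that sl_image_\<H> negligible_\<H> by blast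
  show "sl_image k n N \<subseteq> carrier ?H" using sl_image_\<H> by (simp only: \<H>_module_sel)
  show "\<zero>\<^bsub>?H\<^esub> \<in> sl_image k n N"
    using negligible_zero by (simp only: \<H>_module_sel negligible_def)
  show "x \<oplus>\<^bsub>?H\<^esub> y \<in> sl_image k n N" if "x \<in> sl_image k n N" "y \<in> sl_image k n N" for x y
    using negligible_add[OF neg[OF that(1)] neg[OF that(2)]] by (simp only: \<H>_module_sel negligible_def)
  show "r \<odot>\<^bsub>?H\<^esub> x \<in> sl_image k n N" if "r \<in> carrier (sym_ring N)" "x \<in> sl_image k n N" for r x
  proof -
    have "r \<in> sym_polys N" using that(1) by (simp add: sym_ring_def)
    then have "negligible (\<lambda>XA. trace_form N (1 / of_nat k) r (fst XA) * x XA)"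
      by (intro negligible_mult_invariant[OF neg[OF that(2)]] trace_form_mat_polys trace_form_conj)
    then show ?thesis by (simp only: \<H>_module_smult negligible_def)
  qed
qed

lemma kron_one_mat_pairs:
  assumes "XA \<in> mat_pairs N n"
  shows "(fst XA \<otimes>\<^sub>K 1\<^sub>m k, snd XA \<otimes>\<^sub>K 1\<^sub>m k) \<in> mat_pairs M p"
  using assms kron_one_carrier[of "fst XA" N N k] kron_one_carrier[of "snd XA" n N k] by (simp add: mat_pairs_iff)

lemma level_rank_eq:
  "level_rank k n N f = (\<lambda>XA\<in>mat_pairs N n. f (fst XA \<otimes>\<^sub>K 1\<^sub>m k, snd XA \<otimes>\<^sub>K 1\<^sub>m k))"
  by (simp add: level_rank_def case_prod_unfold)

text \<open>The factor \<open>1 / k\<close> in the action on the source compensates the trace of a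
  power of \<open>X \<otimes>\<^sub>K 1\<^sub>m k\<close>, which is \<open>k\<close> times that for
  \<open>X\<close>.\<close>

lemma level_rank_module_hom:
  "level_rank k n N \<in> LinearCombinations.module_hom (sym_ring N) (\<H>_module N (1 / of_nat k) M p 1) (\<H>_module N 1 N n k)"
  unfolding LinearCombinations.module_hom_def
proof (intro CollectI conjI ballI allI impI funcsetI)
  let ?H = "\<H>_module N (1 / of_nat k) M p 1" and ?L = "\<H>_module N 1 N n k"
  show "level_rank k n N f \<in> carrier ?L" if "f \<in> carrier ?H" for f
    using that level_rank_\<H>[OF _ k_pos] by (simp only: \<H>_module_sel)
  show "level_rank k n N (f \<oplus>\<^bsub>?H\<^esub> g) = level_rank k n N f \<oplus>\<^bsub>?L\<^esub> level_rank k n N g" for f g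
    unfolding level_rank_eq \<H>_module_sel
    by (rule restrict_ext) (simp add: kron_one_mat_pairs)
  show "level_rank k n N (r \<odot>\<^bsub>?H\<^esub> f) = r \<odot>\<^bsub>?L\<^esub> level_rank k n N f" for r f
    unfolding level_rank_eq \<H>_module_smult
  proof (rule restrict_ext)
    fix XA assume XA: "XA \<in> mat_pairs N n"
    then have "fst XA \<in> carrier_mat N N" by (simp add: mat_pairs_iff)
    from trace_form_kron_one[OF this k_pos]
    show "(\<lambda>XA\<in>mat_pairs M p. trace_form N (1 / of_nat k) r (fst XA) * f XA) (fst XA \<otimes>\<^sub>K 1\<^sub>m k, snd XA \<otimes>\<^sub>K 1\<^sub>m k) =
      trace_form N 1 r (fst XA) * (\<lambda>XA\<in>mat_pairs N n. f (fst XA \<otimes>\<^sub>K 1\<^sub>m k, snd XA \<otimes>\<^sub>K 1\<^sub>m k)) XA"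
      using kron_one_mat_pairs[OF XA] XA by (simp only: restrict_apply if_True fst_conv)
  qed
qed

lemma reduced_level_rank_iso:
  "is_module_iso (loc_ring (sym_ring N) (Disc N))
     (loc_module (sym_ring N) (coinvariants k n N) (Disc N))
     (loc_module (sym_ring N) (\<H>_module N 1 N n k) (Disc N))
     (loc_map (sym_ring N) (\<H>_module N 1 N n k) (Disc N) (reduced_level_rank k n N))"
  unfolding coinvariants_def reduced_level_rank_def
proof (rule loc_map_quot_iso[OF module_\<H>_module module_\<H>_module quotient_of_module_sl_image _ level_rank_module_hom])
  let ?H = "\<H>_module N (1 / of_nat k) M p 1" and ?L = "\<H>_module N 1 N n k"
  show "Disc N \<in> carrier (sym_ring N)" using Disc_sym_polys by (simp add: sym_ring_def)
  show "level_rank k n N f = \<zero>\<^bsub>?L\<^esub>" if "f \<in> sl_image k n N" for f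
  proof -
    have f: "f \<in> \<H> M p 1" using that sl_image_\<H> by blast
    then have "negligible f" using that negligible_\<H> by blast
    from negligible_level_rank[OF this] show ?thesis by (simp only: \<H>_ext[OF f] \<H>_module_sel)
  qed
  show "\<exists>c :: nat. (Disc N [^]\<^bsub>sym_ring N\<^esub> c) \<odot>\<^bsub>?H\<^esub> f \<in> sl_image k n N"
    if "f \<in> carrier ?H" "level_rank k n N f = \<zero>\<^bsub>?L\<^esub>" for f
  proof (rule exI)
    have "negligible (\<lambda>XA. disc_trace (disc_exp + k * k) (fst XA) * f XA)"
      using that by (intro level_rank_kernel) (simp_all only: \<H>_module_sel)
    then show "(Disc N [^]\<^bsub>sym_ring N\<^esub> (disc_exp + k * k)) \<odot>\<^bsub>?H\<^esub> f \<in> sl_image k n N"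
      by (simp only: \<H>_module_smult trace_form_pow[OF Disc_sym_polys] disc_trace_def negligible_def)
  qed
  show "\<exists>c :: nat. \<exists>f\<in>carrier ?H. level_rank k n N f = (Disc N [^]\<^bsub>sym_ring N\<^esub> c) \<odot>\<^bsub>?L\<^esub> h" if "h \<in> carrier ?L" for h
  proof (rule exI)
    show "\<exists>f\<in>carrier ?H. level_rank k n N f = (Disc N [^]\<^bsub>sym_ring N\<^esub> (k * k)) \<odot>\<^bsub>?L\<^esub> h"
      using that level_rank_image by (simp only: \<H>_module_smult \<H>_module_sel trace_form_pow[OF Disc_sym_polys])
  qed
qed

end

theorem theorem5p15:
  fixes k n N :: nat
  assumes "k > 0" and "n > 0" and "N > 0"
  shows "is_module_iso
           (loc_ring (sym_ring N) (Disc N))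
           (loc_module (sym_ring N) (coinvariants k n N) (Disc N))
           (loc_module (sym_ring N) (\<H>_module N 1 N n k) (Disc N))
           (loc_map (sym_ring N) (\<H>_module N 1 N n k) (Disc N) (reduced_level_rank k n N))"
  by (rule level_rank_setting.reduced_level_rank_iso) (use assms in unfold_locales)

end
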